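(* Let $\Omega$ be a minimal and uniquely ergodic space of aperiodic tilings of $\mathbb{R}^d$ with finite local complexity (FLC), with invariant probability measure $\mu$. Let $\alpha\in\check H^1(\Omega;\mathbb{R}^d)$ and suppose that $C_\mu(\alpha)$ is invertible. Then there exists a shape change transformation $h_{sc}$ of $\Omega$ such that $[h_{sc}]=\alpha$.
   Context: **Tiling spaces.** A tile is a convex polytope in $\mathbb{R}^d$ with non-empty interior, possibly carrying a label in a compact metric space; the set of prototiles (tiles up to translation) is compact. A tiling is a collection of tiles covering $\mathbb{R}^d$, any two of which meet only along their boundaries. A Delone set is a uniformly discrete and relatively dense subset of $\mathbb{R}^d$, possibly labelled. Tilings and labelled Delone sets are used interchangeably. $\mathbb{R}^d$ acts by translation, $T\mapsto T-x$. The patch $T\cap B(x,R)$ is the set of labelled tiles meeting $B(x,R)$ (for Delone sets: labelled points in $B(x,R)$). Two tilings (Delone sets) are $\varepsilon$-close if on a ball of radius about $1/\varepsilon$ around the origin there is a one-to-one correspondence between their tiles (points), corresponding tiles being $\varepsilon$-close in Hausdorff distance (points being $\varepsilon$-close) with $\varepsilon$-close labels. A tiling space is a compact translation-invariant set of tilings (or labelled Delone sets). It is minimal if every $\mathbb{R}^d$-orbit is dense, aperiodic if $T-x=T$ implies $x=0$ for each of its elements, uniquely ergodic if it carries exactly one translation-invariant Borel probability measure, FLC if for each $R$ there are finitely many patches of radius $R$ up to translation. **FLC transversals.** The canonical transversal of a space of Delone sets is the set of its elements containing the origin. A local derivation between FLC tiling spaces is a continuous onto map $\phi$ with $\phi(T-x)=\phi(T)-x$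 such that for all $r>0$ there is $R>0$ with: $T\cap B(0,R)=T'\cap B(0,R)$ implies $\phi(T)\cap B(0,r)=\phi(T')\cap B(0,r)$. An FLC transversal of $\Omega$ is $\mathcal{D}^{-1}(\Xi')$, where $\mathcal{D}:\Omega\to\Omega_0$ is a local derivation to a space of Delone sets with canonical transversal $\Xi'$. A function on $\Omega$ is transversally locally constant if its restriction to every FLC transversal is locally constant. **Strong cohomology.** A strong 1-cocycle is a continuous $\alpha:\Omega\times\mathbb{R}^d\to\mathbb{R}^d$ with $\alpha(T,x)+\alpha(T-x,y)=\alpha(T,x+y)$ and with $\alpha(\cdot,v)$ transversally locally constant for each $v$; it is a strong coboundary if $\alpha(T,v)=s(T-v)-s(T)$ with $s:\Omega\to\mathbb{R}^d$ continuous and transversally locally constant. The quotient $H^1_s(\Omega;\mathbb{R}^d)$ is canonically isomorphic to $\check H^1(\Omega;\mathbb{R}^d)$: on an open flow box $U=\{S-x: S\in\Xi, |x|<\varepsilon\}$ ($\Xi$ an FLC transversal) put $c_U(S-x)=\alpha(S,x)$; the differences $c_U-c_V$ on overlaps are locally constant and form the Čech cocycle. The fundamental shape class $[\mathcal{F}(\Omega)]$ is the class of $\mathcal{F}(T,v)=v$. For a homeomorphism $h:\Omega\to\Omega'$ of minimal aperiodic FLC tiling spaces, $[h]:=h^*[\mathcal{F}(\Omega')]$, where $h^*$ is pullback in Čech cohomology. **Ruelle–Sullivan map.** For a class represented by a cocycle $\alpha$, $C_\mu([\alpha])$ is the linear map ($d\times d$ matrix) $v\mapsto\int_\Omega\alpha(T,v)\,d\mu(T)=\lim_{r\to\infty}r^{-d}\int_{C_r}\alpha(T-s,v)\,ds$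 (any $T$), with $C_r=[-r/2,r/2]^d$; it depends only on the class. **Shape change transformation.** Let $T\in\Omega$ be a tiling with a vertex at $0$, with vertex set (or associated Delone set) $\Lambda$. A smooth $\mathbb{R}^d$-valued 1-form $\omega$ on $\mathbb{R}^d$ is strongly pattern-equivariant (PE) with radius $R$ with respect to $T$ if its coefficients take the same value at $x$ and $y$ whenever $(T-x)\cap B(0,R)=(T-y)\cap B(0,R)$. Let $\omega$ be closed and strongly PE with radius $R$, let $A(x)=\int_0^x\omega$, and suppose $A:\mathbb{R}^d\to\mathbb{R}^d$ is a homeomorphism. Label each $p\in\Lambda$ by the patch of $T$ of radius $R_0$ around $p$, where $R_0$ exceeds $R$ plus the greatest distance between neighbouring points of $\Lambda$. Let $\Lambda'$ be obtained by moving each $p\in\Lambda$ to $A(p)$, keeping its label; view $\Lambda'$ as (the vertex set of) a new tiling $T'$, and let $\Omega'$ be the orbit closure of $T'$. The map $h_\omega(T-x)=T'-A(x)$ extends to a homeomorphism $h_\omega:\Omega\to\Omega'$, called the shape change transformation associated to $\omega$. *)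

theory Defs
  imports "HOL-Probability.Probability"
begin

section \<open>Tilings and labelled Delone sets\<close>

text \<open>Both kinds of object are sets of labelled subsets of Euclidean space: the labelled tiles
  \<open>(t, l)\<close> of a tiling, and the labelled singletons \<open>({p}, l)\<close> of a labelled Delone set.
  The Hausdorff distance of singletons is the distance of the points, and a singleton meets a
  ball iff its point lies in the ball, so closeness and patches can be defined once for both.
  The labels live in a metric space, given as an element of the type \<open>'l metric\<close>.\<close>

type_synonym ('d, 'l) pattern = "((real ^ 'd) set \<times> 'l) set"

text \<open>The value 0 outside the non-empty compact sets is never used; it makes the locale
  \<open>Metric_space\<close>, which wants a non-negative function on the whole type, applicable.\<close>

definition hausdorff_dist :: "'a::metric_space set \<Rightarrow> 'a set \<Rightarrow> real" where
  "hausdorff_dist A B =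
     (if compact A \<and> A \<noteq> {} \<and> compact B \<and> B \<noteq> {}
      then max (SUP a\<in>A. infdist a B) (SUP b\<in>B. infdist b A) else 0)"

lemma hausdorff_dist_le_iff:
  fixes A B :: "'a::heine_borel set"
  assumes "compact A" "A \<noteq> {}" "compact B" "B \<noteq> {}"
  shows "hausdorff_dist A B \<le> e \<longleftrightarrow>
    (\<forall>a\<in>A. \<exists>b\<in>B. dist a b \<le> e) \<and> (\<forall>b\<in>B. \<exists>a\<in>A. dist a b \<le> e)"
proof -
  have *: "(SUP a\<in>A. infdist a B) \<le> e \<longleftrightarrow> (\<forall>a\<in>A. \<exists>b\<in>B. dist a b \<le> e)"
    if "compact A" "A \<noteq> {}" "compact B" "B \<noteq> {}" for A B :: "'a set"
  proof -
    have "compact ((\<lambda>a. infdist a B) ` A)"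
      by (intro compact_continuous_image continuous_intros that)
    then have "bdd_above ((\<lambda>a. infdist a B) ` A)"
      by (simp add: bounded_imp_bdd_above compact_imp_bounded)
    then have "(SUP a\<in>A. infdist a B) \<le> e \<longleftrightarrow> (\<forall>a\<in>A. infdist a B \<le> e)"
      using that by (simp add: cSUP_le_iff)
    also have "\<dots> \<longleftrightarrow> (\<forall>a\<in>A. \<exists>b\<in>B. dist a b \<le> e)"
    proof (intro ball_cong refl iffI)
      fix a assume "infdist a B \<le> e"
      then show "\<exists>b\<in>B. dist a b \<le> e"
        using infdist_attains_inf[of B a] that by (metis compact_imp_closed)
    next
      fix a assume "\<exists>b\<in>B. dist a b \<le> e"
      then show "infdist a B \<le> e" by (meson infdist_le2)
    qed
    finally show ?thesis .
  qed
  show ?thesis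
    using *[of A B] *[of B A] assms by (simp add: hausdorff_dist_def dist_commute)
qed

lemma hausdorff_dist_commute: "hausdorff_dist A B = hausdorff_dist B A"
  by (auto simp: hausdorff_dist_def max.commute)

lemma hausdorff_dist_nonneg: "0 \<le> hausdorff_dist A (B :: 'a::heine_borel set)"
proof (cases "compact A \<and> A \<noteq> {} \<and> compact B \<and> B \<noteq> {}")
  case True
  then obtain a where "a \<in> A" by blast
  obtain b where "dist a b \<le> hausdorff_dist A B"
    using hausdorff_dist_le_iff[of A B "hausdorff_dist A B"] True \<open>a \<in> A\<close> by blast
  then show ?thesis using zero_le_dist[of a b] by linarith
qed (auto simp: hausdorff_dist_def)

lemma Metric_space_hausdorff:
  "Metric_space {A::'a::heine_borel set. compact A \<and> A \<noteq> {}} hausdorff_dist"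
proof
  fix A B :: "'a set"
  show "0 \<le> hausdorff_dist A B" by (rule hausdorff_dist_nonneg)
  show "hausdorff_dist A B = hausdorff_dist B A" by (rule hausdorff_dist_commute)
next
  fix A B :: "'a set"
  assume A: "A \<in> {A. compact A \<and> A \<noteq> {}}" and B: "B \<in> {A. compact A \<and> A \<noteq> {}}"
  have "hausdorff_dist A B = 0 \<longleftrightarrow> hausdorff_dist A B \<le> 0"
    using hausdorff_dist_nonneg[of A B] by linarith
  also have "\<dots> \<longleftrightarrow> A = B"
    using A B by (subst hausdorff_dist_le_iff) auto
  finally show "hausdorff_dist A B = 0 \<longleftrightarrow> A = B" .
next
  fix A B C :: "'a set"
  assume A: "A \<in> {A. compact A \<and> A \<noteq> {}}" and B: "B \<in> {A. compact A \<and> A \<noteq> {}}"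
    and C: "C \<in> {A. compact A \<and> A \<noteq> {}}"
  let ?r = "hausdorff_dist A B" and ?s = "hausdorff_dist B C"
  have AB: "(\<forall>a\<in>A. \<exists>b\<in>B. dist a b \<le> ?r) \<and> (\<forall>b\<in>B. \<exists>a\<in>A. dist a b \<le> ?r)"
    using A B hausdorff_dist_le_iff[of A B ?r] by simp
  have BC: "(\<forall>a\<in>B. \<exists>b\<in>C. dist a b \<le> ?s) \<and> (\<forall>b\<in>C. \<exists>a\<in>B. dist a b \<le> ?s)"
    using B C hausdorff_dist_le_iff[of B C ?s] by simp
  have tri: "dist a c \<le> ?r + ?s" if "dist a b \<le> ?r" "dist b c \<le> ?s" for a b c :: 'a
    using that dist_triangle[of a c b] by linarith
  have "hausdorff_dist A C \<le> ?r + ?s \<longleftrightarrow>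
      (\<forall>a\<in>A. \<exists>b\<in>C. dist a b \<le> ?r + ?s) \<and> (\<forall>b\<in>C. \<exists>a\<in>A. dist a b \<le> ?r + ?s)"
    using A C by (intro hausdorff_dist_le_iff) auto
  then show "hausdorff_dist A C \<le> ?r + ?s"
    using AB BC tri by meson
qed

definition hausdorff_metric :: "'a::heine_borel set metric" where
  "hausdorff_metric = metric ({A. compact A \<and> A \<noteq> {}}, hausdorff_dist)"

definition discrete_labels :: "'l metric" where
  "discrete_labels = metric (UNIV, discrete_metric.dd)"

text \<open>\<open>translate x T\<close> is \<open>T - x\<close>.\<close>

definition translate :: "real ^ 'd::finite \<Rightarrow> ('d, 'l) pattern \<Rightarrow> ('d, 'l) pattern" where
  "translate x T = (\<lambda>(t, l). ((\<lambda>p. p - x) ` t, l)) ` T"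

definition patch :: "('d::finite, 'l) pattern \<Rightarrow> real ^ 'd \<Rightarrow> real \<Rightarrow> ('d, 'l) pattern" where
  "patch T x R = {(t, l) \<in> T. t \<inter> ball x R \<noteq> {}}"

definition prototiles :: "'l metric \<Rightarrow> ('d::finite, 'l) pattern \<Rightarrow> bool" where
  "prototiles L P \<longleftrightarrow>
     (\<forall>(t, l)\<in>P. polytope t \<and> interior t \<noteq> {} \<and> l \<in> mspace L) \<and>
     compactin (mtopology_of (prod_metric hausdorff_metric L)) P"

definition tiling :: "('d::finite, 'l) pattern \<Rightarrow> ('d, 'l) pattern \<Rightarrow> bool" where
  "tiling P T \<longleftrightarrow>
     (\<forall>\<tau>\<in>T. \<exists>x. \<exists>\<pi>\<in>P. {\<tau>} = translate x {\<pi>}) \<and>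
     (\<Union>(t, l)\<in>T. t) = UNIV \<and>
     (\<forall>(t, l)\<in>T. \<forall>(t', l')\<in>T. (t, l) \<noteq> (t', l') \<longrightarrow> t \<inter> t' \<subseteq> frontier t \<inter> frontier t')"

definition labelled_delone :: "'l metric \<Rightarrow> ('d::finite, 'l) pattern \<Rightarrow> bool" where
  "labelled_delone L T \<longleftrightarrow>
     (\<forall>(t, l)\<in>T. (\<exists>p. t = {p}) \<and> l \<in> mspace L) \<and>
     (\<exists>r>0. \<forall>p l q m. ({p}, l) \<in> T \<longrightarrow> ({q}, m) \<in> T \<longrightarrow> (p, l) \<noteq> (q, m) \<longrightarrow> r \<le> dist p q) \<and>
     (\<exists>R>0. \<forall>x. \<exists>p l. ({p}, l) \<in> T \<and> dist x p \<le> R)"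

text \<open>The one-to-one correspondence is between sets of tiles (points) that contain at least those
  meeting the ball of radius \<open>1/\<epsilon>\<close>: demanding a bijection of the two patches themselves would
  make a tiling far from small translates of itself.\<close>

definition eps_close ::
  "'l metric \<Rightarrow> real \<Rightarrow> ('d::finite, 'l) pattern \<Rightarrow> ('d, 'l) pattern \<Rightarrow> bool" where
  "eps_close L \<epsilon> T T' \<longleftrightarrow>
     (\<exists>S S' f. patch T 0 (1 / \<epsilon>) \<subseteq> S \<and> S \<subseteq> T \<and> patch T' 0 (1 / \<epsilon>) \<subseteq> S' \<and> S' \<subseteq> T' \<and>
        bij_betw f S S' \<and>
        (\<forall>s\<in>S. hausdorff_dist (fst s) (fst (f s)) < \<epsilon> \<and> mdist L (snd s) (snd (f s)) < \<epsilon>))"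

lemma eps_close_mono:
  fixes T T' :: "('d::finite, 'l) pattern"
  assumes "eps_close L \<epsilon> T T'" "0 < \<epsilon>" "\<epsilon> \<le> \<delta>"
  shows "eps_close L \<delta> T T'"
proof -
  have "ball (0::real^'d) (1 / \<delta>) \<subseteq> ball 0 (1 / \<epsilon>)"
    using assms by (intro subset_ball divide_left_mono) auto
  then have "patch S 0 (1 / \<delta>) \<subseteq> patch S 0 (1 / \<epsilon>)" for S :: "('d, 'l) pattern"
    by (auto simp: patch_def)
  then show ?thesis
    using assms unfolding eps_close_def
    by (smt (verit, ccfv_threshold) subset_trans)
qed

definition pattern_topology ::
  "'l metric \<Rightarrow> ('d::finite, 'l) pattern set \<Rightarrow> ('d, 'l) pattern topology" where
  "pattern_topology L \<Omega> =
     topology (\<lambda>U. U \<subseteq> \<Omega> \<and> (\<forall>T\<in>U. \<exists>\<epsilon>>0. \<forall>T'\<in>\<Omega>. eps_close L \<epsilon> T T' \<longrightarrow> T' \<in> U))"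

lemma openin_pattern_topology:
  "openin (pattern_topology L \<Omega>) U \<longleftrightarrow>
     U \<subseteq> \<Omega> \<and> (\<forall>T\<in>U. \<exists>\<epsilon>>0. \<forall>T'\<in>\<Omega>. eps_close L \<epsilon> T T' \<longrightarrow> T' \<in> U)"
proof -
  let ?P = "\<lambda>U. U \<subseteq> \<Omega> \<and> (\<forall>T\<in>U. \<exists>\<epsilon>>0. \<forall>T'\<in>\<Omega>. eps_close L \<epsilon> T T' \<longrightarrow> T' \<in> U)"
  have "?P (U \<inter> V)" if U: "?P U" and V: "?P V" for U V
  proof (intro conjI ballI)
    show "U \<inter> V \<subseteq> \<Omega>" using U by blast
    fix T assume T: "T \<in> U \<inter> V"
    obtain \<epsilon> where e: "\<epsilon> > 0" "\<And>T'. T' \<in> \<Omega> \<Longrightarrow> eps_close L \<epsilon> T T' \<Longrightarrow> T' \<in> U"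
      using U T by blast
    obtain \<delta> where d: "\<delta> > 0" "\<And>T'. T' \<in> \<Omega> \<Longrightarrow> eps_close L \<delta> T T' \<Longrightarrow> T' \<in> V"
      using V T by blast
    show "\<exists>\<epsilon>>0. \<forall>T'\<in>\<Omega>. eps_close L \<epsilon> T T' \<longrightarrow> T' \<in> U \<inter> V"
    proof (intro exI[of _ "min \<epsilon> \<delta>"] conjI ballI impI)
      show "0 < min \<epsilon> \<delta>" using e d by simp
      fix T' assume "T' \<in> \<Omega>" and c: "eps_close L (min \<epsilon> \<delta>) T T'"
      moreover have "eps_close L \<epsilon> T T'" "eps_close L \<delta> T T'"
        using eps_close_mono[OF c] e d by auto
      ultimately show "T' \<in> U \<inter> V" using e d by blast
    qed
  qed
  moreover have "?P (\<Union>K)" if K: "\<forall>U\<in>K. ?P U" for K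
  proof (intro conjI ballI)
    show "\<Union>K \<subseteq> \<Omega>" using K by blast
    fix T assume "T \<in> \<Union>K"
    then obtain U where U: "U \<in> K" "T \<in> U" by blast
    then obtain \<epsilon> where "\<epsilon> > 0" "\<forall>T'\<in>\<Omega>. eps_close L \<epsilon> T T' \<longrightarrow> T' \<in> U"
      using K by meson
    then show "\<exists>\<epsilon>>0. \<forall>T'\<in>\<Omega>. eps_close L \<epsilon> T T' \<longrightarrow> T' \<in> \<Union>K"
      using U by blast
  qed
  ultimately have "istopology ?P"
    unfolding istopology_def by blast
  then show ?thesis
    unfolding pattern_topology_def by (simp add: topology_inverse')
qed

lemma topspace_pattern_topology [simp]: "topspace (pattern_topology L \<Omega>) = \<Omega>"
proof -
  have "openin (pattern_topology L \<Omega>) \<Omega>"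
    unfolding openin_pattern_topology by (auto intro: exI[of _ 1])
  then show ?thesis
    by (metis openin_pattern_topology openin_subset openin_topspace subset_antisym)
qed


section \<open>Tiling spaces\<close>

definition tiling_space :: "'l metric \<Rightarrow> ('d::finite, 'l) pattern set \<Rightarrow> bool" where
  "tiling_space L \<Omega> \<longleftrightarrow>
     compact_space (mtopology_of L) \<and>
     ((\<exists>P. prototiles L P \<and> (\<forall>T\<in>\<Omega>. tiling P T)) \<or> (\<forall>T\<in>\<Omega>. labelled_delone L T)) \<and>
     compact_space (pattern_topology L \<Omega>) \<and>
     (\<forall>T\<in>\<Omega>. \<forall>x. translate x T \<in> \<Omega>)"

definition orbit :: "('d::finite, 'l) pattern \<Rightarrow> ('d, 'l) pattern set" where
  "orbit T = range (\<lambda>x. translate x T)"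

definition minimal :: "'l metric \<Rightarrow> ('d::finite, 'l) pattern set \<Rightarrow> bool" where
  "minimal L \<Omega> \<longleftrightarrow> (\<forall>T\<in>\<Omega>. pattern_topology L \<Omega> closure_of orbit T = \<Omega>)"

definition aperiodic :: "('d::finite, 'l) pattern set \<Rightarrow> bool" where
  "aperiodic \<Omega> \<longleftrightarrow> (\<forall>T\<in>\<Omega>. \<forall>x. translate x T = T \<longrightarrow> x = 0)"

definition FLC :: "('d::finite, 'l) pattern set \<Rightarrow> bool" where
  "FLC \<Omega> \<longleftrightarrow>
     (\<forall>R>0. \<exists>F. finite F \<and> (\<forall>T\<in>\<Omega>. \<forall>x. \<exists>P\<in>F. \<exists>y. patch T x R = translate y P))"

definition invariant_probability ::
  "'l metric \<Rightarrow> ('d::finite, 'l) pattern set \<Rightarrow> ('d, 'l) pattern measure \<Rightarrow> bool" where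
  "invariant_probability L \<Omega> \<mu> \<longleftrightarrow>
     prob_space \<mu> \<and> space \<mu> = \<Omega> \<and>
     sets \<mu> = sigma_sets \<Omega> {U. openin (pattern_topology L \<Omega>) U} \<and>
     (\<forall>x. \<forall>B\<in>sets \<mu>. emeasure \<mu> (translate x ` B) = emeasure \<mu> B)"

definition uniquely_ergodic :: "'l metric \<Rightarrow> ('d::finite, 'l) pattern set \<Rightarrow> bool" where
  "uniquely_ergodic L \<Omega> \<longleftrightarrow> (\<exists>!\<mu>. invariant_probability L \<Omega> \<mu>)"


section \<open>FLC transversals\<close>

definition local_derivation ::
  "'l metric \<Rightarrow> ('d::finite, 'l) pattern set \<Rightarrow> 'm metric \<Rightarrow> ('d, 'm) pattern set \<Rightarrow>
   (('d, 'l) pattern \<Rightarrow> ('d, 'm) pattern) \<Rightarrow> bool" where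
  "local_derivation L \<Omega> L' \<Omega>' \<phi> \<longleftrightarrow>
     continuous_map (pattern_topology L \<Omega>) (pattern_topology L' \<Omega>') \<phi> \<and> \<phi> ` \<Omega> = \<Omega>' \<and>
     (\<forall>T\<in>\<Omega>. \<forall>x. \<phi> (translate x T) = translate x (\<phi> T)) \<and>
     (\<forall>r>0. \<exists>R>0. \<forall>T\<in>\<Omega>. \<forall>T'\<in>\<Omega>.
        patch T 0 R = patch T' 0 R \<longrightarrow> patch (\<phi> T) 0 r = patch (\<phi> T') 0 r)"

text \<open>Unlabelled Delone sets (labels of type \<open>unit\<close>) are enough here: forgetting the labels is a
  local derivation, and it does not change the preimage of the canonical transversal.\<close>

definition flc_transversal ::
  "'l metric \<Rightarrow> ('d::finite, 'l) pattern set \<Rightarrow> ('d, 'l) pattern set \<Rightarrow> bool" where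
  "flc_transversal L \<Omega> \<Xi> \<longleftrightarrow>
     (\<exists>(\<Omega>\<^sub>0 :: ('d, unit) pattern set) D.
        tiling_space discrete_labels \<Omega>\<^sub>0 \<and> (\<forall>T\<in>\<Omega>\<^sub>0. labelled_delone discrete_labels T) \<and>
        FLC \<Omega>\<^sub>0 \<and> local_derivation L \<Omega> discrete_labels \<Omega>\<^sub>0 D \<and>
        \<Xi> = {T \<in> \<Omega>. ({0}, ()) \<in> D T})"

definition locally_constant_on :: "'a topology \<Rightarrow> 'a set \<Rightarrow> ('a \<Rightarrow> 'b) \<Rightarrow> bool" where
  "locally_constant_on X A f \<longleftrightarrow>
     (\<forall>x\<in>A. \<exists>U. openin (subtopology X A) U \<and> x \<in> U \<and> (\<forall>y\<in>U. f y = f x))"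

definition transversally_locally_constant ::
  "'l metric \<Rightarrow> ('d::finite, 'l) pattern set \<Rightarrow> (('d, 'l) pattern \<Rightarrow> 'b) \<Rightarrow> bool" where
  "transversally_locally_constant L \<Omega> f \<longleftrightarrow>
     (\<forall>\<Xi>. flc_transversal L \<Omega> \<Xi> \<longrightarrow> locally_constant_on (pattern_topology L \<Omega>) \<Xi> f)"


section \<open>First Cech cohomology\<close>

text \<open>Coefficients are in the sheaf of locally constant functions. A cochain on an open cover is
  indexed by the members of the cover; only its values on overlaps matter.\<close>

type_synonym ('a, 'b) cech_cochain = "'a set set \<times> ('a set \<Rightarrow> 'a set \<Rightarrow> 'a \<Rightarrow> 'b)"

definition open_cover :: "'a topology \<Rightarrow> 'a set set \<Rightarrow> bool" where
  "open_cover X \<U> \<longleftrightarrow> (\<forall>U\<in>\<U>. openin X U) \<and> \<Union>\<U> = topspace X"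

definition cech_cocycle :: "'a topology \<Rightarrow> ('a, 'b::ab_group_add) cech_cochain \<Rightarrow> bool" where
  "cech_cocycle X = (\<lambda>(\<U>, c). open_cover X \<U> \<and>
     (\<forall>U\<in>\<U>. \<forall>V\<in>\<U>. locally_constant_on X (U \<inter> V) (c U V)) \<and>
     (\<forall>U\<in>\<U>. \<forall>V\<in>\<U>. \<forall>W\<in>\<U>. \<forall>x\<in>U \<inter> V \<inter> W. c U V x + c V W x = c U W x))"

text \<open>Equality in the direct limit over open covers: the two cocycles differ by a coboundary on a
  common refinement \<open>\<W>\<close>, with refinement maps \<open>\<rho>\<close> and \<open>\<sigma>\<close>.\<close>

definition cech_cohomologous ::
  "'a topology \<Rightarrow> ('a, 'b::ab_group_add) cech_cochain \<Rightarrow> ('a, 'b) cech_cochain \<Rightarrow> bool" where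
  "cech_cohomologous X = (\<lambda>(\<U>, c) (\<V>, e).
     \<exists>\<W> \<rho> \<sigma> b. open_cover X \<W> \<and>
       (\<forall>W\<in>\<W>. \<rho> W \<in> \<U> \<and> W \<subseteq> \<rho> W \<and> \<sigma> W \<in> \<V> \<and> W \<subseteq> \<sigma> W \<and> locally_constant_on X W (b W)) \<and>
       (\<forall>W\<in>\<W>. \<forall>W'\<in>\<W>. \<forall>x\<in>W \<inter> W'.
          c (\<rho> W) (\<rho> W') x - e (\<sigma> W) (\<sigma> W') x = b W x - b W' x))"

lemma equiv_cech_cohomologous:
  "equiv {a. cech_cocycle X a}
     {(a, a' :: ('a, 'b::ab_group_add) cech_cochain).
        cech_cocycle X a \<and> cech_cocycle X a' \<and> cech_cohomologous X a a'}"
proof (rule equivI)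
  have "cech_cohomologous X a a" if "cech_cocycle X a" for a :: "('a, 'b) cech_cochain"
  proof -
    obtain \<U> c where a: "a = (\<U>, c)" by (cases a)
    then have "open_cover X \<U>" using that by (simp add: cech_cocycle_def)
    then show ?thesis
      unfolding a cech_cohomologous_def prod.case
      by (intro exI[of _ \<U>] exI[of _ id] exI[of _ "\<lambda>_ _. 0"])
        (auto simp: open_cover_def locally_constant_on_def intro!: exI openin_subtopology_self dest: openin_subset)
  qed
  then show "refl_on {a. cech_cocycle X a}
     {(a, a' :: ('a, 'b) cech_cochain). cech_cocycle X a \<and> cech_cocycle X a' \<and> cech_cohomologous X a a'}"
    by (auto simp: refl_on_def)
  show "{(a, a' :: ('a, 'b) cech_cochain). cech_cocycle X a \<and> cech_cocycle X a' \<and> cech_cohomologous X a a'}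
     \<subseteq> {a. cech_cocycle X a} \<times> {a. cech_cocycle X a}"
    by auto
  have "cech_cohomologous X a' a" if co: "cech_cohomologous X a a'" for a a' :: "('a, 'b) cech_cochain"
  proof -
    obtain \<U> c \<V> e where a: "a = (\<U>, c)" "a' = (\<V>, e)" by (cases a, cases a')
    obtain \<W> \<rho> \<sigma> b where W: "open_cover X \<W>"
       "\<forall>W\<in>\<W>. \<rho> W \<in> \<U> \<and> W \<subseteq> \<rho> W \<and> \<sigma> W \<in> \<V> \<and> W \<subseteq> \<sigma> W \<and> locally_constant_on X W (b W)"
       "\<forall>W\<in>\<W>. \<forall>W'\<in>\<W>. \<forall>x\<in>W \<inter> W'. c (\<rho> W) (\<rho> W') x - e (\<sigma> W) (\<sigma> W') x = b W x - b W' x"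
      using co unfolding a cech_cohomologous_def prod.case by (elim exE conjE) (rule that)
    have "e (\<sigma> W) (\<sigma> W') x - c (\<rho> W) (\<rho> W') x = - b W x - - b W' x"
      if "W \<in> \<W>" "W' \<in> \<W>" "x \<in> W \<inter> W'" for W W' x
      using W(3) that by (metis minus_diff_eq minus_diff_minus)
    moreover have "locally_constant_on X W (\<lambda>x. - b W x)" if "W \<in> \<W>" for W
      using W(2) that unfolding locally_constant_on_def by metis
    ultimately show ?thesis
      unfolding a cech_cohomologous_def prod.case using W(1,2)
      by (intro exI[of _ \<W>] exI[of _ \<sigma>] exI[of _ \<rho>] exI[of _ "\<lambda>W x. - b W x"]) auto
  qed
  then show "sym {(a, a' :: ('a, 'b) cech_cochain).
      cech_cocycle X a \<and> cech_cocycle X a' \<and> cech_cohomologous X a a'}"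
    by (auto simp: sym_def)
  have "cech_cohomologous X a a''"
    if ca: "cech_cocycle X a" "cech_cocycle X a'" "cech_cocycle X a''"
      and co: "cech_cohomologous X a a'" "cech_cohomologous X a' a''"
    for a a' a'' :: "('a, 'b) cech_cochain"
  proof -
    obtain \<U> c \<V> e \<S> g where a: "a = (\<U>, c)" "a' = (\<V>, e)" "a'' = (\<S>, g)"
      by (cases a, cases a', cases a'')
    obtain \<W> \<rho> \<sigma> b where W: "open_cover X \<W>"
       "\<forall>W\<in>\<W>. \<rho> W \<in> \<U> \<and> W \<subseteq> \<rho> W \<and> \<sigma> W \<in> \<V> \<and> W \<subseteq> \<sigma> W \<and> locally_constant_on X W (b W)"
       "\<forall>W\<in>\<W>. \<forall>W'\<in>\<W>. \<forall>x\<in>W \<inter> W'. c (\<rho> W) (\<rho> W') x - e (\<sigma> W) (\<sigma> W') x = b W x - b W' x"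
      using co(1) unfolding a cech_cohomologous_def prod.case by (elim exE conjE) (rule that)
    obtain \<Z> \<tau> \<upsilon> k where Z: "open_cover X \<Z>"
       "\<forall>W\<in>\<Z>. \<tau> W \<in> \<V> \<and> W \<subseteq> \<tau> W \<and> \<upsilon> W \<in> \<S> \<and> W \<subseteq> \<upsilon> W \<and> locally_constant_on X W (k W)"
       "\<forall>W\<in>\<Z>. \<forall>W'\<in>\<Z>. \<forall>x\<in>W \<inter> W'. e (\<tau> W) (\<tau> W') x - g (\<upsilon> W) (\<upsilon> W') x = k W x - k W' x"
      using co(2) unfolding a cech_cohomologous_def prod.case by (elim exE conjE) (rule that)
    define Y where "Y = (\<lambda>(P, Q). P \<inter> Q) ` (\<W> \<times> \<Z>)"
    have "\<forall>M\<in>Y. \<exists>P Q. P \<in> \<W> \<and> Q \<in> \<Z> \<and> M \<subseteq> P \<and> M \<subseteq> Q" unfolding Y_def by blast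
    then obtain p q where pq: "\<And>M. M \<in> Y \<Longrightarrow> p M \<in> \<W> \<and> q M \<in> \<Z> \<and> M \<subseteq> p M \<and> M \<subseteq> q M" by metis
    define m where "m = (\<lambda>M x. b (p M) x + e (\<sigma> (p M)) (\<tau> (q M)) x + k (q M) x)"
    have cover: "open_cover X Y"
      unfolding open_cover_def
    proof
      show "\<forall>U\<in>Y. openin X U"
        using W(1) Z(1) by (auto simp: open_cover_def Y_def)
      have "\<Union>Y = \<Union>\<W> \<inter> \<Union>\<Z>" unfolding Y_def by blast
      then show "\<Union>Y = topspace X"
        using W(1) Z(1) by (simp add: open_cover_def)
    qed
    have lc: "locally_constant_on X M (m M)" if M: "M \<in> Y" for M
      unfolding locally_constant_on_def
    proof
      fix x assume x: "x \<in> M"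
      note mm = pq[OF M]
      have sub: "\<exists>U. openin (subtopology X M) U \<and> x \<in> U \<and> (\<forall>y\<in>U. f y = f x)"
        if lcA: "locally_constant_on X A f" "M \<subseteq> A" for A and f :: "'a \<Rightarrow> 'b"
      proof -
        obtain U where U: "openin (subtopology X A) U" "x \<in> U" "\<forall>y\<in>U. f y = f x"
          using \<open>x \<in> M\<close> lcA unfolding locally_constant_on_def by (meson subsetD)
        then obtain O' where O': "openin X O'" "U = O' \<inter> A" by (auto simp: openin_subtopology)
        have "openin (subtopology X M) (O' \<inter> M)" using O'(1) by (rule openin_subtopology_Int)
        moreover have "O' \<inter> M \<subseteq> U" using O'(2) lcA(2) by blast
        moreover have "x \<in> O' \<inter> M" using U(2) O'(2) \<open>x \<in> M\<close> by blast
        moreover have "\<forall>y\<in>O' \<inter> M. f y = f x" using U(3) \<open>O' \<inter> M \<subseteq> U\<close> by blast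
        ultimately show ?thesis by blast
      qed
      have "locally_constant_on X (p M) (b (p M))" "M \<subseteq> p M"
        using W(2) mm by blast+
      from sub[OF this] obtain U1 where U1: "openin (subtopology X M) U1" "x \<in> U1" "\<forall>y\<in>U1. b (p M) y = b (p M) x" by blast
      have "locally_constant_on X (q M) (k (q M))" "M \<subseteq> q M"
        using Z(2) mm by blast+
      from sub[OF this] obtain U2 where U2: "openin (subtopology X M) U2" "x \<in> U2" "\<forall>y\<in>U2. k (q M) y = k (q M) x" by blast
      have "locally_constant_on X (\<sigma> (p M) \<inter> \<tau> (q M)) (e (\<sigma> (p M)) (\<tau> (q M)))"
        using ca(2) W(2) Z(2) mm unfolding a cech_cocycle_def by blast
      moreover have "M \<subseteq> \<sigma> (p M) \<inter> \<tau> (q M)" using W(2) Z(2) mm by blast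
      ultimately have "\<exists>U. openin (subtopology X M) U \<and> x \<in> U \<and>
          (\<forall>y\<in>U. e (\<sigma> (p M)) (\<tau> (q M)) y = e (\<sigma> (p M)) (\<tau> (q M)) x)" by (rule sub)
      then obtain U3 where U3: "openin (subtopology X M) U3" "x \<in> U3"
         "\<forall>y\<in>U3. e (\<sigma> (p M)) (\<tau> (q M)) y = e (\<sigma> (p M)) (\<tau> (q M)) x" by blast
      show "\<exists>U. openin (subtopology X M) U \<and> x \<in> U \<and> (\<forall>y\<in>U. m M y = m M x)"
      proof (intro exI conjI ballI)
        show "openin (subtopology X M) (U1 \<inter> U2 \<inter> U3)"
          using U1(1) U2(1) U3(1) by (intro openin_Int)
        show "x \<in> U1 \<inter> U2 \<inter> U3" using U1(2) U2(2) U3(2) by blast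
        fix y assume "y \<in> U1 \<inter> U2 \<inter> U3"
        then have "b (p M) y = b (p M) x" "k (q M) y = k (q M) x"
          "e (\<sigma> (p M)) (\<tau> (q M)) y = e (\<sigma> (p M)) (\<tau> (q M)) x"
          using U1(3) U2(3) U3(3) by blast+
        then show "m M y = m M x" by (simp only: m_def)
      qed
    qed
    have coc: "c (\<rho> (p M)) (\<rho> (p N)) x - g (\<upsilon> (q M)) (\<upsilon> (q N)) x = m M x - m N x"
      if M: "M \<in> Y" and N: "N \<in> Y" and x: "x \<in> M \<inter> N" for M N x
    proof -
      note mm = pq[OF M] pq[OF N]
      have xx: "x \<in> p M \<inter> p N" "x \<in> q M \<inter> q N" using x mm by blast+
      have 1: "c (\<rho> (p M)) (\<rho> (p N)) x - e (\<sigma> (p M)) (\<sigma> (p N)) x = b (p M) x - b (p N) x"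
        using W(3) mm xx by blast
      have 2: "e (\<tau> (q M)) (\<tau> (q N)) x - g (\<upsilon> (q M)) (\<upsilon> (q N)) x = k (q M) x - k (q N) x"
        using Z(3) mm xx by blast
      have v: "\<sigma> (p M) \<in> \<V>" "\<sigma> (p N) \<in> \<V>" "\<tau> (q M) \<in> \<V>" "\<tau> (q N) \<in> \<V>"
        "x \<in> \<sigma> (p M)" "x \<in> \<sigma> (p N)" "x \<in> \<tau> (q M)" "x \<in> \<tau> (q N)"
        using W(2) Z(2) mm xx by blast+
      have coc: "e U V x + e V V' x = e U V' x" if "U \<in> \<V>" "V \<in> \<V>" "V' \<in> \<V>" "x \<in> U" "x \<in> V" "x \<in> V'" for U V V'
        using ca(2) that unfolding a cech_cocycle_def by blast
      have 3: "e (\<sigma> (p M)) (\<tau> (q M)) x + e (\<tau> (q M)) (\<tau> (q N)) x = e (\<sigma> (p M)) (\<tau> (q N)) x"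
        using v by (intro coc)
      have 4: "e (\<sigma> (p M)) (\<sigma> (p N)) x + e (\<sigma> (p N)) (\<tau> (q N)) x = e (\<sigma> (p M)) (\<tau> (q N)) x"
        using v by (intro coc)
      have "e (\<sigma> (p M)) (\<sigma> (p N)) x = e (\<sigma> (p M)) (\<tau> (q M)) x + e (\<tau> (q M)) (\<tau> (q N)) x - e (\<sigma> (p N)) (\<tau> (q N)) x"
        using 3 4 by (simp add: eq_diff_eq)
      moreover have "c (\<rho> (p M)) (\<rho> (p N)) x = b (p M) x - b (p N) x + e (\<sigma> (p M)) (\<sigma> (p N)) x"
        using 1 by (simp add: diff_eq_eq)
      moreover have "g (\<upsilon> (q M)) (\<upsilon> (q N)) x = e (\<tau> (q M)) (\<tau> (q N)) x - (k (q M) x - k (q N) x)"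
        using 2 by (metis diff_diff_eq2 add_diff_cancel_left' diff_add_cancel)
      ultimately have "c (\<rho> (p M)) (\<rho> (p N)) x - g (\<upsilon> (q M)) (\<upsilon> (q N)) x =
          (b (p M) x - b (p N) x + (e (\<sigma> (p M)) (\<tau> (q M)) x + e (\<tau> (q M)) (\<tau> (q N)) x
            - e (\<sigma> (p N)) (\<tau> (q N)) x)) - (e (\<tau> (q M)) (\<tau> (q N)) x - (k (q M) x - k (q N) x))"
        by (simp only:)
      also have "\<dots> = m M x - m N x"
        unfolding m_def by (simp add: algebra_simps)
      finally show ?thesis .
    qed
    show ?thesis
      unfolding a cech_cohomologous_def prod.case
    proof (rule exI[of _ Y], rule exI[of _ "\<lambda>M. \<rho> (p M)"],
        rule exI[of _ "\<lambda>M. \<upsilon> (q M)"], rule exI[of _ m], intro conjI cover ballI)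
      fix M assume M: "M \<in> Y"
      note mm = pq[OF M]
      show "\<rho> (p M) \<in> \<U>" "M \<subseteq> \<rho> (p M)" "\<upsilon> (q M) \<in> \<S>" "M \<subseteq> \<upsilon> (q M)" "locally_constant_on X M (m M)"
        using W(2) Z(2) mm lc[OF M] by blast+
    qed (rule coc)
  qed
  then show "trans {(a, a' :: ('a, 'b) cech_cochain).
      cech_cocycle X a \<and> cech_cocycle X a' \<and> cech_cohomologous X a a'}"
    unfolding trans_def by blast
qed

definition cech_H1 :: "'a topology \<Rightarrow> ('a, 'b::ab_group_add) cech_cochain set set" where
  "cech_H1 X =
     {a. cech_cocycle X a} // {(a, a'). cech_cocycle X a \<and> cech_cocycle X a' \<and> cech_cohomologous X a a'}"

text \<open>\<open>cech_pullback X h\<close> is \<open>h\<^sup>*\<close> on cohomology classes, for a homeomorphism \<open>h\<close> with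
  domain \<open>X\<close>; being a bijection, \<open>h\<close> matches the members of a cover with their preimages.\<close>

definition cocycle_pullback ::
  "'a topology \<Rightarrow> ('a \<Rightarrow> 'c) \<Rightarrow> ('c, 'b) cech_cochain \<Rightarrow> ('a, 'b) cech_cochain" where
  "cocycle_pullback X h = (\<lambda>(\<V>, e).
     ((\<lambda>V. {x \<in> topspace X. h x \<in> V}) ` \<V>, \<lambda>U U' x. e (h ` U) (h ` U') (h x)))"

definition cech_pullback ::
  "'a topology \<Rightarrow> ('a \<Rightarrow> 'c) \<Rightarrow> ('c, 'b::ab_group_add) cech_cochain set \<Rightarrow>
   ('a, 'b) cech_cochain set" where
  "cech_pullback X h A =
     {a. cech_cocycle X a \<and> (\<exists>e\<in>A. cech_cohomologous X (cocycle_pullback X h e) a)}"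


section \<open>Strong cocycles and their Cech classes\<close>

definition strong_cocycle ::
  "'l metric \<Rightarrow> ('d::finite, 'l) pattern set \<Rightarrow> (('d, 'l) pattern \<Rightarrow> real ^ 'd \<Rightarrow> real ^ 'd) \<Rightarrow> bool"
where
  "strong_cocycle L \<Omega> \<alpha> \<longleftrightarrow>
     continuous_map (prod_topology (pattern_topology L \<Omega>) euclidean) euclidean (\<lambda>(T, x). \<alpha> T x) \<and>
     (\<forall>T\<in>\<Omega>. \<forall>x y. \<alpha> T x + \<alpha> (translate x T) y = \<alpha> T (x + y)) \<and>
     (\<forall>v. transversally_locally_constant L \<Omega> (\<lambda>T. \<alpha> T v))"

text \<open>The open set \<open>U\<close> is \<open>{S - x. S \<in> \<Xi>, \<bar>x\<bar> < \<epsilon>}\<close>, with the product structure of a flow box.\<close>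

definition flow_box ::
  "'l metric \<Rightarrow> ('d::finite, 'l) pattern set \<Rightarrow> ('d, 'l) pattern set \<Rightarrow> real \<Rightarrow>
   ('d, 'l) pattern set \<Rightarrow> bool" where
  "flow_box L \<Omega> \<Xi> \<epsilon> U \<longleftrightarrow>
     flc_transversal L \<Omega> \<Xi> \<and> 0 < \<epsilon> \<and> openin (pattern_topology L \<Omega>) U \<and>
     homeomorphic_map
       (prod_topology (subtopology (pattern_topology L \<Omega>) \<Xi>) (top_of_set (ball 0 \<epsilon>)))
       (subtopology (pattern_topology L \<Omega>) U)
       (\<lambda>(S, x). translate x S)"

text \<open>The cocycle \<open>c\<^sub>U - c\<^sub>V\<close> of \<open>\<alpha>\<close> for a cover by flow boxes, where
  \<open>c\<^sub>U (S - x) = \<alpha>(S, x)\<close>.\<close>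

definition flow_box_cocycle ::
  "'l metric \<Rightarrow> ('d::finite, 'l) pattern set \<Rightarrow> (('d, 'l) pattern \<Rightarrow> real ^ 'd \<Rightarrow> real ^ 'd) \<Rightarrow>
   (('d, 'l) pattern, real ^ 'd) cech_cochain \<Rightarrow> bool" where
  "flow_box_cocycle L \<Omega> \<alpha> = (\<lambda>(\<U>, g).
     open_cover (pattern_topology L \<Omega>) \<U> \<and>
     (\<exists>\<Xi> \<epsilon> c.
        (\<forall>U\<in>\<U>. flow_box L \<Omega> (\<Xi> U) (\<epsilon> U) U \<and>
           (\<forall>S\<in>\<Xi> U. \<forall>x. norm x < \<epsilon> U \<longrightarrow> c U (translate x S) = \<alpha> S x)) \<and>
        (\<forall>U\<in>\<U>. \<forall>V\<in>\<U>. \<forall>T\<in>U \<inter> V. g U V T = c U T - c V T)))"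

text \<open>The Cech class of a strong cocycle. Different covers by flow boxes give cohomologous
  cocycles, so this is one element of \<open>cech_H1\<close>.\<close>

definition strong_class ::
  "'l metric \<Rightarrow> ('d::finite, 'l) pattern set \<Rightarrow> (('d, 'l) pattern \<Rightarrow> real ^ 'd \<Rightarrow> real ^ 'd) \<Rightarrow>
   (('d, 'l) pattern, real ^ 'd) cech_cochain set" where
  "strong_class L \<Omega> \<alpha> =
     {a. cech_cocycle (pattern_topology L \<Omega>) a \<and>
         (\<exists>g. flow_box_cocycle L \<Omega> \<alpha> g \<and> cech_cohomologous (pattern_topology L \<Omega>) g a)}"

definition fundamental_shape_class ::
  "'l metric \<Rightarrow> ('d::finite, 'l) pattern set \<Rightarrow> (('d, 'l) pattern, real ^ 'd) cech_cochain set" where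
  "fundamental_shape_class L \<Omega> = strong_class L \<Omega> (\<lambda>T v. v)"

definition homeo_class ::
  "'l metric \<Rightarrow> ('d::finite, 'l) pattern set \<Rightarrow> 'm metric \<Rightarrow> ('d, 'm) pattern set \<Rightarrow>
   (('d, 'l) pattern \<Rightarrow> ('d, 'm) pattern) \<Rightarrow> (('d, 'l) pattern, real ^ 'd) cech_cochain set" where
  "homeo_class L \<Omega> L' \<Omega>' h =
     cech_pullback (pattern_topology L \<Omega>) h (fundamental_shape_class L' \<Omega>')"

text \<open>The matrix of \<open>v \<mapsto> \<integral> \<alpha>(T, v) d\<mu>(T)\<close>. The choice of the strong cocycle \<open>\<alpha>\<close>
  representing the class does not affect the integral.\<close>

definition ruelle_sullivan ::
  "'l metric \<Rightarrow> ('d::finite, 'l) pattern set \<Rightarrow> ('d, 'l) pattern measure \<Rightarrow>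
   (('d, 'l) pattern, real ^ 'd) cech_cochain set \<Rightarrow> real ^ 'd ^ 'd" where
  "ruelle_sullivan L \<Omega> \<mu> a =
     (let \<alpha> = (SOME \<alpha>. strong_cocycle L \<Omega> \<alpha> \<and> strong_class L \<Omega> \<alpha> = a)
      in matrix (\<lambda>v. LINT T|\<mu>. \<alpha> T v))"


section \<open>Shape change transformations\<close>

text \<open>For a labelled Delone set the vertices are its points.\<close>

definition vertices :: "('d::finite, 'l) pattern \<Rightarrow> (real ^ 'd) set" where
  "vertices T = {p. \<exists>(t, l)\<in>T. p extreme_point_of t}"

text \<open>Vertices of a common tile are neighbours, and so are points whose closed Voronoi cells
  meet. The first clause is void for labelled Delone sets.\<close>

definition neighbours :: "('d::finite, 'l) pattern \<Rightarrow> real ^ 'd \<Rightarrow> real ^ 'd \<Rightarrow> bool" where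
  "neighbours T p q \<longleftrightarrow>
     (\<exists>(t, l)\<in>T. p extreme_point_of t \<and> q extreme_point_of t) \<or>
     (p \<in> vertices T \<and> q \<in> vertices T \<and>
        (\<exists>z. \<forall>v\<in>vertices T. dist z p \<le> dist z v \<and> dist z q \<le> dist z v))"

text \<open>An \<open>\<real>\<^sup>d\<close>-valued 1-form is given by its matrix of coefficients: its value at \<open>x\<close> on a tangent
  vector \<open>v\<close> is \<open>\<omega> x *v v\<close>.\<close>

primrec times_differentiable ::
  "nat \<Rightarrow> ('a::real_normed_vector \<Rightarrow> 'b::real_normed_vector) \<Rightarrow> bool" where
  "times_differentiable 0 f \<longleftrightarrow> continuous_on UNIV f"
| "times_differentiable (Suc n) f \<longleftrightarrow>
     f differentiable_on UNIV \<and>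
     (\<forall>v. times_differentiable n (\<lambda>x. frechet_derivative f (at x) v))"

definition smooth :: "('a::real_normed_vector \<Rightarrow> 'b::real_normed_vector) \<Rightarrow> bool" where
  "smooth f \<longleftrightarrow> (\<forall>n. times_differentiable n f)"

definition closed_form :: "(real ^ 'd::finite \<Rightarrow> real ^ 'd ^ 'd) \<Rightarrow> bool" where
  "closed_form \<omega> \<longleftrightarrow>
     (\<forall>x v w. frechet_derivative \<omega> (at x) v *v w - frechet_derivative \<omega> (at x) w *v v = 0)"

definition strongly_PE ::
  "('d::finite, 'l) pattern \<Rightarrow> real \<Rightarrow> (real ^ 'd \<Rightarrow> real ^ 'd ^ 'd) \<Rightarrow> bool" where
  "strongly_PE T R \<omega> \<longleftrightarrow>
     (\<forall>x y. patch (translate x T) 0 R = patch (translate y T) 0 R \<longrightarrow> \<omega> x = \<omega> y)"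

text \<open>The integral of \<open>\<omega>\<close> along the segment from 0 to \<open>x\<close>; for closed \<open>\<omega>\<close> every path gives
  the same value.\<close>

definition form_integral :: "(real ^ 'd::finite \<Rightarrow> real ^ 'd ^ 'd) \<Rightarrow> real ^ 'd \<Rightarrow> real ^ 'd" where
  "form_integral \<omega> x = integral {0..1} (\<lambda>t. \<omega> (t *\<^sub>R x) *v x)"

text \<open>The label of \<open>A p\<close> is the patch around \<open>p\<close> moved to the origin, so that equal patches at
  different places give equal labels.\<close>

definition deformed ::
  "('d::finite, 'l) pattern \<Rightarrow> real \<Rightarrow> (real ^ 'd \<Rightarrow> real ^ 'd) \<Rightarrow> ('d, ('d, 'l) pattern) pattern" where
  "deformed T R\<^sub>0 A = {({A p}, patch (translate p T) 0 R\<^sub>0) | p. p \<in> vertices T}"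

definition delone_hull :: "'l metric \<Rightarrow> ('d::finite, 'l) pattern \<Rightarrow> ('d, 'l) pattern set" where
  "delone_hull L T = pattern_topology L {S. labelled_delone L S} closure_of orbit T"

text \<open>The new labels are finitely many patches, whence the discrete metric on them.\<close>

definition shape_change ::
  "'l metric \<Rightarrow> ('d::finite, 'l) pattern set \<Rightarrow> ('d, ('d, 'l) pattern) pattern set \<Rightarrow>
   (('d, 'l) pattern \<Rightarrow> ('d, ('d, 'l) pattern) pattern) \<Rightarrow> bool" where
  "shape_change L \<Omega> \<Omega>' h \<longleftrightarrow>
     (\<exists>T \<omega> R R\<^sub>0 A T'.
        T \<in> \<Omega> \<and> 0 \<in> vertices T \<and>
        smooth \<omega> \<and> closed_form \<omega> \<and> 0 < R \<and> strongly_PE T R \<omega> \<and>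
        A = form_integral \<omega> \<and> (\<exists>B. homeomorphism UNIV UNIV A B) \<and>
        (\<forall>p q. neighbours T p q \<longrightarrow> R + dist p q < R\<^sub>0) \<and>
        T' = deformed T R\<^sub>0 A \<and> labelled_delone discrete_labels T' \<and>
        \<Omega>' = delone_hull discrete_labels T' \<and>
        homeomorphic_map (pattern_topology L \<Omega>) (pattern_topology discrete_labels \<Omega>') h \<and>
        (\<forall>x. h (translate x T) = translate (A x) T'))"

end

theory Submission
  imports Defs
begin

text \<open>A class \<open>a\<close> is represented by a form: a matrix-valued function \<open>W\<close> on \<open>\<Omega>\<close> that depends on a
  patch of fixed radius and whose restriction \<open>x \<mapsto> W (T - x)\<close> to each leaf is smooth and closed. Its
  integrals along leaves form a cocycle \<open>\<beta>\<close> (\<open>leaf_integral W\<close>) with class \<open>a\<close>. Such a form exists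
  because a Cech cocycle splits, by a partition of unity that is smooth along leaves and locally
  constant across them, into local functions whose leafwise derivatives match
  (\<open>cech_cocycle_PE_form\<close>). The mean of \<open>W\<close> over \<open>\<Omega>\<close> is the Ruelle-Sullivan matrix \<open>C\<close> of \<open>a\<close>
  (\<open>ruelle_sullivan_PE_form\<close>).

  The form may be replaced by the average of finitely many translates of it, as this changes \<open>\<beta>\<close> by
  a coboundary. Unique ergodicity makes suitable averages uniformly close to \<open>C\<close>
  (\<open>PE_form_nearly_constant\<close>): otherwise the averages would cluster at an invariant mean, and then
  at an invariant probability measure, with the wrong integral. As \<open>C\<close> is invertible, \<open>\<beta> T\<close> then
  is a small Lipschitz perturbation of an invertible linear map, and so a bilipschitz homeomorphism
  of \<open>\<real>\<^sup>d\<close> for every \<open>T\<close> (\<open>leaf_deformationI\<close>).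

  Now deform all patterns at once: \<open>deform T\<close> moves each vertex \<open>p\<close> of \<open>T\<close> to \<open>\<beta> T p\<close>, labelled by the
  patch around \<open>p\<close>. The cocycle property says that \<open>T - x\<close> goes to \<open>deform T - \<beta> T x\<close>. The labels and
  displacements allow one to recover \<open>T\<close>, walking from vertex to vertex (\<open>deform_inj\<close>), so
  \<open>deform\<close> is a homeomorphism onto its image, which by minimality is the hull of one deformed
  pattern (\<open>delone_hull_deform\<close>). A function that grows like the displacement on the deformed space
  grows like \<open>\<beta>\<close> on \<open>\<Omega>\<close>; so the shape class pulls back to the class of \<open>\<beta>\<close>
  (\<open>homeo_class_deform\<close>), which is \<open>a\<close>.

  The arguments about the topology of \<open>\<Omega>\<close> rest on one consequence of finite local complexity: if
  two patterns are close then, after a small translation of one of them, they have the same patch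
  around the origin (\<open>eps_close_imp_agree\<close>).\<close>

section \<open>Smooth functions\<close>

text \<open>Derivatives are tested in one direction at a time, so the closure properties follow by induction
  from the sum, product and chain rules.\<close>

lemma times_differentiable_SucI:
  assumes "\<And>x. (f has_derivative f' x) (at x)"
    and "\<And>v. times_differentiable n (\<lambda>x. f' x v)"
  shows "times_differentiable (Suc n) f"
proof -
  have "frechet_derivative f (at x) = f' x" for x
    using frechet_derivative_at[OF assms(1)] by metis
  then show ?thesis
    using assms by (auto simp: differentiable_on_def differentiable_def intro: has_derivative_at_withinI)
qed

lemma times_differentiable_SucE:
  assumes "times_differentiable (Suc n) f"
  shows "(f has_derivative frechet_derivative f (at x)) (at x)"
    and "times_differentiable n (\<lambda>x. frechet_derivative f (at x) v)"
  using assms by (auto simp: differentiable_on_def frechet_derivative_works)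

lemma times_differentiable_Suc_imp: "times_differentiable (Suc n) f \<Longrightarrow> times_differentiable n f"
proof (induction n arbitrary: f)
  case 0
  then show ?case by (simp add: differentiable_imp_continuous_on)
next
  case (Suc n)
  then show ?case using times_differentiable.simps(2)[of n f] times_differentiable.simps(2)[of "Suc n" f] by blast
qed

lemma times_differentiable_const: "times_differentiable n (\<lambda>_. c)"
proof (induction n arbitrary: c)
  case (Suc n)
  show ?case
    by (rule times_differentiable_SucI[where f' = "\<lambda>_ _. 0"]) (simp_all add: Suc.IH)
qed simp

lemma times_differentiable_linear:
  assumes "bounded_linear f"
  shows "times_differentiable n f"
proof (cases n)
  case 0
  then show ?thesis using assms by (simp add: linear_continuous_on)
next
  case (Suc m)
  show ?thesis
    unfolding Suc
    by (rule times_differentiable_SucI[where f' = "\<lambda>_. f"])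
      (auto intro: bounded_linear_imp_has_derivative assms times_differentiable_const)
qed

lemma times_differentiable_add:
  "times_differentiable n f \<Longrightarrow> times_differentiable n g \<Longrightarrow> times_differentiable n (\<lambda>x. f x + g x)"
proof (induction n arbitrary: f g)
  case 0
  then show ?case by (simp add: continuous_on_add)
next
  case (Suc n)
  show ?case
    by (rule times_differentiable_SucI[where f' = "\<lambda>x v. frechet_derivative f (at x) v + frechet_derivative g (at x) v"])
      (auto intro!: has_derivative_add Suc.IH times_differentiable_SucE Suc.prems)
qed

lemma times_differentiable_sum:
  "(\<And>i. i \<in> I \<Longrightarrow> times_differentiable n (f i)) \<Longrightarrow> times_differentiable n (\<lambda>x. \<Sum>i\<in>I. f i x)"
  by (induction I rule: infinite_finite_induct) (auto intro!: times_differentiable_const times_differentiable_add)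

lemma times_differentiable_bilinear:
  assumes "bounded_bilinear bop"
  shows "times_differentiable n f \<Longrightarrow> times_differentiable n g \<Longrightarrow> times_differentiable n (\<lambda>x. bop (f x) (g x))"
proof (induction n arbitrary: f g)
  case 0
  then show ?case using bounded_bilinear.continuous_on[OF assms] by auto
next
  case (Suc n)
  show ?case
    by (rule times_differentiable_SucI[where f' = "\<lambda>x v. bop (f x) (frechet_derivative g (at x) v) + bop (frechet_derivative f (at x) v) (g x)"])
      (auto intro!: bounded_bilinear.FDERIV[OF assms] times_differentiable_add Suc.IH
          times_differentiable_SucE[OF Suc.prems(1)] times_differentiable_SucE[OF Suc.prems(2)]
          times_differentiable_Suc_imp[OF Suc.prems(1)] times_differentiable_Suc_imp[OF Suc.prems(2)])
qed

lemmas times_differentiable_mult = times_differentiable_bilinear[OF bounded_bilinear_mult]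
lemmas times_differentiable_scaleR = times_differentiable_bilinear[OF bounded_bilinear_scaleR]

lemma times_differentiable_bounded_linear:
  assumes "bounded_linear L"
  shows "times_differentiable n f \<Longrightarrow> times_differentiable n (\<lambda>x. L (f x))"
proof (induction n arbitrary: f)
  case 0
  then show ?case using bounded_linear.continuous_on[OF assms] by auto
next
  case (Suc n)
  show ?case
    by (rule times_differentiable_SucI[where f' = "\<lambda>x v. L (frechet_derivative f (at x) v)"])
      (auto intro!: bounded_linear.has_derivative[OF assms] Suc.IH times_differentiable_SucE Suc.prems)
qed

lemma times_differentiable_compose_real:
  fixes g :: "real \<Rightarrow> real"
  shows "times_differentiable n g \<Longrightarrow> times_differentiable n f \<Longrightarrow> times_differentiable n (\<lambda>x. g (f x))"
proof (induction n arbitrary: f g)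
  case 0
  then show ?case by (auto intro: continuous_on_compose2[of UNIV g])
next
  case (Suc n)
  note g = times_differentiable_SucE[OF Suc.prems(1)] and f = times_differentiable_SucE[OF Suc.prems(2)]
  have lin: "frechet_derivative g (at y) s = s * frechet_derivative g (at y) 1" for y s
    using linear_scale[OF has_derivative_linear[OF g(1)[of y]], of s 1] by simp
  show ?case
  proof (rule times_differentiable_SucI)
    show "((\<lambda>x. g (f x)) has_derivative
        (\<lambda>v. frechet_derivative f (at x) v * frechet_derivative g (at (f x)) 1)) (at x)" for x
      by (rule has_derivative_eq_rhs[OF has_derivative_compose[OF f(1) g(1)]]) (metis lin)
    show "times_differentiable n (\<lambda>x. frechet_derivative f (at x) v * frechet_derivative g (at (f x)) 1)" for v
      by (rule times_differentiable_mult[OF f(2) Suc.IH[OF g(2) times_differentiable_Suc_imp[OF Suc.prems(2)]]])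
  qed
qed

lemma times_differentiable_inverse:
  fixes f :: "'a::real_normed_vector \<Rightarrow> real"
  assumes "\<And>x. f x \<noteq> 0"
  shows "times_differentiable n f \<Longrightarrow> times_differentiable n (\<lambda>x. inverse (f x))"
proof (induction n)
  case 0
  then show ?case using assms by (simp add: continuous_on_inverse)
next
  case (Suc n)
  note f = times_differentiable_SucE[OF Suc.prems] and IH = Suc.IH[OF times_differentiable_Suc_imp[OF Suc.prems]]
  show ?case
  proof (rule times_differentiable_SucI)
    show "((\<lambda>x. inverse (f x)) has_derivative
        (\<lambda>v. (- 1) * (inverse (f x) * frechet_derivative f (at x) v * inverse (f x)))) (at x)" for x
      by (rule has_derivative_eq_rhs[OF Deriv.has_derivative_inverse[OF assms f(1)]]) (simp add: fun_eq_iff)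
    show "times_differentiable n (\<lambda>x. (- 1) * (inverse (f x) * frechet_derivative f (at x) v * inverse (f x)))" for v
      by (rule times_differentiable_mult[OF times_differentiable_const
            times_differentiable_mult[OF times_differentiable_mult[OF IH f(2)] IH]])
  qed
qed

lemma times_differentiable_shift:
  "times_differentiable n f \<Longrightarrow> times_differentiable n (\<lambda>x. f (x + c))"
proof (induction n arbitrary: f)
  case 0
  then show ?case by (auto intro!: continuous_on_compose2[of UNIV f] continuous_intros)
next
  case (Suc n)
  show ?case
  proof (rule times_differentiable_SucI)
    show "((\<lambda>x. f (x + c)) has_derivative frechet_derivative f (at (x + c))) (at x)" for x
      using has_derivative_compose[OF has_derivative_add[OF has_derivative_ident has_derivative_const[of c]]
          times_differentiable_SucE(1)[OF Suc.prems, of "x + c"]]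
      by (simp add: o_def)
    show "times_differentiable n (\<lambda>x. frechet_derivative f (at (x + c)) v)" for v
      by (rule Suc.IH[OF times_differentiable_SucE(2)[OF Suc.prems]])
  qed
qed

text \<open>Functions on a leaf will be given by different formulas near different points.\<close>

lemma times_differentiable_local:
  assumes "\<And>x. \<exists>g. times_differentiable n g \<and> (\<forall>\<^sub>F y in nhds x. f y = g y)"
  shows "times_differentiable n f"
  using assms
proof (induction n arbitrary: f)
  case 0
  have "isCont f x" for x
  proof -
    obtain g where g: "times_differentiable 0 g" "\<forall>\<^sub>F y in nhds x. f y = g y"
      using 0 by blast
    then have "isCont g x" by (simp add: continuous_on_eq_continuous_at)
    then show ?thesis using isCont_cong[OF g(2)] by simp
  qed
  then show ?case by (simp add: continuous_at_imp_continuous_on)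
next
  case (Suc n)
  have *: "\<exists>g. times_differentiable (Suc n) g \<and> (\<forall>\<^sub>F y in nhds x. f y = g y \<and>
      (f has_derivative frechet_derivative g (at y)) (at y))" for x
  proof -
    obtain g where g: "times_differentiable (Suc n) g" "\<forall>\<^sub>F y in nhds x. f y = g y"
      using Suc.prems by blast
    obtain S where S: "open S" "x \<in> S" "\<And>y. y \<in> S \<Longrightarrow> f y = g y"
      using g(2) by (auto simp: eventually_nhds)
    have "(f has_derivative frechet_derivative g (at y)) (at y)" if "y \<in> S" for y
      using has_derivative_transform_within_open[OF times_differentiable_SucE(1)[OF g(1)] S(1) that] S(3)
      by auto
    then show ?thesis using g(1) S by (auto simp: eventually_nhds)
  qed
  show ?case
  proof (rule times_differentiable_SucI)
    show fd: "(f has_derivative frechet_derivative f (at x)) (at x)" for x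
    proof -
      obtain g where "\<forall>\<^sub>F y in nhds x. f y = g y \<and> (f has_derivative frechet_derivative g (at y)) (at y)"
        using *[of x] by blast
      then have "(f has_derivative frechet_derivative g (at x)) (at x)"
        by (auto dest: eventually_nhds_x_imp_x)
      then show ?thesis using frechet_derivative_at by metis
    qed
    show "times_differentiable n (\<lambda>x. frechet_derivative f (at x) v)" for v
    proof (rule Suc.IH)
      fix x
      obtain g where g: "times_differentiable (Suc n) g" "\<forall>\<^sub>F y in nhds x. f y = g y \<and>
          (f has_derivative frechet_derivative g (at y)) (at y)"
        using * by blast
      have "\<forall>\<^sub>F y in nhds x. frechet_derivative f (at y) v = frechet_derivative g (at y) v"
        using g(2) by eventually_elim (metis frechet_derivative_at)
      then show "\<exists>g. times_differentiable n g \<and> (\<forall>\<^sub>F y in nhds x. frechet_derivative f (at y) v = g y)"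
        using times_differentiable_SucE(2)[OF g(1)] by blast
    qed
  qed
qed

lemma smooth_local:
  assumes "\<And>x. \<exists>g. smooth g \<and> (\<forall>\<^sub>F y in nhds x. f y = g y)"
  shows "smooth f"
  unfolding smooth_def
proof
  fix n show "times_differentiable n f"
  proof (rule times_differentiable_local)
    fix x
    obtain g where "smooth g" "\<forall>\<^sub>F y in nhds x. f y = g y" using assms by blast
    then show "\<exists>g. times_differentiable n g \<and> (\<forall>\<^sub>F y in nhds x. f y = g y)"
      unfolding smooth_def by blast
  qed
qed

lemma smooth_const: "smooth (\<lambda>_. c)"
  by (simp add: smooth_def times_differentiable_const)

lemma smooth_sum: "(\<And>i. i \<in> I \<Longrightarrow> smooth (f i)) \<Longrightarrow> smooth (\<lambda>x. \<Sum>i\<in>I. f i x)"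
  by (simp add: smooth_def times_differentiable_sum)

lemma smooth_scaleR: "smooth f \<Longrightarrow> smooth g \<Longrightarrow> smooth (\<lambda>x. f x *\<^sub>R g x)"
  by (simp add: smooth_def times_differentiable_scaleR)

lemma smooth_inverse: "smooth f \<Longrightarrow> (\<And>x. f x \<noteq> (0::real)) \<Longrightarrow> smooth (\<lambda>x. inverse (f x))"
  by (simp add: smooth_def times_differentiable_inverse)

lemma smooth_shift: "smooth f \<Longrightarrow> smooth (\<lambda>x. f (x + c))"
  by (simp add: smooth_def times_differentiable_shift)

lemma smooth_bounded_linear: "bounded_linear L \<Longrightarrow> smooth f \<Longrightarrow> smooth (\<lambda>x. L (f x))"
  by (simp add: smooth_def times_differentiable_bounded_linear)

lemma smooth_has_derivative: "smooth f \<Longrightarrow> (f has_derivative frechet_derivative f (at x)) (at x)"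
  using times_differentiable_SucE(1)[of 0 f] unfolding smooth_def by blast

lemma smooth_frechet_derivative: "smooth f \<Longrightarrow> smooth (\<lambda>x. frechet_derivative f (at x) v)"
  unfolding smooth_def by (intro allI times_differentiable_SucE(2)) blast

lemma smooth_continuous_on: "smooth f \<Longrightarrow> continuous_on S f"
  using continuous_on_subset[of UNIV f S] times_differentiable.simps(1)[of f] unfolding smooth_def by blast

text \<open>The derivative of \<open>P (1/t) exp (-1/t)\<close> is of the same form, with another polynomial.\<close>

definition flat :: "real poly \<Rightarrow> real \<Rightarrow> real" where
  "flat P t = (if 0 < t then poly P (1 / t) * exp (- (1 / t)) else 0)"

lemma poly_times_exp_minus_tendsto_0: "((\<lambda>s. poly P s * exp (- s)) \<longlongrightarrow> (0::real)) at_top"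
proof -
  have "((\<lambda>s. \<Sum>i\<le>degree P. coeff P i * (s ^ i / exp s)) \<longlongrightarrow> (\<Sum>i\<le>degree P. coeff P i * 0)) at_top"
    by (intro tendsto_sum tendsto_mult tendsto_const tendsto_power_div_exp_0)
  then show ?thesis
    by (simp add: poly_altdef sum_distrib_right exp_minus divide_inverse mult.assoc)
qed

lemma flat_tendsto_0: "(flat P \<longlongrightarrow> 0) (at 0)"
proof (rule filterlim_split_at)
  show "(flat P \<longlongrightarrow> 0) (at_left 0)"
    by (rule tendsto_eventually) (auto simp: flat_def eventually_at_filter)
  have "((\<lambda>t. poly P (inverse t) * exp (- inverse t)) \<longlongrightarrow> 0) (at_right (0::real))"
    by (rule filterlim_compose[OF poly_times_exp_minus_tendsto_0 filterlim_inverse_at_top_right])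
  then show "(flat P \<longlongrightarrow> 0) (at_right 0)"
    by (rule Lim_transform_eventually) (auto simp: flat_def eventually_at_filter inverse_eq_divide)
qed

lemma has_derivative_flat:
  "(flat P has_real_derivative flat ([:0, 0, 1:] * (P - pderiv P)) t) (at t)"
proof (cases t "0::real" rule: linorder_cases)
  case less
  have "((\<lambda>_. 0) has_real_derivative 0) (at t)" by simp
  then have "(flat P has_real_derivative 0) (at t)"
    by (rule has_field_derivative_transform_within_open[of _ _ _ "{..<0}"]) (use less in \<open>auto simp: flat_def\<close>)
  then show ?thesis using less by (simp add: flat_def)
next
  case equal
  \<comment> \<open>dividing by \<open>h\<close> is multiplying \<open>P\<close> by the variable, which stands for \<open>1/h\<close>\<close>
  have "((\<lambda>h. (flat P (0 + h) - flat P 0) / h) \<longlongrightarrow> 0) (at 0)"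
    by (rule Lim_transform_eventually[OF flat_tendsto_0[of "pCons 0 P"]])
      (auto simp: flat_def eventually_at_filter divide_simps)
  then show ?thesis using equal by (simp add: DERIV_def flat_def)
next
  case greater
  have "((\<lambda>t. poly P (inverse t) * exp (- inverse t)) has_real_derivative
      (poly (pderiv P) (inverse t) * (- (inverse t ^ 2))) * exp (- inverse t)
      + poly P (inverse t) * (exp (- inverse t) * (inverse t ^ 2))) (at t)"
    using greater by (auto intro!: derivative_eq_intros DERIV_chain2[OF poly_DERIV] simp: power2_eq_square)
  then have "(flat P has_real_derivative
      (poly (pderiv P) (inverse t) * (- (inverse t ^ 2))) * exp (- inverse t)
      + poly P (inverse t) * (exp (- inverse t) * (inverse t ^ 2))) (at t)"
    by (rule has_field_derivative_transform_within_open[of _ _ _ "{0<..}"]) (use greater in \<open>auto simp: flat_def inverse_eq_divide\<close>)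
  then show ?thesis
    by (rule DERIV_cong) (use greater in \<open>simp add: flat_def inverse_eq_divide algebra_simps power2_eq_square\<close>)
qed

lemma smooth_flat: "smooth (flat P)"
proof -
  have "times_differentiable n (flat P)" for n P
  proof (induction n arbitrary: P)
    case 0
    show ?case
      by (auto intro!: continuous_at_imp_continuous_on DERIV_isCont[OF has_derivative_flat])
  next
    case (Suc n)
    show ?case
    proof (rule times_differentiable_SucI)
      show "(flat P has_derivative (\<lambda>v. flat ([:0, 0, 1:] * (P - pderiv P)) t * v)) (at t)" for t
        using has_derivative_flat unfolding has_field_derivative_def .
      show "times_differentiable n (\<lambda>t. flat ([:0, 0, 1:] * (P - pderiv P)) t * v)" for v
        by (rule times_differentiable_mult[OF Suc.IH times_differentiable_const])
    qed
  qed
  then show ?thesis by (simp add: smooth_def)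
qed

definition bump :: "real \<Rightarrow> 'a::euclidean_space \<Rightarrow> real" where
  "bump d x = flat 1 (d\<^sup>2 - x \<bullet> x)"

lemma bump_nonneg: "0 \<le> bump d x"
  by (simp add: bump_def flat_def)

lemma bump_eq_0_iff:
  assumes "0 < d"
  shows "bump d x = 0 \<longleftrightarrow> d \<le> norm x"
proof -
  have "bump d x = 0 \<longleftrightarrow> d\<^sup>2 \<le> (norm x)\<^sup>2"
    by (simp add: bump_def flat_def dot_square_norm)
  then show ?thesis using abs_le_square_iff[of d "norm x"] assms by simp
qed

lemma smooth_bump: "smooth (bump d :: 'a::euclidean_space \<Rightarrow> real)"
proof -
  have "times_differentiable n (\<lambda>x::'a. flat 1 (d\<^sup>2 + (- 1) * (x \<bullet> x)))" for n
  proof (rule times_differentiable_compose_real[where g = "flat 1"])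
    show "times_differentiable n (flat 1)" using smooth_flat by (simp add: smooth_def)
    have "times_differentiable n (\<lambda>x::'a. x \<bullet> x)"
      by (rule times_differentiable_bilinear[OF bounded_bilinear_inner])
        (rule times_differentiable_linear[OF bounded_linear_ident])+
    then show "times_differentiable n (\<lambda>x::'a. d\<^sup>2 + (- 1) * (x \<bullet> x))"
      by (rule times_differentiable_add[OF times_differentiable_const
            times_differentiable_mult[OF times_differentiable_const]])
  qed
  then show ?thesis by (simp add: smooth_def bump_def[abs_def])
qed

text \<open>Both mixed second derivatives are limits of \<open>\<Delta>(h) / h\<^sup>2\<close>, where the second difference
  \<open>\<Delta>(h) = g (x + hv + hw) - g (x + hv) - g (x + hw) + g x\<close> is symmetric in \<open>v\<close> and \<open>w\<close>.\<close>

lemma second_difference_limit: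
  fixes g :: "'a::real_normed_vector \<Rightarrow> real"
  assumes "times_differentiable 2 g"
  shows "((\<lambda>h. (g (x + h *\<^sub>R v + h *\<^sub>R w) - g (x + h *\<^sub>R v) - g (x + h *\<^sub>R w) + g x) / h\<^sup>2) \<longlongrightarrow>
     frechet_derivative (\<lambda>y. frechet_derivative g (at y) w) (at x) v) (at_right 0)"
proof (rule tendstoI)
  fix e :: real assume "e > 0"
  define G where "G y = frechet_derivative g (at y) w" for y
  define H where "H y = frechet_derivative G (at y) v" for y
  have td: "times_differentiable (Suc (Suc 0)) g" using assms by (simp add: numeral_2_eq_2)
  have g: "(g has_derivative frechet_derivative g (at y)) (at y)" for y
    using times_differentiable_SucE(1)[OF td] .
  have tG: "times_differentiable (Suc 0) G"
    unfolding G_def using times_differentiable_SucE(2)[OF td] .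
  have G: "(G has_derivative frechet_derivative G (at y)) (at y)" for y
    using times_differentiable_SucE(1)[OF tG] .
  have "continuous_on UNIV H"
    unfolding H_def using times_differentiable_SucE(2)[OF tG] by simp
  then obtain d where d: "d > 0" "\<And>y. dist y x < d \<Longrightarrow> dist (H y) (H x) < e"
    using \<open>e > 0\<close> unfolding continuous_on_iff by (metis UNIV_I)
  define m where "m = norm v + norm w + 1"
  have m: "m > 0" by (simp add: m_def add_nonneg_pos)
  have main: "dist ((g (x + h *\<^sub>R v + h *\<^sub>R w) - g (x + h *\<^sub>R v) - g (x + h *\<^sub>R w) + g x) / h\<^sup>2) (H x) < e"
    if h: "0 < h" "h < d / m" for h
  proof -
    define k where "k s = g (x + s *\<^sub>R w + h *\<^sub>R v) - g (x + s *\<^sub>R w)" for s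
    have line: "((\<lambda>s. g (a + s *\<^sub>R b)) has_real_derivative frechet_derivative g (at (a + s *\<^sub>R b)) b) (at s)" for a b s
    proof -
      have "((\<lambda>s. a + s *\<^sub>R b) has_derivative (\<lambda>s. s *\<^sub>R b)) (at s)"
        by (auto intro!: derivative_eq_intros)
      from has_derivative_compose[OF this g] show ?thesis
        unfolding has_field_derivative_def
        by (rule has_derivative_eq_rhs)
          (simp add: fun_eq_iff linear_scale[OF has_derivative_linear[OF g]] mult.commute)
    qed
    have lineG: "((\<lambda>s. G (a + s *\<^sub>R b)) has_real_derivative frechet_derivative G (at (a + s *\<^sub>R b)) b) (at s)" for a b s
    proof -
      have "((\<lambda>s. a + s *\<^sub>R b) has_derivative (\<lambda>s. s *\<^sub>R b)) (at s)"
        by (auto intro!: derivative_eq_intros)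
      from has_derivative_compose[OF this G] show ?thesis
        unfolding has_field_derivative_def
        by (rule has_derivative_eq_rhs)
          (simp add: fun_eq_iff linear_scale[OF has_derivative_linear[OF G]] mult.commute)
    qed
    have dk: "(k has_real_derivative G (x + s *\<^sub>R w + h *\<^sub>R v) - G (x + s *\<^sub>R w)) (at s)" for s
      unfolding k_def G_def
      using DERIV_diff[OF line[of "x + h *\<^sub>R v" w s] line[of x w s]] by (simp add: add_ac)
    \<comment> \<open>the mean value theorem in the direction \<open>w\<close>, then in the direction \<open>v\<close>\<close>
    obtain s where s: "0 < s" "s < h" "k h - k 0 = (h - 0) * (G (x + s *\<^sub>R w + h *\<^sub>R v) - G (x + s *\<^sub>R w))"
      using MVT2[OF h(1) dk] by blast
    obtain r where r: "0 < r" "r < h" "G (x + s *\<^sub>R w + h *\<^sub>R v) - G (x + s *\<^sub>R w + 0 *\<^sub>R v) = (h - 0) * H (x + s *\<^sub>R w + r *\<^sub>R v)"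
      using MVT2[OF h(1) lineG[of "x + s *\<^sub>R w" v]] unfolding H_def by blast
    have "k h - k 0 = h\<^sup>2 * H (x + s *\<^sub>R w + r *\<^sub>R v)"
      using s(3) r(3) by (simp add: power2_eq_square)
    then have eq: "(g (x + h *\<^sub>R v + h *\<^sub>R w) - g (x + h *\<^sub>R v) - g (x + h *\<^sub>R w) + g x) / h\<^sup>2 = H (x + s *\<^sub>R w + r *\<^sub>R v)"
      using h by (simp add: k_def field_simps add_ac)
    have "norm (s *\<^sub>R w + r *\<^sub>R v) \<le> s * norm w + r * norm v"
      using norm_triangle_ineq[of "s *\<^sub>R w" "r *\<^sub>R v"] s r by simp
    also have "\<dots> \<le> h * norm w + h * norm v"
      using s r by (intro add_mono mult_right_mono) auto
    also have "\<dots> < h * m" using h by (simp add: m_def algebra_simps)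
    also have "\<dots> < d" using h m by (simp add: field_simps)
    finally have "dist (x + s *\<^sub>R w + r *\<^sub>R v) x < d" by (simp add: dist_norm add.assoc)
    then show ?thesis using d(2) eq by simp
  qed
  have "\<forall>\<^sub>F h in at_right 0. 0 < h \<and> h < d / m"
    using d(1) m by (auto simp: eventually_at_right intro!: exI[of _ "d / m"])
  then show "\<forall>\<^sub>F h in at_right 0. dist ((g (x + h *\<^sub>R v + h *\<^sub>R w) - g (x + h *\<^sub>R v) - g (x + h *\<^sub>R w) + g x) / h\<^sup>2)
     (frechet_derivative (\<lambda>y. frechet_derivative g (at y) w) (at x) v) < e"
    unfolding G_def[symmetric] H_def[symmetric] using main by (auto elim: eventually_mono)
qed

lemma second_derivative_symmetric:
  fixes f :: "'a::real_normed_vector \<Rightarrow> real ^ 'd::finite"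
  assumes "smooth f"
  shows "frechet_derivative (\<lambda>y. frechet_derivative f (at y) w) (at x) v =
         frechet_derivative (\<lambda>y. frechet_derivative f (at y) v) (at x) w"
proof -
  have comp: "frechet_derivative (\<lambda>y. frechet_derivative f (at y) w) (at x) v $ i =
      frechet_derivative (\<lambda>y. frechet_derivative (\<lambda>z. f z $ i) (at y) w) (at x) v" for w v i
  proof -
    have 1: "frechet_derivative (\<lambda>z. f z $ i) (at y) = (\<lambda>w. frechet_derivative f (at y) w $ i)" for y
      by (rule sym, rule frechet_derivative_at)
        (intro bounded_linear.has_derivative[OF bounded_linear_vec_nth] smooth_has_derivative assms)
    have "frechet_derivative (\<lambda>z. frechet_derivative f (at z) w $ i) (at x)
        = (\<lambda>v. frechet_derivative (\<lambda>y. frechet_derivative f (at y) w) (at x) v $ i)"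
      by (rule sym, rule frechet_derivative_at)
        (intro bounded_linear.has_derivative[OF bounded_linear_vec_nth] smooth_has_derivative
          smooth_frechet_derivative assms)
    then show ?thesis by (simp add: 1)
  qed
  have "frechet_derivative (\<lambda>y. frechet_derivative (\<lambda>z. f z $ i) (at y) w) (at x) v =
      frechet_derivative (\<lambda>y. frechet_derivative (\<lambda>z. f z $ i) (at y) v) (at x) w" for i
  proof -
    have "times_differentiable 2 (\<lambda>z. f z $ i)"
      using smooth_bounded_linear[OF bounded_linear_vec_nth assms] by (auto simp: smooth_def)
    note lim = second_difference_limit[OF this, of x]
    have "((\<lambda>h. (f (x + h *\<^sub>R v + h *\<^sub>R w) $ i - f (x + h *\<^sub>R v) $ i - f (x + h *\<^sub>R w) $ i + f x $ i) / h\<^sup>2)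
        \<longlongrightarrow> frechet_derivative (\<lambda>y. frechet_derivative (\<lambda>z. f z $ i) (at y) v) (at x) w) (at_right 0)"
      using lim[of w v] by (simp add: add_ac diff_diff_eq)
    then show ?thesis using tendsto_unique[OF _ lim[of v w]] by simp
  qed
  then show ?thesis by (simp add: vec_eq_iff comp)
qed

section \<open>Closed matrix-valued forms\<close>

lemma bounded_bilinear_matrix_vector: "bounded_bilinear ((*v) :: real^'n::finite^'m::finite \<Rightarrow> real^'n \<Rightarrow> real^'m)"
  unfolding bilinear_conv_bounded_bilinear[symmetric] bilinear_def
  by (auto intro!: linearI simp: matrix_vector_right_distrib matrix_vector_mult_add_rdistrib
      matrix_vector_mult_scaleR scaleR_matrix_vector_assoc)

definition jacobian :: "(real^'n::finite \<Rightarrow> real^'m::finite) \<Rightarrow> real^'n \<Rightarrow> real^'n^'m" where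
  "jacobian f x = matrix (frechet_derivative f (at x))"

lemma jacobian_mult:
  assumes "smooth f"
  shows "jacobian f x *v v = frechet_derivative f (at x) v"
  unfolding jacobian_def
  using matrix_works[OF linear_matrix_vector_mul_eq[THEN iffD2, OF has_derivative_linear[OF smooth_has_derivative[OF assms]]]] .

lemma smooth_jacobian:
  assumes "smooth f"
  shows "smooth (jacobian f :: real^'n::finite \<Rightarrow> real^'n^'m::finite)"
proof -
  \<comment> \<open>the matrix with \<open>w\<close> in column \<open>j\<close>\<close>
  define col :: "'n \<Rightarrow> real^'m \<Rightarrow> real^'n^'m" where "col j w = (\<chi> i k. if k = j then w $ i else 0)" for j w
  have bl: "bounded_linear (col j)" for j
    unfolding linear_conv_bounded_linear[symmetric] col_def
    by (auto intro!: linearI simp: vec_eq_iff)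
  have "jacobian f = (\<lambda>x. \<Sum>j\<in>UNIV. col j (frechet_derivative f (at x) (axis j 1)))"
    by (simp add: fun_eq_iff jacobian_def matrix_def vec_eq_iff col_def sum.delta)
  then show ?thesis
    by (simp only:) (rule smooth_sum, rule smooth_bounded_linear[OF bl], rule smooth_frechet_derivative[OF assms])
qed

text \<open>An exact form is closed because second derivatives are symmetric.\<close>

lemma closed_form_jacobian:
  fixes a :: "real^'d::finite \<Rightarrow> real^'d"
  assumes "smooth a"
  shows "closed_form (jacobian a)"
  unfolding closed_form_def
proof (intro allI)
  fix x v w
  have "frechet_derivative (jacobian a) (at x) v *v w =
      frechet_derivative (\<lambda>y. frechet_derivative a (at y) w) (at x) v" for v w
  proof -
    have "((\<lambda>y. jacobian a y *v w) has_derivative (\<lambda>v. frechet_derivative (jacobian a) (at x) v *v w)) (at x)"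
      by (rule bounded_linear.has_derivative[OF bounded_bilinear.bounded_linear_left[OF bounded_bilinear_matrix_vector]])
        (rule smooth_has_derivative[OF smooth_jacobian[OF assms]])
    then have "((\<lambda>y. frechet_derivative a (at y) w) has_derivative (\<lambda>v. frechet_derivative (jacobian a) (at x) v *v w)) (at x)"
      by (simp add: jacobian_mult assms)
    from frechet_derivative_at[OF this] show ?thesis by (rule fun_cong)
  qed
  then show "frechet_derivative (jacobian a) (at x) v *v w - frechet_derivative (jacobian a) (at x) w *v v = 0"
    using second_derivative_symmetric[OF assms] by simp
qed

text \<open>The fundamental theorem of calculus along a segment.\<close>

lemma form_integral_primitive:
  assumes "convex S" "0 \<in> S" "x \<in> S"
    and "\<And>y. y \<in> S \<Longrightarrow> (f has_derivative (\<lambda>v. \<omega> y *v v)) (at y within S)"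
  shows "form_integral \<omega> x = f x - f 0"
proof -
  have seg: "t *\<^sub>R x \<in> S" if "t \<in> {0..1}" for t
    using convexD[OF assms(1-3), of "1 - t" t] that by simp
  have "((\<lambda>t. \<omega> (t *\<^sub>R x) *v x) has_integral f (1 *\<^sub>R x) - f (0 *\<^sub>R x)) {0..1}"
  proof (rule fundamental_theorem_of_calculus)
    fix t :: real assume t: "t \<in> {0..1}"
    have "((\<lambda>t. f (t *\<^sub>R x)) has_derivative (\<lambda>s. \<omega> (t *\<^sub>R x) *v (s *\<^sub>R x))) (at t within {0..1})"
      by (rule has_derivative_in_compose2[OF assms(4) _ t])
        (use seg in \<open>auto intro!: derivative_eq_intros\<close>)
    then show "((\<lambda>t. f (t *\<^sub>R x)) has_vector_derivative \<omega> (t *\<^sub>R x) *v x) (at t within {0..1})"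
      unfolding has_vector_derivative_def
      by (rule has_derivative_eq_rhs) (simp add: fun_eq_iff matrix_vector_mult_scaleR)
  qed simp
  then show ?thesis
    unfolding form_integral_def by (simp add: integral_unique)
qed

text \<open>The Poincare lemma: closedness turns the derivative of the integrand into
  \<open>d/dt (t \<omega> (t x) v)\<close>.\<close>

lemma form_integral_has_derivative:
  fixes \<omega> :: "real^'d::finite \<Rightarrow> real^'d^'d"
  assumes "smooth \<omega>" "closed_form \<omega>"
  shows "(form_integral \<omega> has_derivative (\<lambda>v. \<omega> x *v v)) (at x)"
proof -
  define D where "D y v = frechet_derivative \<omega> (at y) v" for y v
  \<comment> \<open>the derivative of the integrand with respect to \<open>x\<close>\<close>
  define G where "G x t = Blinfun (\<lambda>v. D (t *\<^sub>R x) (t *\<^sub>R v) *v x + \<omega> (t *\<^sub>R x) *v v)" for x t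
  note bb = bounded_bilinear_matrix_vector
  have d: "(\<omega> has_derivative D y) (at y)" for y
    unfolding D_def[abs_def] by (rule smooth_has_derivative[OF assms(1)])
  have lin: "linear (D y)" for y using has_derivative_linear[OF d] .
  have bl: "bounded_linear (\<lambda>v. D (t *\<^sub>R x) (t *\<^sub>R v) *v x + \<omega> (t *\<^sub>R x) *v v)" for x t
    unfolding linear_conv_bounded_linear[symmetric]
    by (auto intro!: linearI simp: linear_add[OF lin] linear_scale[OF lin] scaleR_add_right
        matrix_vector_right_distrib matrix_vector_mult_add_rdistrib matrix_vector_mult_scaleR
        scaleR_matrix_vector_assoc mult.commute algebra_simps)
  have G: "blinfun_apply (G x t) v = D (t *\<^sub>R x) (t *\<^sub>R v) *v x + \<omega> (t *\<^sub>R x) *v v" for x t v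
    unfolding G_def by (subst bounded_linear_Blinfun_apply[OF bl]) simp
  have c\<omega>: "continuous_on UNIV \<omega>" by (rule smooth_continuous_on[OF assms(1)])
  have cD: "continuous_on UNIV (\<lambda>y. D y v)" for v
    unfolding D_def by (intro smooth_continuous_on smooth_frechet_derivative assms)
  have cG: "continuous_on (UNIV \<times> cbox 0 1) (\<lambda>(x, t). G x t)"
  proof (rule continuous_on_blinfun_componentwise)
    fix v :: "real^'d"
    have "continuous_on (UNIV \<times> cbox 0 (1::real)) (\<lambda>z. snd z *\<^sub>R (D (snd z *\<^sub>R fst z) v *v fst z) + \<omega> (snd z *\<^sub>R fst z) *v v)"
      by (intro continuous_intros bounded_bilinear.continuous_on[OF bb]
          continuous_on_compose2[OF cD] continuous_on_compose2[OF c\<omega>]) auto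
    then show "continuous_on (UNIV \<times> cbox 0 1) (\<lambda>z. blinfun_apply (case z of (x, t) \<Rightarrow> G x t) v)"
      by (simp add: split_beta G linear_scale[OF lin] scaleR_matrix_vector_assoc)
  qed
  have der: "((\<lambda>x. integral (cbox 0 1) (\<lambda>t. \<omega> (t *\<^sub>R x) *v x)) has_derivative
      blinfun_apply (integral (cbox 0 1) (G x))) (at x)"
  proof (rule leibniz_rule[OF _ _ cG])
    fix x :: "real^'d" and t :: real
    have "((\<lambda>x. \<omega> (t *\<^sub>R x)) has_derivative (\<lambda>v. D (t *\<^sub>R x) (t *\<^sub>R v))) (at x)"
      by (rule has_derivative_compose[OF _ d]) (auto intro!: derivative_eq_intros)
    from bounded_bilinear.FDERIV[OF bb this has_derivative_ident]
    show "((\<lambda>x. \<omega> (t *\<^sub>R x) *v x) has_derivative blinfun_apply (G x t)) (at x within UNIV)"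
      by (rule has_derivative_eq_rhs) (simp add: fun_eq_iff G add.commute)
    show "(\<lambda>t. \<omega> (t *\<^sub>R x) *v x) integrable_on cbox 0 1"
      by (intro integrable_continuous bounded_bilinear.continuous_on[OF bb]
          continuous_on_compose2[OF c\<omega>] continuous_intros) auto
  qed auto
  have int: "G x integrable_on cbox 0 1"
  proof (rule integrable_continuous)
    have "continuous_on (cbox 0 1) (\<lambda>t::real. (x, t))" by (intro continuous_intros)
    moreover have "(\<lambda>t::real. (x, t)) ` cbox 0 1 \<subseteq> UNIV \<times> cbox 0 1" by blast
    ultimately have "continuous_on (cbox 0 1) (\<lambda>t. case (x, t) of (x, t) \<Rightarrow> G x t)"
      by (rule continuous_on_compose2[OF cG])
    then show "continuous_on (cbox 0 1) (G x)" by (simp add: eta_contract_eq)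
  qed
  have "blinfun_apply (integral (cbox 0 1) (G x)) v = \<omega> x *v v" for v
  proof -
    have "((\<lambda>t. blinfun_apply (G x t) v) has_integral 1 *\<^sub>R (\<omega> (1 *\<^sub>R x) *v v) - 0 *\<^sub>R (\<omega> (0 *\<^sub>R x) *v v)) {0..1}"
    proof (rule fundamental_theorem_of_calculus)
      fix t :: real
      have "((\<lambda>t. \<omega> (t *\<^sub>R x)) has_derivative (\<lambda>s. D (t *\<^sub>R x) (s *\<^sub>R x))) (at t)"
        by (rule has_derivative_compose[OF _ d]) (auto intro!: derivative_eq_intros)
      then have 1: "((\<lambda>t. \<omega> (t *\<^sub>R x) *v v) has_derivative (\<lambda>s. D (t *\<^sub>R x) (s *\<^sub>R x) *v v)) (at t)"
        by (rule bounded_linear.has_derivative[OF bounded_bilinear.bounded_linear_left[OF bb]])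
      have cl: "D y x *v v = D y v *v x" for y
        using assms(2) unfolding closed_form_def D_def by (metis eq_iff_diff_eq_0)
      have "((\<lambda>t. t *\<^sub>R (\<omega> (t *\<^sub>R x) *v v)) has_derivative
          (\<lambda>s. t *\<^sub>R (D (t *\<^sub>R x) (s *\<^sub>R x) *v v) + s *\<^sub>R (\<omega> (t *\<^sub>R x) *v v))) (at t)"
        by (rule has_derivative_scaleR[OF has_derivative_ident 1])
      then have "((\<lambda>t. t *\<^sub>R (\<omega> (t *\<^sub>R x) *v v)) has_vector_derivative blinfun_apply (G x t) v) (at t)"
        unfolding has_vector_derivative_def
        by (rule has_derivative_eq_rhs)
          (simp add: fun_eq_iff G linear_scale[OF lin] scaleR_add_right cl mult.commute
            scaleR_matrix_vector_assoc[symmetric])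
      then show "((\<lambda>t. t *\<^sub>R (\<omega> (t *\<^sub>R x) *v v)) has_vector_derivative blinfun_apply (G x t) v) (at t within {0..1})"
        by (rule has_vector_derivative_at_within)
    qed simp
    then show ?thesis
      by (subst blinfun_apply_integral[OF int]) (simp add: integral_unique)
  qed
  then show ?thesis
    using has_derivative_eq_rhs[OF der, of "\<lambda>v. \<omega> x *v v"] unfolding form_integral_def[abs_def]
    by (simp add: fun_eq_iff)
qed

section \<open>Patterns that agree up to a translation\<close>

lemma translate_translate: "translate x (translate y T) = translate (x + y) T"
  unfolding translate_def image_image split_beta
  by (auto simp: image_image diff_diff_eq add.commute)

lemma translate_0 [simp]: "translate 0 T = T"
  by (simp add: translate_def)

lemma translate_minus [simp]: "translate (- x) (translate x T) = T" "translate x (translate (- x) T) = T"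
  by (simp_all add: translate_translate)

lemma translateI: "(t, l) \<in> T \<Longrightarrow> ((\<lambda>p. p - x) ` t, l) \<in> translate x T"
  unfolding translate_def by force

lemma translateE:
  assumes "(t, l) \<in> translate x T"
  obtains t' where "(t', l) \<in> T" "t = (\<lambda>p. p - x) ` t'"
  using assms unfolding translate_def by auto

lemma mem_translate: "(t, l) \<in> translate x T \<longleftrightarrow> ((\<lambda>p. p + x) ` t, l) \<in> T"
proof
  assume "(t, l) \<in> translate x T"
  then obtain t' where "(t', l) \<in> T" "t = (\<lambda>p. p - x) ` t'" by (rule translateE)
  then show "((\<lambda>p. p + x) ` t, l) \<in> T" by (simp add: image_image)
next
  assume "((\<lambda>p. p + x) ` t, l) \<in> T"
  from translateI[OF this, of x] show "(t, l) \<in> translate x T" by (simp add: image_image)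
qed

lemma patch_translate: "patch (translate z T) x r = translate z (patch T (x + z) r)"
proof -
  have eq: "(\<lambda>p. p + z) ` ball x r = ball (x + z) r"
    using ball_translation[of z x r] by (simp add: add.commute)
  have "t \<inter> ball x r \<noteq> {} \<longleftrightarrow> (\<lambda>p. p + z) ` t \<inter> ball (x + z) r \<noteq> {}" for t
    unfolding eq[symmetric] by (simp add: image_Int[symmetric] inj_on_def)
  then have "\<tau> \<in> patch (translate z T) x r \<longleftrightarrow> \<tau> \<in> translate z (patch T (x + z) r)" for \<tau>
    by (cases \<tau>) (simp only: patch_def mem_translate mem_Collect_eq prod.case)
  then show ?thesis by blast
qed

lemma patch_subset: "patch T x r \<subseteq> T"
  by (auto simp: patch_def)

lemma patch_eq_subball:
  assumes "patch T x r = patch T' x r" "ball y s \<subseteq> ball x r"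
  shows "patch T y s = patch T' y s"
proof -
  have *: "patch S y s = {(t, l) \<in> patch S x r. t \<inter> ball y s \<noteq> {}}" for S :: "('a, 'b) pattern"
    using assms(2) by (auto simp: patch_def)
  show ?thesis unfolding *[of T] *[of T'] assms(1) ..
qed

lemma vertices_translate: "p \<in> vertices (translate z T) \<longleftrightarrow> p + z \<in> vertices T"
proof -
  have eq: "p + z extreme_point_of (\<lambda>q. q + z) ` t \<longleftrightarrow> p extreme_point_of t" for t
    using extreme_point_of_translation_eq[of z p t] by (simp add: add.commute)
  show ?thesis
  proof
    assume "p \<in> vertices (translate z T)"
    then show "p + z \<in> vertices T"
      unfolding vertices_def by (auto simp: mem_translate eq[symmetric])
  next
    assume "p + z \<in> vertices T"
    then obtain t l where t: "(t, l) \<in> T" "p + z extreme_point_of t" unfolding vertices_def by blast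
    have "p extreme_point_of (\<lambda>q. q - z) ` t"
      using eq[of "(\<lambda>q. q - z) ` t"] t(2) by (simp add: image_image)
    then show "p \<in> vertices (translate z T)"
      using translateI[OF t(1), of z] unfolding vertices_def by blast
  qed
qed

lemma vertices_patch:
  assumes "p \<in> ball x r"
  shows "p \<in> vertices T \<longleftrightarrow> p \<in> vertices (patch T x r)"
  using assms unfolding vertices_def patch_def extreme_point_of_def by blast

text \<open>Under finite local complexity, closeness of patterns means this for a large radius \<open>r\<close> and a small
  vector \<open>z\<close>. Topological arguments are carried out in terms of it.\<close>

definition agree :: "real \<Rightarrow> real ^ 'd::finite \<Rightarrow> ('d, 'l) pattern \<Rightarrow> ('d, 'l) pattern \<Rightarrow> bool" where
  "agree r z T T' \<longleftrightarrow> patch (translate z T) 0 r = patch T' 0 r"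

lemma agree_translate [simp]: "agree r z T (translate z T)"
  by (simp add: agree_def)

lemma agree_shift:
  assumes "agree r z T T'" "norm w + s \<le> r"
  shows "agree s (w + z) T (translate w T')"
proof -
  have "ball w s \<subseteq> ball 0 r" using assms(2) by (simp add: ball_subset_ball_iff)
  then have "patch (translate z T) w s = patch T' w s"
    using patch_eq_subball assms(1) unfolding agree_def by blast
  then show ?thesis
    unfolding agree_def translate_translate[symmetric] by (simp add: patch_translate)
qed

lemma agree_mono: "agree r z T T' \<Longrightarrow> s \<le> r \<Longrightarrow> agree s z T T'"
  using agree_shift[of r z T T' 0 s] by simp

lemma agree_trans:
  assumes "agree r z T T'" "agree s w T' T''" "norm w + s \<le> r"
  shows "agree s (w + z) T T''"
  using agree_shift[OF assms(1,3)] assms(2) by (simp add: agree_def)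

lemma agree_sym:
  assumes "agree r z T T'" "norm z + s \<le> r"
  shows "agree s (- z) T' T"
  using agree_shift[OF assms(1), of "- z" s] assms(2) by (simp add: agree_def)

lemma agree_vertices:
  assumes "agree r z T T'" "norm p < r"
  shows "p \<in> vertices T' \<longleftrightarrow> p + z \<in> vertices T"
  using assms vertices_patch[of p 0 r T'] vertices_patch[of p 0 r "translate z T"]
  by (simp add: agree_def vertices_translate)

lemma agree_patch_translate:
  assumes "agree r 0 T T'" "norm x + s \<le> r"
  shows "patch (translate x T) 0 s = patch (translate x T') 0 s"
  using agree_shift[OF assms] by (simp add: agree_def)

text \<open>Patches determine the pattern, since every tile meets a large ball.\<close>

lemma patches_eq_imp_eq:
  assumes "\<And>r. patch T 0 r = patch T' 0 r" "\<And>t l. (t, l) \<in> T \<union> T' \<Longrightarrow> t \<noteq> {}"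
  shows "T = T'"
proof -
  have "A \<subseteq> B" if eq: "\<And>r. patch A 0 r = patch B 0 r" and ne: "\<And>t l. (t, l) \<in> A \<Longrightarrow> t \<noteq> {}" for A B :: "('a, 'b) pattern"
  proof
    fix \<tau> assume "\<tau> \<in> A"
    obtain t l where tl: "\<tau> = (t, l)" by fastforce
    then obtain x where "x \<in> t" using ne \<open>\<tau> \<in> A\<close> by blast
    then have "\<tau> \<in> patch A 0 (norm x + 1)" using \<open>\<tau> \<in> A\<close> by (auto simp: patch_def tl intro!: exI[of _ x])
    then show "\<tau> \<in> B" using eq patch_subset by blast
  qed
  from this[of T T'] this[of T' T] assms show ?thesis by (metis Un_iff subset_antisym)
qed

lemma hausdorff_dist_translate_le:
  fixes t t' :: "(real^'d::finite) set"
  assumes "compact t" "t \<noteq> {}" "compact t'" "t' \<noteq> {}"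
  shows "hausdorff_dist ((\<lambda>p. p - u) ` t) ((\<lambda>p. p - v) ` t') \<le> hausdorff_dist t t' + norm (u - v)"
proof -
  have c: "compact ((\<lambda>p. p - u) ` t)" "compact ((\<lambda>p. p - v) ` t')"
    by (simp_all add: compact_translation_subtract assms)
  have *: "(\<forall>a\<in>t. \<exists>b\<in>t'. dist a b \<le> hausdorff_dist t t') \<and> (\<forall>b\<in>t'. \<exists>a\<in>t. dist a b \<le> hausdorff_dist t t')"
    using hausdorff_dist_le_iff[OF assms] by blast
  have **: "dist (a - u) (b - v) \<le> e + norm (u - v)" if "dist a b \<le> e" for a b e
    using norm_triangle_ineq4[of "a - b" "u - v"] that by (simp add: dist_norm algebra_simps)
  show ?thesis
  proof (subst hausdorff_dist_le_iff)
    show "(\<forall>a\<in>(\<lambda>p. p - u) ` t. \<exists>b\<in>(\<lambda>p. p - v) ` t'. dist a b \<le> hausdorff_dist t t' + norm (u - v)) \<and>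
        (\<forall>b\<in>(\<lambda>p. p - v) ` t'. \<exists>a\<in>(\<lambda>p. p - u) ` t. dist a b \<le> hausdorff_dist t t' + norm (u - v))"
      using * ** by simp meson
  qed (use c assms in auto)
qed

text \<open>Translating each tile by \<open>z\<close> is the required correspondence. The extra radius \<open>\<epsilon>\<close> keeps the tiles
  that meet the ball of radius \<open>1/\<epsilon>\<close> within the common patch.\<close>

lemma agree_imp_eps_close:
  fixes T T' :: "('d::finite, 'l) pattern"
  assumes tiles: "\<And>t l. (t, l) \<in> T \<Longrightarrow> compact t \<and> t \<noteq> {} \<and> l \<in> mspace L"
    and "0 < \<epsilon>" "norm z < \<epsilon>" "1 / \<epsilon> + \<epsilon> \<le> r" "agree r z T T'"
  shows "eps_close L \<epsilon> T T'"
proof -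
  define f :: "(real^'d) set \<times> 'l \<Rightarrow> (real^'d) set \<times> 'l"
    where "f = (\<lambda>(t, l). ((\<lambda>p. p - z) ` t, l))"
  define S where "S = {s \<in> T. f s \<in> patch T' 0 r}"
  have inj: "inj f"
  proof (rule injI)
    fix a b assume ab: "f a = f b"
    have "inj (\<lambda>p::real^'d. p - z)" by (rule injI) simp
    then show "a = b"
      using ab by (cases a, cases b) (simp add: f_def inj_image_eq_iff)
  qed
  have im: "f ` T \<inter> patch T' 0 r = patch T' 0 r"
    using assms(5) patch_subset[of "translate z T" 0 r] unfolding agree_def
    by (simp only: translate_def f_def[symmetric]) blast
  have bij: "bij_betw f S (patch T' 0 r)"
  proof (rule bij_betw_imageI)
    show "inj_on f S" by (rule inj_on_subset[OF inj subset_UNIV])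
    have "f ` S = f ` T \<inter> patch T' 0 r" by (auto simp only: S_def)
    then show "f ` S = patch T' 0 r" by (simp only: im)
  qed
  have sub: "patch T 0 (1 / \<epsilon>) \<subseteq> S"
  proof
    fix s assume s: "s \<in> patch T 0 (1 / \<epsilon>)"
    obtain t l where tl: "s = (t, l)" by fastforce
    obtain x where x: "x \<in> t" "norm x < 1 / \<epsilon>" "(t, l) \<in> T" using s by (auto simp: patch_def tl)
    have "norm (x - z) < r" using norm_triangle_ineq4[of x z] x assms by linarith
    then have "((\<lambda>p. p - z) ` t, l) \<in> patch (translate z T) 0 r"
      using x translateI[of t l T z] by (auto simp: patch_def)
    then show "s \<in> S" using x assms(5) by (simp add: S_def tl agree_def f_def)
  qed
  have "ball (0::real^'d) (1 / \<epsilon>) \<subseteq> ball 0 r"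
    using assms by (intro subset_ball) linarith
  then have sub': "patch T' 0 (1 / \<epsilon>) \<subseteq> patch T' 0 r" by (auto simp: patch_def)
  have "\<forall>s\<in>S. hausdorff_dist (fst s) (fst (f s)) < \<epsilon> \<and> mdist L (snd s) (snd (f s)) < \<epsilon>"
  proof
    fix s assume "s \<in> S"
    then have "s \<in> T" unfolding S_def by blast
    obtain t l where tl: "s = (t, l)" by fastforce
    have t: "compact t" "t \<noteq> {}" "l \<in> mspace L" using tiles \<open>s \<in> T\<close> tl by blast+
    have "hausdorff_dist t t \<le> 0" using hausdorff_dist_le_iff[OF t(1,2,1,2), of 0] by force
    then have "hausdorff_dist t ((\<lambda>p. p - z) ` t) \<le> norm z"
      using hausdorff_dist_translate_le[OF t(1,2,1,2), of 0 z] by simp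
    moreover have "mdist L l l = 0" using t(3) by simp
    ultimately show "hausdorff_dist (fst s) (fst (f s)) < \<epsilon> \<and> mdist L (snd s) (snd (f s)) < \<epsilon>"
      using assms by (simp add: tl f_def)
  qed
  then show ?thesis
    unfolding eps_close_def using sub sub' bij patch_subset[of T' 0 r]
    by (intro exI[of _ S] exI[of _ "patch T' 0 r"] exI[of _ f]) (auto simp: S_def)
qed

subsection \<open>A reference point of a compact set\<close>

text \<open>The infimum in each coordinate: a point that moves with the set under translation and depends
  continuously on it, and so allows one to compare positions of tiles.\<close>

definition corner :: "(real^'d::finite) set \<Rightarrow> real^'d" where
  "corner t = (\<chi> i. Inf ((\<lambda>x. x $ i) ` t))"

lemma compact_component_image:
  fixes t :: "(real^'d::finite) set"
  assumes "compact t"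
  shows "bdd_below ((\<lambda>x. x $ i) ` t)"
  using compact_continuous_image[OF continuous_on_component[OF continuous_on_id] assms, of i]
  by (simp add: bounded_imp_bdd_below compact_imp_bounded)

lemma corner_translate:
  fixes t :: "(real^'d::finite) set"
  assumes "compact t" "t \<noteq> {}"
  shows "corner ((\<lambda>p. p - x) ` t) = corner t - x"
proof -
  have "(INF p\<in>t. p $ i - x $ i) = (INF p\<in>t. p $ i) - x $ i" for i
  proof (rule cInf_eq_non_empty)
    show "(\<lambda>p. p $ i - x $ i) ` t \<noteq> {}" using assms by simp
    fix y assume "y \<in> (\<lambda>p. p $ i - x $ i) ` t"
    then show "(INF p\<in>t. p $ i) - x $ i \<le> y"
      using cINF_lower[OF compact_component_image[OF assms(1), of i]] by auto
  next
    fix y assume y: "\<And>z. z \<in> (\<lambda>p. p $ i - x $ i) ` t \<Longrightarrow> y \<le> z"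
    have "y + x $ i \<le> (INF p\<in>t. p $ i)"
    proof (rule cINF_greatest[OF assms(2)])
      fix p assume "p \<in> t"
      then have "y \<le> p $ i - x $ i" using y by blast
      then show "y + x $ i \<le> p $ i" by simp
    qed
    then show "y \<le> (INF p\<in>t. p $ i) - x $ i" by simp
  qed
  then show ?thesis by (simp add: corner_def vec_eq_iff image_image)
qed

lemma corner_hausdorff_dist:
  fixes t t' :: "(real^'d::finite) set"
  assumes "compact t" "t \<noteq> {}" "compact t'" "t' \<noteq> {}"
  shows "norm (corner t - corner t') \<le> real CARD('d) * hausdorff_dist t t'"
proof -
  have *: "corner t $ i - corner t' $ i \<le> hausdorff_dist t t'"
    if c: "compact t" "t \<noteq> {}" "compact t'" "t' \<noteq> {}" for t t' :: "(real^'d) set" and i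
  proof -
    have "corner t $ i - hausdorff_dist t t' \<le> (INF p\<in>t'. p $ i)"
    proof (rule cINF_greatest[OF c(4)])
      fix b assume "b \<in> t'"
      then obtain a where a: "a \<in> t" "dist a b \<le> hausdorff_dist t t'"
        using hausdorff_dist_le_iff[OF c, of "hausdorff_dist t t'"] by blast
      have "corner t $ i \<le> a $ i"
        using cINF_lower[OF compact_component_image[OF c(1), of i] a(1)] by (simp add: corner_def)
      moreover have "\<bar>(a - b) $ i\<bar> \<le> dist a b" unfolding dist_norm by (rule component_le_norm_cart)
      ultimately show "corner t $ i - hausdorff_dist t t' \<le> b $ i" using a(2) by simp
    qed
    then show ?thesis by (simp add: corner_def)
  qed
  have "norm (corner t - corner t') \<le> (\<Sum>i\<in>UNIV. \<bar>(corner t - corner t') $ i\<bar>)"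
    by (rule norm_le_l1_cart)
  also have "\<dots> \<le> (\<Sum>i\<in>(UNIV::'d set). hausdorff_dist t t')"
    using *[OF assms] *[OF assms(3,4,1,2)] by (intro sum_mono) (simp add: abs_le_iff hausdorff_dist_commute)
  finally show ?thesis by simp
qed

lemma finite_separation:
  fixes d :: "'a \<Rightarrow> 'a \<Rightarrow> real"
  assumes "finite A" "\<And>a b. a \<in> A \<Longrightarrow> b \<in> A \<Longrightarrow> a \<noteq> b \<Longrightarrow> 0 < d a b"
  shows "\<exists>e>0. \<forall>a\<in>A. \<forall>b\<in>A. d a b < e \<longrightarrow> a = b"
proof -
  define D where "D = insert 1 ((\<lambda>(a, b). d a b) ` {(a, b) \<in> A \<times> A. a \<noteq> b})"
  have "finite {(a, b) \<in> A \<times> A. a \<noteq> b}" by (rule finite_subset[of _ "A \<times> A"]) (use assms in auto)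
  then have D: "finite D" "D \<noteq> {}" unfolding D_def by auto
  moreover have "\<forall>x\<in>D. 0 < x" using assms(2) by (auto simp: D_def)
  ultimately have "0 < Min D" by simp
  moreover have "a = b" if "a \<in> A" "b \<in> A" "d a b < Min D" for a b
  proof (rule ccontr)
    assume "a \<noteq> b"
    then have "d a b \<in> D" using that by (force simp: D_def)
    then show False using that D by (meson Min_le leD)
  qed
  ultimately show ?thesis by blast
qed

section \<open>Spaces of finite local complexity\<close>

text \<open>What is needed of a space of tilings or Delone sets, so that both are treated at once; the space
  of deformed patterns will be another instance.\<close>

locale flc_space =
  fixes L :: "'l metric" and \<Omega> :: "('d::finite, 'l) pattern set"
  assumes tiles: "T \<in> \<Omega> \<Longrightarrow> (t, l) \<in> T \<Longrightarrow> polytope t \<and> t \<noteq> {} \<and> l \<in> mspace L"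
    and translate_closed [simp]: "T \<in> \<Omega> \<Longrightarrow> translate x T \<in> \<Omega>"
    and finite_patch: "T \<in> \<Omega> \<Longrightarrow> finite (patch T x R)"
    and FLC: "FLC \<Omega>"
    and compact: "compact_space (pattern_topology L \<Omega>)"
    and vertices_dense: "\<exists>\<rho>>0. \<forall>T\<in>\<Omega>. \<forall>x. \<exists>p\<in>vertices T. dist x p \<le> \<rho>"
begin

abbreviation X where "X \<equiv> pattern_topology L \<Omega>"

lemma tiles_compact: "T \<in> \<Omega> \<Longrightarrow> (t, l) \<in> T \<Longrightarrow> compact t \<and> t \<noteq> {} \<and> l \<in> mspace L"
  using tiles polytope_imp_compact by blast

lemma finite_patch_types:
  assumes "R > 0"
  obtains F where "finite F" "\<And>P. P \<in> F \<Longrightarrow> \<exists>T\<in>\<Omega>. \<exists>x. P = patch T x R"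
    "\<And>T x. T \<in> \<Omega> \<Longrightarrow> \<exists>P\<in>F. \<exists>y. patch T x R = translate y P"
proof -
  obtain F where F: "finite F" "\<forall>T\<in>\<Omega>. \<forall>x. \<exists>P\<in>F. \<exists>y. patch T x R = translate y P"
    using FLC[unfolded FLC_def, rule_format, OF assms] by (elim exE conjE)
  show ?thesis
  proof (rule that[of "{P \<in> F. \<exists>T\<in>\<Omega>. \<exists>x. P = patch T x R}"])
    show "finite {P \<in> F. \<exists>T\<in>\<Omega>. \<exists>x. P = patch T x R}" using F(1) by simp
    fix T x assume T: "T \<in> \<Omega>"
    then obtain P y where P: "P \<in> F" "patch T x R = translate y P" using F(2) by blast
    have "P = translate (- y) (patch T (- y + (x + y)) R)" using P(2) by simp
    then have "P = patch (translate (- y) T) (x + y) R" by (simp only: patch_translate add.commute)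
    then show "\<exists>P\<in>{P \<in> F. \<exists>T\<in>\<Omega>. \<exists>x. P = patch T x R}. \<exists>y. patch T x R = translate y P"
      using P T translate_closed by blast
  qed blast
qed

lemma finite_vertices_patch:
  assumes "T \<in> \<Omega>"
  shows "finite (vertices (patch T x R))"
proof -
  have "vertices (patch T x R) = (\<Union>(t, l)\<in>patch T x R. {p. p extreme_point_of t})"
    by (auto simp: vertices_def)
  moreover have "finite {p. p extreme_point_of t}" if "(t, l) \<in> patch T x R" for t l
    using that tiles[OF assms] patch_subset[of T x R] finite_polyhedron_extreme_points polytope_imp_polyhedron by blast
  ultimately show ?thesis using finite_patch[OF assms] by auto
qed

text \<open>Centred at a vertex, there are finitely many patches, not only up to translation.\<close>

lemma finite_vertex_patches:
  assumes "R > 0"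
  shows "finite {patch T 0 R |T. T \<in> \<Omega> \<and> 0 \<in> vertices T}"
proof -
  obtain F where F: "finite F" "\<And>P. P \<in> F \<Longrightarrow> \<exists>T\<in>\<Omega>. \<exists>x. P = patch T x R"
    "\<And>T x. T \<in> \<Omega> \<Longrightarrow> \<exists>P\<in>F. \<exists>y. patch T x R = translate y P"
    using finite_patch_types[OF assms] by metis
  have "finite (\<Union>P\<in>F. (\<lambda>y. translate y P) ` vertices P)"
    using F(1,2) finite_vertices_patch by fastforce
  moreover have "{patch T 0 R |T. T \<in> \<Omega> \<and> 0 \<in> vertices T} \<subseteq> (\<Union>P\<in>F. (\<lambda>y. translate y P) ` vertices P)"
  proof clarify
    fix T assume T: "T \<in> \<Omega>" "0 \<in> vertices T"
    obtain P y where P: "P \<in> F" "patch T 0 R = translate y P" using F(3)[OF T(1)] by blast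
    have "0 \<in> vertices (patch T 0 R)" using T(2) assms vertices_patch[of 0 0 R T] by simp
    then have "y \<in> vertices P" by (simp add: P(2) vertices_translate)
    then show "patch T 0 R \<in> (\<Union>P\<in>F. (\<lambda>y. translate y P) ` vertices P)" using P by blast
  qed
  ultimately show ?thesis by (rule finite_subset[rotated])
qed

text \<open>Two vertices at distance less than 1 lie in a common patch of radius 1, and these patches show
  finitely many differences of vertices.\<close>

lemma vertices_discrete: "\<exists>\<eta>>0. \<forall>T\<in>\<Omega>. \<forall>p\<in>vertices T. \<forall>q\<in>vertices T. dist p q < \<eta> \<longrightarrow> p = q"
proof -
  obtain F where F: "finite F" "\<And>P. P \<in> F \<Longrightarrow> \<exists>T\<in>\<Omega>. \<exists>x. P = patch T x 1"
    "\<And>T x. T \<in> \<Omega> \<Longrightarrow> \<exists>P\<in>F. \<exists>y. patch T x 1 = translate y P"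
    using finite_patch_types[of 1] zero_less_one by metis
  define D where "D = (\<Union>P\<in>F. \<Union>a\<in>vertices P. \<Union>b\<in>vertices P. {a - b})"
  have "finite (vertices P)" if "P \<in> F" for P using F(2)[OF that] finite_vertices_patch by blast
  then have "finite D" unfolding D_def using F(1) by blast
  then obtain e where e: "e > 0" "\<And>a. a \<in> insert 0 D \<Longrightarrow> norm a < e \<Longrightarrow> a = 0"
    using finite_separation[of "insert 0 D" dist] by (auto simp: dist_norm)
  have "p = q" if T: "T \<in> \<Omega>" and p: "p \<in> vertices T" and q: "q \<in> vertices T" and d: "dist p q < min e 1" for T p q
  proof -
    obtain P y where P: "P \<in> F" "patch T p 1 = translate y P" using F(3)[OF T] by blast
    have "p \<in> vertices (patch T p 1)" "q \<in> vertices (patch T p 1)"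
      using p q d vertices_patch[of p p 1 T] vertices_patch[of q p 1 T] by auto
    then have "p + y \<in> vertices P" "q + y \<in> vertices P" by (auto simp: P(2) vertices_translate)
    then have "(p + y) - (q + y) \<in> D" using P(1) unfolding D_def by blast
    then show "p = q" using e(2)[of "p - q"] d by (auto simp: dist_norm)
  qed
  then show ?thesis using e(1) by (intro exI[of _ "min e 1"]) auto
qed

text \<open>A choice of uniform constants for the relative density and the separation of the vertices.\<close>

definition radius :: real where
  "radius = (SOME \<rho>. \<rho> > 0 \<and> (\<forall>T\<in>\<Omega>. \<forall>x. \<exists>p\<in>vertices T. dist x p \<le> \<rho>))"

definition gap :: real where
  "gap = (SOME \<eta>. \<eta> > 0 \<and> (\<forall>T\<in>\<Omega>. \<forall>p\<in>vertices T. \<forall>q\<in>vertices T. dist p q < \<eta> \<longrightarrow> p = q))"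

lemma radius: "radius > 0" "T \<in> \<Omega> \<Longrightarrow> \<exists>p\<in>vertices T. dist x p \<le> radius"
  using someI_ex[OF vertices_dense] unfolding radius_def by blast+

lemma gap: "gap > 0" "T \<in> \<Omega> \<Longrightarrow> p \<in> vertices T \<Longrightarrow> q \<in> vertices T \<Longrightarrow> dist p q < gap \<Longrightarrow> p = q"
  using someI_ex[OF vertices_discrete] unfolding gap_def by blast+

text \<open>A vertex of \<open>T'\<close> near the origin, shifted by either vector, is a vertex of \<open>T\<close>.\<close>

lemma agree_unique:
  assumes "T \<in> \<Omega>" "T' \<in> \<Omega>" "agree r z T T'" "agree r z' T T'" "radius < r" "norm (z - z') < gap"
  shows "z = z'"
proof -
  obtain p where p: "p \<in> vertices T'" "norm p \<le> radius" using radius(2)[OF assms(2), of 0] by auto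
  have "p + z \<in> vertices T" "p + z' \<in> vertices T"
    using agree_vertices[OF assms(3), of p] agree_vertices[OF assms(4), of p] p assms(5) by auto
  then show ?thesis using gap(2)[OF assms(1)] assms(6) by (fastforce simp: dist_norm)
qed

text \<open>By uniqueness the vector does not depend on how small it is required to be, and hence vanishes.\<close>

lemma agree_small_imp_eq:
  assumes T: "T \<in> \<Omega>" "T' \<in> \<Omega>"
    and near: "\<And>r \<delta>. r > 0 \<Longrightarrow> \<delta> > 0 \<Longrightarrow> \<exists>z. norm z < \<delta> \<and> agree r z T T'"
  shows "T = T'"
proof -
  have r: "radius + 1 > 0" using radius(1) by simp
  have "agree s 0 T T'" if s: "s > radius + 1" for s
  proof -
    obtain z where z: "norm z < gap / 2" "agree s z T T'" using near[of s "gap / 2"] s r gap(1) by auto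
    have "norm z < \<delta>" if \<delta>: "\<delta> > 0" for \<delta>
    proof -
      obtain w where w: "norm w < min \<delta> (gap / 2)" "agree s w T T'"
        using near[of s "min \<delta> (gap / 2)"] s r gap(1) \<delta> by auto
      have "norm (z - w) < gap" using norm_triangle_ineq4[of z w] z w by linarith
      then have "z = w" using agree_unique[OF T z(2) w(2)] s by simp
      then show ?thesis using w(1) by simp
    qed
    then have "z = 0" by (metis less_irrefl norm_eq_zero zero_less_norm_iff)
    then show ?thesis using z(2) by simp
  qed
  then have *: "patch T 0 s = patch T' 0 s" if "s > radius + 1" for s using that by (simp add: agree_def)
  have "patch T 0 s = patch T' 0 s" for s
    by (rule patch_eq_subball[OF *[of "max s (radius + 2)"]]) auto
  then show ?thesis
    by (rule patches_eq_imp_eq) (use T tiles in blast)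
qed

text \<open>The finitely many shapes and labels of tiles are separated from one another, and so are the
  finitely many relative positions of two tiles of a patch of given radius. Hence a bijection that
  moves the tiles of a large patch only a little moves all of them by the same vector.\<close>

lemma eps_close_imp_agree:
  assumes "r > 0" "\<delta> > 0"
  shows "\<exists>\<epsilon>>0. \<forall>T\<in>\<Omega>. \<forall>T'\<in>\<Omega>. eps_close L \<epsilon> T T' \<longrightarrow> (\<exists>z. norm z < \<delta> \<and> agree r z T T')"
proof -
  \<comment> \<open>a tile moved so that its reference point is the origin\<close>
  define nrm :: "(real^'d) set \<times> 'l \<Rightarrow> (real^'d) set \<times> 'l"
    where "nrm = (\<lambda>(t, l). ((\<lambda>p. p - corner t) ` t, l))"
  \<comment> \<open>room for the patch \<open>Q\<close> of radius \<open>r + 1\<close> and for moving its tiles by at most 1\<close>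
  define R where "R = r + 2"
  have "R > 0" using assms by (simp add: R_def)
  then obtain F where F: "finite F" "\<And>P. P \<in> F \<Longrightarrow> \<exists>T\<in>\<Omega>. \<exists>x. P = patch T x R"
    "\<And>T x. T \<in> \<Omega> \<Longrightarrow> \<exists>P\<in>F. \<exists>y. patch T x R = translate y P"
    using finite_patch_types by metis
  have finP: "finite P" if "P \<in> F" for P using F(2)[OF that] finite_patch by blast
  have tilesP: "compact t \<and> t \<noteq> {} \<and> l \<in> mspace L" if "P \<in> F" "(t, l) \<in> P" for P t l
    using F(2)[OF that(1)] that(2) tiles_compact patch_subset by blast
  \<comment> \<open>the labelled shapes, and the relative positions within patches of radius \<open>R\<close>; both are finite sets\<close>
  define N where "N = (\<Union>P\<in>F. nrm ` P)"
  define D where "D = (\<Union>P\<in>F. \<Union>a\<in>P. \<Union>b\<in>P. {corner (fst a) - corner (fst b)})"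
  have fin: "finite N" "finite D" unfolding N_def D_def using F(1) finP by blast+
  have nrmN: "nrm s \<in> N" if T: "T \<in> \<Omega>" and s: "s \<in> T" for T s
  proof -
    obtain t l where tl: "s = (t, l)" by fastforce
    have t: "compact t" "t \<noteq> {}" using tiles_compact T s tl by blast+
    then obtain x where "x \<in> t" by blast
    then have x: "(t, l) \<in> patch T x R" using s \<open>R > 0\<close> by (auto simp: patch_def tl)
    obtain P y where P: "P \<in> F" "patch T x R = translate y P" using F(3)[OF T] by blast
    obtain t' where t': "(t', l) \<in> P" "t = (\<lambda>p. p - y) ` t'" using x unfolding P(2) by (rule translateE)
    have "compact t'" "t' \<noteq> {}" using tilesP[OF P(1) t'(1)] by blast+
    then have "nrm (t, l) = nrm (t', l)"
      by (simp add: nrm_def t'(2) corner_translate image_image)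
    then show ?thesis using P(1) t'(1) unfolding N_def tl by blast
  qed
  have offD: "corner t - corner u \<in> D"
    if T: "T \<in> \<Omega>" and tu: "(t, l) \<in> patch T 0 R" "(u, m) \<in> patch T 0 R" for T t l u m
  proof -
    obtain P y where P: "P \<in> F" "patch T 0 R = translate y P" using F(3)[OF T] by blast
    obtain t' where t': "(t', l) \<in> P" "t = (\<lambda>p. p - y) ` t'"
      using tu(1) unfolding P(2) by (rule translateE)
    obtain u' where u': "(u', m) \<in> P" "u = (\<lambda>p. p - y) ` u'"
      using tu(2) unfolding P(2) by (rule translateE)
    have "corner t - corner u = corner t' - corner u'"
      using tilesP[OF P(1) t'(1)] tilesP[OF P(1) u'(1)] by (simp add: t'(2) u'(2) corner_translate)
    then show ?thesis using P(1) t'(1) u'(1) unfolding D_def by force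
  qed
  have NE: "compact t \<and> t \<noteq> {} \<and> l \<in> mspace L" if tl: "(t, l) \<in> N" for t l
  proof -
    obtain P t' where "P \<in> F" "(t', l) \<in> P" "t = (\<lambda>p. p - corner t') ` t'"
      using tl unfolding N_def nrm_def by auto
    then show ?thesis using tilesP[of P t' l] compact_translation_subtract by auto
  qed
  have pos: "0 < hausdorff_dist (fst a) (fst b) + mdist L (snd a) (snd b)" if "a \<in> N" "b \<in> N" "a \<noteq> b" for a b
  proof -
    interpret H: Metric_space "{A::(real^'d) set. compact A \<and> A \<noteq> {}}" hausdorff_dist
      by (rule Metric_space_hausdorff)
    obtain t l u m where ab: "a = (t, l)" "b = (u, m)" by fastforce
    have "t \<noteq> u \<or> l \<noteq> m" using that ab by blast
    then show ?thesis
    proof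
      assume "t \<noteq> u"
      then have "0 < hausdorff_dist t u" using H.mdist_pos_eq NE that ab by fastforce
      then show ?thesis using mdist_nonneg[of L l m] by (simp add: ab add_pos_nonneg)
    next
      assume "l \<noteq> m"
      moreover have "l \<in> mspace L" "m \<in> mspace L" using NE that ab by blast+
      ultimately have "0 < mdist L l m" using mdist_zero[of l L m] mdist_nonneg[of L l m] by linarith
      then show ?thesis using hausdorff_dist_nonneg[of t u] by (simp add: ab add_nonneg_pos)
    qed
  qed
  obtain e1 where e1: "e1 > 0" "\<And>a b. a \<in> N \<Longrightarrow> b \<in> N \<Longrightarrow>
      hausdorff_dist (fst a) (fst b) + mdist L (snd a) (snd b) < e1 \<Longrightarrow> a = b"
    using finite_separation[OF fin(1), of "\<lambda>a b. hausdorff_dist (fst a) (fst b) + mdist L (snd a) (snd b)"] pos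
    by blast
  obtain e2 where e2: "e2 > 0" "\<And>a b. a \<in> D \<Longrightarrow> b \<in> D \<Longrightarrow> dist a b < e2 \<Longrightarrow> a = b"
    using finite_separation[OF fin(2), of dist] by auto
  \<comment> \<open>\<open>k\<close> bounds the movement of corners in terms of the Hausdorff distance\<close>
  define k where "k = real CARD('d)"
  have k: "k > 0" by (simp add: k_def)
  define \<epsilon> where "\<epsilon> = Min {e1 / (k + 2), e2 / (2 * k), min \<delta> 1 / k, 1 / 2, 1 / R}"
  have \<epsilon>pos: "\<epsilon> > 0" using e1(1) e2(1) k assms \<open>R > 0\<close> by (simp add: \<epsilon>_def)
  have "\<epsilon> \<le> e1 / (k + 2)" "\<epsilon> \<le> e2 / (2 * k)" "\<epsilon> \<le> min \<delta> 1 / k" "\<epsilon> \<le> 1 / 2" "\<epsilon> \<le> 1 / R"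
    unfolding \<epsilon>_def by (rule Min_le; simp)+
  then have \<epsilon>: "(k + 2) * \<epsilon> \<le> e1" "2 * k * \<epsilon> \<le> e2" "k * \<epsilon> \<le> min \<delta> 1" "\<epsilon> < 1" "R \<le> 1 / \<epsilon>"
    using k \<open>R > 0\<close> \<epsilon>pos by (simp_all add: field_simps)
  have "\<exists>z. norm z < \<delta> \<and> agree r z T T'"
    if T: "T \<in> \<Omega>" "T' \<in> \<Omega>" and close: "eps_close L \<epsilon> T T'" for T T'
  proof -
    obtain S S' f where S: "patch T 0 (1 / \<epsilon>) \<subseteq> S" "S \<subseteq> T" "patch T' 0 (1 / \<epsilon>) \<subseteq> S'" "S' \<subseteq> T'"
      and bij: "bij_betw f S S'"
      and f: "\<And>s. s \<in> S \<Longrightarrow> hausdorff_dist (fst s) (fst (f s)) < \<epsilon> \<and> mdist L (snd s) (snd (f s)) < \<epsilon>"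
      using close unfolding eps_close_def by blast
    have fS: "f s \<in> T'" if "s \<in> S" for s using bij that S(4) by (auto simp: bij_betw_def)
    have patchR: "patch A 0 \<sigma> \<subseteq> patch A 0 (1 / \<epsilon>)" if "\<sigma> \<le> R" for \<sigma> and A :: "('d, 'l) pattern"
    proof -
      have "ball (0::real^'d) \<sigma> \<subseteq> ball 0 (1 / \<epsilon>)" using that \<epsilon>(5) by (intro subset_ball) simp
      then show ?thesis by (auto simp: patch_def)
    qed
    define shift where "shift s = corner (fst s) - corner (fst (f s))" for s
    have tile: "f s = ((\<lambda>p. p - shift s) ` fst s, snd s) \<and> norm (shift s) < k * \<epsilon> \<and>
        compact (fst s) \<and> fst s \<noteq> {} \<and> compact (fst (f s)) \<and> fst (f s) \<noteq> {}" if s: "s \<in> S" for s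
    proof -
      obtain t l u m where tl: "s = (t, l)" "f s = (u, m)" by fastforce
      have t: "compact t" "t \<noteq> {}" "l \<in> mspace L" using tiles_compact[OF T(1), of t l] s S(2) tl by auto
      have u: "compact u" "u \<noteq> {}" "m \<in> mspace L" using tiles_compact[OF T(2), of u m] fS[OF s] tl by auto
      have h: "hausdorff_dist t u < \<epsilon>" "mdist L l m < \<epsilon>" using f[OF s] tl by auto
      have "k * hausdorff_dist t u < k * \<epsilon>" using h(1) k by simp
      then have n: "norm (corner t - corner u) < k * \<epsilon>"
        using corner_hausdorff_dist[OF t(1,2) u(1,2)] unfolding k_def[symmetric] by linarith
      have "hausdorff_dist ((\<lambda>p. p - corner t) ` t) ((\<lambda>p. p - corner u) ` u) + mdist L l m < (k + 2) * \<epsilon>"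
        using hausdorff_dist_translate_le[OF t(1,2) u(1,2), of "corner t" "corner u"] h n by (simp add: algebra_simps)
      moreover have ns: "nrm s = ((\<lambda>p. p - corner t) ` t, l)" "nrm (f s) = ((\<lambda>p. p - corner u) ` u, m)"
        by (simp_all add: nrm_def tl(1)) (simp add: tl(1)[symmetric] tl(2))
      ultimately have "nrm s = nrm (f s)"
        using e1(2)[OF nrmN[OF T(1), of s] nrmN[OF T(2) fS[OF s]]] s S(2) \<epsilon>(1) by auto
      then have eq: "(\<lambda>p. p - corner t) ` t = (\<lambda>p. p - corner u) ` u" "l = m" by (auto simp: ns)
      have "u = (\<lambda>p. p + corner u) ` (\<lambda>p. p - corner u) ` u" by (simp add: image_image)
      also have "\<dots> = (\<lambda>p. p - (corner t - corner u)) ` t"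
        unfolding eq(1)[symmetric] by (simp add: image_image algebra_simps)
      finally have "u = (\<lambda>p. p - (corner t - corner u)) ` t" .
      moreover have "shift s = corner t - corner u" by (simp add: shift_def tl(2)) (simp add: tl(1))
      ultimately show ?thesis using eq(2) n t u by (simp add: tl(2)) (simp add: tl(1))
    qed
    have meets: "\<exists>q\<in>fst (f s). norm q < \<sigma> + 1" if s: "s \<in> S" and pn: "p \<in> fst s" "norm p < \<sigma>" for s p \<sigma>
    proof -
      have c: "compact (fst s)" "fst s \<noteq> {}" "compact (fst (f s))" "fst (f s) \<noteq> {}" using tile[OF s] by blast+
      have h: "(\<forall>a\<in>fst s. \<exists>b\<in>fst (f s). dist a b \<le> \<epsilon>) \<and> (\<forall>b\<in>fst (f s). \<exists>a\<in>fst s. dist a b \<le> \<epsilon>)"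
        using f[OF s] less_imp_le hausdorff_dist_le_iff[OF c, of \<epsilon>] by blast
      obtain q where q: "q \<in> fst (f s)" "dist p q \<le> \<epsilon>"
        using h pn(1) by blast
      have "norm q \<le> norm p + dist p q" using norm_triangle_ineq[of p "q - p"] by (simp add: dist_norm norm_minus_commute)
      then show ?thesis using q pn(2) \<epsilon>(4) by force
    qed
    have meets': "\<exists>q\<in>fst s. norm q < \<sigma> + 1" if s: "s \<in> S" and pn: "p \<in> fst (f s)" "norm p < \<sigma>" for s p \<sigma>
    proof -
      have c: "compact (fst s)" "fst s \<noteq> {}" "compact (fst (f s))" "fst (f s) \<noteq> {}" using tile[OF s] by blast+
      have h: "(\<forall>a\<in>fst s. \<exists>b\<in>fst (f s). dist a b \<le> \<epsilon>) \<and> (\<forall>b\<in>fst (f s). \<exists>a\<in>fst s. dist a b \<le> \<epsilon>)"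
        using f[OF s] less_imp_le hausdorff_dist_le_iff[OF c, of \<epsilon>] by blast
      obtain q where q: "q \<in> fst s" "dist q p \<le> \<epsilon>"
        using h pn(1) by blast
      have "norm q \<le> norm p + dist q p" using norm_triangle_ineq[of p "q - p"] by (simp add: dist_norm)
      then show ?thesis using q pn(2) \<epsilon>(4) by force
    qed
    \<comment> \<open>the shapes in \<open>Q\<close> do not change, nor do the relative positions, so there is one shift for all\<close>
    define Q where "Q = patch T 0 (r + 1)"
    have QS: "Q \<subseteq> S" unfolding Q_def using patchR[of "r + 1" T] S(1) by (auto simp: R_def)
    have same: "shift s = shift s'" if "s \<in> Q" "s' \<in> Q" for s s'
    proof -
      have sS: "s \<in> S" "s' \<in> S" using that QS by blast+
      have in1: "s \<in> patch T 0 R" "s' \<in> patch T 0 R"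
        using that unfolding Q_def R_def patch_def by (auto; force)+
      have in2: "f s \<in> patch T' 0 R" if "s \<in> Q" for s
      proof -
        obtain p where "p \<in> fst s" "norm p < r + 1" using \<open>s \<in> Q\<close> by (auto simp: Q_def patch_def)
        moreover have "s \<in> S" "r + 1 + 1 = R" using \<open>s \<in> Q\<close> QS by (auto simp: R_def)
        ultimately obtain q where "q \<in> fst (f s)" "norm q < R" using meets[of s p "r + 1"] by metis
        then show ?thesis using fS[of s] \<open>s \<in> S\<close> by (cases "f s") (auto simp: patch_def)
      qed
      have "corner (fst s) - corner (fst s') \<in> D"
        using offD[OF T(1), of "fst s" "snd s" "fst s'" "snd s'"] in1 by simp
      moreover have "corner (fst (f s)) - corner (fst (f s')) \<in> D"
        using offD[OF T(2), of "fst (f s)" "snd (f s)" "fst (f s')" "snd (f s')"] in2 that by simp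
      moreover have "dist (corner (fst s) - corner (fst s')) (corner (fst (f s)) - corner (fst (f s'))) = norm (shift s - shift s')"
        by (simp add: dist_norm shift_def algebra_simps)
      moreover have "norm (shift s - shift s') < e2"
      proof -
        have "norm (shift s) < k * \<epsilon>" "norm (shift s') < k * \<epsilon>" using tile sS by blast+
        then show ?thesis using norm_triangle_ineq4[of "shift s" "shift s'"] \<epsilon>(2) by linarith
      qed
      ultimately have "corner (fst s) - corner (fst s') = corner (fst (f s)) - corner (fst (f s'))"
        using e2(2) by metis
      then show ?thesis by (simp add: shift_def algebra_simps)
    qed
    define z where "z = (if Q = {} then 0 else shift (SOME s. s \<in> Q))"
    have z: "shift s = z" if "s \<in> Q" for s
    proof -
      have "(SOME s. s \<in> Q) \<in> Q" by (rule someI[of "\<lambda>s. s \<in> Q", OF that])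
      then show ?thesis using same[OF that] that unfolding z_def by (metis empty_iff)
    qed
    have zn: "norm z < \<delta> \<and> norm z < 1"
    proof (cases "Q = {}")
      case True
      then show ?thesis using assms(2) by (simp add: z_def)
    next
      case False
      then obtain s where "s \<in> Q" by blast
      then have "norm z < k * \<epsilon>" using z tile QS by blast
      then show ?thesis using \<epsilon>(3) by simp
    qed
    have "patch (translate z T) 0 r \<subseteq> patch T' 0 r"
    proof
      fix s assume s: "s \<in> patch (translate z T) 0 r"
      obtain t l where tl: "s = (t, l)" by fastforce
      obtain t' where t': "(t', l) \<in> T" "t = (\<lambda>p. p - z) ` t'"
        using s patch_subset[of "translate z T" 0 r] unfolding tl by (blast elim: translateE)
      obtain p where p: "p \<in> t'" "norm (p - z) < r" using s by (auto simp: tl patch_def t'(2))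
      have "norm p < r + 1" using norm_triangle_ineq[of "p - z" z] p(2) zn by simp
      then have "(t', l) \<in> Q" using p(1) t'(1) by (auto simp: Q_def patch_def)
      then have "f (t', l) = (t, l)" "f (t', l) \<in> T'"
        using tile[of "(t', l)"] z[of "(t', l)"] fS[of "(t', l)"] QS by (auto simp: t'(2))
      then show "s \<in> patch T' 0 r" using s by (auto simp: tl patch_def)
    qed
    moreover have "patch T' 0 r \<subseteq> patch (translate z T) 0 r"
    proof
      fix s' assume s': "s' \<in> patch T' 0 r"
      then have "s' \<in> S'" using patchR[of r T'] S(3) by (auto simp: R_def)
      then obtain s where s: "s \<in> S" "s' = f s" using bij by (auto simp: bij_betw_def)
      obtain p where p: "p \<in> fst (f s)" "norm p < r" using s' by (auto simp: s(2) patch_def)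
      obtain q where "q \<in> fst s" "norm q < r + 1" using meets'[OF s(1) p] by blast
      then have "s \<in> Q" using s(1) S(2) by (cases s) (auto simp: Q_def patch_def)
      then have "f s \<in> translate z T"
        using tile[OF s(1)] z translateI[of "fst s" "snd s" T z] s(1) S(2) by auto
      then show "s' \<in> patch (translate z T) 0 r" using s' s(2) by (auto simp: patch_def)
    qed
    ultimately show ?thesis using zn unfolding agree_def by blast
  qed
  then show ?thesis using \<epsilon>pos by blast
qed

subsection \<open>The topology in terms of agreement\<close>

lemma openin_iff_agree:
  "openin X U \<longleftrightarrow> U \<subseteq> \<Omega> \<and> (\<forall>T\<in>U. \<exists>r>0. \<exists>\<delta>>0. \<forall>T'\<in>\<Omega>. \<forall>z. norm z < \<delta> \<longrightarrow> agree r z T T' \<longrightarrow> T' \<in> U)"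
  (is "_ \<longleftrightarrow> _ \<and> ?R")
proof (cases "U \<subseteq> \<Omega>")
  case sub: True
  have "(\<exists>\<epsilon>>0. \<forall>T'\<in>\<Omega>. eps_close L \<epsilon> T T' \<longrightarrow> T' \<in> U) \<longleftrightarrow>
      (\<exists>r>0. \<exists>\<delta>>0. \<forall>T'\<in>\<Omega>. \<forall>z. norm z < \<delta> \<longrightarrow> agree r z T T' \<longrightarrow> T' \<in> U)" if T: "T \<in> U" for T
  proof
    assume "\<exists>\<epsilon>>0. \<forall>T'\<in>\<Omega>. eps_close L \<epsilon> T T' \<longrightarrow> T' \<in> U"
    then obtain \<epsilon> where \<epsilon>: "\<epsilon> > 0" "\<And>T'. T' \<in> \<Omega> \<Longrightarrow> eps_close L \<epsilon> T T' \<Longrightarrow> T' \<in> U" by blast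
    have "eps_close L \<epsilon> T T'" if "norm z < \<epsilon>" "agree (1 / \<epsilon> + \<epsilon>) z T T'" for z T'
      by (rule agree_imp_eps_close[OF _ \<epsilon>(1) that(1) _ that(2)]) (use tiles_compact T sub in blast)+
    then show "\<exists>r>0. \<exists>\<delta>>0. \<forall>T'\<in>\<Omega>. \<forall>z. norm z < \<delta> \<longrightarrow> agree r z T T' \<longrightarrow> T' \<in> U"
      using \<epsilon> by (intro exI[of _ "1 / \<epsilon> + \<epsilon>"] exI[of _ \<epsilon>]) (auto intro: add_pos_pos)
  next
    assume "\<exists>r>0. \<exists>\<delta>>0. \<forall>T'\<in>\<Omega>. \<forall>z. norm z < \<delta> \<longrightarrow> agree r z T T' \<longrightarrow> T' \<in> U"
    then obtain r \<delta> where r: "r > 0" "\<delta> > 0" "\<And>T' z. T' \<in> \<Omega> \<Longrightarrow> norm z < \<delta> \<Longrightarrow> agree r z T T' \<Longrightarrow> T' \<in> U" by blast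
    obtain \<epsilon> where \<epsilon>: "\<epsilon> > 0" "\<forall>T\<in>\<Omega>. \<forall>T'\<in>\<Omega>. eps_close L \<epsilon> T T' \<longrightarrow> (\<exists>z. norm z < \<delta> \<and> agree r z T T')"
      using eps_close_imp_agree[OF r(1,2)] by blast
    have "T \<in> \<Omega>" using T sub by blast
    then show "\<exists>\<epsilon>>0. \<forall>T'\<in>\<Omega>. eps_close L \<epsilon> T T' \<longrightarrow> T' \<in> U"
      using \<epsilon> r(3) by blast
  qed
  then show ?thesis using sub unfolding openin_pattern_topology by blast
qed (auto simp: openin_pattern_topology)

text \<open>Asking for agreement beyond radius \<open>r\<close> leaves some room, which makes these sets open.\<close>

definition cylinder :: "('d, 'l) pattern \<Rightarrow> real \<Rightarrow> real \<Rightarrow> ('d, 'l) pattern set" where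
  "cylinder T r \<delta> = {T' \<in> \<Omega>. \<exists>z s. norm z < \<delta> \<and> r < s \<and> agree s z T T'}"

lemma cylinderE:
  assumes "T' \<in> cylinder T r \<delta>"
  obtains z where "T' \<in> \<Omega>" "norm z < \<delta>" "agree r z T T'"
proof -
  obtain z s where "T' \<in> \<Omega>" "norm z < \<delta>" "r < s" "agree s z T T'" using assms unfolding cylinder_def by blast
  then show ?thesis using that[of z] agree_mono[of s z T T' r] by simp
qed

lemma cylinder_self: "T \<in> \<Omega> \<Longrightarrow> 0 < \<delta> \<Longrightarrow> T \<in> cylinder T r \<delta>"
  unfolding cylinder_def using agree_translate[of "r + 1" 0 T] by (auto intro!: exI[of _ 0] exI[of _ "r + 1"])

lemma openin_cylinder:
  assumes "0 < r"
  shows "openin X (cylinder T r \<delta>)"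
  unfolding openin_iff_agree
proof (intro conjI ballI)
  show "cylinder T r \<delta> \<subseteq> \<Omega>" by (auto simp: cylinder_def)
  fix T' assume "T' \<in> cylinder T r \<delta>"
  then obtain z s where z: "norm z < \<delta>" "r < s" "agree s z T T'" by (auto simp: cylinder_def)
  define e where "e = min (\<delta> - norm z) ((s - r) / 2)"
  have e': "e \<le> \<delta> - norm z" "e \<le> (s - r) / 2"
    unfolding e_def by (rule min.cobounded1, rule min.cobounded2)
  have e: "norm z + e \<le> \<delta>" "2 * e \<le> s - r" using e' by simp_all
  have e0: "e > 0" using z by (simp add: e_def)
  show "\<exists>s>0. \<exists>\<delta>'>0. \<forall>T''\<in>\<Omega>. \<forall>w. norm w < \<delta>' \<longrightarrow> agree s w T' T'' \<longrightarrow> T'' \<in> cylinder T r \<delta>"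
  proof (rule exI[of _ s], rule conjI, use assms z in simp, rule exI[of _ e], rule conjI, rule e0, intro ballI allI impI)
    fix T'' w assume w: "T'' \<in> \<Omega>" "norm w < e" "agree s w T' T''"
    have "agree (s - e) (w + z) T T''"
      by (rule agree_trans[OF z(3) agree_mono[OF w(3)]]) (use w e e0 in auto)
    moreover have "norm (w + z) < \<delta>" using norm_triangle_ineq[of w z] w e by linarith
    moreover have "r < s - e" using e e0 by linarith
    ultimately show "T'' \<in> cylinder T r \<delta>" using w(1) unfolding cylinder_def by blast
  qed
qed

lemma finite_cylinder_cover:
  assumes "\<And>T. T \<in> \<Omega> \<Longrightarrow> 0 < r T \<and> 0 < \<delta> T"
  obtains F where "finite F" "F \<subseteq> \<Omega>" "\<Omega> \<subseteq> (\<Union>T\<in>F. cylinder T (r T) (\<delta> T))"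
proof -
  have "compactin X \<Omega>" using compact by (simp add: compact_space_def)
  moreover have "\<forall>U\<in>(\<lambda>T. cylinder T (r T) (\<delta> T)) ` \<Omega>. openin X U" using assms openin_cylinder by blast
  moreover have "\<Omega> \<subseteq> \<Union>((\<lambda>T. cylinder T (r T) (\<delta> T)) ` \<Omega>)" using assms cylinder_self by blast
  ultimately obtain F' where F': "finite F'" "F' \<subseteq> (\<lambda>T. cylinder T (r T) (\<delta> T)) ` \<Omega>" "\<Omega> \<subseteq> \<Union>F'"
    unfolding compactin_def by meson
  then obtain F where "F \<subseteq> \<Omega>" "finite F" "F' = (\<lambda>T. cylinder T (r T) (\<delta> T)) ` F"
    by (meson finite_subset_image)
  then show ?thesis using that F'(3) by blast
qed

lemma Hausdorff: "Hausdorff_space X"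
  unfolding Hausdorff_space_def topspace_pattern_topology
proof (intro allI impI)
  fix T T' assume T: "T \<in> \<Omega> \<and> T' \<in> \<Omega> \<and> T \<noteq> T'"
  then obtain r \<delta> where r: "r > 0" "\<delta> > 0" and far: "\<And>z. norm z < \<delta> \<Longrightarrow> \<not> agree r z T T'"
    using agree_small_imp_eq[of T T'] by blast
  define U where "U = cylinder T (r + \<delta>) (\<delta> / 2)"
  define V where "V = cylinder T' (r + \<delta>) (\<delta> / 2)"
  have "disjnt U V"
    unfolding disjnt_iff
  proof (intro allI notI)
    fix S assume "S \<in> U \<and> S \<in> V"
    then obtain z w where z: "norm z < \<delta> / 2" "agree (r + \<delta>) z T S" and w: "norm w < \<delta> / 2" "agree (r + \<delta>) w T' S"
      unfolding U_def V_def by (meson cylinderE)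
    have 1: "agree (r + \<delta> / 2) (- w) S T'" by (rule agree_sym[OF w(2)]) (use w in auto)
    have "agree r (- w + z) T T'"
      by (rule agree_trans[OF z(2) agree_mono[OF 1]]) (use w r in auto)
    moreover have "norm (- w + z) < \<delta>" using norm_triangle_ineq[of "- w" z] z w by simp
    ultimately show False using far by blast
  qed
  moreover have "openin X U" "openin X V" unfolding U_def V_def using r by (simp_all add: openin_cylinder)
  moreover have "T \<in> U" "T' \<in> V" unfolding U_def V_def using T r by (simp_all add: cylinder_self)
  ultimately show "\<exists>U V. openin X U \<and> openin X V \<and> T \<in> U \<and> T' \<in> V \<and> disjnt U V" by blast
qed

lemma continuous_mapI:
  assumes "\<And>T. T \<in> \<Omega> \<Longrightarrow> f T \<in> topspace Y"
    and "\<And>T V. T \<in> \<Omega> \<Longrightarrow> openin Y V \<Longrightarrow> f T \<in> V \<Longrightarrow>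
      \<exists>r>0. \<exists>\<delta>>0. \<forall>T'\<in>\<Omega>. \<forall>z. norm z < \<delta> \<longrightarrow> agree r z T T' \<longrightarrow> f T' \<in> V"
  shows "continuous_map X Y f"
  unfolding continuous_map_def
proof (intro conjI allI impI)
  show "f \<in> topspace X \<rightarrow> topspace Y" using assms(1) by simp
  fix V assume V: "openin Y V"
  show "openin X {T \<in> topspace X. f T \<in> V}"
    unfolding openin_iff_agree using assms(2)[OF _ V] by auto
qed

lemma continuous_euclideanI:
  fixes f :: "('d, 'l) pattern \<Rightarrow> 'e::metric_space"
  assumes "\<And>T e. T \<in> \<Omega> \<Longrightarrow> e > 0 \<Longrightarrow>
      \<exists>r>0. \<exists>\<delta>>0. \<forall>T'\<in>\<Omega>. \<forall>z. norm z < \<delta> \<longrightarrow> agree r z T T' \<longrightarrow> dist (f T') (f T) < e"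
  shows "continuous_map X euclidean f"
proof (rule continuous_mapI)
  fix T V assume T: "T \<in> \<Omega>" and V: "openin euclidean V" "f T \<in> V"
  then obtain e where "e > 0" "ball (f T) e \<subseteq> V" by (metis open_contains_ball open_openin)
  then show "\<exists>r>0. \<exists>\<delta>>0. \<forall>T'\<in>\<Omega>. \<forall>z. norm z < \<delta> \<longrightarrow> agree r z T T' \<longrightarrow> f T' \<in> V"
  proof -
    from assms[OF T \<open>e > 0\<close>] obtain r \<delta> where r: "r > 0" "\<delta> > 0"
      "\<forall>T'\<in>\<Omega>. \<forall>z. norm z < \<delta> \<longrightarrow> agree r z T T' \<longrightarrow> dist (f T') (f T) < e" by blast
    have "f T' \<in> V" if "dist (f T') (f T) < e" for T'
      using that \<open>ball (f T) e \<subseteq> V\<close> by (auto simp: dist_commute)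
    then show ?thesis using r by blast
  qed
qed simp

lemma continuous_patternI:
  fixes f :: "('d, 'l) pattern \<Rightarrow> ('d, 'm) pattern"
  assumes \<Omega>': "\<And>S t l. S \<in> \<Omega>' \<Longrightarrow> (t, l) \<in> S \<Longrightarrow> compact t \<and> t \<noteq> {} \<and> l \<in> mspace L'"
    and f: "\<And>T. T \<in> \<Omega> \<Longrightarrow> f T \<in> \<Omega>'"
    and near: "\<And>T s e. T \<in> \<Omega> \<Longrightarrow> s > 0 \<Longrightarrow> e > 0 \<Longrightarrow>
      \<exists>r>0. \<exists>\<delta>>0. \<forall>T'\<in>\<Omega>. \<forall>z. norm z < \<delta> \<longrightarrow> agree r z T T' \<longrightarrow> (\<exists>w. norm w < e \<and> agree s w (f T) (f T'))"
  shows "continuous_map X (pattern_topology L' \<Omega>') f"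
proof (rule continuous_mapI)
  show "f T \<in> topspace (pattern_topology L' \<Omega>')" if "T \<in> \<Omega>" for T using f that by simp
  fix T V assume T: "T \<in> \<Omega>" and V: "openin (pattern_topology L' \<Omega>') V" "f T \<in> V"
  then obtain \<epsilon> where \<epsilon>: "\<epsilon> > 0" "\<And>S. S \<in> \<Omega>' \<Longrightarrow> eps_close L' \<epsilon> (f T) S \<Longrightarrow> S \<in> V"
    unfolding openin_pattern_topology by blast
  have pos: "1 / \<epsilon> + \<epsilon> > 0" using \<epsilon>(1) by (simp add: add_pos_pos)
  have "eps_close L' \<epsilon> (f T) S" if "norm w < \<epsilon>" "agree (1 / \<epsilon> + \<epsilon>) w (f T) S" for w S
    by (rule agree_imp_eps_close[OF _ \<epsilon>(1) that(1) _ that(2)]) (use \<Omega>' f T in blast)+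
  then have V: "S \<in> V" if "S \<in> \<Omega>'" "norm w < \<epsilon>" "agree (1 / \<epsilon> + \<epsilon>) w (f T) S" for w S
    using that \<epsilon>(2) by blast
  then show "\<exists>r>0. \<exists>\<delta>>0. \<forall>T'\<in>\<Omega>. \<forall>z. norm z < \<delta> \<longrightarrow> agree r z T T' \<longrightarrow> f T' \<in> V"
  proof -
    obtain r \<delta> where r: "r > 0" "\<delta> > 0" "\<forall>T'\<in>\<Omega>. \<forall>z. norm z < \<delta> \<longrightarrow> agree r z T T' \<longrightarrow>
        (\<exists>w. norm w < \<epsilon> \<and> agree (1 / \<epsilon> + \<epsilon>) w (f T) (f T'))"
      using near[OF T pos \<epsilon>(1)] by (elim exE conjE)
    have "f T' \<in> V" if "T' \<in> \<Omega>" "norm z < \<delta>" "agree r z T T'" for T' z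
      using r(3)[rule_format, OF that] V f[OF that(1)] by blast
    then show ?thesis using r(1,2) by blast
  qed
qed

lemma continuous_prodI:
  fixes f :: "('d, 'l) pattern \<times> 'e::metric_space \<Rightarrow> 'f"
  assumes "\<And>T x. T \<in> \<Omega> \<Longrightarrow> f (T, x) \<in> topspace Y"
    and "\<And>T x V. T \<in> \<Omega> \<Longrightarrow> openin Y V \<Longrightarrow> f (T, x) \<in> V \<Longrightarrow>
      \<exists>r>0. \<exists>\<delta>>0. \<forall>T'\<in>\<Omega>. \<forall>z x'. norm z < \<delta> \<longrightarrow> agree r z T T' \<longrightarrow> dist x' x < \<delta> \<longrightarrow> f (T', x') \<in> V"
  shows "continuous_map (prod_topology X euclidean) Y f"
  unfolding continuous_map_def
proof (intro conjI allI impI)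
  show "f \<in> topspace (prod_topology X euclidean) \<rightarrow> topspace Y" using assms(1) by auto
  fix V assume V: "openin Y V"
  show "openin (prod_topology X euclidean) {p \<in> topspace (prod_topology X euclidean). f p \<in> V}"
    unfolding openin_prod_topology_alt
  proof (intro allI impI)
    fix T x assume "(T, x) \<in> {p \<in> topspace (prod_topology X euclidean). f p \<in> V}"
    then have T: "T \<in> \<Omega>" "f (T, x) \<in> V" by auto
    obtain r \<delta> where r: "r > 0" "\<delta> > 0"
      "\<And>T' z x'. T' \<in> \<Omega> \<Longrightarrow> norm z < \<delta> \<Longrightarrow> agree r z T T' \<Longrightarrow> dist x' x < \<delta> \<Longrightarrow> f (T', x') \<in> V"
      using assms(2)[OF T(1) V T(2)] by blast
    have "cylinder T r \<delta> \<times> ball x \<delta> \<subseteq> {p \<in> topspace (prod_topology X euclidean). f p \<in> V}"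
    proof clarsimp
      fix T' x' assume "T' \<in> cylinder T r \<delta>" and x': "dist x x' < \<delta>"
      then obtain z where "T' \<in> \<Omega>" "norm z < \<delta>" "agree r z T T'" by (elim cylinderE)
      then show "T' \<in> \<Omega> \<and> f (T', x') \<in> V" using r(3) x' by (metis dist_commute)
    qed
    then show "\<exists>U W. openin X U \<and> openin euclidean W \<and> T \<in> U \<and> x \<in> W \<and>
        U \<times> W \<subseteq> {p \<in> topspace (prod_topology X euclidean). f p \<in> V}"
      using openin_cylinder[OF r(1)] cylinder_self[OF T(1) r(2)] r(2) by (meson centre_in_ball open_ball open_openin)
  qed
qed

lemma continuous_translate_prod: "continuous_map (prod_topology X euclidean) X (\<lambda>(T, x). translate x T)"
proof (rule continuous_prodI)
  fix T x V assume T: "T \<in> \<Omega>" and V: "openin X V" "(case (T, x) of (T, x) \<Rightarrow> translate x T) \<in> V"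
  then obtain r \<delta> where r: "r > 0" "\<delta> > 0"
    "\<And>T' z. T' \<in> \<Omega> \<Longrightarrow> norm z < \<delta> \<Longrightarrow> agree r z (translate x T) T' \<Longrightarrow> T' \<in> V"
    unfolding openin_iff_agree by auto
  have "translate x' T' \<in> V"
    if "T' \<in> \<Omega>" "norm z < \<delta> / 2" "agree (r + norm x + \<delta>) z T T'" "dist x' x < \<delta> / 2" for T' z x'
  proof -
    have "norm x' \<le> norm x + dist x' x" using norm_triangle_ineq[of x "x' - x"] by (simp add: dist_norm)
    then have "agree r (x' + z) T (translate x' T')" by (intro agree_shift[OF that(3)]) (use that r in linarith)
    then have "agree r (x' - x + z) (translate x T) (translate x' T')"
      by (simp add: agree_def translate_translate algebra_simps)
    moreover have "norm (x' - x + z) < \<delta>"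
      using norm_triangle_ineq[of "x' - x" z] that by (simp add: dist_norm)
    ultimately show ?thesis using r(3) that(1) by simp
  qed
  then show "\<exists>r>0. \<exists>\<delta>>0. \<forall>T'\<in>\<Omega>. \<forall>z x'. norm z < \<delta> \<longrightarrow> agree r z T T' \<longrightarrow> dist x' x < \<delta> \<longrightarrow>
      (case (T', x') of (T, x) \<Rightarrow> translate x T) \<in> V"
  proof (rule_tac exI[of _ "r + norm x + \<delta>"], rule_tac conjI, goal_cases)
    case 1
    then show ?case using r(1,2) norm_ge_zero[of x] by linarith
  next
    case 2
    then show ?case using r(2) by (intro exI[of _ "\<delta> / 2"]) auto
  qed
qed simp

lemma continuous_translate: "continuous_map X X (translate x)"
proof -
  have "continuous_map X (prod_topology X euclidean) (\<lambda>T. (T, x))"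
    by (intro continuous_map_pairedI) (simp_all add: continuous_map_id[unfolded id_def])
  from continuous_map_compose[OF this continuous_translate_prod] show ?thesis by (simp add: o_def)
qed

lemma locally_constant_onI:
  assumes "\<And>T. T \<in> A \<Longrightarrow> \<exists>r>0. \<exists>\<delta>>0. \<forall>T'\<in>A. \<forall>z. norm z < \<delta> \<longrightarrow> agree r z T T' \<longrightarrow> f T' = f T" "A \<subseteq> \<Omega>"
  shows "locally_constant_on X A f"
  unfolding locally_constant_on_def
proof
  fix T assume T: "T \<in> A"
  obtain r \<delta> where r: "r > 0" "\<delta> > 0" "\<And>T' z. T' \<in> A \<Longrightarrow> norm z < \<delta> \<Longrightarrow> agree r z T T' \<Longrightarrow> f T' = f T"
    using assms(1)[OF T] by blast
  show "\<exists>U. openin (subtopology X A) U \<and> T \<in> U \<and> (\<forall>y\<in>U. f y = f T)"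
  proof (intro exI[of _ "cylinder T r \<delta> \<inter> A"] conjI)
    show "openin (subtopology X A) (cylinder T r \<delta> \<inter> A)" using openin_cylinder[OF r(1)] by (rule openin_subtopology_Int)
    show "T \<in> cylinder T r \<delta> \<inter> A" using T assms(2) r(2) cylinder_self by blast
    show "\<forall>y\<in>cylinder T r \<delta> \<inter> A. f y = f T" using r(3) by (auto elim!: cylinderE)
  qed
qed

lemma locally_constant_onD:
  assumes "locally_constant_on X A f" "T \<in> A" "openin X A"
  shows "\<exists>r>0. \<exists>\<delta>>0. \<forall>T'\<in>\<Omega>. \<forall>z. norm z < \<delta> \<longrightarrow> agree r z T T' \<longrightarrow> T' \<in> A \<and> f T' = f T"
proof -
  obtain U where U: "openin (subtopology X A) U" "T \<in> U" "\<forall>y\<in>U. f y = f T"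
    using assms(1,2) unfolding locally_constant_on_def by blast
  then have "openin X U" "U \<subseteq> A" using assms(3) openin_open_subtopology by blast+
  then show ?thesis using U(2,3) unfolding openin_iff_agree by (meson subsetD)
qed

end

section \<open>Tiling spaces of finite local complexity\<close>

lemma finite_separated:
  fixes S :: "'a::heine_borel set"
  assumes "bounded S" "e > 0" "\<And>x y. x \<in> S \<Longrightarrow> y \<in> S \<Longrightarrow> dist x y < e \<Longrightarrow> x = y"
  shows "finite S"
proof (rule ccontr)
  assume "infinite S"
  moreover have "compact (closure S)" using assms(1) by (simp add: compact_closure)
  ultimately obtain x where "x islimpt S"
    using closure_subset unfolding compact_eq_Bolzano_Weierstrass by blast
  then have inf: "infinite (S \<inter> ball x (e / 2))"
    unfolding islimpt_eq_infinite_ball using assms(2) by simp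
  obtain y where y: "y \<in> S \<inter> ball x (e / 2)" using inf infinite_imp_nonempty by blast
  have "infinite (S \<inter> ball x (e / 2) - {y})" using inf by simp
  then obtain z where z: "z \<in> S \<inter> ball x (e / 2) - {y}" using infinite_imp_nonempty by blast
  have "dist y z < e" using y z dist_triangle_half_r[of x y e z] by auto
  then show False using assms(3)[of y z] y z by blast
qed

text \<open>A point outside the convex set \<open>t\<close> but well inside \<open>t0\<close> could be pushed within \<open>t0\<close> away
  from a hyperplane separating it from \<open>t\<close>, too far to be near \<open>t\<close>.\<close>

lemma convex_contains_inner_ball:
  fixes t t0 :: "'a::euclidean_space set"
  assumes "convex t" "closed t" "t \<noteq> {}" "cball c \<rho> \<subseteq> t0" "0 \<le> h"
    and near: "\<And>a. a \<in> t0 \<Longrightarrow> \<exists>b\<in>t. dist a b \<le> h"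
  shows "cball c (\<rho> - h) \<subseteq> t"
proof (rule ccontr)
  assume "\<not> cball c (\<rho> - h) \<subseteq> t"
  then obtain q where q: "dist c q \<le> \<rho> - h" "q \<notin> t" unfolding subset_iff mem_cball by blast
  obtain a b where ab: "inner a q < b" "\<forall>x\<in>t. inner a x > b"
    using separating_hyperplane_closed_point[OF assms(1,2) q(2)] by blast
  have a: "a \<noteq> 0" using ab assms(3) by force
  define y where "y = q - (h / norm a) *\<^sub>R a"
  have "dist c y \<le> dist c q + h"
    using norm_triangle_ineq[of "c - q" "(h / norm a) *\<^sub>R a"] a assms(5) by (simp add: y_def dist_norm algebra_simps)
  then have "y \<in> t0" using q assms(4) by auto
  then obtain x where x: "x \<in> t" "dist y x \<le> h" using near by blast
  have "inner a y = inner a q - h * norm a"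
    using a by (simp add: y_def inner_diff_right dot_square_norm power2_eq_square)
  then have "inner a (x - y) > h * norm a" using ab x(1) by (auto simp: inner_diff_right)
  moreover have "inner a (x - y) \<le> norm a * norm (x - y)" by (rule norm_cauchy_schwarz)
  moreover have "norm a * norm (x - y) \<le> norm a * h"
    using x(2) by (intro mult_left_mono) (auto simp: dist_norm norm_minus_commute)
  ultimately show False by (simp add: mult.commute)
qed

lemma compactin_prototile_shapes:
  fixes P :: "('d::finite, 'l) pattern"
  assumes "prototiles L P"
  shows "compactin (mtopology_of hausdorff_metric) (fst ` P)"
proof -
  have "continuous_map (mtopology_of (prod_metric hausdorff_metric L)) (mtopology_of (hausdorff_metric :: (real^'d) set metric)) fst"
    by (simp add: mtopology_of_prod_metric continuous_map_fst)
  then show ?thesis using assms image_compactin unfolding prototiles_def by blast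
qed

text \<open>A prototile that is near \<open>t0\<close> in the Hausdorff distance contains the ball of half the radius of a
  ball inside \<open>t0\<close>; by compactness finitely many \<open>t0\<close> suffice.\<close>

lemma prototiles_uniform:
  fixes P :: "('d::finite, 'l) pattern"
  assumes "prototiles L P"
  shows "\<exists>\<rho>>0. \<exists>K. \<forall>t\<in>fst ` P. \<exists>c. cball c \<rho> \<subseteq> t \<and> t \<subseteq> cball c K"
proof -
  interpret H: Metric_space "{A::(real^'d) set. compact A \<and> A \<noteq> {}}" hausdorff_dist
    by (rule Metric_space_hausdorff)
  have pol: "polytope t \<and> interior t \<noteq> {}" if "t \<in> fst ` P" for t
    using assms that unfolding prototiles_def by auto
  then have good: "compact t \<and> convex t \<and> t \<noteq> {}" if "t \<in> fst ` P" for t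
    using that polytope_imp_compact polytope_imp_convex by fastforce
  have "\<exists>c \<rho>. 0 < \<rho> \<and> cball c \<rho> \<subseteq> t" if "t \<in> fst ` P" for t
  proof -
    obtain c where "c \<in> interior t" using pol \<open>t \<in> fst ` P\<close> by blast
    then show ?thesis using mem_interior_cball by blast
  qed
  then obtain c \<rho> where c: "\<And>t. t \<in> fst ` P \<Longrightarrow> 0 < \<rho> t \<and> cball (c t) (\<rho> t) \<subseteq> t" by metis
  have "\<exists>K. t \<subseteq> cball (c t) K" if "t \<in> fst ` P" for t
    using bounded_subset_ballD[OF compact_imp_bounded, of t "c t"] good[OF that] ball_subset_cball by blast
  then obtain K where K: "\<And>t. t \<in> fst ` P \<Longrightarrow> t \<subseteq> cball (c t) (K t)" by metis
  have cpt: "compactin H.mtopology (fst ` P)"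
    using compactin_prototile_shapes[OF assms] by (simp add: hausdorff_metric_def)
  define U where "U t = H.mball t (\<rho> t / 2)" for t
  have "\<forall>V\<in>U ` fst ` P. openin H.mtopology V" unfolding U_def by (auto intro: H.openin_mball)
  moreover have "fst ` P \<subseteq> \<Union>(U ` fst ` P)"
  proof
    fix t assume t: "t \<in> fst ` P"
    then have "t \<in> U t" using good c unfolding U_def by (subst H.centre_in_mball_iff) auto
    then show "t \<in> \<Union>(U ` fst ` P)" using t by blast
  qed
  ultimately obtain F' where F': "finite F'" "F' \<subseteq> U ` fst ` P" "fst ` P \<subseteq> \<Union>F'"
    using cpt unfolding compactin_def by meson
  then obtain F where F: "F \<subseteq> fst ` P" "finite F" "F' = U ` F" by (meson finite_subset_image)
  define r where "r = Min (insert 1 ((\<lambda>t. \<rho> t / 2) ` F))"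
  define M where "M = Max (insert 1 ((\<lambda>t. K t + \<rho> t / 2) ` F))"
  have "r > 0" unfolding r_def using F c by (subst Min_gr_iff) auto
  moreover have "\<exists>c. cball c r \<subseteq> t \<and> t \<subseteq> cball c M" if t: "t \<in> fst ` P" for t
  proof -
    obtain t0 where t0: "t0 \<in> F" "t \<in> U t0" using t F'(3) F(3) by blast
    then have t0P: "t0 \<in> fst ` P" using F(1) by blast
    have "hausdorff_dist t0 t \<le> \<rho> t0 / 2" using t0(2) by (simp add: U_def)
    then have h: "(\<forall>a\<in>t0. \<exists>b\<in>t. dist a b \<le> \<rho> t0 / 2) \<and> (\<forall>b\<in>t. \<exists>a\<in>t0. dist a b \<le> \<rho> t0 / 2)"
      using hausdorff_dist_le_iff[of t0 t] good[OF t] good[OF t0P] by blast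
    have "cball (c t0) (\<rho> t0 - \<rho> t0 / 2) \<subseteq> t"
    proof (rule convex_contains_inner_ball)
      show "convex t" "closed t" "t \<noteq> {}" using good[OF t] compact_imp_closed by blast+
      show "cball (c t0) (\<rho> t0) \<subseteq> t0" "0 \<le> \<rho> t0 / 2" using c[OF t0P] by auto
      show "\<exists>b\<in>t. dist a b \<le> \<rho> t0 / 2" if "a \<in> t0" for a using h that by blast
    qed
    moreover have "r \<le> \<rho> t0 / 2" unfolding r_def using t0(1) F(2) by (intro Min_le) auto
    ultimately have 1: "cball (c t0) r \<subseteq> t"
      using subset_cball[of r "\<rho> t0 - \<rho> t0 / 2" "c t0"] by force
    have "K t0 + \<rho> t0 / 2 \<le> M" unfolding M_def using t0(1) F(2) by (intro Max_ge) auto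
    moreover have "dist (c t0) b \<le> K t0 + \<rho> t0 / 2" if "b \<in> t" for b
    proof -
      obtain a where "a \<in> t0" "dist a b \<le> \<rho> t0 / 2" using h \<open>b \<in> t\<close> by blast
      moreover have "dist (c t0) a \<le> K t0" using K[OF t0P] \<open>a \<in> t0\<close> by auto
      ultimately show ?thesis using dist_triangle[of "c t0" b a] by linarith
    qed
    ultimately have "t \<subseteq> cball (c t0) M" by force
    then show ?thesis using 1 by blast
  qed
  ultimately show ?thesis by blast
qed

text \<open>The balls inside distinct tiles are disjoint, so patches are finite; each point is near a vertex
  because its tile is a polytope of bounded diameter.\<close>

lemma tiling_flc_space:
  fixes L :: "'l metric" and \<Omega> :: "('d::finite, 'l) pattern set"
  assumes "tiling_space L \<Omega>" "FLC \<Omega>" and P: "prototiles L P" "\<And>T. T \<in> \<Omega> \<Longrightarrow> tiling P T"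
  shows "flc_space L \<Omega>"
proof -
  obtain \<rho> K where \<rho>: "\<rho> > 0" and K: "\<And>t. t \<in> fst ` P \<Longrightarrow> \<exists>c. cball c \<rho> \<subseteq> t \<and> t \<subseteq> cball c K"
    using prototiles_uniform[OF P(1)] by blast
  have tile: "polytope t \<and> t \<noteq> {} \<and> l \<in> mspace L \<and> (\<exists>c. cball c \<rho> \<subseteq> t \<and> t \<subseteq> cball c K)"
    if T: "T \<in> \<Omega>" and tl: "(t, l) \<in> T" for T t l
  proof -
    have "\<forall>\<tau>\<in>T. \<exists>x. \<exists>\<pi>\<in>P. {\<tau>} = translate x {\<pi>}"
      using P(2)[OF T] unfolding tiling_def by (rule conjunct1)
    then obtain x \<pi> where x: "\<pi> \<in> P" "{(t, l)} = translate x {\<pi>}"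
      using tl by blast
    obtain t0 where t0: "(t0, l) \<in> P" "t = (\<lambda>p. p - x) ` t0"
      using x by (cases \<pi>) (auto simp: translate_def)
    then have p: "polytope t0" "interior t0 \<noteq> {}" "l \<in> mspace L" "t0 \<in> fst ` P"
      using P(1) unfolding prototiles_def by force+
    obtain c where c: "cball c \<rho> \<subseteq> t0" "t0 \<subseteq> cball c K" using K[OF p(4)] by blast
    have tt: "t = (+) (- x) ` t0" using t0(2) by simp
    have "cball (c - x) R = (+) (- x) ` cball c R" for R
      using cball_translation[of "- x" c R] by simp
    then have "cball (c - x) \<rho> \<subseteq> t \<and> t \<subseteq> cball (c - x) K"
      unfolding tt using c by (metis image_mono)
    moreover have "polytope t" unfolding tt using p(1) by (simp only: polytope_translation_eq)
    moreover have "t \<noteq> {}" using p(2) tt by auto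
    ultimately show ?thesis using p(3) by blast
  qed
  show ?thesis
  proof
    fix T x assume T: "T \<in> \<Omega>"
    show "translate x T \<in> \<Omega>" using assms(1) T unfolding tiling_space_def by blast
    show "polytope t \<and> t \<noteq> {} \<and> l \<in> mspace L" if "(t, l) \<in> T" for t l
      using tile[OF T that] by blast
    fix R
    have "\<forall>s\<in>T. \<exists>c. cball c \<rho> \<subseteq> fst s \<and> fst s \<subseteq> cball c K" using tile[OF T] by (metis prod.collapse)
    then obtain c where c: "\<And>s. s \<in> T \<Longrightarrow> cball (c s) \<rho> \<subseteq> fst s \<and> fst s \<subseteq> cball (c s) K" by metis
    have int: "c s \<in> interior (fst s')" if "s' \<in> T" "dist (c s) (c s') < \<rho>" for s s'
    proof -
      have "ball (c s') \<rho> \<subseteq> interior (fst s')"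
        using c[OF that(1)] ball_subset_cball[of "c s'" \<rho>] by (intro interior_maximal) auto
      then show ?thesis using that(2) by (auto simp: dist_commute)
    qed
    have sep: "s = s'" if "s \<in> T" "s' \<in> T" "dist (c s) (c s') < \<rho>" for s s'
    proof (rule ccontr)
      assume ne: "s \<noteq> s'"
      have i: "c s \<in> interior (fst s)" "c s \<in> interior (fst s')"
        using int[OF that(1), of s] int[OF that(2,3)] \<rho> by auto
      then have "c s \<in> fst s \<inter> fst s'" using interior_subset by blast
      moreover have "fst s \<inter> fst s' \<subseteq> frontier (fst s) \<inter> frontier (fst s')"
      proof -
        have "\<forall>(t, l)\<in>T. \<forall>(t', l')\<in>T. (t, l) \<noteq> (t', l') \<longrightarrow> t \<inter> t' \<subseteq> frontier t \<inter> frontier t'"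
          using P(2)[OF T] unfolding tiling_def by blast
        from bspec[OF bspec[OF this that(1), unfolded split_beta], OF that(2)]
        show ?thesis using ne by (simp add: split_beta prod_eq_iff)
      qed
      ultimately show False using i(1) by (auto simp: frontier_def)
    qed
    have "finite (c ` patch T x R)"
    proof (rule finite_separated[OF _ \<rho>])
      have "c s \<in> cball x (R + K)" if "s \<in> patch T x R" for s
      proof -
        obtain p where p: "p \<in> fst s" "dist x p < R" "s \<in> T"
          using \<open>s \<in> patch T x R\<close> unfolding patch_def by auto
        then have "dist (c s) p \<le> K" using c[OF p(3)] by auto
        then show ?thesis using p(2) dist_triangle[of x "c s" p] by (simp add: dist_commute)
      qed
      then have "c ` patch T x R \<subseteq> cball x (R + K)" by (rule image_subsetI)
      then show "bounded (c ` patch T x R)" by (rule bounded_subset[OF bounded_cball])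
      show "a = b" if ab: "a \<in> c ` patch T x R" "b \<in> c ` patch T x R" "dist a b < \<rho>" for a b
      proof -
        obtain s s' where "s \<in> patch T x R" "s' \<in> patch T x R" "a = c s" "b = c s'" using ab(1,2) by blast
        then show ?thesis using sep[of s s'] ab(3) patch_subset[of T x R] by blast
      qed
    qed
    moreover have "inj_on c (patch T x R)"
    proof (rule inj_onI)
      fix s s' assume "s \<in> patch T x R" "s' \<in> patch T x R" "c s = c s'"
      then show "s = s'" using sep[of s s'] \<rho> patch_subset[of T x R] by auto
    qed
    ultimately show "finite (patch T x R)" by (rule finite_imageD)
  next
    show "FLC \<Omega>" by (rule assms(2))
    show "compact_space (pattern_topology L \<Omega>)" using assms(1) unfolding tiling_space_def by blast
    have "\<exists>p\<in>vertices T. dist x p \<le> max 1 (2 * K)" if T: "T \<in> \<Omega>" for T x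
    proof -
      have "x \<in> (\<Union>(t, l)\<in>T. t)" using P(2)[OF T] unfolding tiling_def by blast
      then obtain t l where t: "(t, l) \<in> T" "x \<in> t" by blast
      obtain c where c: "polytope t" "t \<noteq> {}" "t \<subseteq> cball c K" using tile[OF T t(1)] by blast
      obtain v where v: "v extreme_point_of t"
        using Krein_Milman_Minkowski[OF polytope_imp_compact polytope_imp_convex, OF c(1) c(1)] c(2) by force
      then have "v \<in> t" by (simp add: extreme_point_of_def)
      have "dist x v \<le> 2 * K"
      proof -
        have "dist c x \<le> K" "dist c v \<le> K" using c(3) t(2) \<open>v \<in> t\<close> by auto
        then show ?thesis using dist_triangle[of x v c] by (simp add: dist_commute)
      qed
      then show ?thesis using v t(1) unfolding vertices_def by fastforce
    qed
    then show "\<exists>\<rho>>0. \<forall>T\<in>\<Omega>. \<forall>x. \<exists>p\<in>vertices T. dist x p \<le> \<rho>"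
      by (intro exI[of _ "max 1 (2 * K)"]) auto
  qed
qed

lemma labelled_delone_finite_patch:
  fixes T :: "('d::finite, 'l) pattern"
  assumes "labelled_delone L T"
  shows "finite (patch T x R)"
proof -
  obtain r where r: "r > 0" "\<And>p l q m. ({p}, l) \<in> T \<Longrightarrow> ({q}, m) \<in> T \<Longrightarrow> (p, l) \<noteq> (q, m) \<Longrightarrow> r \<le> dist p q"
    using assms unfolding labelled_delone_def by blast
  have pt: "\<exists>p l. s = ({p}, l) \<and> ({p}, l) \<in> T \<and> p \<in> ball x R" if "s \<in> patch T x R" for s
  proof -
    obtain t l where tl: "s = (t, l)" by fastforce
    then show ?thesis
      using assms \<open>s \<in> patch T x R\<close> unfolding labelled_delone_def patch_def by fastforce
  qed
  define c where "c s = the_elem (fst s)" for s :: "(real^'d) set \<times> 'l"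
  have "finite (c ` patch T x R)"
  proof (rule finite_separated[OF _ r(1)])
    have "c ` patch T x R \<subseteq> ball x R" using pt by (force simp: c_def)
    then show "bounded (c ` patch T x R)" using bounded_ball bounded_subset by blast
    show "a = b" if ab: "a \<in> c ` patch T x R" "b \<in> c ` patch T x R" "dist a b < r" for a b
    proof -
      obtain l m where "({a}, l) \<in> T" "({b}, m) \<in> T" using ab(1,2) pt by (force simp: c_def)
      then show ?thesis using r(2)[of a l b m] ab(3) by force
    qed
  qed
  moreover have "inj_on c (patch T x R)"
  proof (rule inj_onI)
    fix s s' assume s: "s \<in> patch T x R" "s' \<in> patch T x R" "c s = c s'"
    obtain p l q m where "s = ({p}, l)" "({p}, l) \<in> T" "s' = ({q}, m)" "({q}, m) \<in> T" using pt s(1,2) by blast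
    then show "s = s'" using r(2)[of p l q m] r(1) s(3) by (force simp: c_def)
  qed
  ultimately show ?thesis by (rule finite_imageD)
qed

text \<open>Each Delone set comes with a covering radius of its own. The patterns with a point at distance
  less than \<open>n\<close> from the origin form an open set; by compactness a single \<open>n\<close> serves all patterns and,
  by translation invariance, all places.\<close>

lemma delone_flc_space:
  fixes L :: "'l metric" and \<Omega> :: "('d::finite, 'l) pattern set"
  assumes "tiling_space L \<Omega>" "FLC \<Omega>" and delone: "\<And>T. T \<in> \<Omega> \<Longrightarrow> labelled_delone L T"
  shows "flc_space L \<Omega>"
proof
  have cpt: "compact_space (pattern_topology L \<Omega>)" and
    inv: "\<And>T x. T \<in> \<Omega> \<Longrightarrow> translate x T \<in> \<Omega>" using assms(1) unfolding tiling_space_def by blast+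
  show "FLC \<Omega>" "compact_space (pattern_topology L \<Omega>)" by fact+
  show "translate x T \<in> \<Omega>" if "T \<in> \<Omega>" for x T using inv that .
  show "polytope t \<and> t \<noteq> {} \<and> l \<in> mspace L" if "T \<in> \<Omega>" "(t, l) \<in> T" for T t l
    using delone[OF that(1)] that(2) polytope_sing unfolding labelled_delone_def by fastforce
  show "finite (patch T x R)" if "T \<in> \<Omega>" for T x R
    using labelled_delone_finite_patch[OF delone[OF that]] .
  define U where "U n = {T \<in> \<Omega>. \<exists>p l. ({p}, l) \<in> T \<and> norm p < real n}" for n :: nat
  have "openin (pattern_topology L \<Omega>) (U n)" for n
    unfolding openin_pattern_topology
  proof (intro conjI ballI)
    show "U n \<subseteq> \<Omega>" by (auto simp: U_def)
    fix T assume "T \<in> U n"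
    then obtain p l where p: "({p}, l) \<in> T" "norm p < n" "T \<in> \<Omega>" by (auto simp: U_def)
    then have n: "real n > 0" using norm_ge_zero[of p] by linarith
    define \<epsilon> where "\<epsilon> = min (1 / n) (n - norm p)"
    have \<epsilon>: "\<epsilon> > 0" "\<epsilon> \<le> n - norm p" "\<epsilon> \<le> 1 / n" using n p by (simp_all add: \<epsilon>_def)
    have "real n \<le> 1 / \<epsilon>" using \<epsilon>(1,3) n by (simp add: field_simps)
    have "T' \<in> U n" if T': "T' \<in> \<Omega>" "eps_close L \<epsilon> T T'" for T'
    proof -
      obtain S S' f where S: "patch T 0 (1 / \<epsilon>) \<subseteq> S" "S' \<subseteq> T'" "bij_betw f S S'"
        "\<And>s. s \<in> S \<Longrightarrow> hausdorff_dist (fst s) (fst (f s)) < \<epsilon>"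
        using T'(2) unfolding eps_close_def by blast
      have "({p}, l) \<in> patch T 0 (1 / \<epsilon>)" using p \<open>real n \<le> 1 / \<epsilon>\<close> by (auto simp: patch_def)
      then have pS: "({p}, l) \<in> S" using S(1) by blast
      then have "f ({p}, l) \<in> T'" using S(2,3) by (auto simp: bij_betw_def)
      then obtain q m where q: "f ({p}, l) = ({q}, m)" "({q}, m) \<in> T'"
        using delone[OF T'(1)] unfolding labelled_delone_def by (cases "f ({p}, l)") fastforce
      have "hausdorff_dist {p} {q} < \<epsilon>" using S(4)[OF pS] q(1) by simp
      then have "dist p q \<le> \<epsilon>" "hausdorff_dist {p} {q} \<noteq> \<epsilon>" using hausdorff_dist_le_iff[of "{p}" "{q}" \<epsilon>] by auto
      moreover have "dist p q \<le> hausdorff_dist {p} {q}"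
        using hausdorff_dist_le_iff[of "{p}" "{q}" "hausdorff_dist {p} {q}"] by auto
      ultimately have "dist p q < \<epsilon>" using \<open>hausdorff_dist {p} {q} < \<epsilon>\<close> by linarith
      then have "norm q < n" using norm_triangle_ineq[of p "q - p"] \<epsilon>(2) by (simp add: dist_norm norm_minus_commute)
      then show ?thesis using q(2) T'(1) by (auto simp: U_def)
    qed
    then show "\<exists>\<epsilon>>0. \<forall>T'\<in>\<Omega>. eps_close L \<epsilon> T T' \<longrightarrow> T' \<in> U n" using \<epsilon>(1) by blast
  qed
  moreover have "\<Omega> \<subseteq> (\<Union>n. U n)"
  proof
    fix T assume T: "T \<in> \<Omega>"
    then obtain R where "\<forall>x. \<exists>p l. ({p}, l) \<in> T \<and> dist x p \<le> R"
      using delone[OF T] unfolding labelled_delone_def by blast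
    then obtain p l where "({p}, l) \<in> T" by blast
    moreover obtain n :: nat where "norm p < n" using reals_Archimedean2 by blast
    ultimately show "T \<in> (\<Union>n. U n)" using T by (auto simp: U_def)
  qed
  moreover have "compactin (pattern_topology L \<Omega>) \<Omega>" using cpt by (simp add: compact_space_def)
  ultimately obtain F' where F': "finite F'" "F' \<subseteq> range U" "\<Omega> \<subseteq> \<Union>F'"
    unfolding compactin_def by (metis (no_types, lifting) rangeE)
  then obtain F where F: "finite F" "F' = U ` F" by (meson finite_subset_image)
  define N where "N = Max (insert 1 F)"
  have N: "N \<ge> 1" "\<And>n. n \<in> F \<Longrightarrow> n \<le> N" using F(1) by (auto simp: N_def)
  show "\<exists>\<rho>>0. \<forall>T\<in>\<Omega>. \<forall>x. \<exists>p\<in>vertices T. dist x p \<le> \<rho>"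
  proof (intro exI[of _ "real N"] conjI ballI allI)
    show "0 < real N" using N by simp
    fix T x assume T: "T \<in> \<Omega>"
    then obtain n where n: "n \<in> F" "translate x T \<in> U n" using F'(3) F(2) inv by blast
    then obtain p l where p: "({p}, l) \<in> translate x T" "norm p < n" by (auto simp: U_def)
    then have "({p + x}, l) \<in> T" by (simp add: mem_translate)
    then have "p + x \<in> vertices T" unfolding vertices_def by force
    moreover have "dist x (p + x) \<le> N" using p(2) N(2)[OF n(1)] by (simp add: dist_norm)
    ultimately show "\<exists>p\<in>vertices T. dist x p \<le> N" by blast
  qed
qed

lemma tiling_space_flc_space: "tiling_space L \<Omega> \<Longrightarrow> FLC \<Omega> \<Longrightarrow> flc_space L \<Omega>"
  using tiling_flc_space delone_flc_space unfolding tiling_space_def by metis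

section \<open>Transversals and flow boxes\<close>

lemma mspace_discrete_labels [simp]: "mspace (discrete_labels :: 'l metric) = UNIV"
  using Metric_space.mspace_metric[OF metric_M_dd[of "UNIV :: 'l set"]] by (simp add: discrete_labels_def)

lemma mdist_discrete_labels: "mdist discrete_labels a b = (if a = b then 0 else 1)"
  unfolding discrete_labels_def Metric_space.mdist_metric[OF metric_M_dd] by (simp only: discrete_metric.dd_def)

text \<open>With this derivation, the patterns with a vertex at \<open>v\<close> become a transversal: then the origin
  belongs to the derived Delone set.\<close>

definition vertex_pattern :: "real^'d::finite \<Rightarrow> ('d, 'l) pattern \<Rightarrow> ('d, unit) pattern" where
  "vertex_pattern v T = {({p - v}, ()) |p. p \<in> vertices T}"

lemma mem_vertex_pattern: "(t, u) \<in> vertex_pattern v T \<longleftrightarrow> (\<exists>q. t = {q} \<and> q + v \<in> vertices T)"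
proof
  assume "(t, u) \<in> vertex_pattern v T"
  then obtain p where "t = {p - v}" "p \<in> vertices T" by (auto simp: vertex_pattern_def)
  then show "\<exists>q. t = {q} \<and> q + v \<in> vertices T" by (intro exI[of _ "p - v"]) simp
next
  assume "\<exists>q. t = {q} \<and> q + v \<in> vertices T"
  then obtain q where "t = {q}" "q + v \<in> vertices T" by blast
  then show "(t, u) \<in> vertex_pattern v T" unfolding vertex_pattern_def
    by (auto intro!: exI[of _ "q + v"])
qed

lemma vertex_pattern_translate: "vertex_pattern v (translate x T) = translate x (vertex_pattern v T)"
proof -
  have "(t, u) \<in> vertex_pattern v (translate x T) \<longleftrightarrow> (t, u) \<in> translate x (vertex_pattern v T)" for t u
  proof -
    have "(\<lambda>p. p + x) ` t = {q} \<longleftrightarrow> t = {q - x}" for q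
      by (auto simp: set_eq_iff image_iff) (metis add_diff_cancel eq_diff_eq)+
    then show ?thesis
      by (auto simp: mem_translate mem_vertex_pattern vertices_translate algebra_simps)
  qed
  then show ?thesis by (simp add: set_eq_iff split_paired_all)
qed

lemma patch_vertex_pattern:
  "patch (vertex_pattern v T) x r = {({q}, ()) |q. q + v \<in> vertices T \<and> q \<in> ball x r}"
  unfolding patch_def by (auto simp: mem_vertex_pattern)

lemma agree_vertex_pattern:
  assumes "agree r z T T'" "norm v + s \<le> r"
  shows "agree s z (vertex_pattern v T) (vertex_pattern v T')"
proof -
  have "q + v \<in> vertices (translate z T) \<longleftrightarrow> q + v \<in> vertices T'" if "norm q < s" for q
  proof -
    have "norm (q + v) < r" using norm_triangle_ineq[of q v] that assms(2) by linarith
    then show ?thesis using agree_vertices[OF assms(1)] by (simp add: vertices_translate)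
  qed
  then show ?thesis
    unfolding agree_def vertex_pattern_translate[symmetric] patch_vertex_pattern by auto
qed

context flc_space
begin

lemma labelled_delone_vertex_pattern:
  assumes "T \<in> \<Omega>"
  shows "labelled_delone discrete_labels (vertex_pattern v T)"
  unfolding labelled_delone_def
proof (intro conjI)
  show "\<forall>(t, l)\<in>vertex_pattern v T. (\<exists>p. t = {p}) \<and> l \<in> mspace discrete_labels"
    by (auto simp: mem_vertex_pattern)
  have "gap \<le> dist p q" if "p + v \<in> vertices T" "q + v \<in> vertices T" "p \<noteq> q" for p q
    using gap(2)[OF assms that(1,2)] that(3) by force
  then show "\<exists>r>0. \<forall>p l q m. ({p}, l) \<in> vertex_pattern v T \<longrightarrow> ({q}, m) \<in> vertex_pattern v T \<longrightarrow>
      (p, l) \<noteq> (q, m) \<longrightarrow> r \<le> dist p q"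
    using gap(1) by (intro exI[of _ gap]) (auto simp: mem_vertex_pattern)
  have "\<exists>p. p + v \<in> vertices T \<and> dist x p \<le> radius" for x
  proof -
    obtain q where "q \<in> vertices T" "dist (x + v) q \<le> radius" using radius(2)[OF assms] by blast
    then show ?thesis by (intro exI[of _ "q - v"]) (simp add: dist_norm algebra_simps)
  qed
  then show "\<exists>R>0. \<forall>x. \<exists>p l. ({p}, l) \<in> vertex_pattern v T \<and> dist x p \<le> R"
    using radius(1) by (intro exI[of _ radius]) (auto simp: mem_vertex_pattern)
qed

definition transversal :: "real^'d \<Rightarrow> ('d, 'l) pattern set" where
  "transversal v = {T \<in> \<Omega>. v \<in> vertices T}"

text \<open>Up to translation, the patches of the vertex pattern are subsets of the vertex sets of finitely
  many patches.\<close>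

lemma flc_transversal_transversal: "flc_transversal L \<Omega> (transversal v)"
proof -
  define D where "D = vertex_pattern v ` \<Omega>"
  have del: "labelled_delone discrete_labels S" if "S \<in> D" for S
    using that labelled_delone_vertex_pattern by (auto simp: D_def)
  have cont: "continuous_map X (pattern_topology discrete_labels D) (vertex_pattern v)"
  proof (rule continuous_patternI)
    show "compact t \<and> t \<noteq> {} \<and> l \<in> mspace discrete_labels" if "S \<in> D" "(t, l) \<in> S" for S t l
      using that by (auto simp: D_def mem_vertex_pattern)
    show "vertex_pattern v T \<in> D" if "T \<in> \<Omega>" for T using that by (simp add: D_def)
    show "\<exists>r>0. \<exists>\<delta>>0. \<forall>T'\<in>\<Omega>. \<forall>z. norm z < \<delta> \<longrightarrow> agree r z T T' \<longrightarrow>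
        (\<exists>w. norm w < e \<and> agree s w (vertex_pattern v T) (vertex_pattern v T'))" if "s > 0" "e > 0" for T s e
      using that agree_vertex_pattern[of "norm v + s" _ T _ v s]
      by (intro exI[of _ "norm v + s"] conjI exI[of _ e]) (auto intro: add_nonneg_pos)
  qed
  have "compactin (pattern_topology discrete_labels D) (vertex_pattern v ` \<Omega>)"
    using image_compactin[OF _ cont] compact by (simp add: compact_space_def)
  then have cpt: "compact_space (pattern_topology discrete_labels D)"
    by (simp add: compact_space_def D_def)
  have "compact_space (mtopology_of (discrete_labels :: unit metric))"
    by (simp add: compact_space_def finite_imp_compactin)
  moreover have "translate x S \<in> D" if "S \<in> D" for S x
    using that by (auto simp: D_def vertex_pattern_translate[symmetric])
  ultimately have ts: "tiling_space discrete_labels D"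
    unfolding tiling_space_def using del cpt by blast
  have "\<exists>F. finite F \<and> (\<forall>S\<in>D. \<forall>x. \<exists>P\<in>F. \<exists>y. patch S x R = translate y P)" if "R > 0" for R
  proof -
    obtain F where F: "finite F" "\<And>P. P \<in> F \<Longrightarrow> \<exists>T\<in>\<Omega>. \<exists>x. P = patch T x R"
      "\<And>T x. T \<in> \<Omega> \<Longrightarrow> \<exists>P\<in>F. \<exists>y. patch T x R = translate y P"
      using finite_patch_types[OF \<open>R > 0\<close>] by metis
    define pts :: "(real^'d) set \<Rightarrow> ('d, unit) pattern" where "pts B = (\<lambda>b. ({b}, ())) ` B" for B
    have "finite (pts ` Pow (\<Union>P\<in>F. vertices P))"
      using F(1,2) finite_vertices_patch by fastforce
    moreover have "\<exists>P\<in>pts ` Pow (\<Union>P\<in>F. vertices P). \<exists>y. patch (vertex_pattern v T) x R = translate y P"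
      if T: "T \<in> \<Omega>" for T x
    proof -
      obtain P y where P: "P \<in> F" "patch T (x + v) R = translate y P" using F(3)[OF T] by blast
      define B where "B = {b \<in> vertices P. b - (v + y) \<in> ball x R}"
      have "q + v \<in> vertices T \<longleftrightarrow> q + (v + y) \<in> vertices P" if "q \<in> ball x R" for q
      proof -
        have "q + v \<in> ball (x + v) R" using that by (simp add: dist_norm)
        then show ?thesis
          using vertices_patch[of "q + v" "x + v" R T] by (simp add: P(2) vertices_translate add.assoc)
      qed
      then have "patch (vertex_pattern v T) x R = {({q}, ()) |q. q + (v + y) \<in> vertices P \<and> q \<in> ball x R}"
        unfolding patch_vertex_pattern by blast
      also have "\<dots> = translate (v + y) (pts B)"
      proof -
        have "{({q}, ()) |q. q + w \<in> vertices P \<and> q \<in> ball x R} =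
            (\<lambda>b. ({b - w}, ())) ` {b \<in> vertices P. b - w \<in> ball x R}" for w
        proof (intro set_eqI iffI)
          fix s assume "s \<in> {({q}, ()) |q. q + w \<in> vertices P \<and> q \<in> ball x R}"
          then obtain q where q: "s = ({q}, ())" "q + w \<in> vertices P" "q \<in> ball x R" by blast
          then show "s \<in> (\<lambda>b. ({b - w}, ())) ` {b \<in> vertices P. b - w \<in> ball x R}"
            by (intro image_eqI[of _ _ "q + w"]) auto
        qed auto
        then show ?thesis by (simp add: translate_def pts_def image_image B_def)
      qed
      finally show ?thesis using P(1) by (auto simp: B_def)
    qed
    ultimately show ?thesis unfolding D_def by blast
  qed
  then have flc: "FLC D" unfolding FLC_def by blast
  have ld: "local_derivation L \<Omega> discrete_labels D (vertex_pattern v)"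
    unfolding local_derivation_def
  proof (intro conjI cont ballI allI impI)
    show "vertex_pattern v ` \<Omega> = D" by (simp add: D_def)
    show "vertex_pattern v (translate x T) = translate x (vertex_pattern v T)" for x T
      by (rule vertex_pattern_translate)
    fix r :: real assume "r > 0"
    show "\<exists>R>0. \<forall>T\<in>\<Omega>. \<forall>T'\<in>\<Omega>. patch T 0 R = patch T' 0 R \<longrightarrow>
        patch (vertex_pattern v T) 0 r = patch (vertex_pattern v T') 0 r"
      using \<open>r > 0\<close> agree_vertex_pattern[of "norm v + r" 0 _ _ v r]
      by (intro exI[of _ "norm v + r"]) (auto simp: agree_def intro: add_nonneg_pos)
  qed
  have "transversal v = {T \<in> \<Omega>. ({0}, ()) \<in> vertex_pattern v T}"
    by (auto simp: transversal_def mem_vertex_pattern)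
  then show ?thesis
    unfolding flc_transversal_def using ts del flc ld by blast
qed

lemma flc_transversal_subset: "flc_transversal L \<Omega> \<Xi> \<Longrightarrow> \<Xi> \<subseteq> \<Omega>"
  unfolding flc_transversal_def by blast

text \<open>A small translation \<open>z\<close> between elements of a transversal would put both 0 and \<open>z\<close> into
  the Delone set derived from one of them.\<close>

lemma flc_transversal_rigid:
  assumes "flc_transversal L \<Omega> \<Xi>" "S \<in> \<Xi>"
  shows "\<exists>r>0. \<exists>\<delta>>0. \<forall>S'\<in>\<Xi>. \<forall>z. norm z < \<delta> \<longrightarrow> agree r z S S' \<longrightarrow> z = 0"
proof -
  obtain D and \<Omega>\<^sub>0 :: "('d, unit) pattern set" where del: "\<forall>T\<in>\<Omega>\<^sub>0. labelled_delone discrete_labels T"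
    and D: "local_derivation L \<Omega> discrete_labels \<Omega>\<^sub>0 D" and \<Xi>: "\<Xi> = {T \<in> \<Omega>. ({0}, ()) \<in> D T}"
    using assms(1) unfolding flc_transversal_def by blast
  have S: "S \<in> \<Omega>" "({0}, ()) \<in> D S" using assms(2) \<Xi> by auto
  have eq: "D (translate x T) = translate x (D T)" if "T \<in> \<Omega>" for x T
    using D that unfolding local_derivation_def by blast
  have "D S \<in> \<Omega>\<^sub>0" using D S(1) unfolding local_derivation_def by blast
  then have "labelled_delone discrete_labels (D S)" using del by blast
  then obtain \<delta> where \<delta>: "\<delta> > 0" "\<And>p l q m. ({p}, l) \<in> D S \<Longrightarrow> ({q}, m) \<in> D S \<Longrightarrow> (p, l) \<noteq> (q, m) \<Longrightarrow> \<delta> \<le> dist p q"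
    unfolding labelled_delone_def by blast
  obtain R where R: "R > 0" "\<And>T T'. T \<in> \<Omega> \<Longrightarrow> T' \<in> \<Omega> \<Longrightarrow> patch T 0 R = patch T' 0 R \<Longrightarrow> patch (D T) 0 1 = patch (D T') 0 1"
    using D unfolding local_derivation_def by (meson zero_less_one)
  have "z = 0" if S': "S' \<in> \<Xi>" and z: "norm z < \<delta>" "agree R z S S'" for S' z
  proof (rule ccontr)
    assume "z \<noteq> 0"
    have "patch (D (translate z S)) 0 1 = patch (D S') 0 1"
      using R(2)[of "translate z S" S'] z(2) S S' \<Xi> by (simp add: agree_def)
    moreover have "({0}, ()) \<in> patch (D S') 0 1" using S' \<Xi> by (simp add: patch_def)
    ultimately have "({0}, ()) \<in> translate z (D S)" using eq[OF S(1)] patch_subset by blast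
    then have "({z}, ()) \<in> D S" by (simp add: mem_translate)
    then have "\<delta> \<le> dist z 0" using \<delta>(2)[of z "()" 0 "()"] S(2) \<open>z \<noteq> 0\<close> by simp
    then show False using z(1) by simp
  qed
  then show ?thesis using R(1) \<delta>(1) by blast
qed

text \<open>A pattern close to \<open>S - x\<close>, moved back by \<open>x\<close> and a small correction, has the same large patch
  as \<open>S\<close>, in particular the vertex \<open>v\<close>.\<close>

lemma open_box_image:
  fixes W :: "(('d, 'l) pattern \<times> (real^'d)) set"
  assumes "openin (prod_topology (subtopology X (transversal v)) (top_of_set (ball 0 \<epsilon>))) W"
  shows "openin X ((\<lambda>(S, x). translate x S) ` W)"
  unfolding openin_iff_agree
proof (intro conjI ballI)
  have W: "W \<subseteq> transversal v \<times> ball 0 \<epsilon>" using openin_subset[OF assms] by auto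
  then show "(\<lambda>(S, x). translate x S) ` W \<subseteq> \<Omega>" unfolding transversal_def by auto
  fix T assume "T \<in> (\<lambda>(S, x). translate x S) ` W"
  then obtain S x where S: "(S, x) \<in> W" "T = translate x S" by auto
  obtain A0 B0 where AB0: "openin (subtopology X (transversal v)) A0" "openin (top_of_set (ball 0 \<epsilon>)) B0"
    "S \<in> A0" "x \<in> B0" "A0 \<times> B0 \<subseteq> W"
    using assms[unfolded openin_prod_topology_alt, rule_format, OF S(1)] by (elim exE conjE)
  obtain A where A: "openin X A" "A0 = A \<inter> transversal v" using AB0(1) by (auto simp: openin_subtopology)
  have "open B0" using AB0(2) openin_open_eq[of "ball 0 \<epsilon>" B0] by simp
  then obtain e where e: "e > 0" "ball x e \<subseteq> B0" using AB0(4) open_contains_ball by blast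
  obtain r \<delta> where r: "r > 0" "\<delta> > 0" "\<And>S' z. S' \<in> \<Omega> \<Longrightarrow> norm z < \<delta> \<Longrightarrow> agree r z S S' \<Longrightarrow> S' \<in> A"
    using A(1) AB0(3) unfolding openin_iff_agree A(2) by blast
  have S\<Omega>: "S \<in> \<Omega>" "v \<in> vertices S" using AB0(3) A(2) by (auto simp: transversal_def)
  define s where "s = max r (norm v + 1)"
  have "T' \<in> (\<lambda>(S, x). translate x S) ` W"
    if T': "T' \<in> \<Omega>" and z: "norm z < e" "agree (s + norm x + e) z T T'" for T' z
  proof -
    define S' where "S' = translate (- (x + z)) T'"
    have "norm (- (x + z)) + s \<le> s + norm x + e" using norm_triangle_ineq[of x z] z(1) unfolding norm_minus_cancel by linarith
    from agree_shift[OF z(2) this] have "agree s (- x) T S'" by (simp add: S'_def algebra_simps)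
    then have ag: "agree s 0 S S'" by (simp add: S(2) agree_def)
    have S': "S' \<in> \<Omega>" using T' by (simp add: S'_def)
    have "S' \<in> A" using r(3)[OF S', of 0] agree_mono[OF ag, of r] r(2) by (simp add: s_def)
    moreover have "v \<in> vertices S'" using agree_vertices[OF ag, of v] S\<Omega>(2) by (simp add: s_def)
    ultimately have "S' \<in> A0" using S' by (simp add: A(2) transversal_def)
    moreover have "x + z \<in> B0" using e(2) z(1) by (auto simp: dist_norm)
    ultimately have "(S', x + z) \<in> W" using AB0(5) by blast
    moreover have "T' = translate (x + z) S'" unfolding S'_def by (simp only: translate_minus)
    ultimately show ?thesis by force
  qed
  moreover have "s + norm x + e > 0"
    using r(1) e(1) norm_ge_zero[of x] max.cobounded1[of r "norm v + 1"] unfolding s_def by linarith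
  ultimately show "\<exists>r>0. \<exists>\<delta>>0. \<forall>T'\<in>\<Omega>. \<forall>z. norm z < \<delta> \<longrightarrow> agree r z T T' \<longrightarrow> T' \<in> (\<lambda>(S, x). translate x S) ` W"
    using e(1) by blast
qed

definition box_at :: "real^'d \<Rightarrow> ('d, 'l) pattern set" where
  "box_at v = (\<lambda>(S, x). translate x S) ` (transversal v \<times> ball 0 (gap / 2))"

text \<open>The two coordinates are determined by the pattern: otherwise it would have two vertices at
  distance less than \<open>gap\<close>.\<close>

lemma flow_box_at: "flow_box L \<Omega> (transversal v) (gap / 2) (box_at v)"
proof -
  let ?P = "prod_topology (subtopology X (transversal v)) (top_of_set (ball (0::real^'d) (gap / 2)))"
  have tv: "transversal v \<subseteq> \<Omega>" by (auto simp: transversal_def)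
  have top: "topspace ?P = transversal v \<times> ball 0 (gap / 2)" using tv by auto
  have U: "openin X (box_at v)"
    using open_box_image[of v "gap / 2" "topspace ?P"] openin_topspace[of ?P] unfolding top box_at_def by simp
  have "homeomorphic_map ?P (subtopology X (box_at v)) (\<lambda>(S, x). translate x S)"
  proof (rule bijective_open_imp_homeomorphic_map)
    have "continuous_map ?P X (\<lambda>(S, x). translate x S)"
      unfolding subtopology_Times[symmetric] by (rule continuous_map_from_subtopology[OF continuous_translate_prod])
    then show "continuous_map ?P (subtopology X (box_at v)) (\<lambda>(S, x). translate x S)"
      using top by (intro continuous_map_into_subtopology) (auto simp: box_at_def)
    show "open_map ?P (subtopology X (box_at v)) (\<lambda>(S, x). translate x S)"
      unfolding open_map_def
    proof (intro allI impI)
      fix W assume W: "openin ?P W"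
      then have "W \<subseteq> transversal v \<times> ball 0 (gap / 2)" using openin_subset top by blast
      then have "(\<lambda>(S, x). translate x S) ` W \<subseteq> box_at v" unfolding box_at_def by (rule image_mono)
      then show "openin (subtopology X (box_at v)) ((\<lambda>(S, x). translate x S) ` W)"
        using openin_open_subtopology[OF U] open_box_image[OF W] by blast
    qed
    show "(\<lambda>(S, x). translate x S) ` topspace ?P = topspace (subtopology X (box_at v))"
      unfolding top using openin_subset[OF U] by (auto simp: box_at_def)
    show "inj_on (\<lambda>(S, x). translate x S) (topspace ?P)"
      unfolding top
    proof (rule inj_onI, clarsimp)
      fix S x S' x' assume S: "S \<in> transversal v" "S' \<in> transversal v"
        and x: "norm x * 2 < gap" "norm x' * 2 < gap" and eq: "translate x S = translate x' S'"
      have "v - x \<in> vertices (translate x S)" using S by (simp add: vertices_translate transversal_def)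
      then have "v - x + x' \<in> vertices S'" unfolding eq by (simp add: vertices_translate)
      moreover have "v \<in> vertices S'" "S' \<in> \<Omega>" using S by (auto simp: transversal_def)
      moreover have "dist (v - x + x') v < gap" using norm_triangle_ineq4[of x' x] x by (simp add: dist_norm)
      ultimately have "x = x'" using gap(2) by fastforce
      then show "S = S' \<and> x = x'" using eq by (metis translate_minus(1))
    qed
  qed
  then show ?thesis
    unfolding flow_box_def using flc_transversal_transversal U gap(1) by simp
qed

lemma box_at_cover: "(\<Union>v. box_at v) = \<Omega>"
proof
  show "(\<Union>v. box_at v) \<subseteq> \<Omega>" by (auto simp: box_at_def transversal_def)
  show "\<Omega> \<subseteq> (\<Union>v. box_at v)"
  proof
    fix T assume T: "T \<in> \<Omega>"
    then obtain v where "v \<in> vertices T" using radius(2) by blast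
    then have "(T, 0) \<in> transversal v \<times> ball 0 (gap / 2)" using T gap(1) by (simp add: transversal_def)
    then have "(\<lambda>(S, x). translate x S) (T, 0) \<in> box_at v" unfolding box_at_def by (rule imageI)
    then show "T \<in> (\<Union>v. box_at v)" by auto
  qed
qed

end

section \<open>Pattern-equivariant cocycles and their Cech classes\<close>

context flc_space
begin

text \<open>A strong cocycle whose values for bounded \<open>x\<close> are determined by patches of bounded radius. This
  form of locality can be used without reference to transversals.\<close>

definition PE_cocycle :: "(('d, 'l) pattern \<Rightarrow> real^'d \<Rightarrow> real^'d) \<Rightarrow> bool" where
  "PE_cocycle \<beta> \<longleftrightarrow>
     (\<forall>T\<in>\<Omega>. \<forall>x y. \<beta> T x + \<beta> (translate x T) y = \<beta> T (x + y)) \<and>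
     (\<forall>T\<in>\<Omega>. continuous_on UNIV (\<beta> T)) \<and>
     (\<exists>R. \<forall>T\<in>\<Omega>. \<forall>T'\<in>\<Omega>. \<forall>x. patch T 0 (R + norm x) = patch T' 0 (R + norm x) \<longrightarrow> \<beta> T x = \<beta> T' x)"

lemma PE_cocycle_add: "PE_cocycle \<beta> \<Longrightarrow> T \<in> \<Omega> \<Longrightarrow> \<beta> T x + \<beta> (translate x T) y = \<beta> T (x + y)"
  unfolding PE_cocycle_def by blast

lemma PE_cocycle_0: "PE_cocycle \<beta> \<Longrightarrow> T \<in> \<Omega> \<Longrightarrow> \<beta> T 0 = 0"
  using PE_cocycle_add[of \<beta> T 0 0] by simp

lemma PE_cocycle_continuous: "PE_cocycle \<beta> \<Longrightarrow> T \<in> \<Omega> \<Longrightarrow> continuous_on UNIV (\<beta> T)"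
  unfolding PE_cocycle_def by blast

lemma PE_cocycle_agree:
  assumes "PE_cocycle \<beta>"
  obtains R where "R > 0"
    "\<And>T T' s z x. T \<in> \<Omega> \<Longrightarrow> T' \<in> \<Omega> \<Longrightarrow> agree s z T T' \<Longrightarrow> R + norm x \<le> s \<Longrightarrow> \<beta> T' x = \<beta> T (z + x) - \<beta> T z"
proof -
  obtain R where R: "\<And>T T' x. T \<in> \<Omega> \<Longrightarrow> T' \<in> \<Omega> \<Longrightarrow> patch T 0 (R + norm x) = patch T' 0 (R + norm x) \<Longrightarrow> \<beta> T x = \<beta> T' x"
    using assms unfolding PE_cocycle_def by blast
  show ?thesis
  proof (rule that[of "max R 1"])
    fix T T' :: "('d, 'l) pattern" and s and z x :: "real^'d"
    assume T: "T \<in> \<Omega>" "T' \<in> \<Omega>" "agree s z T T'" "max R 1 + norm x \<le> s"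
    have "agree (R + norm x) z T T'" by (rule agree_mono[OF T(3)]) (use T(4) in simp)
    then have "\<beta> (translate z T) x = \<beta> T' x" using R[of "translate z T" T' x] T by (simp add: agree_def)
    then show "\<beta> T' x = \<beta> T (z + x) - \<beta> T z" using PE_cocycle_add[OF assms T(1), of z x] by (simp add: algebra_simps)
  qed simp
qed

text \<open>Nearby elements of a transversal agree without any translation, so the cocycle takes the same
  value on them.\<close>

lemma PE_cocycle_strong_cocycle:
  assumes "PE_cocycle \<beta>"
  shows "strong_cocycle L \<Omega> \<beta>"
  unfolding strong_cocycle_def
proof (intro conjI ballI allI)
  obtain R where R: "R > 0"
    "\<And>T T' s z x. T \<in> \<Omega> \<Longrightarrow> T' \<in> \<Omega> \<Longrightarrow> agree s z T T' \<Longrightarrow> R + norm x \<le> s \<Longrightarrow> \<beta> T' x = \<beta> T (z + x) - \<beta> T z"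
    using PE_cocycle_agree[OF assms] by metis
  show "continuous_map (prod_topology X euclidean) euclidean (\<lambda>(T, x). \<beta> T x)"
  proof (rule continuous_prodI)
    fix T x V assume T: "T \<in> \<Omega>" and V: "openin euclidean V" "(case (T, x) of (T, x) \<Rightarrow> \<beta> T x) \<in> V"
    obtain e where e: "e > 0" "ball (\<beta> T x) e \<subseteq> V" using V openE[of V "\<beta> T x"] by auto
    note c = PE_cocycle_continuous[OF assms T]
    obtain d1 where d1: "d1 > 0" "\<And>y. dist y x < d1 \<Longrightarrow> dist (\<beta> T y) (\<beta> T x) < e / 2"
      using c e(1) unfolding continuous_on_iff by (metis UNIV_I half_gt_zero)
    obtain d2 where d2: "d2 > 0" "\<And>y. dist y 0 < d2 \<Longrightarrow> dist (\<beta> T y) (\<beta> T 0) < e / 2"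
      using c e(1) unfolding continuous_on_iff by (metis UNIV_I half_gt_zero)
    define \<delta> where "\<delta> = min (d1 / 2) d2"
    have \<delta>: "\<delta> > 0" "\<delta> \<le> d1 / 2" "\<delta> \<le> d2" using d1(1) d2(1) by (simp_all add: \<delta>_def)
    have "\<beta> T' x' \<in> V" if T': "T' \<in> \<Omega>" "norm z < \<delta>" "agree (R + norm x + d1) z T T'" "dist x' x < \<delta>" for T' z x'
    proof -
      have "norm x' \<le> norm x + dist x' x" using norm_triangle_ineq[of x "x' - x"] by (simp add: dist_norm)
      then have eq: "\<beta> T' x' = \<beta> T (z + x') - \<beta> T z"
        by (intro R(2)[OF T T'(1,3)]) (use T' \<delta> d1 in linarith)
      have "dist (z + x') x < d1"
        using norm_triangle_ineq[of z "x' - x"] T'(2,4) \<delta>(2) by (simp add: dist_norm algebra_simps)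
      then have "dist (\<beta> T (z + x')) (\<beta> T x) < e / 2" by (rule d1(2))
      moreover have "dist (\<beta> T z) (\<beta> T 0) < e / 2" using d2(2)[of z] T'(2) \<delta>(3) by simp
      ultimately have "norm (\<beta> T (z + x') - \<beta> T x) < e / 2" "norm (\<beta> T z) < e / 2"
        using PE_cocycle_0[OF assms T] by (simp_all add: dist_norm)
      then have "dist (\<beta> T x) (\<beta> T' x') < e"
        using norm_triangle_ineq4[of "\<beta> T (z + x') - \<beta> T x" "\<beta> T z"]
        by (simp add: eq dist_norm norm_minus_commute algebra_simps)
      then show ?thesis using e(2) by auto
    qed
    moreover have "R + norm x + d1 > 0" using R(1) d1(1) norm_ge_zero[of x] by linarith
    ultimately show "\<exists>r>0. \<exists>\<delta>>0. \<forall>T'\<in>\<Omega>. \<forall>z x'. norm z < \<delta> \<longrightarrow> agree r z T T' \<longrightarrow> dist x' x < \<delta> \<longrightarrow>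
        (case (T', x') of (T, x) \<Rightarrow> \<beta> T x) \<in> V"
      using \<delta>(1) by (intro exI[of _ "R + norm x + d1"] conjI exI[of _ \<delta>]) auto
  qed simp
  show "\<beta> T x + \<beta> (translate x T) y = \<beta> T (x + y)" if "T \<in> \<Omega>" for T x y
    using PE_cocycle_add[OF assms that] .
  show "transversally_locally_constant L \<Omega> (\<lambda>T. \<beta> T v)" for v
    unfolding transversally_locally_constant_def
  proof (intro allI impI locally_constant_onI)
    fix \<Xi> S assume \<Xi>: "flc_transversal L \<Omega> \<Xi>" "S \<in> \<Xi>"
    then have sub: "\<Xi> \<subseteq> \<Omega>" by (simp add: flc_transversal_subset)
    obtain r \<delta> where r: "r > 0" "\<delta> > 0" "\<And>S' z. S' \<in> \<Xi> \<Longrightarrow> norm z < \<delta> \<Longrightarrow> agree r z S S' \<Longrightarrow> z = 0"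
      using flc_transversal_rigid[OF \<Xi>] by blast
    have "\<beta> S' v = \<beta> S v" if S': "S' \<in> \<Xi>" "norm z < \<delta>" "agree (max r (R + norm v)) z S S'" for S' z
    proof -
      have "z = 0" using r(3)[OF S'(1,2)] agree_mono[OF S'(3), of r] by simp
      have "\<beta> S' v = \<beta> S (z + v) - \<beta> S z"
        by (rule R(2)[OF _ _ S'(3)]) (use S'(1) \<Xi>(2) sub in auto)
      then show ?thesis using \<open>z = 0\<close> PE_cocycle_0[OF assms] \<Xi>(2) sub by auto
    qed
    then show "\<exists>r>0. \<exists>\<delta>>0. \<forall>S'\<in>\<Xi>. \<forall>z. norm z < \<delta> \<longrightarrow> agree r z S S' \<longrightarrow> \<beta> S' v = \<beta> S v"
      using r(1,2) by (intro exI[of _ "max r (R + norm v)"] conjI exI[of _ \<delta>]) auto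
  qed (use flc_transversal_subset in blast)
qed

text \<open>A local primitive: locally it changes along leaves as \<open>\<beta>\<close> does and is constant across them.\<close>

definition primitive ::
  "(('d, 'l) pattern \<Rightarrow> real^'d \<Rightarrow> real^'d) \<Rightarrow> ('d, 'l) pattern set \<Rightarrow> (('d, 'l) pattern \<Rightarrow> real^'d) \<Rightarrow> bool"
where
  "primitive \<beta> U c \<longleftrightarrow> (\<forall>T\<in>U. \<exists>r>0. \<exists>\<delta>>0. \<forall>T'\<in>\<Omega>. \<forall>z. norm z < \<delta> \<longrightarrow> agree r z T T' \<longrightarrow>
     T' \<in> U \<and> c T' = c T + \<beta> T z)"

lemma primitive_diff_locally_constant:
  assumes c: "primitive \<beta> U c" and e: "primitive \<beta> V e" and "W \<subseteq> U \<inter> V" "W \<subseteq> \<Omega>"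
  shows "locally_constant_on X W (\<lambda>T. c T - e T)"
proof (rule locally_constant_onI)
  fix T assume "T \<in> W"
  then have T: "T \<in> U" "T \<in> V" using assms(3) by auto
  obtain r1 \<delta>1 where 1: "r1 > 0" "\<delta>1 > 0"
    "\<forall>T'\<in>\<Omega>. \<forall>z. norm z < \<delta>1 \<longrightarrow> agree r1 z T T' \<longrightarrow> T' \<in> U \<and> c T' = c T + \<beta> T z"
    using c T(1) unfolding primitive_def by blast
  obtain r2 \<delta>2 where 2: "r2 > 0" "\<delta>2 > 0"
    "\<forall>T'\<in>\<Omega>. \<forall>z. norm z < \<delta>2 \<longrightarrow> agree r2 z T T' \<longrightarrow> T' \<in> V \<and> e T' = e T + \<beta> T z"
    using e T(2) unfolding primitive_def by blast
  have "c T' - e T' = c T - e T" if T': "T' \<in> W" "norm z < min \<delta>1 \<delta>2" "agree (max r1 r2) z T T'" for T' z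
  proof -
    have "T' \<in> \<Omega>" using T'(1) assms(4) by blast
    moreover have "agree r1 z T T'" "agree r2 z T T'" using agree_mono[OF T'(3)] by simp_all
    ultimately have "c T' = c T + \<beta> T z" "e T' = e T + \<beta> T z" using 1(3) 2(3) T'(2) by auto
    then show ?thesis by simp
  qed
  then show "\<exists>r>0. \<exists>\<delta>>0. \<forall>T'\<in>W. \<forall>z. norm z < \<delta> \<longrightarrow> agree r z T T' \<longrightarrow> c T' - e T' = c T - e T"
    using 1(1,2) 2(2) by (intro exI[of _ "max r1 r2"] conjI exI[of _ "min \<delta>1 \<delta>2"]) auto
qed (use assms in auto)

text \<open>These represent the class of \<open>\<beta>\<close> as flow box cocycles do, but on arbitrary open covers and for
  arbitrary primitives.\<close>

definition primitive_cocycle where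
  "primitive_cocycle \<beta> \<U> g \<longleftrightarrow> open_cover X \<U> \<and>
     (\<exists>c. (\<forall>U\<in>\<U>. primitive \<beta> U (c U)) \<and> (\<forall>U\<in>\<U>. \<forall>V\<in>\<U>. \<forall>T\<in>U \<inter> V. g U V T = c U T - c V T))"

lemma locally_constant_on_cong:
  assumes "locally_constant_on Y A f" "\<And>x. x \<in> A \<Longrightarrow> f x = g x"
  shows "locally_constant_on Y A g"
  unfolding locally_constant_on_def
proof
  fix x assume "x \<in> A"
  then obtain U where U: "openin (subtopology Y A) U" "x \<in> U" "\<forall>y\<in>U. f y = f x"
    using assms(1) unfolding locally_constant_on_def by blast
  then have "U \<subseteq> A" by (simp add: openin_imp_subset)
  then have "\<forall>y\<in>U. g y = g x" using U assms(2) \<open>x \<in> A\<close> by (metis subsetD)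
  then show "\<exists>U. openin (subtopology Y A) U \<and> x \<in> U \<and> (\<forall>y\<in>U. g y = g x)" using U by blast
qed

lemma primitive_cocycle_cech_cocycle:
  assumes "primitive_cocycle \<beta> \<U> g"
  shows "cech_cocycle X (\<U>, g)"
proof -
  obtain c where cov: "open_cover X \<U>" and c: "\<And>U. U \<in> \<U> \<Longrightarrow> primitive \<beta> U (c U)"
    and g: "\<And>U V T. U \<in> \<U> \<Longrightarrow> V \<in> \<U> \<Longrightarrow> T \<in> U \<inter> V \<Longrightarrow> g U V T = c U T - c V T"
    using assms unfolding primitive_cocycle_def by blast
  have sub: "U \<subseteq> \<Omega>" if "U \<in> \<U>" for U using cov that openin_subset unfolding open_cover_def by fastforce
  have "locally_constant_on X (U \<inter> V) (g U V)" if UV: "U \<in> \<U>" "V \<in> \<U>" for U V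
    by (rule locally_constant_on_cong[OF primitive_diff_locally_constant[OF c[OF UV(1)] c[OF UV(2)]]])
      (use g UV sub[OF UV(1)] in auto)
  moreover have "g U V x + g V W x = g U W x" if "U \<in> \<U>" "V \<in> \<U>" "W \<in> \<U>" "x \<in> U \<inter> V \<inter> W" for U V W x
    using that by (simp add: g)
  ultimately show ?thesis unfolding cech_cocycle_def using cov by simp
qed

text \<open>On the intersections of members of the two covers, the differences of the two kinds of primitives
  are a cochain of locally constant functions.\<close>

lemma primitive_cocycles_cohomologous:
  assumes "primitive_cocycle \<beta> \<U> g" "primitive_cocycle \<beta> \<V> k"
  shows "cech_cohomologous X (\<U>, g) (\<V>, k)"
proof -
  obtain c where U: "open_cover X \<U>" and c: "\<And>U. U \<in> \<U> \<Longrightarrow> primitive \<beta> U (c U)"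
    and g: "\<And>U V T. U \<in> \<U> \<Longrightarrow> V \<in> \<U> \<Longrightarrow> T \<in> U \<inter> V \<Longrightarrow> g U V T = c U T - c V T"
    using assms(1) unfolding primitive_cocycle_def by blast
  obtain e where V: "open_cover X \<V>" and e: "\<And>U. U \<in> \<V> \<Longrightarrow> primitive \<beta> U (e U)"
    and k: "\<And>U V T. U \<in> \<V> \<Longrightarrow> V \<in> \<V> \<Longrightarrow> T \<in> U \<inter> V \<Longrightarrow> k U V T = e U T - e V T"
    using assms(2) unfolding primitive_cocycle_def by blast
  define \<W> where "\<W> = (\<lambda>(P, Q). P \<inter> Q) ` (\<U> \<times> \<V>)"
  have "\<forall>W\<in>\<W>. \<exists>P Q. P \<in> \<U> \<and> Q \<in> \<V> \<and> W \<subseteq> P \<and> W \<subseteq> Q" unfolding \<W>_def by blast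
  then obtain \<rho> \<sigma> where \<rho>: "\<And>W. W \<in> \<W> \<Longrightarrow> \<rho> W \<in> \<U> \<and> \<sigma> W \<in> \<V> \<and> W \<subseteq> \<rho> W \<and> W \<subseteq> \<sigma> W" by metis
  have cov: "open_cover X \<W>"
    unfolding open_cover_def
  proof
    show "\<forall>W\<in>\<W>. openin X W" using U V by (auto simp: open_cover_def \<W>_def)
    have "\<Union>\<W> = \<Union>\<U> \<inter> \<Union>\<V>" unfolding \<W>_def by blast
    then show "\<Union>\<W> = topspace X" using U V by (simp add: open_cover_def)
  qed
  then have sub: "W \<subseteq> \<Omega>" if "W \<in> \<W>" for W using that openin_subset unfolding open_cover_def by fastforce
  show ?thesis
    unfolding cech_cohomologous_def prod.case
  proof (rule exI[of _ \<W>], rule exI[of _ \<rho>], rule exI[of _ \<sigma>], rule exI[of _ "\<lambda>W T. c (\<rho> W) T - e (\<sigma> W) T"],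
      intro conjI cov ballI)
    fix W assume W: "W \<in> \<W>"
    show "\<rho> W \<in> \<U>" "W \<subseteq> \<rho> W" "\<sigma> W \<in> \<V>" "W \<subseteq> \<sigma> W" using \<rho>[OF W] by blast+
    show "locally_constant_on X W (\<lambda>T. c (\<rho> W) T - e (\<sigma> W) T)"
      by (rule primitive_diff_locally_constant[OF c e]) (use \<rho>[OF W] sub[OF W] in auto)
  next
    fix W W' T assume W: "W \<in> \<W>" "W' \<in> \<W>" "T \<in> W \<inter> W'"
    have "T \<in> \<rho> W \<inter> \<rho> W'" "T \<in> \<sigma> W \<inter> \<sigma> W'" using W \<rho>[OF W(1)] \<rho>[OF W(2)] by blast+
    then show "g (\<rho> W) (\<rho> W') T - k (\<sigma> W) (\<sigma> W') T
        = c (\<rho> W) T - e (\<sigma> W) T - (c (\<rho> W') T - e (\<sigma> W') T)"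
      using \<rho>[OF W(1)] \<rho>[OF W(2)] by (simp add: g k algebra_simps)
  qed
qed

text \<open>In a flow box the transversal coordinate is rigid, so nearby elements differ from one another
  by a translation in the box coordinate only.\<close>

lemma flow_box_primitive:
  assumes \<beta>: "PE_cocycle \<beta>" and fb: "flow_box L \<Omega> \<Xi> \<epsilon> U"
    and c: "\<And>S x. S \<in> \<Xi> \<Longrightarrow> norm x < \<epsilon> \<Longrightarrow> c (translate x S) = \<beta> S x"
  shows "primitive \<beta> U c"
  unfolding primitive_def
proof
  let ?P = "prod_topology (subtopology X \<Xi>) (top_of_set (ball (0::real^'d) \<epsilon>))"
  let ?f = "\<lambda>(S, x). translate x S"
  fix T assume T: "T \<in> U"
  have \<Xi>: "flc_transversal L \<Omega> \<Xi>" and U: "openin X U" and h: "homeomorphic_map ?P (subtopology X U) ?f"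
    using fb unfolding flow_box_def by blast+
  have sub: "\<Xi> \<subseteq> \<Omega>" "U \<subseteq> \<Omega>" using flc_transversal_subset[OF \<Xi>] openin_subset[OF U] by auto
  have "?f ` topspace ?P = topspace (subtopology X U)" using homeomorphic_imp_surjective_map[OF h] .
  then have "?f ` (\<Xi> \<times> ball 0 \<epsilon>) = U" using sub by (simp add: Int_absorb1 Int_absorb2)
  then obtain S x where S: "S \<in> \<Xi>" "norm x < \<epsilon>" "T = translate x S" using T by auto
  then have S\<Omega>: "S \<in> \<Omega>" "T \<in> \<Omega>" using sub by auto
  obtain R where R: "R > 0"
    "\<And>T T' s z x. T \<in> \<Omega> \<Longrightarrow> T' \<in> \<Omega> \<Longrightarrow> agree s z T T' \<Longrightarrow> R + norm x \<le> s \<Longrightarrow> \<beta> T' x = \<beta> T (z + x) - \<beta> T z"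
    using PE_cocycle_agree[OF \<beta>] by metis
  obtain r \<delta> where r: "r > 0" "\<delta> > 0" "\<And>S' z. S' \<in> \<Xi> \<Longrightarrow> norm z < \<delta> \<Longrightarrow> agree r z S S' \<Longrightarrow> z = 0"
    using flc_transversal_rigid[OF \<Xi> S(1)] by blast
  define r1 where "r1 = max r (R + \<epsilon> + radius + 1)"
  have r1: "r1 \<ge> r" "r1 \<ge> R + \<epsilon> + radius + 1" "r1 > 0" using r(1) by (auto simp: r1_def)
  \<comment> \<open>the elements of \<open>A\<close> have the same patch of radius \<open>r1\<close> as \<open>S\<close>; the image of \<open>A \<times> B\<close> is a neighbourhood of \<open>T\<close>\<close>
  define A where "A = cylinder S r1 \<delta> \<inter> \<Xi>"
  define B where "B = ball x (gap / 2) \<inter> ball 0 \<epsilon>"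
  have "openin (subtopology X \<Xi>) A"
    unfolding A_def by (rule openin_subtopology_Int[OF openin_cylinder[OF r1(3)]])
  moreover have "openin (top_of_set (ball 0 \<epsilon>)) B"
    unfolding B_def by (rule openin_subtopology_Int) simp
  ultimately have "openin ?P (A \<times> B)" by (simp add: openin_prod_Times_iff)
  then have "openin (subtopology X U) (?f ` (A \<times> B))"
    using homeomorphic_imp_open_map[OF h] unfolding open_map_def by blast
  then have op: "openin X (?f ` (A \<times> B))" using openin_open_subtopology[OF U] by blast
  have "?f (S, x) \<in> ?f ` (A \<times> B)"
    using S(1,2) cylinder_self[OF S\<Omega>(1) r(2)] gap(1) by (intro imageI) (simp add: A_def B_def)
  then have TD: "T \<in> ?f ` (A \<times> B)" using S(3) by simp
  obtain s \<delta>' where s: "s > 0" "\<delta>' > 0"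
    "\<forall>T'\<in>\<Omega>. \<forall>z. norm z < \<delta>' \<longrightarrow> agree s z T T' \<longrightarrow> T' \<in> ?f ` (A \<times> B)"
    using bspec[OF op[unfolded openin_iff_agree, THEN conjunct2] TD] by (elim exE conjE)
  have "T' \<in> U \<and> c T' = c T + \<beta> T z"
    if T': "T' \<in> \<Omega>" "norm z < min \<delta>' (gap / 2)" "agree (max s (radius + 1)) z T T'" for T' z
  proof -
    have "T' \<in> ?f ` (A \<times> B)" using s(3)[rule_format, OF T'(1), of z] T'(2) agree_mono[OF T'(3), of s] by simp
    then obtain S' x' where S': "S' \<in> cylinder S r1 \<delta>" "S' \<in> \<Xi>" "dist x x' < gap / 2" "norm x' < \<epsilon>" "T' = translate x' S'"
      by (auto simp: A_def B_def)
    obtain w where w: "norm w < \<delta>" "agree r1 w S S'" using S'(1) by (elim cylinderE)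
    have "w = 0" using r(3)[OF S'(2) w(1)] agree_mono[OF w(2) r1(1)] by blast
    then have ag: "agree r1 0 S S'" using w(2) by simp
    have 1: "agree (radius + 1) (x' + 0) S T'"
      unfolding S'(5) by (rule agree_shift[OF ag]) (use S'(4) r1(2) R(1) in linarith)
    have 2: "agree (radius + 1) (z + x) S T'"
      using agree_mono[OF T'(3), of "radius + 1"] unfolding S(3) agree_def by (simp add: translate_translate)
    \<comment> \<open>both \<open>x'\<close> and \<open>z + x\<close> make \<open>S\<close> agree with \<open>T'\<close>\<close>
    have "norm (x' + 0 - (z + x)) < gap"
      using norm_triangle_ineq4[of "x' - x" z] S'(3) T'(2) by (simp add: dist_norm norm_minus_commute algebra_simps)
    then have x': "x' = x + z" using agree_unique[OF S\<Omega>(1) T'(1) 1 2] by simp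
    have "\<beta> S' x' = \<beta> S x'"
      using R(2)[OF S\<Omega>(1) _ ag, of x'] S'(2,4) sub r1(2) radius(1) PE_cocycle_0[OF \<beta> S\<Omega>(1)] by auto
    then have "c T' = \<beta> S (x + z)" using c[OF S'(2,4)] S'(5) x' by simp
    also have "\<dots> = c T + \<beta> T z" using PE_cocycle_add[OF \<beta> S\<Omega>(1), of x z] c[OF S(1,2)] S(3) by simp
    finally have "c T' = c T + \<beta> T z" .
    moreover have "T' \<in> U" using \<open>T' \<in> ?f ` (A \<times> B)\<close> \<open>openin (subtopology X U) (?f ` (A \<times> B))\<close>
      openin_imp_subset by blast
    ultimately show ?thesis by blast
  qed
  then show "\<exists>r>0. \<exists>\<delta>>0. \<forall>T'\<in>\<Omega>. \<forall>z. norm z < \<delta> \<longrightarrow> agree r z T T' \<longrightarrow> T' \<in> U \<and> c T' = c T + \<beta> T z"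
    using s(1,2) gap(1) by (intro exI[of _ "max s (radius + 1)"] conjI exI[of _ "min \<delta>' (gap / 2)"]) auto
qed

lemma flow_box_cocycle_primitive:
  assumes "PE_cocycle \<beta>" "flow_box_cocycle L \<Omega> \<beta> (\<U>, g)"
  shows "primitive_cocycle \<beta> \<U> g"
proof -
  obtain \<Xi> \<epsilon> c where cov: "open_cover X \<U>" and
    fb: "\<forall>U\<in>\<U>. flow_box L \<Omega> (\<Xi> U) (\<epsilon> U) U \<and>
           (\<forall>S\<in>\<Xi> U. \<forall>x. norm x < \<epsilon> U \<longrightarrow> c U (translate x S) = \<beta> S x)" and
    g: "\<forall>U\<in>\<U>. \<forall>V\<in>\<U>. \<forall>T\<in>U \<inter> V. g U V T = c U T - c V T"
    using assms(2) unfolding flow_box_cocycle_def prod.case by blast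
  have "\<forall>U\<in>\<U>. primitive \<beta> U (c U)" using flow_box_primitive[OF assms(1)] fb by blast
  then show ?thesis unfolding primitive_cocycle_def using cov g by blast
qed

lemma flow_box_cocycle_exists: "\<exists>g. flow_box_cocycle L \<Omega> \<beta> g"
proof -
  have "\<forall>U\<in>range box_at. \<exists>v. U = box_at v" by blast
  then obtain v where v: "\<And>U. U \<in> range box_at \<Longrightarrow> U = box_at (v U)" by metis
  define \<Xi> where "\<Xi> U = transversal (v U)" for U
  let ?f = "\<lambda>(S, x). translate x S"
  have fb: "flow_box L \<Omega> (\<Xi> U) (gap / 2) U" if "U \<in> range box_at" for U
    unfolding \<Xi>_def using flow_box_at[of "v U"] v[OF that] by simp
  have inj: "inj_on ?f (\<Xi> U \<times> ball 0 (gap / 2))" if U: "U \<in> range box_at" for U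
  proof -
    have "\<Xi> U \<subseteq> \<Omega>" by (auto simp: \<Xi>_def transversal_def)
    then show ?thesis
      using fb[OF U] homeomorphic_imp_injective_map unfolding flow_box_def by (fastforce simp: Int_absorb1)
  qed
  define c where "c U T = (case inv_into (\<Xi> U \<times> ball 0 (gap / 2)) ?f T of (S, x) \<Rightarrow> \<beta> S x)" for U T
  have c: "c U (translate x S) = \<beta> S x" if "U \<in> range box_at" "S \<in> \<Xi> U" "norm x < gap / 2" for U S x
    using inv_into_f_f[OF inj[OF that(1)], of "(S, x)"] that by (simp add: c_def)
  have op: "openin X U" if "U \<in> range box_at" for U using fb[OF that] unfolding flow_box_def by blast
  have "open_cover X (range box_at)" unfolding open_cover_def using op box_at_cover by simp
  then have "flow_box_cocycle L \<Omega> \<beta> (range box_at, \<lambda>U V T. c U T - c V T)"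
    unfolding flow_box_cocycle_def prod.case using fb c
    by (intro conjI exI[of _ \<Xi>] exI[of _ "\<lambda>_. gap / 2"] exI[of _ c]) auto
  then show ?thesis by blast
qed

text \<open>All primitives of \<open>\<beta>\<close> give cohomologous cocycles, those of flow boxes among them.\<close>

lemma strong_class_primitive:
  assumes \<beta>: "PE_cocycle \<beta>" and g: "primitive_cocycle \<beta> \<U> g"
  shows "strong_class L \<Omega> \<beta> = {a. cech_cocycle X a \<and> cech_cohomologous X (\<U>, g) a}"
proof -
  note eq = equiv_cech_cohomologous[of X]
  have trans: "trans {(a, a' :: (('d, 'l) pattern, real^'d) cech_cochain).
      cech_cocycle X a \<and> cech_cocycle X a' \<and> cech_cohomologous X a a'}"
    using eq by (rule equivE)
  have tr: "cech_cohomologous X a b \<Longrightarrow> cech_cohomologous X b d \<Longrightarrow> cech_cocycle X a \<Longrightarrow> cech_cocycle X b \<Longrightarrow>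
      cech_cocycle X d \<Longrightarrow> cech_cohomologous X a d" for a b d :: "(('d, 'l) pattern, real^'d) cech_cochain"
    using transD[OF trans, of a b d] by simp
  have gc: "cech_cocycle X (\<U>, g)" by (rule primitive_cocycle_cech_cocycle[OF g])
  have *: "cech_cocycle X k \<and> cech_cohomologous X (\<U>, g) k \<and> cech_cohomologous X k (\<U>, g)"
    if "flow_box_cocycle L \<Omega> \<beta> k" for k
  proof -
    obtain \<V> k' where k: "k = (\<V>, k')" by fastforce
    have "primitive_cocycle \<beta> \<V> k'" using flow_box_cocycle_primitive[OF \<beta>] that k by blast
    then show ?thesis using g primitive_cocycles_cohomologous primitive_cocycle_cech_cocycle k by blast
  qed
  obtain k where "flow_box_cocycle L \<Omega> \<beta> k" using flow_box_cocycle_exists by blast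
  then show ?thesis unfolding strong_class_def using * gc tr by blast
qed

end

section \<open>Smooth pattern-equivariant forms\<close>

context flc_space
begin

text \<open>The value at \<open>x\<close> of the form on the leaf of \<open>T\<close> is \<open>W (T - x)\<close>.\<close>

definition PE_form :: "(('d, 'l) pattern \<Rightarrow> real^'d^'d) \<Rightarrow> bool" where
  "PE_form W \<longleftrightarrow>
     (\<exists>R. \<forall>T\<in>\<Omega>. \<forall>T'\<in>\<Omega>. patch T 0 R = patch T' 0 R \<longrightarrow> W T = W T') \<and>
     (\<forall>T\<in>\<Omega>. smooth (\<lambda>x. W (translate x T)) \<and> closed_form (\<lambda>x. W (translate x T)))"

definition leaf_integral :: "(('d, 'l) pattern \<Rightarrow> real^'d^'d) \<Rightarrow> ('d, 'l) pattern \<Rightarrow> real^'d \<Rightarrow> real^'d" where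
  "leaf_integral W T = form_integral (\<lambda>x. W (translate x T))"

lemma leaf_integral_has_derivative:
  assumes "PE_form W" "T \<in> \<Omega>"
  shows "(leaf_integral W T has_derivative (\<lambda>v. W (translate x T) *v v)) (at x)"
  unfolding leaf_integral_def
  using form_integral_has_derivative[of "\<lambda>x. W (translate x T)" x] assms unfolding PE_form_def by blast

text \<open>As functions of \<open>y\<close>, both sides of the cocycle identity have the same derivative.\<close>

lemma PE_form_cocycle:
  assumes "PE_form W"
  shows "PE_cocycle (leaf_integral W)"
  unfolding PE_cocycle_def
proof (intro conjI ballI allI)
  note d = leaf_integral_has_derivative[OF assms]
  have 0: "leaf_integral W T 0 = 0" for T by (simp add: leaf_integral_def form_integral_def)
  fix T x y assume T: "T \<in> \<Omega>"
  have "((\<lambda>y. leaf_integral W T (x + y) - leaf_integral W (translate x T) y) has_derivative (\<lambda>v. 0)) (at y within UNIV)" for y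
  proof -
    have "((\<lambda>y. leaf_integral W T (x + y)) has_derivative (\<lambda>v. W (translate (x + y) T) *v v)) (at y)"
      by (rule has_derivative_compose[OF _ d[OF T]]) (auto intro!: derivative_eq_intros)
    from has_derivative_diff[OF this d[OF translate_closed[OF T], of x y]]
    show ?thesis by (simp add: translate_translate add.commute)
  qed
  then obtain k where k: "\<And>y. leaf_integral W T (x + y) - leaf_integral W (translate x T) y = k"
    using has_derivative_zero_constant[OF convex_UNIV, of "\<lambda>y. leaf_integral W T (x + y) - leaf_integral W (translate x T) y"] by blast
  show "leaf_integral W T x + leaf_integral W (translate x T) y = leaf_integral W T (x + y)"
  proof -
    have "k = leaf_integral W T x" using k[of 0] by (simp add: 0)
    then show ?thesis using k[of y] by (simp add: diff_eq_eq)
  qed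
next
  note d = leaf_integral_has_derivative[OF assms]
  show "continuous_on UNIV (leaf_integral W T)" if "T \<in> \<Omega>" for T
    by (intro continuous_at_imp_continuous_on ballI has_derivative_continuous[OF d[OF that]])
next
  obtain R where R: "\<And>T T'. T \<in> \<Omega> \<Longrightarrow> T' \<in> \<Omega> \<Longrightarrow> patch T 0 R = patch T' 0 R \<Longrightarrow> W T = W T'"
    using assms unfolding PE_form_def by blast
  have "leaf_integral W T x = leaf_integral W T' x"
    if T: "T \<in> \<Omega>" "T' \<in> \<Omega>" "patch T 0 (R + norm x) = patch T' 0 (R + norm x)" for T T' x
  proof -
    have "W (translate (t *\<^sub>R x) T) = W (translate (t *\<^sub>R x) T')" if "t \<in> {0..1}" for t
    proof (rule R)
      have "norm (t *\<^sub>R x) \<le> norm x" using mult_right_mono[of "\<bar>t\<bar>" 1 "norm x"] that unfolding norm_scaleR by auto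
      then show "patch (translate (t *\<^sub>R x) T) 0 R = patch (translate (t *\<^sub>R x) T') 0 R"
        by (intro agree_patch_translate[where r = "R + norm x"]) (use T(3) in \<open>simp_all add: agree_def\<close>)
    qed (use T in auto)
    then show ?thesis unfolding leaf_integral_def form_integral_def by (intro integral_cong) auto
  qed
  then show "\<exists>R. \<forall>T\<in>\<Omega>. \<forall>T'\<in>\<Omega>. \<forall>x. patch T 0 (R + norm x) = patch T' 0 (R + norm x) \<longrightarrow>
      leaf_integral W T x = leaf_integral W T' x"
    by blast
qed

subsection \<open>Partitions of unity\<close>

definition PE_function :: "(('d, 'l) pattern \<Rightarrow> real) \<Rightarrow> bool" where
  "PE_function F \<longleftrightarrow> (\<exists>R>0. \<forall>T\<in>\<Omega>. \<forall>T'\<in>\<Omega>. patch T 0 R = patch T' 0 R \<longrightarrow> F T = F T') \<and>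
     (\<forall>T\<in>\<Omega>. smooth (\<lambda>x. F (translate x T)))"

lemma finite_vertices_cball: "T \<in> \<Omega> \<Longrightarrow> finite {p \<in> vertices T. dist x p < R}"
  by (rule finite_subset[OF _ finite_vertices_patch[of T x R]]) (use vertices_patch in auto)

text \<open>The vertices carrying a given patch form a Delone set that moves rigidly along a leaf; a sum
  of bumps around them is smooth along leaves and transversally locally constant.\<close>

lemma bump_function_exists:
  assumes T0: "T0 \<in> U" and U: "openin X U"
  shows "\<exists>\<psi> r \<delta>. PE_function \<psi> \<and> 0 < r \<and> 0 < \<delta> \<and> (\<forall>T. 0 \<le> \<psi> T) \<and> (\<forall>T\<in>cylinder T0 r \<delta>. 0 < \<psi> T) \<and>
    (\<forall>T\<in>\<Omega> - U. \<forall>x. norm x < \<delta> \<longrightarrow> \<psi> (translate x T) = 0)"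
proof -
  have T0\<Omega>: "T0 \<in> \<Omega>" using openin_subset[OF U] T0 by auto
  obtain s d where s: "s > 0" "d > 0"
    "\<And>T z. T \<in> \<Omega> \<Longrightarrow> norm z < d \<Longrightarrow> agree s z T0 T \<Longrightarrow> T \<in> U"
    using U T0 unfolding openin_iff_agree by blast
  define \<delta> where "\<delta> = d / 2"
  have \<delta>: "\<delta> > 0" using s by (simp add: \<delta>_def)
  obtain p0 where p0: "p0 \<in> vertices T0" using radius(2)[OF T0\<Omega>] by blast
  \<comment> \<open>a vertex with patch \<open>P\<close> within \<open>2 * \<delta>\<close> of \<open>p0\<close> forces agreement with \<open>T0\<close> to radius \<open>s\<close>\<close>
  define r where "r = s + norm p0 + 2 * \<delta>"
  have r: "r > 0" using s \<delta> by (simp add: r_def add_pos_nonneg)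
  define P where "P = patch (translate p0 T0) 0 r"
  define V where "V T = {p \<in> vertices T. patch (translate p T) 0 r = P}" for T
  define \<psi> where "\<psi> T = (\<Sum>p\<in>{p \<in> V T. dist p0 p < \<delta>}. bump \<delta> (p - p0))" for T
  have finV: "finite {p \<in> V T. dist x p < c}" if "T \<in> \<Omega>" for T x c
    by (rule finite_subset[OF _ finite_vertices_cball[OF that, of x c]]) (auto simp: V_def)
  have Vt: "p \<in> V (translate x T) \<longleftrightarrow> p + x \<in> V T" for p x T
    by (auto simp: V_def vertices_translate translate_translate)
  have PE: "\<psi> T = \<psi> T'" if T: "T \<in> \<Omega>" "T' \<in> \<Omega>" "patch T 0 (norm p0 + \<delta> + r) = patch T' 0 (norm p0 + \<delta> + r)" for T T'
  proof -
    have ag: "agree (norm p0 + \<delta> + r) 0 T T'" using T(3) by (simp add: agree_def)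
    have "p \<in> V T \<longleftrightarrow> p \<in> V T'" if "dist p0 p < \<delta>" for p
    proof -
      have n: "norm p < norm p0 + \<delta>" using that norm_triangle_ineq[of p0 "p - p0"] by (simp add: dist_norm norm_minus_commute)
      have "p \<in> vertices T' \<longleftrightarrow> p \<in> vertices T" using agree_vertices[OF ag, of p] n r by simp
      moreover have "patch (translate p T) 0 r = patch (translate p T') 0 r"
        by (rule agree_patch_translate[OF ag]) (use n in simp)
      ultimately show ?thesis by (simp add: V_def)
    qed
    then have "{p \<in> V T. dist p0 p < \<delta>} = {p \<in> V T'. dist p0 p < \<delta>}" by blast
    then show ?thesis by (simp add: \<psi>_def)
  qed
  have "smooth (\<lambda>x. \<psi> (translate x T))" if T: "T \<in> \<Omega>" for T
  proof (rule smooth_local)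
    fix x0 :: "real^'d"
    \<comment> \<open>for \<open>x\<close> within distance 1 of \<open>x0\<close> only these finitely many bumps contribute\<close>
    define E where "E = {p \<in> V T. dist (p0 + x0) p < \<delta> + 1}"
    have "smooth (\<lambda>x. \<Sum>p\<in>E. bump \<delta> (x + (p0 - p)))"
      by (rule smooth_sum) (rule smooth_shift[OF smooth_bump])
    moreover have "\<psi> (translate x T) = (\<Sum>p\<in>E. bump \<delta> (x + (p0 - p)))" if x: "dist x x0 < 1" for x
    proof -
      have "\<psi> (translate x T) = (\<Sum>p\<in>{p \<in> V T. dist (p0 + x) p < \<delta>}. bump \<delta> (x + (p0 - p)))"
        unfolding \<psi>_def
      proof (rule sum.reindex_bij_witness[of _ "\<lambda>p. p - x" "\<lambda>p. p + x"])
        fix p assume "p \<in> {p \<in> V (translate x T). dist p0 p < \<delta>}"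
        then show "p + x \<in> {p \<in> V T. dist (p0 + x) p < \<delta>}" by (simp add: Vt)
        have "x + (p0 - (p + x)) = - (p - p0)" by simp
        then show "bump \<delta> (x + (p0 - (p + x))) = bump \<delta> (p - p0)" by (simp only: bump_def inner_minus_left inner_minus_right minus_minus)
      next
        fix p assume "p \<in> {p \<in> V T. dist (p0 + x) p < \<delta>}"
        then show "p - x \<in> {p \<in> V (translate x T). dist p0 p < \<delta>}" by (simp add: Vt dist_norm algebra_simps)
      qed auto
      also have "\<dots> = (\<Sum>p\<in>E. bump \<delta> (x + (p0 - p)))"
      proof (rule sum.mono_neutral_left)
        show "finite E" unfolding E_def by (rule finV[OF T])
        have tri: "dist (p0 + x0) p \<le> dist (p0 + x) p + dist x x0" for p
          using norm_triangle_ineq4[of "p0 + x - p" "x - x0"] by (simp add: dist_norm algebra_simps)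
        show "{p \<in> V T. dist (p0 + x) p < \<delta>} \<subseteq> E"
          unfolding E_def using tri x by (force intro: le_less_trans)
        show "\<forall>p\<in>E - {p \<in> V T. dist (p0 + x) p < \<delta>}. bump \<delta> (x + (p0 - p)) = 0"
          unfolding E_def bump_eq_0_iff[OF \<delta>] by (auto simp: dist_norm algebra_simps)
      qed
      finally show ?thesis .
    qed
    ultimately show "\<exists>g. smooth g \<and> (\<forall>\<^sub>F x in nhds x0. \<psi> (translate x T) = g x)"
      by (intro exI[of _ "\<lambda>x. \<Sum>p\<in>E. bump \<delta> (x + (p0 - p))"] conjI) (auto simp: eventually_nhds_metric intro!: exI[of _ 1])
  qed
  then have "PE_function \<psi>"
    unfolding PE_function_def
  proof (intro conjI exI[of _ "norm p0 + \<delta> + r"] ballI impI)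
    show "norm p0 + \<delta> + r > 0" using r \<delta> norm_ge_zero[of p0] by linarith
  qed (rule PE)
  moreover have "0 \<le> \<psi> T" for T unfolding \<psi>_def by (intro sum_nonneg) (simp add: bump_nonneg)
  moreover have "0 < \<psi> T" if T: "T \<in> cylinder T0 (norm p0 + \<delta> + r) \<delta>" for T
  proof -
    obtain z where z: "T \<in> \<Omega>" "norm z < \<delta>" "agree (norm p0 + \<delta> + r) z T0 T" using T by (rule cylinderE)
    have n: "norm (p0 - z) < norm p0 + \<delta>" using norm_triangle_ineq4[of p0 z] z(2) by simp
    have "p0 - z \<in> vertices T" using agree_vertices[OF z(3), of "p0 - z"] n r p0 by simp
    moreover have "agree r (p0 - z + z) T0 (translate (p0 - z) T)" by (rule agree_shift[OF z(3)]) (use n in simp)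
    ultimately have "p0 - z \<in> {p \<in> V T. dist p0 p < \<delta>}"
      using z(2) by (simp add: V_def P_def agree_def dist_norm)
    moreover have "0 < bump \<delta> (p0 - z - p0)"
      using bump_nonneg[of \<delta> "p0 - z - p0"] bump_eq_0_iff[OF \<delta>, of "p0 - z - p0"] z(2) by (simp add: order_less_le)
    ultimately show ?thesis
      unfolding \<psi>_def using finV[OF z(1)] by (intro sum_pos2[of _ "p0 - z"]) (auto simp: bump_nonneg)
  qed
  moreover have "\<psi> (translate x T) = 0" if T: "T \<in> \<Omega> - U" and x: "norm x < \<delta>" for T x
  proof -
    have "{p \<in> V (translate x T). dist p0 p < \<delta>} = {}"
    proof (rule ccontr)
      assume "{p \<in> V (translate x T). dist p0 p < \<delta>} \<noteq> {}"
      then obtain p where p: "p + x \<in> V T" "dist p0 p < \<delta>" by (auto simp: Vt)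
      have "agree r p0 T0 (translate (p + x) T)" using p(1) by (simp add: V_def P_def agree_def)
      moreover have "norm (- (p + x)) + s \<le> r"
        using norm_triangle_ineq[of p x] norm_triangle_ineq[of p0 "p - p0"] p(2) x
        unfolding norm_minus_cancel r_def by (simp add: dist_norm norm_minus_commute)
      ultimately have "agree s (- (p + x) + p0) T0 (translate (- (p + x)) (translate (p + x) T))" by (rule agree_shift)
      then have "agree s (- (p + x) + p0) T0 T" by (simp only: translate_minus)
      moreover have "norm (- (p + x) + p0) < d"
        using norm_triangle_ineq4[of "p0 - p" x] p(2) x by (simp add: dist_norm \<delta>_def algebra_simps)
      ultimately show False using s(3) T by blast
    qed
    then show ?thesis by (simp only: \<psi>_def sum.empty)
  qed
  moreover have "norm p0 + \<delta> + r > 0" using r \<delta> norm_ge_zero[of p0] by linarith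
  ultimately show ?thesis using \<delta> by blast
qed

lemma PE_function_radius: "PE_function F \<Longrightarrow> \<exists>R>0. \<forall>T\<in>\<Omega>. \<forall>T'\<in>\<Omega>. patch T 0 R = patch T' 0 R \<longrightarrow> F T = F T'"
  unfolding PE_function_def by blast

text \<open>The margin \<open>\<delta> i\<close> ensures that, along leaves, \<open>\<xi> i\<close> vanishes near the complement of \<open>u i\<close>. So
  the product with a function on \<open>u i\<close> extends by 0.\<close>

lemma partition_of_unity:
  assumes "open_cover X \<U>"
  shows "\<exists>(I :: ('d, 'l) pattern set) u \<xi> \<delta>. finite I \<and>
    (\<forall>i\<in>I. u i \<in> \<U> \<and> PE_function (\<xi> i) \<and> 0 < \<delta> i \<and>
      (\<forall>T\<in>\<Omega> - u i. \<forall>x. norm x < \<delta> i \<longrightarrow> \<xi> i (translate x T) = 0)) \<and>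
    (\<forall>T\<in>\<Omega>. (\<Sum>i\<in>I. \<xi> i T) = 1)"
proof -
  have "\<exists>U \<psi> r \<delta>. U \<in> \<U> \<and> PE_function \<psi> \<and> 0 < r \<and> 0 < \<delta> \<and> (\<forall>T. 0 \<le> \<psi> T) \<and> (\<forall>T\<in>cylinder T0 r \<delta>. 0 < \<psi> T) \<and>
    (\<forall>T\<in>\<Omega> - U. \<forall>x. norm x < \<delta> \<longrightarrow> \<psi> (translate x T) = 0)" if T0: "T0 \<in> \<Omega>" for T0
  proof -
    have "\<Union>\<U> = \<Omega>" using assms unfolding open_cover_def by simp
    then obtain U where U: "U \<in> \<U>" "T0 \<in> U" using T0 by blast
    then have "openin X U" using assms unfolding open_cover_def by blast
    from bump_function_exists[OF U(2) this] U(1) show ?thesis by blast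
  qed
  then obtain u \<psi> r \<delta> where *: "\<And>i. i \<in> \<Omega> \<Longrightarrow> u i \<in> \<U> \<and> PE_function (\<psi> i) \<and> 0 < r i \<and> 0 < \<delta> i \<and> (\<forall>T. 0 \<le> \<psi> i T) \<and>
      (\<forall>T\<in>cylinder i (r i) (\<delta> i). 0 < \<psi> i T) \<and> (\<forall>T\<in>\<Omega> - u i. \<forall>x. norm x < \<delta> i \<longrightarrow> \<psi> i (translate x T) = 0)"
    by metis
  have "\<And>T. T \<in> \<Omega> \<Longrightarrow> 0 < r T \<and> 0 < \<delta> T" using * by blast
  then obtain I where I: "finite I" "I \<subseteq> \<Omega>" "\<Omega> \<subseteq> (\<Union>T\<in>I. cylinder T (r T) (\<delta> T))"
    by (rule finite_cylinder_cover)
  define s where "s T = (\<Sum>i\<in>I. \<psi> i T)" for T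
  have s: "0 < s T" if T: "T \<in> \<Omega>" for T
  proof -
    obtain i where "i \<in> I" "T \<in> cylinder i (r i) (\<delta> i)" using I(3) T by blast
    then show ?thesis unfolding s_def using I(1,2) * by (intro sum_pos2[of I i]) blast+
  qed
  have "PE_function (\<lambda>T. inverse (s T) * \<psi> i T)" if i: "i \<in> I" for i
    unfolding PE_function_def
  proof
    have "\<forall>j\<in>I. \<exists>R>0. \<forall>T\<in>\<Omega>. \<forall>T'\<in>\<Omega>. patch T 0 R = patch T' 0 R \<longrightarrow> \<psi> j T = \<psi> j T'"
      using PE_function_radius * I(2) by blast
    then obtain R where R: "\<And>j. j \<in> I \<Longrightarrow> R j > 0"
      "\<And>j T T'. j \<in> I \<Longrightarrow> T \<in> \<Omega> \<Longrightarrow> T' \<in> \<Omega> \<Longrightarrow> patch T 0 (R j) = patch T' 0 (R j) \<Longrightarrow> \<psi> j T = \<psi> j T'"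
      by metis
    have le: "R j \<le> Max (R ` I)" if "j \<in> I" for j using I(1) that by simp
    have \<psi>R: "\<psi> j T = \<psi> j T'" if "j \<in> I" "T \<in> \<Omega>" "T' \<in> \<Omega>" "patch T 0 (Max (R ` I)) = patch T' 0 (Max (R ` I))" for j T T'
      using R(2)[OF that(1-3)] patch_eq_subball[OF that(4)] subset_ball[OF le[OF that(1)]] by blast
    have "Max (R ` I) > 0" using R(1)[OF i] le[OF i] by linarith
    then show "\<exists>R>0. \<forall>T\<in>\<Omega>. \<forall>T'\<in>\<Omega>. patch T 0 R = patch T' 0 R \<longrightarrow> inverse (s T) * \<psi> i T = inverse (s T') * \<psi> i T'"
    proof (intro exI[of _ "Max (R ` I)"] conjI ballI impI)
      fix T T' assume T: "T \<in> \<Omega>" "T' \<in> \<Omega>" "patch T 0 (Max (R ` I)) = patch T' 0 (Max (R ` I))"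
      have eq: "\<psi> j T = \<psi> j T'" if "j \<in> I" for j using \<psi>R[OF that T] .
      then have "s T = s T'" unfolding s_def by (intro sum.cong) simp_all
      then show "inverse (s T) * \<psi> i T = inverse (s T') * \<psi> i T'" using eq[OF i] by simp
    qed
    show "\<forall>T\<in>\<Omega>. smooth (\<lambda>x. inverse (s (translate x T)) * \<psi> i (translate x T))"
    proof
      fix T assume T: "T \<in> \<Omega>"
      have sm: "smooth (\<lambda>x. \<psi> j (translate x T))" if "j \<in> I" for j
        using * I(2) that T unfolding PE_function_def by blast
      have "smooth (\<lambda>x. s (translate x T))" unfolding s_def by (rule smooth_sum) (rule sm)
      then have "smooth (\<lambda>x. inverse (s (translate x T)))"
        by (rule smooth_inverse) (use s[OF translate_closed[OF T]] less_imp_neq in fastforce)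
      from smooth_scaleR[OF this sm[OF i]] show "smooth (\<lambda>x. inverse (s (translate x T)) * \<psi> i (translate x T))"
        by simp
    qed
  qed
  moreover have "(\<Sum>i\<in>I. inverse (s T) * \<psi> i T) = 1" if "T \<in> \<Omega>" for T
    using s[OF that] by (simp add: sum_distrib_left[symmetric] s_def[symmetric])
  moreover have "inverse (s (translate x T)) * \<psi> i (translate x T) = 0"
    if "i \<in> I" "T \<in> \<Omega> - u i" "norm x < \<delta> i" for i T x
    using that * I(2) by (simp add: subset_iff)
  ultimately show ?thesis
    using I(1,2) * by (intro exI[of _ I] exI[of _ u] exI[of _ "\<lambda>i T. inverse (s T) * \<psi> i T"] exI[of _ \<delta>]) blast
qed

end

lemma smooth_shift_has_derivative:
  assumes "smooth a"
  shows "((\<lambda>y. a (y + c)) has_derivative frechet_derivative a (at (x + c))) (at x)"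
  using has_derivative_compose[OF has_derivative_add[OF has_derivative_ident has_derivative_const[of c]]
      smooth_has_derivative[OF assms, of "x + c"]] by simp

context flc_space
begin

lemma finite_near:
  assumes "finite I"
    "\<And>i. i \<in> I \<Longrightarrow> \<exists>r>0. \<exists>\<delta>>0. \<forall>T'\<in>\<Omega>. \<forall>z. norm z < \<delta> \<longrightarrow> agree r z T T' \<longrightarrow> Q i T' z"
  shows "\<exists>r>0. \<exists>\<delta>>0. \<forall>T'\<in>\<Omega>. \<forall>z. norm z < \<delta> \<longrightarrow> agree r z T T' \<longrightarrow> (\<forall>i\<in>I. Q i T' z)"
  using assms
proof (induction I)
  case empty
  show ?case by (intro exI[of _ "1::real"] conjI) simp_all
next
  case (insert i I)
  have "\<exists>r>0. \<exists>\<delta>>0. \<forall>T'\<in>\<Omega>. \<forall>z. norm z < \<delta> \<longrightarrow> agree r z T T' \<longrightarrow> (\<forall>i\<in>I. Q i T' z)"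
    by (rule insert.IH) (rule insert.prems, simp)
  then obtain r1 d1 where 1: "r1 > 0" "d1 > 0"
    "\<forall>T'\<in>\<Omega>. \<forall>z. norm z < d1 \<longrightarrow> agree r1 z T T' \<longrightarrow> (\<forall>i\<in>I. Q i T' z)" by (elim exE conjE)
  have "\<exists>r>0. \<exists>\<delta>>0. \<forall>T'\<in>\<Omega>. \<forall>z. norm z < \<delta> \<longrightarrow> agree r z T T' \<longrightarrow> Q i T' z"
    by (rule insert.prems) simp
  then obtain r2 d2 where 2: "r2 > 0" "d2 > 0"
    "\<forall>T'\<in>\<Omega>. \<forall>z. norm z < d2 \<longrightarrow> agree r2 z T T' \<longrightarrow> Q i T' z" by (elim exE conjE)
  have "Q j T' z" if "T' \<in> \<Omega>" "norm z < min d1 d2" "agree (max r1 r2) z T T'" "j \<in> insert i I" for T' z j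
    using that 1(3) 2(3) agree_mono[of "max r1 r2" z T T'] by auto
  then show ?case
    using 1(1,2) 2(2) by (intro exI[of _ "max r1 r2"] conjI exI[of _ "min d1 d2"]) auto
qed

text \<open>Gluing with a partition of unity \<open>\<xi>\<close>: the functions \<open>c U = \<Sum>i. \<xi> i * g U (u i)\<close> have
  differences \<open>g\<close>; along a leaf they are locally smooth, and across leaves locally constant.\<close>

lemma smooth_local_primitives:
  assumes "cech_cocycle X (\<U>, g)"
  obtains c :: "('d, 'l) pattern set \<Rightarrow> ('d, 'l) pattern \<Rightarrow> real^'d" where
    "\<And>U V T. U \<in> \<U> \<Longrightarrow> V \<in> \<U> \<Longrightarrow> T \<in> U \<inter> V \<Longrightarrow> c U T - c V T = g U V T"
    "\<And>U T. U \<in> \<U> \<Longrightarrow> T \<in> U \<Longrightarrow> \<exists>a r \<delta>. smooth a \<and> r > 0 \<and> \<delta> > 0 \<and>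
       (\<forall>T'\<in>\<Omega>. \<forall>z. norm z < \<delta> \<longrightarrow> agree r z T T' \<longrightarrow> T' \<in> U \<and> c U T' = a z)"
proof -
  have cov: "open_cover X \<U>"
    and lc: "\<And>U V. U \<in> \<U> \<Longrightarrow> V \<in> \<U> \<Longrightarrow> locally_constant_on X (U \<inter> V) (g U V)"
    and g: "\<And>U V W T. U \<in> \<U> \<Longrightarrow> V \<in> \<U> \<Longrightarrow> W \<in> \<U> \<Longrightarrow> T \<in> U \<inter> V \<inter> W \<Longrightarrow> g U V T + g V W T = g U W T"
    using assms unfolding cech_cocycle_def prod.case by blast+
  have op: "openin X U" if "U \<in> \<U>" for U using cov that unfolding open_cover_def by blast
  then have sub: "U \<subseteq> \<Omega>" if "U \<in> \<U>" for U using openin_subset[OF op[OF that]] by simp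
  obtain I :: "('d, 'l) pattern set" and u \<xi> \<delta> where I: "finite I"
    and u': "\<forall>i\<in>I. u i \<in> \<U> \<and> PE_function (\<xi> i) \<and> 0 < \<delta> i \<and>
      (\<forall>T\<in>\<Omega> - u i. \<forall>x. norm x < \<delta> i \<longrightarrow> \<xi> i (translate x T) = 0)"
    and one': "\<forall>T\<in>\<Omega>. (\<Sum>i\<in>I. \<xi> i T) = 1"
    using partition_of_unity[OF cov] by (elim exE conjE)
  have u: "u i \<in> \<U> \<and> PE_function (\<xi> i) \<and> 0 < \<delta> i" if "i \<in> I" for i using u' that by blast
  have van: "\<xi> i (translate x T) = 0" if "i \<in> I" "T \<in> \<Omega> - u i" "norm x < \<delta> i" for i T x
    using u' that by blast
  have one: "(\<Sum>i\<in>I. \<xi> i T) = 1" if "T \<in> \<Omega>" for T using one' that by blast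
  define c where "c U T = (\<Sum>i\<in>I. \<xi> i T *\<^sub>R g U (u i) T)" for U T
  show ?thesis
  proof (rule that[of c])
    fix U V T assume UV: "U \<in> \<U>" "V \<in> \<U>" "T \<in> U \<inter> V"
    then have T: "T \<in> \<Omega>" using sub by blast
    have "\<xi> i T *\<^sub>R g U (u i) T - \<xi> i T *\<^sub>R g V (u i) T = \<xi> i T *\<^sub>R g U V T" if i: "i \<in> I" for i
    proof (cases "T \<in> u i")
      case True
      have "T \<in> U \<inter> V \<inter> u i" using True UV(3) by blast
      then have "g U V T + g V (u i) T = g U (u i) T" by (intro g UV(1,2)) (use u[OF i] in blast)
      then have "g U V T = g U (u i) T - g V (u i) T" by (simp add: eq_diff_eq)
      then show ?thesis by (simp add: scaleR_diff_right)
    next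
      case False
      then have "\<xi> i T = 0" using van[OF i, of T 0] T u[OF i] by simp
      then show ?thesis by simp
    qed
    then have "c U T - c V T = (\<Sum>i\<in>I. \<xi> i T *\<^sub>R g U V T)"
      unfolding c_def sum_subtractf[symmetric] by (intro sum.cong) simp_all
    also have "\<dots> = g U V T" by (simp add: scaleR_sum_left[symmetric] one[OF T])
    finally show "c U T - c V T = g U V T" .
  next
    fix U T assume U: "U \<in> \<U>" "T \<in> U"
    then have T: "T \<in> \<Omega>" using sub by blast
    \<comment> \<open>\<open>g U (u i)\<close> is constant near \<open>T\<close>, or multiplied by 0 there\<close>
    define \<gamma> where "\<gamma> i = (if T \<in> u i then g U (u i) T else 0)" for i
    define a where "a z = (\<Sum>i\<in>I. \<xi> i (translate z T) *\<^sub>R \<gamma> i)" for z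
    have "smooth (\<lambda>z. \<Sum>i\<in>I. \<xi> i (translate z T) *\<^sub>R \<gamma> i)"
    proof (rule smooth_sum)
      fix i assume "i \<in> I"
      then have "smooth (\<lambda>z. \<xi> i (translate z T))" using u T unfolding PE_function_def by blast
      then show "smooth (\<lambda>z. \<xi> i (translate z T) *\<^sub>R \<gamma> i)" by (rule smooth_scaleR[OF _ smooth_const])
    qed
    then have sm: "smooth a" unfolding a_def .
    have step: "\<exists>r>0. \<exists>\<delta>>0. \<forall>T'\<in>\<Omega>. \<forall>z. norm z < \<delta> \<longrightarrow> agree r z T T' \<longrightarrow>
        \<xi> i T' *\<^sub>R g U (u i) T' = \<xi> i (translate z T) *\<^sub>R \<gamma> i" if i: "i \<in> I" for i
    proof -
      obtain R where R: "R > 0" "\<forall>T\<in>\<Omega>. \<forall>T'\<in>\<Omega>. patch T 0 R = patch T' 0 R \<longrightarrow> \<xi> i T = \<xi> i T'"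
        using PE_function_radius u[OF i] by blast
      have \<xi>: "\<xi> i T' = \<xi> i (translate z T)" if "T' \<in> \<Omega>" "agree R z T T'" for T' z
        using R(2) T that unfolding agree_def by (metis translate_closed)
      show ?thesis
      proof (cases "T \<in> u i")
        case True
        have ui: "u i \<in> \<U>" using u[OF i] by blast
        obtain r d where rd: "r > 0" "d > 0" "\<forall>T'\<in>\<Omega>. \<forall>z. norm z < d \<longrightarrow> agree r z T T' \<longrightarrow> T' \<in> U \<inter> u i \<and> g U (u i) T' = g U (u i) T"
          using locally_constant_onD[OF lc[OF U(1) ui], of T] True U(2) op[OF U(1)] op[OF ui] by blast
        have "\<xi> i T' *\<^sub>R g U (u i) T' = \<xi> i (translate z T) *\<^sub>R \<gamma> i"
          if T': "T' \<in> \<Omega>" "norm z < d" "agree (max r R) z T T'" for T' z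
        proof -
          have "agree r z T T'" "agree R z T T'" using agree_mono[OF T'(3)] by simp_all
          then show ?thesis using rd(3) \<xi> T' True by (simp add: \<gamma>_def)
        qed
        then show ?thesis using rd(1,2) by (intro exI[of _ "max r R"] conjI exI[of _ d]) auto
      next
        case False
        then have "\<xi> i (translate z T) = 0" if "norm z < \<delta> i" for z using van[OF i] T that by blast
        then show ?thesis using R(1) u[OF i] \<xi> by (intro exI[of _ R] conjI exI[of _ "\<delta> i"]) auto
      qed
    qed
    have "\<exists>r>0. \<exists>\<delta>>0. \<forall>T'\<in>\<Omega>. \<forall>z. norm z < \<delta> \<longrightarrow> agree r z T T' \<longrightarrow>
        (\<forall>i\<in>I. \<xi> i T' *\<^sub>R g U (u i) T' = \<xi> i (translate z T) *\<^sub>R \<gamma> i)"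
      by (rule finite_near[OF I step])
    then obtain r d where rd: "r > 0" "d > 0"
      "\<forall>T'\<in>\<Omega>. \<forall>z. norm z < d \<longrightarrow> agree r z T T' \<longrightarrow> (\<forall>i\<in>I. \<xi> i T' *\<^sub>R g U (u i) T' = \<xi> i (translate z T) *\<^sub>R \<gamma> i)"
      by (elim exE conjE)
    have "\<forall>T\<in>U. \<exists>r>0. \<exists>\<delta>>0. \<forall>T'\<in>\<Omega>. \<forall>z. norm z < \<delta> \<longrightarrow> agree r z T T' \<longrightarrow> T' \<in> U"
      using op[OF U(1)] unfolding openin_iff_agree by (rule conjunct2)
    from bspec[OF this U(2)] obtain r' d' where rd': "r' > 0" "d' > 0"
      "\<forall>T'\<in>\<Omega>. \<forall>z. norm z < d' \<longrightarrow> agree r' z T T' \<longrightarrow> T' \<in> U" by (elim exE conjE)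
    have "T' \<in> U \<and> c U T' = a z" if T': "T' \<in> \<Omega>" "norm z < min d d'" "agree (max r r') z T T'" for T' z
    proof -
      have ag: "agree r z T T'" "agree r' z T T'" using agree_mono[OF T'(3)] by simp_all
      have "c U T' = a z" unfolding c_def a_def using rd(3) T' ag by (intro sum.cong) auto
      moreover have "T' \<in> U" using rd'(3)[rule_format, OF T'(1), of z] T'(2) ag by simp
      ultimately show ?thesis by blast
    qed
    then show "\<exists>a r \<delta>. smooth a \<and> r > 0 \<and> \<delta> > 0 \<and>
       (\<forall>T'\<in>\<Omega>. \<forall>z. norm z < \<delta> \<longrightarrow> agree r z T T' \<longrightarrow> T' \<in> U \<and> c U T' = a z)"
      using sm rd(1,2) rd'(2) by (intro exI[of _ a] exI[of _ "max r r'"] exI[of _ "min d d'"]) auto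
  qed
qed

text \<open>Every Cech class is the class of a smooth form: the leafwise derivatives of the local
  primitives agree on overlaps, as the differences of primitives are locally constant.\<close>

theorem cech_cocycle_PE_form:
  fixes g :: "('d, 'l) pattern set \<Rightarrow> ('d, 'l) pattern set \<Rightarrow> ('d, 'l) pattern \<Rightarrow> real^'d"
  assumes coc: "cech_cocycle X (\<U>, g)"
  shows "\<exists>W. PE_form W \<and> primitive_cocycle (leaf_integral W) \<U> g"
proof -
  have cov: "open_cover X \<U>" and lc: "\<And>U V. U \<in> \<U> \<Longrightarrow> V \<in> \<U> \<Longrightarrow> locally_constant_on X (U \<inter> V) (g U V)"
    using coc unfolding cech_cocycle_def prod.case by blast+
  have op: "openin X U" if "U \<in> \<U>" for U using cov that unfolding open_cover_def by blast
  obtain c :: "('d, 'l) pattern set \<Rightarrow> ('d, 'l) pattern \<Rightarrow> real^'d" where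
    diff: "\<And>U V T. U \<in> \<U> \<Longrightarrow> V \<in> \<U> \<Longrightarrow> T \<in> U \<inter> V \<Longrightarrow> c U T - c V T = g U V T" and
    sm: "\<And>U T. U \<in> \<U> \<Longrightarrow> T \<in> U \<Longrightarrow> \<exists>a r \<delta>. smooth a \<and> r > 0 \<and> \<delta> > 0 \<and>
       (\<forall>T'\<in>\<Omega>. \<forall>z. norm z < \<delta> \<longrightarrow> agree r z T T' \<longrightarrow> T' \<in> U \<and> c U T' = a z)"
    using smooth_local_primitives[OF coc] by metis
  have "\<forall>T\<in>\<Omega>. \<exists>U\<in>\<U>. T \<in> U" using cov unfolding open_cover_def by auto
  then obtain V where V: "\<And>T. T \<in> \<Omega> \<Longrightarrow> V T \<in> \<U> \<and> T \<in> V T" by metis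
  define W where "W T = jacobian (\<lambda>x. c (V T) (translate x T)) 0" for T
  \<comment> \<open>the derivative can be computed from any member of the cover, as \<open>g\<close> is locally constant\<close>
  have key: "W T' = jacobian a z"
    if U: "U \<in> \<U>" and a: "smooth a" "\<delta> > 0"
      "\<And>T' z. T' \<in> \<Omega> \<Longrightarrow> norm z < \<delta> \<Longrightarrow> agree r z T T' \<Longrightarrow> T' \<in> U \<and> c U T' = a z"
      and T': "T' \<in> \<Omega>" "norm z < \<delta> / 2" "agree (r + \<delta>) z T T'" for U T a r \<delta> T' z
  proof -
    have ag: "agree r (x + z) T (translate x T')" if "norm x < \<delta> / 2" for x
      by (rule agree_shift[OF T'(3)]) (use that a(2) in simp)
    have nxz: "norm (x + z) < \<delta>" if "norm x < \<delta> / 2" for x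
      using norm_triangle_ineq[of x z] that T'(2) by linarith
    have cU: "translate x T' \<in> U \<and> c U (translate x T') = a (x + z)" if "norm x < \<delta> / 2" for x
      using a(3)[OF translate_closed[OF T'(1)] nxz[OF that] ag[OF that]] .
    have VT: "V T' \<in> \<U>" "T' \<in> V T'" using V[OF T'(1)] by blast+
    have TU: "T' \<in> U" using cU[of 0] a(2) by simp
    have Vop: "openin X (V T' \<inter> U)" using op VT(1) U by blast
    have "T' \<in> V T' \<inter> U" using VT TU by blast
    from locally_constant_onD[OF lc[OF VT(1) U] this Vop] obtain s e where s: "s > 0" "e > 0"
      "\<forall>S\<in>\<Omega>. \<forall>w. norm w < e \<longrightarrow> agree s w T' S \<longrightarrow> S \<in> V T' \<inter> U \<and> g (V T') U S = g (V T') U T'"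
      by (elim exE conjE)
    have eq: "c (V T') (translate x T') = a (x + z) + g (V T') U T'" if "norm x < min e (\<delta> / 2)" for x
    proof -
      have x: "norm x < e" "norm x < \<delta> / 2" using that by simp_all
      have S: "translate x T' \<in> V T' \<inter> U" "g (V T') U (translate x T') = g (V T') U T'"
        using s(3)[rule_format, OF translate_closed[OF T'(1)] x(1) agree_translate] by blast+
      have "c (V T') (translate x T') = c U (translate x T') + g (V T') U (translate x T')"
        using diff[OF VT(1) U S(1)] by (simp add: algebra_simps)
      then show ?thesis using cU[OF x(2)] S(2) by simp
    qed
    have "((\<lambda>x. a (x + z) + g (V T') U T') has_derivative frechet_derivative a (at z)) (at 0)"
    proof -
      have "((\<lambda>x. a (x + z)) has_derivative frechet_derivative a (at z)) (at 0)"
        using smooth_shift_has_derivative[OF a(1), of z 0] by simp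
      then show ?thesis by (rule has_derivative_eq_rhs[OF has_derivative_add[OF _ has_derivative_const]]) simp
    qed
    then have "((\<lambda>x. c (V T') (translate x T')) has_derivative frechet_derivative a (at z)) (at 0)"
      by (rule has_derivative_transform_within_open[OF _ open_ball[of 0 "min e (\<delta> / 2)"]])
        (use eq s(2) a(2) in auto)
    from frechet_derivative_at[OF this] show ?thesis unfolding W_def jacobian_def by simp
  qed
  have local: "\<exists>a r \<delta>. smooth a \<and> r > 0 \<and> \<delta> > 0 \<and>
      (\<forall>T'\<in>\<Omega>. \<forall>z. norm z < \<delta> \<longrightarrow> agree r z T T' \<longrightarrow> T' \<in> U \<and> c U T' = a z \<and> W T' = jacobian a z)"
    if U: "U \<in> \<U>" "T \<in> U" for U T
  proof -
    obtain a r \<delta> where a: "smooth a" "r > 0" "\<delta> > 0"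
      "\<forall>T'\<in>\<Omega>. \<forall>z. norm z < \<delta> \<longrightarrow> agree r z T T' \<longrightarrow> T' \<in> U \<and> c U T' = a z"
      using sm[OF U] by (elim exE conjE)
    have "T' \<in> U \<and> c U T' = a z \<and> W T' = jacobian a z"
      if "T' \<in> \<Omega>" "norm z < \<delta> / 2" "agree (r + \<delta>) z T T'" for T' z
    proof -
      have "agree r z T T'" using agree_mono[OF that(3)] a(3) by simp
      moreover have "norm z < \<delta>" using that(2) a(3) by simp
      moreover have A: "T' \<in> U \<and> c U T' = a z" if "T' \<in> \<Omega>" "norm z < \<delta>" "agree r z T T'" for T' z
        using a(4) that by blast
      have "W T' = jacobian a z" by (rule key[OF U(1) a(1,3) A that])
      ultimately show ?thesis using A[OF that(1)] by blast
    qed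
    then show ?thesis using a(1,2,3) by (intro exI[of _ a] exI[of _ "r + \<delta>"] exI[of _ "\<delta> / 2"]) simp
  qed
  have local0: "\<exists>a r \<delta>. smooth a \<and> r > 0 \<and> \<delta> > 0 \<and>
      (\<forall>T'\<in>\<Omega>. \<forall>z. norm z < \<delta> \<longrightarrow> agree r z T T' \<longrightarrow> W T' = jacobian a z)" if T: "T \<in> \<Omega>" for T
  proof -
    have "V T \<in> \<U>" "T \<in> V T" using V[OF T] by blast+
    from local[OF this] show ?thesis by blast
  qed
  have "\<exists>R. \<forall>T\<in>\<Omega>. \<forall>T'\<in>\<Omega>. patch T 0 R = patch T' 0 R \<longrightarrow> W T = W T'"
  proof -
    have "\<forall>T\<in>\<Omega>. \<exists>a r \<delta>. smooth a \<and> r > 0 \<and> \<delta> > 0 \<and>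
      (\<forall>T'\<in>\<Omega>. \<forall>z. norm z < \<delta> \<longrightarrow> agree r z T T' \<longrightarrow> W T' = jacobian a z)" using local0 by blast
    then obtain a r \<delta> where a: "\<And>T. T \<in> \<Omega> \<Longrightarrow> 0 < r T \<and> 0 < \<delta> T"
      "\<And>T T' z. T \<in> \<Omega> \<Longrightarrow> T' \<in> \<Omega> \<Longrightarrow> norm z < \<delta> T \<Longrightarrow> agree (r T) z T T' \<Longrightarrow> W T' = jacobian (a T) z"
      by metis
    obtain F where F: "finite F" "F \<subseteq> \<Omega>" "\<Omega> \<subseteq> (\<Union>T\<in>F. cylinder T (r T) (\<delta> T))"
      using finite_cylinder_cover[OF a(1)] .
    have "W T = W T'" if T: "T \<in> \<Omega>" "T' \<in> \<Omega>" "patch T 0 (Max (r ` F)) = patch T' 0 (Max (r ` F))" for T T'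
    proof -
      obtain S where S: "S \<in> F" "T \<in> cylinder S (r S) (\<delta> S)" using F(3) T(1) by blast
      obtain z where z: "norm z < \<delta> S" "agree (r S) z S T" using S(2) by (elim cylinderE)
      have "r S \<le> Max (r ` F)" using F(1) S(1) by simp
      then have "patch T 0 (r S) = patch T' 0 (r S)"
        using patch_eq_subball[OF T(3)] subset_ball by blast
      then have "agree (r S) z S T'" using z(2) by (simp add: agree_def)
      then show ?thesis using a(2)[of S] z T S(1) F(2) by (metis subsetD)
    qed
    then show ?thesis by blast
  qed
  moreover have "smooth (\<lambda>x. W (translate x T)) \<and> closed_form (\<lambda>x. W (translate x T))" if T: "T \<in> \<Omega>" for T
  proof -
    have *: "\<exists>b. smooth b \<and> (\<forall>\<^sub>F x in nhds x0. W (translate x T) = jacobian b x)" for x0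
    proof -
      obtain a r \<delta> where a: "smooth a" "r > 0" "\<delta> > 0"
        "\<forall>T'\<in>\<Omega>. \<forall>z. norm z < \<delta> \<longrightarrow> agree r z (translate x0 T) T' \<longrightarrow> W T' = jacobian a z"
        using local0[OF translate_closed[OF T, of x0]] by (elim exE conjE)
      have "W (translate x T) = jacobian (\<lambda>y. a (y + - x0)) x" if "dist x x0 < \<delta>" for x
      proof -
        have "agree r (x - x0) (translate x0 T) (translate x T)"
          by (simp add: agree_def translate_translate)
        then have "W (translate x T) = jacobian a (x - x0)" using a(4) T that by (simp add: dist_norm)
        moreover have "((\<lambda>y. a (y + - x0)) has_derivative frechet_derivative a (at (x - x0))) (at x)"
          using smooth_shift_has_derivative[OF a(1), of "- x0" x] by simp
        then have "frechet_derivative (\<lambda>y. a (y + - x0)) (at x) = frechet_derivative a (at (x - x0))"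
          using frechet_derivative_at by metis
        ultimately show ?thesis by (simp add: jacobian_def)
      qed
      then show ?thesis using a(3) smooth_shift[OF a(1), of "- x0"]
        by (intro exI[of _ "\<lambda>y. a (y + - x0)"]) (auto simp: eventually_nhds_metric)
    qed
    have "smooth (\<lambda>x. W (translate x T))"
      by (rule smooth_local) (use * smooth_jacobian in blast)
    moreover have "closed_form (\<lambda>x. W (translate x T))"
      unfolding closed_form_def
    proof (intro allI)
      fix x0 v w
      obtain b where b: "smooth b" "\<forall>\<^sub>F x in nhds x0. W (translate x T) = jacobian b x" using * by blast
      then obtain S where S: "open S" "x0 \<in> S" "\<And>x. x \<in> S \<Longrightarrow> W (translate x T) = jacobian b x"
        by (auto simp: eventually_nhds)
      have "((\<lambda>x. W (translate x T)) has_derivative frechet_derivative (jacobian b) (at x0)) (at x0)"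
        by (rule has_derivative_transform_within_open[OF smooth_has_derivative[OF smooth_jacobian[OF b(1)]] S(1,2)])
          (use S(3) in simp)
      from frechet_derivative_at[OF this, symmetric]
      show "frechet_derivative (\<lambda>x. W (translate x T)) (at x0) v *v w -
          frechet_derivative (\<lambda>x. W (translate x T)) (at x0) w *v v = 0"
        using closed_form_jacobian[OF b(1)] unfolding closed_form_def by (simp only:)
    qed
    ultimately show ?thesis by blast
  qed
  ultimately have W: "PE_form W" unfolding PE_form_def by blast
  have "primitive (leaf_integral W) U (c U)" if U: "U \<in> \<U>" for U
    unfolding primitive_def
  proof
    fix T assume T: "T \<in> U"
    obtain a r \<delta> where a: "smooth a" "r > 0" "\<delta> > 0"
      "\<forall>T'\<in>\<Omega>. \<forall>z. norm z < \<delta> \<longrightarrow> agree r z T T' \<longrightarrow> T' \<in> U \<and> c U T' = a z \<and> W T' = jacobian a z"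
      using local[OF U T] by (elim exE conjE)
    have T\<Omega>: "T \<in> \<Omega>" using openin_subset[OF op[OF U]] T by auto
    have "c U T' = c U T + leaf_integral W T z" if T': "T' \<in> \<Omega>" "norm z < \<delta>" "agree r z T T'" for T' z
    proof -
      have "leaf_integral W T z = a z - a 0"
        unfolding leaf_integral_def
      proof (rule form_integral_primitive[of "ball 0 \<delta>"])
        fix y :: "real^'d" assume "y \<in> ball 0 \<delta>"
        then have "W (translate y T) = jacobian a y" using a(4) T\<Omega> by simp
        then show "(a has_derivative (\<lambda>v. W (translate y T) *v v)) (at y within ball 0 \<delta>)"
          using smooth_has_derivative[OF a(1), of y] by (simp add: jacobian_mult[OF a(1)] has_derivative_at_withinI)
      qed (use T'(2) a(3) in auto)
      moreover have "agree r 0 T T" by (simp add: agree_def)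
      then have "c U T = a 0" using a(3,4) T\<Omega> by simp
      moreover have "c U T' = a z" using a(4) T' by blast
      ultimately show ?thesis by simp
    qed
    then show "\<exists>r>0. \<exists>\<delta>>0. \<forall>T'\<in>\<Omega>. \<forall>z. norm z < \<delta> \<longrightarrow> agree r z T T' \<longrightarrow> T' \<in> U \<and> c U T' = c U T + leaf_integral W T z"
      using a(2,3,4) by (intro exI[of _ r] conjI exI[of _ \<delta>]) blast+
  qed
  then have "primitive_cocycle (leaf_integral W) \<U> g"
    unfolding primitive_cocycle_def using cov diff by (intro conjI exI[of _ c]) auto
  then show ?thesis using W by blast
qed

end

section \<open>From finitely additive to Borel probability\<close>

text \<open>A finitely additive probability on all subsets of a compact Hausdorff space is regularised:
  open sets get the supremum of the values of their closed subsets, and Caratheodory's construction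
  does the rest.\<close>

locale finitely_additive_probability =
  fixes Y :: "'a topology" and l :: "'a set \<Rightarrow> real"
  assumes compact: "compact_space Y" and Hausdorff: "Hausdorff_space Y"
    and nonneg: "0 \<le> l A" and total: "l (topspace Y) = 1"
    and additive: "A \<inter> B = {} \<Longrightarrow> A \<union> B \<subseteq> topspace Y \<Longrightarrow> l (A \<union> B) = l A + l B"
begin

lemma mono: "A \<subseteq> B \<Longrightarrow> B \<subseteq> topspace Y \<Longrightarrow> l A \<le> l B"
  using additive[of A "B - A"] nonneg[of "B - A"] by (simp add: Un_absorb1)

lemma empty [simp]: "l {} = 0"
  using additive[of "{}" "{}"] by simp

lemma normal: "normal_space Y"
  using compact Hausdorff by (simp add: compact_Hausdorff_or_regular_imp_normal_space)

definition inner :: "'a set \<Rightarrow> ennreal" where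
  "inner U = (SUP C\<in>{C. closedin Y C \<and> C \<subseteq> U}. ennreal (l C))"

definition outer :: "'a set \<Rightarrow> ennreal" where
  "outer E = (INF U\<in>{U. openin Y U \<and> E \<subseteq> U}. inner U)"

lemma inner_upper: "closedin Y C \<Longrightarrow> C \<subseteq> U \<Longrightarrow> ennreal (l C) \<le> inner U"
  unfolding inner_def by (rule SUP_upper) simp

lemma inner_least: "(\<And>C. closedin Y C \<Longrightarrow> C \<subseteq> U \<Longrightarrow> ennreal (l C) \<le> b) \<Longrightarrow> inner U \<le> b"
  unfolding inner_def by (rule SUP_least) simp

lemma outer_lower: "openin Y U \<Longrightarrow> E \<subseteq> U \<Longrightarrow> outer E \<le> inner U"
  unfolding outer_def by (rule INF_lower) simp

lemma outer_greatest: "(\<And>U. openin Y U \<Longrightarrow> E \<subseteq> U \<Longrightarrow> b \<le> inner U) \<Longrightarrow> b \<le> outer E"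
  unfolding outer_def by (rule INF_greatest) simp

lemma inner_mono: "U \<subseteq> V \<Longrightarrow> inner U \<le> inner V"
  by (rule inner_least) (meson inner_upper subset_trans)

lemma inner_le: "U \<subseteq> topspace Y \<Longrightarrow> inner U \<le> ennreal (l U)"
  by (rule inner_least) (auto intro!: ennreal_leI mono)

lemma outer_open: "openin Y U \<Longrightarrow> outer U = inner U"
  by (intro antisym outer_lower outer_greatest inner_mono) auto

lemma outer_mono: "E \<subseteq> F \<Longrightarrow> outer E \<le> outer F"
  by (rule outer_greatest) (meson outer_lower subset_trans)

lemma inner_empty: "inner {} = 0"
  using inner_le[of "{}"] by simp

lemma outer_empty: "outer {} = 0"
  by (simp add: outer_open inner_empty)

text \<open>By normality a closed subset of \<open>U \<union> V\<close> is the union of a closed subset of \<open>U\<close> and a closed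
  subset of \<open>V\<close>.\<close>

lemma inner_Un:
  assumes "openin Y U" "openin Y V"
  shows "inner (U \<union> V) \<le> inner U + inner V"
proof (rule inner_least)
  fix C assume C: "closedin Y C" "C \<subseteq> U \<union> V"
  have "closedin Y (C - U)" "closedin Y (C - V)" "disjnt (C - U) (C - V)"
    using C assms by (auto simp: closedin_diff disjnt_iff)
  then obtain U' V' where UV: "openin Y U'" "openin Y V'" "C - U \<subseteq> U'" "C - V \<subseteq> V'" "disjnt U' V'"
    using normal unfolding normal_space_def by metis
  have 1: "closedin Y (C - U')" "closedin Y (C - V')" using C(1) UV(1,2) by (simp_all add: closedin_diff)
  have 2: "C - U' \<subseteq> U" "C - V' \<subseteq> V" using UV(3,4) by auto
  have top: "C \<subseteq> topspace Y" using C(1) closedin_subset by blast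
  have "l C \<le> l (C - U') + l (C - V')"
  proof -
    have "C = (C - U') \<union> (C \<inter> U')" by blast
    then have "l C = l (C - U') + l (C \<inter> U')" using additive[of "C - U'" "C \<inter> U'"] top by auto
    moreover have "l (C \<inter> U') \<le> l (C - V')" using UV(5) top by (intro mono) (auto simp: disjnt_iff)
    ultimately show ?thesis by simp
  qed
  then have "ennreal (l C) \<le> ennreal (l (C - U')) + ennreal (l (C - V'))"
    by (simp add: nonneg flip: ennreal_plus)
  also have "\<dots> \<le> inner U + inner V" using 1 2 by (intro add_mono inner_upper)
  finally show "ennreal (l C) \<le> inner U + inner V" .
qed

lemma inner_Union_finite:
  fixes U :: "nat \<Rightarrow> 'a set"
  assumes "\<And>i. openin Y (U i)"
  shows "inner (\<Union>i<n. U i) \<le> (\<Sum>i<n. inner (U i))"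
proof (induction n)
  case (Suc n)
  have "inner (\<Union>i<Suc n. U i) = inner ((\<Union>i<n. U i) \<union> U n)" by (simp add: lessThan_Suc Un_commute)
  also have "\<dots> \<le> inner (\<Union>i<n. U i) + inner (U n)" using assms by (intro inner_Un openin_Union) auto
  also have "\<dots> \<le> (\<Sum>i<n. inner (U i)) + inner (U n)" using Suc by (simp add: add_right_mono)
  finally show ?case by simp
qed (simp add: inner_empty)

text \<open>Closed sets are compact, so finite subadditivity suffices.\<close>

lemma inner_Union:
  fixes U :: "nat \<Rightarrow> 'a set"
  assumes op: "\<And>i. openin Y (U i)"
  shows "inner (\<Union>i. U i) \<le> (\<Sum>i. inner (U i))"
proof (rule inner_least)
  fix C assume C: "closedin Y C" "C \<subseteq> (\<Union>i. U i)"
  have "compactin Y C" using C(1) compact by (simp add: closedin_compact_space)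
  then obtain F where F: "finite F" "F \<subseteq> range U" "C \<subseteq> \<Union>F"
    using C(2) op unfolding compactin_def by (metis (no_types, lifting) rangeE)
  then obtain J where J: "finite J" "F = U ` J" by (meson finite_subset_image)
  define n where "n = Suc (Max (insert 0 J))"
  have "i < n" if "i \<in> J" for i using that J(1) by (simp add: n_def less_Suc_eq_le)
  then have "C \<subseteq> (\<Union>i<n. U i)" using F(3) J(2) by blast
  then have "ennreal (l C) \<le> inner (\<Union>i<n. U i)" by (rule inner_upper[OF C(1)])
  also have "\<dots> \<le> (\<Sum>i<n. inner (U i))" by (rule inner_Union_finite[OF op])
  also have "\<dots> \<le> (\<Sum>i. inner (U i))" by (rule sum_le_suminf) auto
  finally show "ennreal (l C) \<le> (\<Sum>i. inner (U i))" .
qed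

lemma outer_Union:
  fixes E :: "nat \<Rightarrow> 'a set"
  assumes "\<And>i. E i \<subseteq> topspace Y"
  shows "outer (\<Union>i. E i) \<le> (\<Sum>i. outer (E i))"
proof (rule ennreal_le_epsilon)
  fix e :: real assume fin: "(\<Sum>i. outer (E i)) < top" and e: "0 < e"
  have "\<exists>U. openin Y U \<and> E i \<subseteq> U \<and> inner U \<le> outer (E i) + ennreal (e * (1 / 2) ^ Suc i)" for i
  proof -
    have "outer (E i) \<le> (\<Sum>i. outer (E i))" using sum_le_suminf[of "\<lambda>i. outer (E i)" "{i}"] by simp
    then have "outer (E i) < top" using fin by (rule le_less_trans)
    then have "outer (E i) + 0 < outer (E i) + ennreal (e * (1 / 2) ^ Suc i)"
      using e by (subst ennreal_add_left_cancel_less) auto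
    then have "outer (E i) < outer (E i) + ennreal (e * (1 / 2) ^ Suc i)" by simp
    then show ?thesis unfolding outer_def[of "E i"] INF_less_iff by (auto intro: less_imp_le)
  qed
  then obtain U where U: "\<And>i. openin Y (U i)" "\<And>i. E i \<subseteq> U i"
    "\<And>i. inner (U i) \<le> outer (E i) + ennreal (e * (1 / 2) ^ Suc i)" by metis
  have "outer (\<Union>i. E i) \<le> inner (\<Union>i. U i)" using U(1,2) by (intro outer_lower openin_Union) blast+
  also have "\<dots> \<le> (\<Sum>i. inner (U i))" by (rule inner_Union[OF U(1)])
  also have "\<dots> \<le> (\<Sum>i. outer (E i) + ennreal (e * (1 / 2) ^ Suc i))"
    by (intro suminf_le U(3)) auto
  also have "\<dots> = (\<Sum>i. outer (E i)) + (\<Sum>i. ennreal (e * (1 / 2) ^ Suc i))"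
    by (rule suminf_add[symmetric]) auto
  also have "(\<Sum>i. ennreal (e * (1 / 2) ^ Suc i)) = ennreal e"
  proof (rule suminf_ennreal_eq)
    show "(\<lambda>i. e * (1 / 2) ^ Suc i) sums e" using sums_mult[OF power_half_series, of e] by simp
  qed (use e in simp)
  finally show "outer (\<Union>i. E i) \<le> (\<Sum>i. outer (E i)) + ennreal e" .
qed

lemma outer_measure: "outer_measure_space (Pow (topspace Y)) outer"
  unfolding outer_measure_space_def positive_def increasing_def countably_subadditive_def
proof (intro conjI ballI allI impI)
  fix A :: "nat \<Rightarrow> 'a set" assume "range A \<subseteq> Pow (topspace Y)"
  then show "outer (\<Union>i. A i) \<le> (\<Sum>i. outer (A i))" by (intro outer_Union) auto
qed (simp_all add: outer_empty outer_mono)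

text \<open>Closed subsets of \<open>V \<inter> W\<close> and of the rest of \<open>W\<close> are disjoint, so \<open>l\<close> is additive on them; hence
  open sets are measurable in the sense of Caratheodory.\<close>

lemma open_lambda_system:
  assumes V: "openin Y V"
  shows "V \<in> lambda_system (topspace Y) (Pow (topspace Y)) outer"
proof -
  have "outer (V \<inter> E) + outer ((topspace Y - V) \<inter> E) \<le> outer E" if E: "E \<subseteq> topspace Y" for E
  proof (rule outer_greatest)
    fix W assume W: "openin Y W" "E \<subseteq> W"
    define m where "m = outer (W - V)"
    have "ennreal (l C) + m \<le> inner W" if C: "closedin Y C" "C \<subseteq> V \<inter> W" for C
    proof -
      have "ennreal (l C) + m \<le> ennreal (l C) + inner (W - C)"
        unfolding m_def using W C by (intro add_left_mono outer_lower openin_diff) auto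
      also have "\<dots> = (SUP D\<in>{D. closedin Y D \<and> D \<subseteq> W - C}. ennreal (l C) + ennreal (l D))"
        unfolding inner_def by (rule ennreal_SUP_add_right) (auto intro!: exI[of _ "{}"])
      also have "\<dots> \<le> inner W"
      proof (rule SUP_least)
        fix D assume "D \<in> {D. closedin Y D \<and> D \<subseteq> W - C}"
        then have D: "closedin Y D" "D \<subseteq> W - C" by auto
        have "C \<union> D \<subseteq> topspace Y" using C(1) D(1) closedin_subset by blast
        then have "l (C \<union> D) = l C + l D" using additive[of C D] D(2) by blast
        then have "ennreal (l C) + ennreal (l D) = ennreal (l (C \<union> D))" by (simp add: nonneg flip: ennreal_plus)
        also have "\<dots> \<le> inner W" using C D by (intro inner_upper closedin_Un) auto
        finally show "ennreal (l C) + ennreal (l D) \<le> inner W" .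
      qed
      finally show ?thesis .
    qed
    then have "(SUP C\<in>{C. closedin Y C \<and> C \<subseteq> V \<inter> W}. ennreal (l C) + m) \<le> inner W"
      by (intro SUP_least) auto
    moreover have "(SUP C\<in>{C. closedin Y C \<and> C \<subseteq> V \<inter> W}. ennreal (l C) + m) = inner (V \<inter> W) + m"
      unfolding inner_def by (rule ennreal_SUP_add_left) (auto intro!: exI[of _ "{}"])
    ultimately have "inner (V \<inter> W) + m \<le> inner W" by simp
    moreover have "outer (V \<inter> E) \<le> inner (V \<inter> W)" using V W by (intro outer_lower openin_Int) auto
    moreover have "outer ((topspace Y - V) \<inter> E) \<le> m" unfolding m_def using W(2) by (intro outer_mono) auto
    ultimately show "outer (V \<inter> E) + outer ((topspace Y - V) \<inter> E) \<le> inner W"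
      using add_mono order_trans by blast
  qed
  moreover have "outer E \<le> outer (V \<inter> E) + outer ((topspace Y - V) \<inter> E)" if E: "E \<subseteq> topspace Y" for E
  proof -
    define A where "A i = (if i = 0 then V \<inter> E else if i = Suc 0 then (topspace Y - V) \<inter> E else {})" for i :: nat
    have "E = (\<Union>i. A i)"
    proof
      show "E \<subseteq> (\<Union>i. A i)"
      proof
        fix x assume "x \<in> E"
        then have "x \<in> A 0 \<union> A (Suc 0)" using E by (auto simp: A_def)
        then show "x \<in> (\<Union>i. A i)" by blast
      qed
    qed (auto simp: A_def)
    moreover have "A i \<subseteq> topspace Y" for i using E by (auto simp: A_def)
    ultimately have "outer E \<le> (\<Sum>i. outer (A i))" using outer_Union[of A] by simp
    also have "\<dots> = (\<Sum>i<Suc (Suc 0). outer (A i))"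
      by (rule suminf_finite) (auto simp: A_def outer_empty)
    finally show ?thesis by (simp add: A_def)
  qed
  ultimately show ?thesis
    unfolding lambda_system_def using openin_subset[OF V] by (auto intro!: antisym)
qed

definition Borel :: "'a set set" where
  "Borel = sigma_sets (topspace Y) {U. openin Y U}"

definition measure :: "'a measure" where
  "measure = measure_of (topspace Y) Borel outer"

lemma sigma_algebra_Borel: "sigma_algebra (topspace Y) Borel"
  unfolding Borel_def by (rule sigma_algebra_sigma_sets) (use openin_subset in auto)

lemma space_measure [simp]: "space measure = topspace Y"
  unfolding measure_def by (rule space_measure_of) (use sigma_sets_into_sp[of "{U. openin Y U}" "topspace Y"] openin_subset in \<open>auto simp: Borel_def\<close>)

lemma sets_measure [simp]: "sets measure = Borel"
  unfolding measure_def by (rule sigma_algebra.sets_measure_of_eq[OF sigma_algebra_Borel])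

lemma emeasure_measure:
  assumes "B \<in> Borel"
  shows "emeasure measure B = outer B"
proof -
  define Q where "Q = lambda_system (topspace Y) (Pow (topspace Y)) outer"
  have Q: "measure_space (topspace Y) Q outer"
    unfolding Q_def by (rule sigma_algebra.caratheodory_lemma[OF sigma_algebra_Pow outer_measure])
  then have "sigma_algebra (topspace Y) Q" "countably_additive Q outer" unfolding measure_space_def by blast+
  moreover have "{U. openin Y U} \<subseteq> Q" unfolding Q_def using open_lambda_system by blast
  ultimately have "Borel \<subseteq> Q" unfolding Borel_def by (intro sigma_algebra.sigma_sets_subset) auto
  then have "countably_additive Borel outer"
    using \<open>countably_additive Q outer\<close> unfolding countably_additive_def by blast
  then show ?thesis
    unfolding measure_def
    by (intro emeasure_measure_of_sigma[OF sigma_algebra_Borel _ _ assms]) (simp_all add: positive_def outer_empty)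
qed

lemma open_Borel: "openin Y U \<Longrightarrow> U \<in> Borel"
  unfolding Borel_def by auto

lemma closed_Borel:
  assumes "closedin Y C"
  shows "C \<in> Borel"
proof -
  have "topspace Y - (topspace Y - C) \<in> Borel"
    unfolding Borel_def using assms by (intro sigma_sets.Compl sigma_sets.Basic) (auto simp: closedin_def)
  moreover have "topspace Y - (topspace Y - C) = C" using closedin_subset[OF assms] by blast
  ultimately show ?thesis by simp
qed

lemma prob_space_measure: "prob_space measure"
proof (rule prob_spaceI)
  have "inner (topspace Y) \<le> 1" using inner_le[of "topspace Y"] total by simp
  moreover have "1 \<le> inner (topspace Y)" using inner_upper[OF closedin_topspace subset_refl] total by simp
  ultimately have "inner (topspace Y) = 1" by (rule antisym)
  then show "emeasure measure (space measure) = 1"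
    by (simp add: emeasure_measure open_Borel outer_open)
qed

text \<open>Regularisation preserves invariance under a homeomorphism.\<close>

lemma outer_image_le:
  assumes f: "homeomorphic_map Y Y f" and l: "\<And>A. A \<subseteq> topspace Y \<Longrightarrow> l (f ` A) = l A"
    and E: "E \<subseteq> topspace Y"
  shows "outer (f ` E) \<le> outer E"
proof (rule outer_greatest)
  fix U assume U: "openin Y U" "E \<subseteq> U"
  have top: "U \<subseteq> topspace Y" using openin_subset[OF U(1)] .
  have "openin Y (f ` U)" using homeomorphic_imp_open_map[OF f] U(1) unfolding open_map_def by blast
  then have "outer (f ` E) \<le> inner (f ` U)" using U(2) by (intro outer_lower) auto
  also have "\<dots> \<le> inner U"
  proof (rule inner_least)
    fix C assume C: "closedin Y C" "C \<subseteq> f ` U"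
    define D where "D = {x \<in> topspace Y. f x \<in> C}"
    have D: "closedin Y D"
      unfolding D_def using closedin_continuous_map_preimage[OF homeomorphic_imp_continuous_map[OF f] C(1)] .
    have inj: "inj_on f (topspace Y)" using homeomorphic_imp_injective_map[OF f] .
    have "f ` D = C" using C(2) top by (auto simp: D_def)
    moreover have "D \<subseteq> U"
    proof
      fix x assume x: "x \<in> D"
      then obtain y where "y \<in> U" "f x = f y" using C(2) by (auto simp: D_def)
      then show "x \<in> U" using inj x top by (auto simp: D_def inj_on_def)
    qed
    moreover have "D \<subseteq> topspace Y" by (auto simp: D_def)
    ultimately show "ennreal (l C) \<le> inner U"
      using l[of D] inner_upper[OF D, of U] by simp
  qed
  finally show "outer (f ` E) \<le> inner U" .
qed

end

section \<open>Uniform averages over orbits\<close>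

definition avg :: "(real^'d::finite) list \<Rightarrow> (('d, 'l) pattern \<Rightarrow> 'e::real_vector) \<Rightarrow> ('d, 'l) pattern \<Rightarrow> 'e" where
  "avg xs F T = (\<Sum>s\<leftarrow>xs. F (translate s T)) /\<^sub>R real (length xs)"

text \<open>Averaging along these sums is averaging along one list and then along the other.\<close>

definition list_sums :: "(real^'d::finite) list \<Rightarrow> (real^'d) list \<Rightarrow> (real^'d) list" where
  "list_sums xs ys = concat (map (\<lambda>x. map (\<lambda>y. y + x) ys) xs)"

lemma list_sums_eq_Nil [simp]: "list_sums xs ys = [] \<longleftrightarrow> xs = [] \<or> ys = []"
  by (auto simp: list_sums_def)

lemma sum_list_scaleR: "(\<Sum>x\<leftarrow>xs. f x /\<^sub>R c) = (\<Sum>x\<leftarrow>xs. f x) /\<^sub>R c" for f :: "_ \<Rightarrow> 'e::real_vector"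
  by (induction xs) (simp_all add: scaleR_add_right)

lemma avg_list_sums: "avg (list_sums xs ys) F T = avg xs (avg ys F) T"
proof -
  have len: "length (list_sums xs ys) = length xs * length ys"
    by (induction xs) (simp_all add: list_sums_def)
  have "(\<Sum>s\<leftarrow>list_sums xs ys. F (translate s T)) = (\<Sum>x\<leftarrow>xs. \<Sum>y\<leftarrow>ys. F (translate y (translate x T)))"
    by (induction xs) (simp_all add: list_sums_def translate_translate o_def)
  then show ?thesis unfolding avg_def[abs_def] by (simp add: len sum_list_scaleR)
qed

lemma sum_list_swap:
  "(\<Sum>x\<leftarrow>xs. \<Sum>y\<leftarrow>ys. f x y) = (\<Sum>y\<leftarrow>ys. \<Sum>x\<leftarrow>xs. f x y)" for f :: "_ \<Rightarrow> _ \<Rightarrow> 'e::comm_monoid_add"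
  by (induction xs) (simp_all add: sum_list_addf)

lemma avg_commute: "avg xs (avg ys F) T = avg ys (avg xs F) T"
proof -
  have "(\<Sum>x\<leftarrow>xs. \<Sum>y\<leftarrow>ys. F (translate y (translate x T))) = (\<Sum>y\<leftarrow>ys. \<Sum>x\<leftarrow>xs. F (translate x (translate y T)))"
    by (subst sum_list_swap) (simp add: translate_translate add.commute)
  then show ?thesis unfolding avg_def[abs_def] by (simp add: sum_list_scaleR mult.commute)
qed

lemma avg_add: "avg xs (\<lambda>T. F T + G T) T = avg xs F T + avg xs G T"
  by (simp add: avg_def sum_list_addf scaleR_add_right)

lemma avg_diff: "avg xs (\<lambda>T. F T - G T) T = avg xs F T - avg xs G T"
  by (simp add: avg_def sum_list_subtractf scaleR_diff_right)

lemma avg_mult: "avg xs (\<lambda>T. c * F T) T = c * avg xs F T" for F :: "_ \<Rightarrow> real"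
  by (simp add: avg_def sum_list_const_mult)

lemma avg_const: "xs \<noteq> [] \<Longrightarrow> avg xs (\<lambda>_. c) T = c" for c :: real
  by (simp add: avg_def sum_list_triv)

context flc_space
begin

lemma avg_mono:
  fixes F G :: "('d, 'l) pattern \<Rightarrow> real"
  assumes "\<And>S. S \<in> \<Omega> \<Longrightarrow> F S \<le> G S" "T \<in> \<Omega>"
  shows "avg xs F T \<le> avg xs G T"
  unfolding avg_def real_scaleR_def using assms by (intro mult_left_mono sum_list_mono) auto

lemma avg_le:
  fixes F :: "('d, 'l) pattern \<Rightarrow> real"
  assumes "\<And>S. S \<in> \<Omega> \<Longrightarrow> F S \<le> b" "T \<in> \<Omega>" "xs \<noteq> []"
  shows "avg xs F T \<le> b"
  using avg_mono[of F "\<lambda>_. b"] assms avg_const[OF assms(3)] by metis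

lemma avg_less:
  fixes F :: "('d, 'l) pattern \<Rightarrow> real"
  assumes "\<And>S. S \<in> \<Omega> \<Longrightarrow> F S < b" "T \<in> \<Omega>" "xs \<noteq> []"
  shows "avg xs F T < b"
proof -
  have "(\<Sum>s\<leftarrow>xs. F (translate s T)) < (\<Sum>s\<leftarrow>xs. b)"
    using assms(3) by (induction xs rule: list_nonempty_induct)
      (auto intro!: add_strict_mono assms(1) translate_closed assms(2))
  then show ?thesis using assms(3) by (simp add: avg_def sum_list_triv field_simps)
qed

lemma avg_abs_le:
  fixes F :: "('d, 'l) pattern \<Rightarrow> real"
  assumes "\<And>S. S \<in> \<Omega> \<Longrightarrow> \<bar>F S\<bar> \<le> b" "T \<in> \<Omega>" "xs \<noteq> []"
  shows "\<bar>avg xs F T\<bar> \<le> b"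
proof -
  have "avg xs F T \<le> b" using assms by (intro avg_le) (auto simp: abs_le_iff)
  moreover have "avg xs (\<lambda>T. - 1 * F T) T \<le> b" using assms by (intro avg_le) (auto simp: abs_le_iff)
  ultimately show ?thesis unfolding avg_mult by simp
qed

text \<open>Taken over all bounded functions \<open>G\<close>, so that it survives further averaging.\<close>

definition almost_invariant :: "real^'d \<Rightarrow> nat \<Rightarrow> (real^'d) list \<Rightarrow> bool" where
  "almost_invariant x n xs \<longleftrightarrow> (\<forall>G b T. (\<forall>S\<in>\<Omega>. \<bar>G S\<bar> \<le> b) \<longrightarrow> T \<in> \<Omega> \<longrightarrow>
     \<bar>avg xs (\<lambda>S. G (translate x S)) T - avg xs G T\<bar> \<le> 2 * b / real n)"

text \<open>Averages of \<open>G\<close> and its translate along \<open>0, x, \<dots>, (n - 1) x\<close> differ in the first and the last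
  term only.\<close>

lemma almost_invariant_steps:
  assumes "n > 0"
  shows "almost_invariant x n (map (\<lambda>k. real k *\<^sub>R x) [0..<n])"
  unfolding almost_invariant_def
proof (intro allI impI)
  fix G :: "('d, 'l) pattern \<Rightarrow> real" and b T
  assume b: "\<forall>S\<in>\<Omega>. \<bar>G S\<bar> \<le> b" and T: "T \<in> \<Omega>"
  define h where "h k = G (translate (real k *\<^sub>R x) T)" for k
  have "avg (map (\<lambda>k. real k *\<^sub>R x) [0..<n]) (\<lambda>S. G (translate x S)) T - avg (map (\<lambda>k. real k *\<^sub>R x) [0..<n]) G T
      = ((\<Sum>k<n. h (Suc k)) - (\<Sum>k<n. h k)) / real n"
    by (simp add: avg_def h_def translate_translate o_def interv_sum_list_conv_sum_set_nat atLeast0LessThan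
        algebra_simps divide_inverse scaleR_add_left)
  also have "\<dots> = (h n - h 0) / real n"
    by (simp add: sum_subtractf[symmetric] sum_lessThan_telescope)
  finally have eq: "avg (map (\<lambda>k. real k *\<^sub>R x) [0..<n]) (\<lambda>S. G (translate x S)) T - avg (map (\<lambda>k. real k *\<^sub>R x) [0..<n]) G T
      = (h n - h 0) / real n" .
  have "\<bar>h n\<bar> \<le> b" "\<bar>h 0\<bar> \<le> b" unfolding h_def using b T by auto
  then have "\<bar>h n - h 0\<bar> \<le> 2 * b" by linarith
  then show "\<bar>avg (map (\<lambda>k. real k *\<^sub>R x) [0..<n]) (\<lambda>S. G (translate x S)) T - avg (map (\<lambda>k. real k *\<^sub>R x) [0..<n]) G T\<bar>
      \<le> 2 * b / real n"
    unfolding eq using assms by (simp add: divide_right_mono)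
qed

lemma almost_invariant_sums:
  assumes "xs \<noteq> []" "ys \<noteq> []" "almost_invariant x n xs \<or> almost_invariant x n ys"
  shows "almost_invariant x n (list_sums xs ys)"
proof -
  have *: "\<bar>avg zs (avg ws (\<lambda>S. G (translate x S))) T - avg zs (avg ws G) T\<bar> \<le> 2 * b / real n"
    if "zs \<noteq> []" "almost_invariant x n ws" "\<forall>S\<in>\<Omega>. \<bar>G S\<bar> \<le> b" "T \<in> \<Omega>" for zs ws G b T
  proof -
    have "\<bar>avg zs (\<lambda>S. avg ws (\<lambda>S. G (translate x S)) S - avg ws G S) T\<bar> \<le> 2 * b / real n"
      by (rule avg_abs_le[OF _ that(4,1)]) (use that(2,3) in \<open>simp add: almost_invariant_def\<close>)
    then show ?thesis by (simp only: avg_diff[of zs "avg ws (\<lambda>S. G (translate x S))" "avg ws G" T])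
  qed
  show ?thesis
    unfolding almost_invariant_def avg_list_sums
    using assms *[OF assms(1), of ys] *[OF assms(2), of xs] by (metis avg_commute)
qed

lemma almost_invariant_finite:
  assumes "finite A" "\<And>x n. (x, n) \<in> A \<Longrightarrow> n > 0"
  shows "\<exists>xs. xs \<noteq> [] \<and> (\<forall>(x, n)\<in>A. almost_invariant x n xs)"
  using assms
proof (induction A)
  case empty
  show ?case by (intro exI[of _ "[0]"]) simp
next
  case (insert a A)
  obtain x n where a: "a = (x, n)" by fastforce
  then have n: "n > 0" using insert.prems[of x n] by simp
  have "\<exists>xs. xs \<noteq> [] \<and> (\<forall>(x, n)\<in>A. almost_invariant x n xs)" by (rule insert.IH) (use insert.prems in blast)
  then obtain xs where xs: "xs \<noteq> []" "\<forall>(x, n)\<in>A. almost_invariant x n xs" by blast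
  define ys where "ys = map (\<lambda>k. real k *\<^sub>R x) [0..<n]"
  have ys: "ys \<noteq> []" "almost_invariant x n ys" unfolding ys_def using almost_invariant_steps[OF n] n by auto
  have "almost_invariant y m (list_sums xs ys)" if "(y, m) \<in> insert a A" for y m
    using that xs ys a by (intro almost_invariant_sums) auto
  then show ?case using xs(1) ys(1) by (intro exI[of _ "list_sums xs ys"]) auto
qed

definition bdd :: "(('d, 'l) pattern \<Rightarrow> real) \<Rightarrow> bool" where
  "bdd G \<longleftrightarrow> (\<exists>b. \<forall>S\<in>\<Omega>. \<bar>G S\<bar> \<le> b)"

lemma bdd_add: "bdd F \<Longrightarrow> bdd G \<Longrightarrow> bdd (\<lambda>T. F T + G T)"
  unfolding bdd_def by (meson abs_triangle_ineq add_mono order_trans)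

lemma bdd_mult: "bdd F \<Longrightarrow> bdd (\<lambda>T. c * F T)"
  unfolding bdd_def by (metis abs_ge_zero abs_mult mult_left_mono)

lemma bdd_translate: "bdd F \<Longrightarrow> bdd (\<lambda>T. F (translate x T))"
  unfolding bdd_def using translate_closed by blast

lemma bdd_indicator: "bdd (indicator A)"
  unfolding bdd_def by (intro exI[of _ 1]) (simp add: indicator_def)

lemma closed_imp: "(P \<Longrightarrow> closed {x. Q x}) \<Longrightarrow> closed {x. P \<longrightarrow> Q x}"
  by (cases P) auto

definition invariant_mean :: "((('d, 'l) pattern \<Rightarrow> real) \<Rightarrow> real) \<Rightarrow> bool" where
  "invariant_mean \<Lambda> \<longleftrightarrow>
     (\<forall>G H. bdd G \<longrightarrow> bdd H \<longrightarrow> \<Lambda> (\<lambda>T. G T + H T) = \<Lambda> G + \<Lambda> H) \<and>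
     (\<forall>G c. bdd G \<longrightarrow> \<Lambda> (\<lambda>T. c * G T) = c * \<Lambda> G) \<and>
     (\<forall>G. bdd G \<longrightarrow> (\<forall>T\<in>\<Omega>. 0 \<le> G T) \<longrightarrow> 0 \<le> \<Lambda> G) \<and>
     \<Lambda> (indicator \<Omega>) = 1 \<and>
     (\<forall>G x. bdd G \<longrightarrow> \<Lambda> (\<lambda>T. G (translate x T)) = \<Lambda> G)"

text \<open>Averages over lists, evaluated at single patterns, lie in a compact product of intervals. The
  conditions on \<open>\<Lambda>\<close> are closed, invariance being stated as invariance up to errors of order \<open>1/n\<close>,
  and any finitely many of them are met by the average over a suitable list. So all of them are met
  by some \<open>\<Lambda>\<close>.\<close>

lemma invariant_mean_exists:
  assumes F: "bdd F" and c: "\<And>xs. xs \<noteq> [] \<Longrightarrow> \<exists>T\<in>\<Omega>. c \<le> avg xs F T"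
  shows "\<exists>\<Lambda>. invariant_mean \<Lambda> \<and> c \<le> \<Lambda> F"
proof -
  define N where "N G = (SOME b. \<forall>S\<in>\<Omega>. \<bar>G S\<bar> \<le> b)" for G :: "('d, 'l) pattern \<Rightarrow> real"
  have N: "\<bar>G S\<bar> \<le> N G" if "bdd G" "S \<in> \<Omega>" for G S
    using that someI_ex[of "\<lambda>b. \<forall>S\<in>\<Omega>. \<bar>G S\<bar> \<le> b"] unfolding N_def bdd_def by blast
  define K where "K = PiE UNIV (\<lambda>G. if bdd G then {- N G..N G} else {0})"
  define A :: "((('d, 'l) pattern \<Rightarrow> real) \<Rightarrow> real) set" where "A = {\<Lambda>.
     (\<forall>G H. bdd G \<longrightarrow> bdd H \<longrightarrow> \<Lambda> (\<lambda>T. G T + H T) = \<Lambda> G + \<Lambda> H) \<and>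
     (\<forall>G c. bdd G \<longrightarrow> \<Lambda> (\<lambda>T. c * G T) = c * \<Lambda> G) \<and>
     (\<forall>G. bdd G \<longrightarrow> (\<forall>T\<in>\<Omega>. 0 \<le> G T) \<longrightarrow> 0 \<le> \<Lambda> G) \<and>
     \<Lambda> (indicator \<Omega>) = 1 \<and> c \<le> \<Lambda> F}"
  define B where "B = (\<lambda>(x, n::nat). {\<Lambda>. \<forall>G. bdd G \<longrightarrow> \<bar>\<Lambda> (\<lambda>T. G (translate x T)) - \<Lambda> G\<bar> \<le> 2 * N G / real n})"
  define m where "m xs T G = (if bdd G then avg xs G T else 0)" for xs T G
  have cK: "compact K"
  proof -
    have "compactin (product_topology (\<lambda>_. euclidean) UNIV) K"
      unfolding K_def by (simp add: compactin_PiE)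
    then show ?thesis by (simp add: euclidean_product_topology)
  qed
  have coord: "continuous_on UNIV (\<lambda>\<Lambda>::(('d, 'l) pattern \<Rightarrow> real) \<Rightarrow> real. \<Lambda> G)" for G
    by (rule continuous_on_product_coordinates)
  have clA: "closed A"
    unfolding A_def
    by (intro closed_Collect_conj closed_Collect_all closed_imp closed_Collect_eq closed_Collect_le
        continuous_on_add continuous_on_mult continuous_on_const coord)
  have clB: "closed (B p)" for p
    unfolding B_def split_beta
    by (intro closed_Collect_all closed_imp closed_Collect_le continuous_on_rabs continuous_on_diff continuous_on_const coord)
  have mA: "m xs T \<in> A" if T: "T \<in> \<Omega>" "xs \<noteq> []" "c \<le> avg xs F T" for xs T
  proof -
    have "avg xs (indicator \<Omega>) T = (1::real)"
    proof -
      have "avg xs (indicator \<Omega>) T = avg xs (\<lambda>_. 1::real) T"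
        using avg_mono[of "indicator \<Omega>" "\<lambda>_. 1::real" T xs] avg_mono[of "\<lambda>_. 1::real" "indicator \<Omega>" T xs] T(1)
        by (auto intro: antisym)
      then show ?thesis by (simp only: avg_const[OF T(2)])
    qed
    moreover have "0 \<le> avg xs G T" if "\<forall>T\<in>\<Omega>. 0 \<le> G T" for G :: "('d, 'l) pattern \<Rightarrow> real"
      using avg_mono[of "\<lambda>_. 0" G T xs] that T(1) avg_const[OF T(2), of 0 T] by simp
    ultimately show ?thesis
      unfolding A_def m_def using T F bdd_add bdd_mult bdd_indicator by (simp add: avg_add avg_mult)
  qed
  have mK: "m xs T \<in> K" if "T \<in> \<Omega>" "xs \<noteq> []" for xs T
  proof -
    have "\<bar>avg xs G T\<bar> \<le> N G" if "bdd G" for G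
      by (rule avg_abs_le[OF N[OF that] \<open>T \<in> \<Omega>\<close> \<open>xs \<noteq> []\<close>])
    then show ?thesis unfolding K_def m_def by (auto simp: abs_le_iff minus_le_iff)
  qed
  have mB: "m xs T \<in> B (x, n)" if "T \<in> \<Omega>" "almost_invariant x n xs" for xs T x n
    using that N bdd_translate unfolding B_def m_def almost_invariant_def by auto
  define \<F> where "\<F> = insert A (B ` (UNIV \<times> {0<..}))"
  have "K \<inter> \<Inter>\<F> \<noteq> {}"
  proof (rule compact_imp_fip[OF cK])
    show "closed C" if "C \<in> \<F>" for C using that clA clB unfolding \<F>_def by blast
    fix \<G> assume G: "finite \<G>" "\<G> \<subseteq> \<F>"
    have "finite (\<G> - {A})" "\<G> - {A} \<subseteq> B ` (UNIV \<times> {0<..})" using G by (auto simp: \<F>_def)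
    then obtain Q where Q: "Q \<subseteq> UNIV \<times> {0<..}" "finite Q" "\<G> - {A} = B ` Q" by (meson finite_subset_image)
    obtain xs where xs: "xs \<noteq> []" "\<forall>(x, n)\<in>Q. almost_invariant x n xs"
      using almost_invariant_finite[OF Q(2)] Q(1) by blast
    obtain T where T: "T \<in> \<Omega>" "c \<le> avg xs F T" using c[OF xs(1)] by blast
    have "m xs T \<in> C" if C: "C \<in> \<G>" for C
    proof (cases "C = A")
      case True
      then show ?thesis using mA[OF T(1) xs(1) T(2)] by simp
    next
      case False
      then have "C \<in> B ` Q" using C unfolding Q(3)[symmetric] by blast
      then obtain x n where "(x, n) \<in> Q" "C = B (x, n)" by auto
      then show ?thesis using mB[OF T(1), of x n xs] xs(2) by auto
    qed
    then have "m xs T \<in> K \<inter> \<Inter>\<G>" using mK[OF T(1) xs(1)] by simp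
    then show "K \<inter> \<Inter>\<G> \<noteq> {}" by (metis empty_iff)
  qed
  then obtain \<Lambda> where L: "\<Lambda> \<in> \<Inter>\<F>" by blast
  have \<Lambda>: "\<Lambda> \<in> A" "\<And>x n. n > 0 \<Longrightarrow> \<Lambda> \<in> B (x, n)" using L unfolding \<F>_def by auto
  have "\<Lambda> (\<lambda>T. G (translate x T)) = \<Lambda> G" if G: "bdd G" for G x
  proof -
    define d where "d = \<bar>\<Lambda> (\<lambda>T. G (translate x T)) - \<Lambda> G\<bar>"
    have "d \<le> 2 * N G / real n" if "n > 0" for n
      using \<Lambda>(2)[OF that, of x] G unfolding B_def d_def by blast
    then have "d \<le> 2 * N G / real (Suc n)" for n by blast
    moreover have "(\<lambda>n. 2 * N G / real (Suc n)) \<longlonglongrightarrow> 0"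
      using LIMSEQ_Suc[OF lim_const_over_n] by blast
    ultimately have "d \<le> 0" by (intro LIMSEQ_le_const[of _ 0 d]) auto
    then show ?thesis by (simp add: d_def)
  qed
  then show ?thesis using \<Lambda>(1) unfolding invariant_mean_def A_def by blast
qed

end

text \<open>Counting thresholds \<open>i/n\<close> approximates a number; with \<open>y = F T\<close> this approximates a function by
  indicators of its superlevel sets.\<close>

lemma sum_thresholds:
  fixes y :: real
  assumes "0 \<le> y" "y \<le> 1" "n > 0"
  defines "s \<equiv> (\<Sum>i=1..n. if real i / real n \<le> y then 1 else (0::real)) / real n"
  shows "s \<le> y" "y \<le> s + 1 / real n"
proof -
  have iff: "real i / real n \<le> y \<longleftrightarrow> i \<le> nat \<lfloor>y * n\<rfloor>" for i
    using assms by (simp add: pos_divide_le_eq le_nat_iff le_floor_iff)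
  have "nat \<lfloor>y * n\<rfloor> \<le> n"
  proof -
    have "y * n \<le> 1 * real n" using assms(2) by (intro mult_right_mono) auto
    then have "\<lfloor>y * n\<rfloor> \<le> \<lfloor>real n\<rfloor>" by (intro floor_mono) simp
    then show ?thesis by (simp add: nat_le_iff)
  qed
  then have "{1..n} \<inter> {i. i \<le> nat \<lfloor>y * n\<rfloor>} = {1..nat \<lfloor>y * n\<rfloor>}" by auto
  then have "(\<Sum>i=1..n. if real i / real n \<le> y then 1 else (0::real)) = real (nat \<lfloor>y * n\<rfloor>)"
    unfolding iff by (simp add: sum.If_cases)
  then have s: "s * n = of_int \<lfloor>y * n\<rfloor>" using assms by (simp add: s_def)
  have "s * n \<le> y * n" "y * n \<le> (s + 1 / n) * n"
    unfolding distrib_right s using assms(3) by (simp_all add: of_int_floor_le)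
  then show "s \<le> y" "y \<le> s + 1 / real n" using assms(3) by simp_all
qed

context flc_space
begin

lemma continuous_bdd:
  assumes "continuous_map X euclideanreal F"
  shows "bdd F"
proof -
  have "compactin euclideanreal (F ` \<Omega>)"
    using image_compactin[OF _ assms] compact by (simp add: compact_space_def)
  then have "bounded (F ` \<Omega>)" by (simp add: compact_imp_bounded)
  then show ?thesis unfolding bdd_def bounded_iff by auto
qed

lemma homeomorphic_map_translate: "homeomorphic_map X X (translate x)"
proof -
  have "homeomorphic_maps X X (translate x) (translate (- x))"
    unfolding homeomorphic_maps_def using continuous_translate by simp
  then show ?thesis using homeomorphic_maps_map by blast
qed

lemma translate_image_iff: "T \<in> translate x ` A \<longleftrightarrow> translate (- x) T \<in> A"
proof
  assume "translate (- x) T \<in> A"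
  then have "translate x (translate (- x) T) \<in> translate x ` A" by (rule imageI)
  then show "T \<in> translate x ` A" by simp
qed auto

lemma measurable_continuous:
  fixes F :: "('d, 'l) pattern \<Rightarrow> 'e::real_normed_vector"
  assumes "continuous_map X euclidean F" "space M = \<Omega>" "sets M = sigma_sets \<Omega> {U. openin X U}"
  shows "F \<in> borel_measurable M"
proof (rule borel_measurableI)
  fix S :: "'e set" assume "open S"
  then have "openin X {T \<in> topspace X. F T \<in> S}" using openin_continuous_map_preimage[OF assms(1), of S] by simp
  moreover have "F -` S \<inter> space M = {T \<in> topspace X. F T \<in> S}" using assms(2) by auto
  ultimately show "F -` S \<inter> space M \<in> sets M" using assms(3) by auto
qed

lemma measurable_translate:
  assumes "space M = \<Omega>" "sets M = sigma_sets \<Omega> {U. openin X U}"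
  shows "translate x \<in> measurable M M"
proof (rule measurable_sigma_sets[OF assms(2)])
  show "{U. openin X U} \<subseteq> Pow \<Omega>" using openin_subset[of X] by auto
  show "translate x \<in> space M \<rightarrow> \<Omega>" by (simp add: assms(1))
  show "translate x -` U \<inter> space M \<in> sets M" if "U \<in> {U. openin X U}" for U
  proof -
    have "openin X {T \<in> topspace X. translate x T \<in> U}"
      using openin_continuous_map_preimage[OF continuous_translate] that by blast
    moreover have "translate x -` U \<inter> space M = {T \<in> topspace X. translate x T \<in> U}" by (auto simp: assms(1))
    ultimately show ?thesis by (simp add: assms(2))
  qed
qed

lemma mean_sum:
  assumes \<Lambda>: "invariant_mean \<Lambda>"
  shows "bdd (\<lambda>T. \<Sum>i\<in>I. indicator (E i) T) \<and> \<Lambda> (\<lambda>T. \<Sum>i\<in>I. indicator (E i) T) = (\<Sum>i\<in>I. \<Lambda> (indicator (E i)))"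
proof -
  have "\<Lambda> (\<lambda>T. 0 * indicator \<Omega> T) = 0 * \<Lambda> (indicator \<Omega>)"
    using \<Lambda> bdd_indicator unfolding invariant_mean_def by blast
  then have z: "bdd (\<lambda>_. 0) \<and> \<Lambda> (\<lambda>_. 0) = 0" using bdd_mult[OF bdd_indicator, of 0] by simp
  show ?thesis
  proof (induction I rule: infinite_finite_induct)
    case (insert i I)
    have "(\<lambda>T. \<Sum>i\<in>insert i I. indicator (E i) T) = (\<lambda>T. indicator (E i) T + (\<Sum>i\<in>I. indicator (E i) T :: real))"
      using insert by (simp add: fun_eq_iff)
    then show ?case using insert \<Lambda> bdd_indicator bdd_add unfolding invariant_mean_def by simp
  qed (use z in simp_all)
qed

lemma mean_mono:
  assumes \<Lambda>: "invariant_mean \<Lambda>" and "bdd F" "bdd G" "\<And>T. T \<in> \<Omega> \<Longrightarrow> F T \<le> G T"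
  shows "\<Lambda> F \<le> \<Lambda> G"
proof -
  have b: "bdd (\<lambda>T. - 1 * F T)" by (rule bdd_mult[OF assms(2)])
  have "0 \<le> \<Lambda> (\<lambda>T. G T + - 1 * F T)"
    using \<Lambda> bdd_add[OF assms(3) b] assms(4) unfolding invariant_mean_def by simp
  also have "\<dots> = \<Lambda> G + - 1 * \<Lambda> F"
    using \<Lambda> b assms(2,3) unfolding invariant_mean_def by metis
  finally show ?thesis by simp
qed

text \<open>The measure regularises \<open>A \<mapsto> \<Lambda> (indicator A)\<close>. On closed sets it is at least as large, and a
  continuous function is approximated by sums of indicators of closed superlevel sets.\<close>

lemma mean_measure:
  assumes \<Lambda>: "invariant_mean \<Lambda>"
  shows "\<exists>M. invariant_probability L \<Omega> M \<and>
    (\<forall>F. continuous_map X euclideanreal F \<longrightarrow> \<Lambda> F \<le> (LINT T|M. F T))"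
proof -
  have lin: "\<And>G H. bdd G \<Longrightarrow> bdd H \<Longrightarrow> \<Lambda> (\<lambda>T. G T + H T) = \<Lambda> G + \<Lambda> H"
    "\<And>G c. bdd G \<Longrightarrow> \<Lambda> (\<lambda>T. c * G T) = c * \<Lambda> G"
    "\<And>G. bdd G \<Longrightarrow> (\<forall>T\<in>\<Omega>. 0 \<le> G T) \<Longrightarrow> 0 \<le> \<Lambda> G"
    "\<Lambda> (indicator \<Omega>) = 1"
    "\<And>G x. bdd G \<Longrightarrow> \<Lambda> (\<lambda>T. G (translate x T)) = \<Lambda> G"
    using \<Lambda> unfolding invariant_mean_def by blast+
  interpret P: finitely_additive_probability X "\<lambda>A. \<Lambda> (indicator A)"
  proof
    show "\<Lambda> (indicator (A \<union> B)) = \<Lambda> (indicator A) + \<Lambda> (indicator B)" if "A \<inter> B = {}" for A B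
    proof -
      have "indicator (A \<union> B) = (\<lambda>T. indicator A T + indicator B T :: real)"
        using that by (auto simp: fun_eq_iff indicator_def)
      then show ?thesis using lin(1)[OF bdd_indicator bdd_indicator, of A B] by simp
    qed
    show "0 \<le> \<Lambda> (indicator A)" for A by (rule lin(3)[OF bdd_indicator]) simp
  qed (use compact Hausdorff lin(4) in simp_all)
  have inv: "P.outer (translate x ` B) \<le> P.outer B" if "B \<subseteq> \<Omega>" for x B
  proof (rule P.outer_image_le[OF homeomorphic_map_translate])
    fix A :: "('d, 'l) pattern set"
    have "(\<lambda>T. indicator A (translate (- x) T)) = (indicator (translate x ` A) :: _ \<Rightarrow> real)"
      by (auto simp: fun_eq_iff indicator_def translate_image_iff)
    then show "\<Lambda> (indicator (translate x ` A)) = \<Lambda> (indicator A)"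
      using lin(5)[OF bdd_indicator, of A "- x"] by simp
  qed (use that in simp)
  have sets: "sets P.measure = sigma_sets \<Omega> {U. openin X U}" by (simp add: P.Borel_def)
  have "translate x ` B \<in> P.Borel" if B: "B \<in> P.Borel" for x B
  proof -
    have "translate (- x) \<in> measurable P.measure P.measure" by (rule measurable_translate) (simp_all add: sets del: P.sets_measure)
    then have "translate (- x) -` B \<inter> space P.measure \<in> P.Borel" using measurable_sets[of _ P.measure P.measure B] B by simp
    moreover have "translate (- x) -` B \<inter> space P.measure = translate x ` B"
    proof -
      have "B \<subseteq> \<Omega>" using sets.sets_into_space[of B P.measure] B by simp
      then show ?thesis by (auto simp: translate_image_iff)
    qed
    ultimately show ?thesis by simp
  qed
  note image_Borel = this
  have "emeasure P.measure (translate x ` B) = emeasure P.measure B" if B: "B \<in> sets P.measure" for x B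
  proof -
    have sub: "B \<subseteq> \<Omega>" using sets.sets_into_space[OF B] by simp
    have "translate (- x) ` translate x ` B = B" by (simp add: image_image)
    moreover have "translate x ` B \<subseteq> \<Omega>" using sub by auto
    ultimately have "P.outer B \<le> P.outer (translate x ` B)" using inv[of "translate x ` B" "- x"] by simp
    then have "P.outer (translate x ` B) = P.outer B" using inv[OF sub, of x] by (rule antisym[rotated])
    then show ?thesis using B image_Borel[of B x] by (simp add: P.emeasure_measure)
  qed
  then have M: "invariant_probability L \<Omega> P.measure"
    unfolding invariant_probability_def using P.prob_space_measure sets by simp
  interpret prob_space P.measure by (rule P.prob_space_measure)
  have closed: "\<Lambda> (indicator C) \<le> measure P.measure C" if C: "closedin X C" for C
  proof -
    have CB: "C \<in> P.Borel" by (rule P.closed_Borel[OF C])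
    have "ennreal (\<Lambda> (indicator C)) \<le> P.outer C"
    proof (rule P.outer_greatest)
      fix U assume "openin X U" "C \<subseteq> U"
      then show "ennreal (\<Lambda> (indicator C)) \<le> P.inner U" by (intro P.inner_upper[OF C])
    qed
    then have "ennreal (\<Lambda> (indicator C)) \<le> ennreal (measure P.measure C)"
      using CB by (simp add: emeasure_eq_measure[symmetric] P.emeasure_measure)
    then show ?thesis by (simp add: ennreal_le_iff)
  qed
  have unit: "\<Lambda> F \<le> (LINT T|P.measure. F T)"
    if F: "continuous_map X euclideanreal F" "\<And>T. T \<in> \<Omega> \<Longrightarrow> 0 \<le> F T \<and> F T \<le> 1" for F
  proof -
    have bF: "bdd F" by (rule continuous_bdd[OF F(1)])
    have intF: "integrable P.measure F"
      by (rule integrable_const_bound[where B = 1])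
        (use F measurable_continuous[OF F(1)] sets in \<open>auto intro!: AE_I2\<close>)
    have "\<Lambda> F \<le> (LINT T|P.measure. F T) + 1 / real n" if n: "n > 0" for n
    proof -
      define E where "E i = {T \<in> \<Omega>. real i / real n \<le> F T}" for i :: nat
      have cl: "closedin X (E i)" for i
        using closedin_continuous_map_preimage[OF F(1), of "{real i / real n..}"] by (simp add: E_def)
      have sub: "E i \<inter> \<Omega> = E i" for i by (auto simp: E_def)
      have ind: "integrable P.measure (indicator (E i) :: _ \<Rightarrow> real)"
        "(LINT T|P.measure. indicator (E i) T) = measure P.measure (E i)" for i
        using P.closed_Borel[OF cl[of i]] sub[of i] by (simp_all add: emeasure_eq_measure)
      define s where "s T = (\<Sum>i=1..n. indicator (E i) T :: real)" for T
      have s: "s T / n \<le> F T" "F T \<le> s T / n + 1 / n" if "T \<in> \<Omega>" for T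
      proof -
        have "s T = (\<Sum>i=1..n. if real i / real n \<le> F T then 1 else 0)"
          unfolding s_def E_def by (intro sum.cong) (auto simp: that indicator_def)
        then show "s T / n \<le> F T" "F T \<le> s T / n + 1 / n"
          using sum_thresholds[of "F T" n] F(2)[OF that] n by simp_all
      qed
      have bs: "bdd s" and \<Lambda>s: "\<Lambda> s = (\<Sum>i=1..n. \<Lambda> (indicator (E i)))"
        using mean_sum[OF \<Lambda>, where I = "{1..n}" and E = E] unfolding s_def[abs_def] by blast+
      have "\<Lambda> F \<le> \<Lambda> (\<lambda>T. (1 / n) * s T + (1 / n) * indicator \<Omega> T)"
        using s(2) by (intro mean_mono[OF \<Lambda> bF] bdd_add bdd_mult bs bdd_indicator) auto
      also have "\<dots> = (1 / n) * \<Lambda> s + 1 / n"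
        using lin(1)[OF bdd_mult[OF bs] bdd_mult[OF bdd_indicator], of "1 / n" "1 / n" \<Omega>]
          lin(2)[OF bs, of "1 / n"] lin(2)[OF bdd_indicator, of "1 / n" \<Omega>] lin(4) by simp
      also have "\<dots> \<le> (1 / n) * (\<Sum>i=1..n. measure P.measure (E i)) + 1 / n"
        unfolding \<Lambda>s using closed[OF cl] by (intro add_right_mono mult_left_mono sum_mono) auto
      also have "(1 / n) * (\<Sum>i=1..n. measure P.measure (E i)) = (LINT T|P.measure. (1 / n) * s T)"
        unfolding s_def by (simp add: Bochner_Integration.integral_sum ind sub)
      also have "\<dots> \<le> (LINT T|P.measure. F T)"
      proof (rule integral_mono[OF _ intF])
        show "integrable P.measure (\<lambda>T. (1 / n) * s T)"
          unfolding s_def by (intro integrable_mult_right Bochner_Integration.integrable_sum ind)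
      qed (use s(1) in auto)
      finally show ?thesis by simp
    qed
    then have "\<Lambda> F \<le> (LINT T|P.measure. F T) + 1 / real (Suc n)" for n by blast
    moreover have "(\<lambda>n. (LINT T|P.measure. F T) + 1 / real (Suc n)) \<longlonglongrightarrow> (LINT T|P.measure. F T) + 0"
      by (intro tendsto_add tendsto_const) (use LIMSEQ_Suc[OF lim_const_over_n[of 1]] in simp)
    ultimately show ?thesis by (intro LIMSEQ_le_const[of _ "LINT T|P.measure. F T" "\<Lambda> F"]) auto
  qed
  have "\<Lambda> F \<le> (LINT T|P.measure. F T)" if F: "continuous_map X euclideanreal F" for F
  proof -
    obtain b0 where b0: "\<forall>S\<in>\<Omega>. \<bar>F S\<bar> \<le> b0" using continuous_bdd[OF F] unfolding bdd_def by blast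
    define b where "b = max b0 1"
    have b: "b > 0" "\<And>S. S \<in> \<Omega> \<Longrightarrow> \<bar>F S\<bar> \<le> b" using b0 by (auto simp: b_def)
    have intF: "integrable P.measure F"
      by (rule integrable_const_bound[where B = b])
        (use b measurable_continuous[OF F] sets in \<open>auto intro!: AE_I2\<close>)
    \<comment> \<open>rescaled to take values in the unit interval\<close>
    define G where "G T = (1 / (2 * b)) * F T + 1 / 2" for T
    have "continuous_map X euclideanreal G"
      unfolding G_def by (intro continuous_map_add continuous_map_real_mult continuous_map_const[THEN iffD2] F) auto
    moreover have "0 \<le> G T \<and> G T \<le> 1" if "T \<in> \<Omega>" for T
      using b(2)[OF that] b(1) by (auto simp: G_def field_simps abs_le_iff)
    ultimately have "\<Lambda> G \<le> (LINT T|P.measure. G T)" by (rule unit)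
    also have "\<dots> = (1 / (2 * b)) * (LINT T|P.measure. F T) + 1 / 2"
      unfolding G_def using intF prob_space by simp
    finally have 1: "\<Lambda> G \<le> (1 / (2 * b)) * (LINT T|P.measure. F T) + 1 / 2" .
    have bF: "bdd F" by (rule continuous_bdd[OF F])
    have "(1 / (2 * b)) * \<Lambda> F + 1 / 2 = \<Lambda> (\<lambda>T. (1 / (2 * b)) * F T + (1 / 2) * indicator \<Omega> T)"
      using lin(1)[OF bdd_mult[OF bF] bdd_mult[OF bdd_indicator], of "1 / (2 * b)" "1 / 2" \<Omega>]
        lin(2)[OF bF, of "1 / (2 * b)"] lin(2)[OF bdd_indicator, of "1 / 2" \<Omega>] lin(4) by simp
    also have "\<dots> \<le> \<Lambda> G"
      using \<open>continuous_map X euclideanreal G\<close>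
      by (intro mean_mono[OF \<Lambda>] bdd_add bdd_mult bF bdd_indicator continuous_bdd) (auto simp: G_def)
    finally have "(1 / (2 * b)) * \<Lambda> F \<le> (1 / (2 * b)) * (LINT T|P.measure. F T)" using 1 by simp
    moreover have "0 < 1 / (2 * b)" using b(1) by simp
    ultimately show ?thesis by (simp only: mult_le_cancel_left_pos)
  qed
  then show ?thesis using M by blast
qed

text \<open>If every average exceeded the bound somewhere, so would some invariant mean, and then the integral
  with respect to some invariant probability measure.\<close>

theorem uniquely_ergodic_average_less:
  assumes ue: "uniquely_ergodic L \<Omega>" and \<mu>: "invariant_probability L \<Omega> \<mu>"
    and F: "continuous_map X euclideanreal F" and e: "0 < e"
  shows "\<exists>xs. xs \<noteq> [] \<and> (\<forall>T\<in>\<Omega>. avg xs F T < (LINT T|\<mu>. F T) + e)"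
proof (rule ccontr)
  assume "\<not> ?thesis"
  then have "\<exists>T\<in>\<Omega>. (LINT T|\<mu>. F T) + e \<le> avg xs F T" if "xs \<noteq> []" for xs
    using that by (meson not_less)
  from invariant_mean_exists[OF continuous_bdd[OF F] this]
  obtain \<Lambda> where \<Lambda>: "invariant_mean \<Lambda>" "(LINT T|\<mu>. F T) + e \<le> \<Lambda> F" by blast
  obtain M where M: "invariant_probability L \<Omega> M" "\<Lambda> F \<le> (LINT T|M. F T)"
    using mean_measure[OF \<Lambda>(1)] F by blast
  have "M = \<mu>" using ue \<mu> M(1) unfolding uniquely_ergodic_def by blast
  then show False using M(2) \<Lambda>(2) e by simp
qed

text \<open>Averaging again does not spoil what is achieved, so finitely many functions can be treated
  one after the other.\<close>

corollary uniquely_ergodic_average_close: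
  assumes ue: "uniquely_ergodic L \<Omega>" and \<mu>: "invariant_probability L \<Omega> \<mu>"
    and "finite I" and F: "\<And>i. i \<in> I \<Longrightarrow> continuous_map X euclideanreal (F i)" and e: "0 < e"
  shows "\<exists>xs. xs \<noteq> [] \<and> (\<forall>i\<in>I. \<forall>T\<in>\<Omega>. \<bar>avg xs (F i) T - (LINT T|\<mu>. F i T)\<bar> < e)"
  using assms(3) F
proof (induction I)
  case empty
  show ?case by (intro exI[of _ "[0]"]) simp
next
  case (insert i I)
  then obtain xs where xs: "xs \<noteq> []" "\<And>i T. i \<in> I \<Longrightarrow> T \<in> \<Omega> \<Longrightarrow> \<bar>avg xs (F i) T - (LINT T|\<mu>. F i T)\<bar> < e"
    by blast
  have Fi: "continuous_map X euclideanreal (F i)" using insert.prems by simp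
  then have Fi': "continuous_map X euclideanreal (\<lambda>T. - 1 * F i T)"
    by (intro continuous_map_real_mult continuous_map_const[THEN iffD2]) auto
  obtain ys where ys: "ys \<noteq> []" "\<And>T. T \<in> \<Omega> \<Longrightarrow> avg ys (F i) T < (LINT T|\<mu>. F i T) + e"
    using uniquely_ergodic_average_less[OF ue \<mu> Fi e] by blast
  obtain zs where zs: "zs \<noteq> []" "\<And>T. T \<in> \<Omega> \<Longrightarrow> avg zs (\<lambda>T. - 1 * F i T) T < (LINT T|\<mu>. - 1 * F i T) + e"
    using uniquely_ergodic_average_less[OF ue \<mu> Fi' e] by blast
  define ws where "ws = list_sums ys (list_sums zs xs)"
  have "\<bar>avg ws (F j) T - (LINT T|\<mu>. F j T)\<bar> < e" if j: "j \<in> insert i I" and T: "T \<in> \<Omega>" for j T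
  proof (cases "j \<in> I")
    case True
    have lt: "avg xs (F j) S < (LINT T|\<mu>. F j T) + e" "(LINT T|\<mu>. F j T) - e < avg xs (F j) S" if "S \<in> \<Omega>" for S
      using xs(2)[OF True that] by (auto simp: abs_less_iff)
    have c: "avg ws (F j) T = avg (list_sums ys zs) (avg xs (F j)) T" unfolding ws_def avg_list_sums
      by (simp add: avg_list_sums[abs_def])
    have ne: "list_sums ys zs \<noteq> []" using ys(1) zs(1) by simp
    have "avg ws (F j) T < (LINT T|\<mu>. F j T) + e" unfolding c by (rule avg_less[OF lt(1) T ne])
    moreover have "avg (list_sums ys zs) (\<lambda>S. - 1 * avg xs (F j) S) T < e - (LINT T|\<mu>. F j T)"
      by (rule avg_less[OF _ T ne]) (use lt(2) in force)
    then have "- avg ws (F j) T < e - (LINT T|\<mu>. F j T)" unfolding c avg_mult by simp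
    ultimately show ?thesis by (simp add: abs_less_iff)
  next
    case False
    then have [simp]: "j = i" using j by simp
    have 1: "avg ws (F i) T = avg (list_sums zs xs) (avg ys (F i)) T"
      unfolding ws_def avg_list_sums[of ys] by (rule avg_commute)
    have ne: "list_sums zs xs \<noteq> []" "list_sums ys xs \<noteq> []" using ys(1) zs(1) xs(1) by simp_all
    have "avg ws (F i) T < (LINT T|\<mu>. F i T) + e" unfolding 1 by (rule avg_less[OF ys(2) T ne(1)])
    moreover have 2: "avg ws G T = avg (list_sums ys xs) (avg zs G) T" for G :: "('d, 'l) pattern \<Rightarrow> real"
    proof -
      have "avg ws G T = avg ys (avg zs (avg xs G)) T" unfolding ws_def avg_list_sums by (simp add: avg_list_sums[abs_def])
      also have "avg zs (avg xs G) = avg xs (avg zs G)" by (simp add: fun_eq_iff avg_commute)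
      finally show ?thesis by (simp add: avg_list_sums)
    qed
    have "avg ws (\<lambda>T. - 1 * F i T) T < (LINT T|\<mu>. - 1 * F i T) + e" unfolding 2 by (rule avg_less[OF zs(2) T ne(2)])
    then have "- avg ws (F i) T < - (LINT T|\<mu>. F i T) + e" unfolding avg_mult by simp
    ultimately show ?thesis by (simp add: abs_less_iff)
  qed
  moreover have "ws \<noteq> []" using xs(1) ys(1) zs(1) by (simp add: ws_def)
  ultimately show ?case by blast
qed

end

section \<open>Averaging a form\<close>

lemma closed_form_add:
  assumes "smooth \<omega>" "smooth \<eta>" "closed_form \<omega>" "closed_form \<eta>"
  shows "closed_form (\<lambda>x. \<omega> x + \<eta> x)"
proof -
  have "frechet_derivative (\<lambda>x. \<omega> x + \<eta> x) (at x) = (\<lambda>v. frechet_derivative \<omega> (at x) v + frechet_derivative \<eta> (at x) v)" for x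
    using frechet_derivative_at[OF has_derivative_add[OF smooth_has_derivative[OF assms(1)] smooth_has_derivative[OF assms(2)]]] by metis
  then show ?thesis using assms(3,4) unfolding closed_form_def by (simp add: matrix_vector_mult_add_rdistrib)
qed

lemma closed_form_scaleR:
  assumes "smooth \<omega>" "closed_form \<omega>"
  shows "closed_form (\<lambda>x. c *\<^sub>R \<omega> x)"
proof -
  have "frechet_derivative (\<lambda>x. c *\<^sub>R \<omega> x) (at x) = (\<lambda>v. c *\<^sub>R frechet_derivative \<omega> (at x) v)" for x
    using frechet_derivative_at[OF has_derivative_scaleR_right[OF smooth_has_derivative[OF assms(1)]]] by metis
  then show ?thesis using assms(2) unfolding closed_form_def by (simp add: scaleR_matrix_vector_assoc[symmetric])
qed

lemma smooth_add: "smooth f \<Longrightarrow> smooth g \<Longrightarrow> smooth (\<lambda>x. f x + g x)"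
  by (simp add: smooth_def times_differentiable_add)

lemma frechet_derivative_const': "frechet_derivative (\<lambda>x. c) (at x) = (\<lambda>_. 0)"
  using frechet_derivative_at[OF has_derivative_const] by metis

lemma closed_form_const: "closed_form (\<lambda>_. c)"
  by (simp add: closed_form_def frechet_derivative_const')

lemma matrix_entries_bound:
  fixes M :: "real^'n::finite^'m::finite"
  assumes "\<And>i j. \<bar>M $ i $ j\<bar> \<le> e"
  shows "norm (M *v v) \<le> real CARD('m) * real CARD('n) * e * norm v"
proof -
  have "\<bar>(M *v v) $ i\<bar> \<le> real CARD('n) * e * norm v" for i
  proof -
    have "\<bar>(M *v v) $ i\<bar> \<le> (\<Sum>j\<in>UNIV. \<bar>M $ i $ j * v $ j\<bar>)"
      unfolding matrix_vector_mult_def by simp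
    also have "\<dots> \<le> (\<Sum>j\<in>(UNIV::'n set). e * norm v)"
      unfolding abs_mult using assms order_trans[OF abs_ge_zero assms]
      by (intro sum_mono mult_mono component_le_norm_cart) auto
    finally show ?thesis by simp
  qed
  then have "(\<Sum>i\<in>UNIV. \<bar>(M *v v) $ i\<bar>) \<le> (\<Sum>i\<in>(UNIV::'m set). real CARD('n) * e * norm v)" by (intro sum_mono)
  then show ?thesis using norm_le_l1_cart[of "M *v v"] by simp
qed

context flc_space
begin

lemma PE_form_0: "PE_form (\<lambda>_. 0)"
  by (simp add: PE_form_def smooth_const closed_form_const)

lemma PE_form_scaleR:
  assumes "PE_form W"
  shows "PE_form (\<lambda>T. c *\<^sub>R W T)"
  unfolding PE_form_def
proof (intro conjI ballI)
  show "\<exists>R. \<forall>T\<in>\<Omega>. \<forall>T'\<in>\<Omega>. patch T 0 R = patch T' 0 R \<longrightarrow> c *\<^sub>R W T = c *\<^sub>R W T'"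
    using assms unfolding PE_form_def by metis
  fix T assume "T \<in> \<Omega>"
  then have "smooth (\<lambda>x. W (translate x T))" "closed_form (\<lambda>x. W (translate x T))"
    using assms unfolding PE_form_def by blast+
  then show "smooth (\<lambda>x. c *\<^sub>R W (translate x T))" "closed_form (\<lambda>x. c *\<^sub>R W (translate x T))"
    using smooth_scaleR[OF smooth_const[of c]] closed_form_scaleR by blast+
qed

lemma PE_form_add:
  assumes "PE_form W" "PE_form W'"
  shows "PE_form (\<lambda>T. W T + W' T)"
proof -
  obtain R where R: "\<And>T T'. T \<in> \<Omega> \<Longrightarrow> T' \<in> \<Omega> \<Longrightarrow> patch T 0 R = patch T' 0 R \<Longrightarrow> W T = W T'"
    using assms(1) unfolding PE_form_def by blast
  obtain R' where R': "\<And>T T'. T \<in> \<Omega> \<Longrightarrow> T' \<in> \<Omega> \<Longrightarrow> patch T 0 R' = patch T' 0 R' \<Longrightarrow> W' T = W' T'"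
    using assms(2) unfolding PE_form_def by blast
  have "W T + W' T = W T' + W' T'"
    if "T \<in> \<Omega>" "T' \<in> \<Omega>" "patch T 0 (max R R') = patch T' 0 (max R R')" for T T'
    using R[OF that(1,2)] R'[OF that(1,2)] patch_eq_subball[OF that(3)] subset_ball max.cobounded1 max.cobounded2 by metis
  moreover have "smooth (\<lambda>x. W (translate x T) + W' (translate x T)) \<and> closed_form (\<lambda>x. W (translate x T) + W' (translate x T))"
    if "T \<in> \<Omega>" for T
  proof -
    have "smooth (\<lambda>x. W (translate x T))" "smooth (\<lambda>x. W' (translate x T))"
      "closed_form (\<lambda>x. W (translate x T))" "closed_form (\<lambda>x. W' (translate x T))"
      using assms that unfolding PE_form_def by blast+
    then show ?thesis using smooth_add closed_form_add by blast
  qed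
  ultimately show ?thesis unfolding PE_form_def by blast
qed

lemma PE_form_translate:
  assumes "PE_form W"
  shows "PE_form (\<lambda>T. W (translate s T))"
proof -
  obtain R where R: "\<And>T T'. T \<in> \<Omega> \<Longrightarrow> T' \<in> \<Omega> \<Longrightarrow> patch T 0 R = patch T' 0 R \<Longrightarrow> W T = W T'"
    using assms unfolding PE_form_def by blast
  have "W (translate s T) = W (translate s T')"
    if "T \<in> \<Omega>" "T' \<in> \<Omega>" "patch T 0 (norm s + R) = patch T' 0 (norm s + R)" for T T'
    by (rule R) (use that agree_patch_translate[of "norm s + R" T T' s R] in \<open>auto simp: agree_def\<close>)
  moreover have "smooth (\<lambda>x. W (translate s (translate x T))) \<and> closed_form (\<lambda>x. W (translate s (translate x T)))"
    if "T \<in> \<Omega>" for T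
  proof -
    have "(\<lambda>x. W (translate s (translate x T))) = (\<lambda>x. W (translate x (translate s T)))"
      by (simp add: translate_translate add.commute)
    then show ?thesis using assms translate_closed[OF that, of s] unfolding PE_form_def by simp
  qed
  ultimately show ?thesis unfolding PE_form_def by blast
qed

lemma PE_form_avg:
  assumes "PE_form W"
  shows "PE_form (avg xs W)"
proof -
  have "PE_form (\<lambda>T. \<Sum>s\<leftarrow>xs. W (translate s T))"
    by (induction xs) (auto intro: PE_form_0 PE_form_add PE_form_translate[OF assms])
  from PE_form_scaleR[OF this, of "inverse (real (length xs))"] show ?thesis
    unfolding avg_def[abs_def] .
qed

lemma leaf_integral_avg:
  assumes W: "PE_form W" and T: "T \<in> \<Omega>"
  shows "leaf_integral (avg xs W) T v = avg xs (\<lambda>S. leaf_integral W S v) T"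
proof -
  have "((\<lambda>x. \<Sum>s\<leftarrow>xs. leaf_integral W (translate s T) x) has_derivative
      (\<lambda>v. (\<Sum>s\<leftarrow>xs. W (translate s (translate x T))) *v v)) (at x)" for x
  proof (induction xs)
    case (Cons s xs)
    have "(leaf_integral W (translate s T) has_derivative (\<lambda>v. W (translate s (translate x T)) *v v)) (at x)"
      using leaf_integral_has_derivative[OF W translate_closed[OF T], of s x] by (simp add: translate_translate add.commute)
    from has_derivative_add[OF this Cons] show ?case by (simp add: matrix_vector_mult_add_rdistrib)
  qed simp
  then have d: "((\<lambda>x. avg xs (\<lambda>S. leaf_integral W S x) T) has_derivative (\<lambda>v. avg xs W (translate x T) *v v)) (at x)" for x
    unfolding avg_def scaleR_matrix_vector_assoc[symmetric] by (rule has_derivative_scaleR_right)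
  have "leaf_integral W S 0 = 0" for S by (simp add: leaf_integral_def form_integral_def)
  then have "avg xs (\<lambda>S. leaf_integral W S 0) T = 0" by (simp add: avg_def)
  moreover have "leaf_integral (avg xs W) T v = avg xs (\<lambda>S. leaf_integral W S v) T - avg xs (\<lambda>S. leaf_integral W S 0) T"
    unfolding leaf_integral_def[of "avg xs W"] by (rule form_integral_primitive[of UNIV]) (use d in auto)
  ultimately show ?thesis by simp
qed

text \<open>Averaging changes a cocycle by the coboundary of \<open>T \<mapsto> avg (\<beta> T)\<close>, so not its class.\<close>

lemma primitive_cocycle_avg:
  assumes W: "PE_form W" and pc: "primitive_cocycle (leaf_integral W) \<U> g" and xs: "xs \<noteq> []"
  shows "primitive_cocycle (leaf_integral (avg xs W)) \<U> g"
proof -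
  let ?\<beta> = "leaf_integral W"
  note \<beta> = PE_form_cocycle[OF W]
  obtain c where cov: "open_cover X \<U>" and c: "\<And>U. U \<in> \<U> \<Longrightarrow> primitive ?\<beta> U (c U)"
    and g: "\<And>U V T. U \<in> \<U> \<Longrightarrow> V \<in> \<U> \<Longrightarrow> T \<in> U \<inter> V \<Longrightarrow> g U V T = c U T - c V T"
    using pc unfolding primitive_cocycle_def by blast
  define \<sigma> where "\<sigma> T = (\<Sum>s\<leftarrow>xs. ?\<beta> T s) /\<^sub>R real (length xs)" for T
  obtain R where R: "R > 0"
    "\<And>T T' s z x. T \<in> \<Omega> \<Longrightarrow> T' \<in> \<Omega> \<Longrightarrow> agree s z T T' \<Longrightarrow> R + norm x \<le> s \<Longrightarrow> ?\<beta> T' x = ?\<beta> T (z + x) - ?\<beta> T z"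
    using PE_cocycle_agree[OF \<beta>] by metis
  define m where "m = Max (insert 0 (norm ` set xs))"
  have m: "m \<ge> 0" "\<And>s. s \<in> set xs \<Longrightarrow> norm s \<le> m" by (simp_all add: m_def)
  have \<sigma>: "\<sigma> T' = \<sigma> T + leaf_integral (avg xs W) T z - ?\<beta> T z"
    if T: "T \<in> \<Omega>" "T' \<in> \<Omega>" "agree (R + m) z T T'" for T T' z
  proof -
    have eq: "?\<beta> T' s = ?\<beta> T s + (?\<beta> (translate s T) z - ?\<beta> T z)" if "s \<in> set xs" for s
      using R(2)[OF T, of s] m(2)[OF that] PE_cocycle_add[OF \<beta> T(1), of s z] by (simp add: add.commute algebra_simps)
    have "(\<Sum>s\<leftarrow>xs. ?\<beta> T' s) = (\<Sum>s\<leftarrow>xs. ?\<beta> T s + (?\<beta> (translate s T) z - ?\<beta> T z))"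
      using eq by (intro arg_cong[where f = sum_list] map_cong) auto
    also have "\<dots> = (\<Sum>s\<leftarrow>xs. ?\<beta> T s) + ((\<Sum>s\<leftarrow>xs. ?\<beta> (translate s T) z) - real (length xs) *\<^sub>R ?\<beta> T z)"
      by (simp add: sum_list_addf sum_list_subtractf sum_list_triv scaleR_conv_of_real)
    finally show ?thesis
      using xs by (simp add: \<sigma>_def leaf_integral_avg[OF W T(1)] avg_def scaleR_add_right scaleR_diff_right)
  qed
  have "primitive (leaf_integral (avg xs W)) U (\<lambda>T. c U T + \<sigma> T)" if U: "U \<in> \<U>" for U
    unfolding primitive_def
  proof
    fix T assume T: "T \<in> U"
    have T\<Omega>: "T \<in> \<Omega>" using cov U T openin_subset[of X U] unfolding open_cover_def by auto
    have "\<forall>T\<in>U. \<exists>r>0. \<exists>\<delta>>0. \<forall>T'\<in>\<Omega>. \<forall>z. norm z < \<delta> \<longrightarrow> agree r z T T' \<longrightarrow> T' \<in> U \<and> c U T' = c U T + ?\<beta> T z"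
      using c[OF U] unfolding primitive_def .
    from bspec[OF this T] obtain r \<delta> where r: "r > 0" "\<delta> > 0"
      "\<forall>T'\<in>\<Omega>. \<forall>z. norm z < \<delta> \<longrightarrow> agree r z T T' \<longrightarrow> T' \<in> U \<and> c U T' = c U T + ?\<beta> T z" by (elim exE conjE)
    have "T' \<in> U \<and> c U T' + \<sigma> T' = c U T + \<sigma> T + leaf_integral (avg xs W) T z"
      if T': "T' \<in> \<Omega>" "norm z < \<delta>" "agree (max r (R + m)) z T T'" for T' z
    proof -
      have "agree r z T T'" "agree (R + m) z T T'" using agree_mono[OF T'(3)] by simp_all
      then show ?thesis using r(3)[rule_format, OF T'(1,2)] \<sigma>[OF T\<Omega> T'(1)] by simp
    qed
    then show "\<exists>r>0. \<exists>\<delta>>0. \<forall>T'\<in>\<Omega>. \<forall>z. norm z < \<delta> \<longrightarrow> agree r z T T' \<longrightarrow>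
        T' \<in> U \<and> c U T' + \<sigma> T' = c U T + \<sigma> T + leaf_integral (avg xs W) T z"
      using r(1,2) by (intro exI[of _ "max r (R + m)"] conjI exI[of _ \<delta>]) auto
  qed
  then show ?thesis
    unfolding primitive_cocycle_def using cov g by (intro conjI exI[of _ "\<lambda>U T. c U T + \<sigma> T"]) auto
qed

lemma PE_form_continuous:
  assumes "PE_form W"
  shows "continuous_map X euclidean W"
proof (rule continuous_euclideanI)
  fix T e assume T: "T \<in> \<Omega>" and e: "(e::real) > 0"
  obtain R where R: "\<And>T T'. T \<in> \<Omega> \<Longrightarrow> T' \<in> \<Omega> \<Longrightarrow> patch T 0 R = patch T' 0 R \<Longrightarrow> W T = W T'"
    using assms unfolding PE_form_def by blast
  have "continuous_on UNIV (\<lambda>x. W (translate x T))"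
    using assms T unfolding PE_form_def by (blast intro: smooth_continuous_on)
  then obtain d where d: "d > 0" "\<And>x. dist x 0 < d \<Longrightarrow> dist (W (translate x T)) (W (translate 0 T)) < e"
    using e unfolding continuous_on_iff by (metis UNIV_I)
  have "dist (W T') (W T) < e" if "T' \<in> \<Omega>" "norm z < d" "agree (max R 1) z T T'" for T' z
  proof -
    have "agree R z T T'" using agree_mono[OF that(3)] by simp
    then have "W (translate z T) = W T'" using R[of "translate z T" T'] that(1) T by (simp add: agree_def)
    then show ?thesis using d(2)[of z] that(2) by simp
  qed
  then show "\<exists>r>0. \<exists>\<delta>>0. \<forall>T'\<in>\<Omega>. \<forall>z. norm z < \<delta> \<longrightarrow> agree r z T T' \<longrightarrow> dist (W T') (W T) < e"
    using d(1) by (intro exI[of _ "max R 1"] conjI exI[of _ d]) auto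
qed

text \<open>Unique ergodicity makes long averages of the form uniformly close to its mean.\<close>

lemma PE_form_nearly_constant:
  assumes ue: "uniquely_ergodic L \<Omega>" and \<mu>: "invariant_probability L \<Omega> \<mu>"
    and W: "PE_form W" and pc: "primitive_cocycle (leaf_integral W) \<U> g" and B: "B > 0"
  defines "C \<equiv> (\<chi> i j. LINT T|\<mu>. W T $ i $ j)"
  shows "\<exists>W'. PE_form W' \<and> primitive_cocycle (leaf_integral W') \<U> g \<and>
    (\<forall>T\<in>\<Omega>. \<forall>v. norm ((W' T - C) *v v) \<le> B * norm v)"
proof -
  define k where "k = real CARD('d) * real CARD('d)"
  have k: "k > 0" by (simp add: k_def)
  have "continuous_map X euclideanreal (\<lambda>T. W T $ i $ j)" for i j
  proof -
    have "continuous_map euclidean euclideanreal (\<lambda>M::real^'d^'d. M $ i $ j)"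
      by (simp add: continuous_on_component)
    from continuous_map_compose[OF PE_form_continuous[OF W] this] show ?thesis by (simp add: o_def)
  qed
  then have "\<exists>xs. xs \<noteq> [] \<and> (\<forall>p\<in>UNIV. \<forall>T\<in>\<Omega>. \<bar>avg xs (\<lambda>T. W T $ fst p $ snd p) T - (LINT T|\<mu>. W T $ fst p $ snd p)\<bar> < B / k)"
    using k B by (intro uniquely_ergodic_average_close[OF ue \<mu>]) auto
  then obtain xs where xs: "xs \<noteq> []"
    "\<And>p T. T \<in> \<Omega> \<Longrightarrow> \<bar>avg xs (\<lambda>T. W T $ fst p $ snd p) T - (LINT T|\<mu>. W T $ fst p $ snd p)\<bar> < B / k" by blast
  have comp: "avg xs W T $ i $ j = avg xs (\<lambda>T. W T $ i $ j) T" for T i j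
  proof -
    have "(\<Sum>s\<leftarrow>xs. W (translate s T)) $ i $ j = (\<Sum>s\<leftarrow>xs. W (translate s T) $ i $ j)"
      by (induction xs) simp_all
    then show ?thesis by (simp add: avg_def)
  qed
  have "norm ((avg xs W T - C) *v v) \<le> B * norm v" if "T \<in> \<Omega>" for T v
  proof -
    have "\<bar>(avg xs W T - C) $ i $ j\<bar> \<le> B / k" for i j
      using xs(2)[OF that, of "(i, j)"] by (simp add: comp C_def)
    from matrix_entries_bound[OF this, of v] show ?thesis using k by (simp add: k_def)
  qed
  then show ?thesis using PE_form_avg[OF W] primitive_cocycle_avg[OF W pc xs(1)] by blast
qed

text \<open>The mean value inequality, applied to the difference of the integral and the linear map.\<close>

lemma leaf_integral_nearly_linear:
  assumes W: "PE_form W" and T: "T \<in> \<Omega>" and B: "\<And>T v. T \<in> \<Omega> \<Longrightarrow> norm ((W T - C) *v v) \<le> B * norm v"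
  shows "norm (leaf_integral W T x - leaf_integral W T y - C *v (x - y)) \<le> B * norm (x - y)"
proof -
  define f where "f x = leaf_integral W T x - C *v x" for x
  have "norm (f x - f y) \<le> B * norm (x - y)"
  proof (rule differentiable_bound[of UNIV f "\<lambda>x v. (W (translate x T) - C) *v v"])
    fix x
    have "(f has_derivative (\<lambda>v. W (translate x T) *v v - C *v v)) (at x)"
      unfolding f_def
      by (intro has_derivative_diff leaf_integral_has_derivative[OF W T] bounded_linear_imp_has_derivative) simp
    then show "(f has_derivative (\<lambda>v. (W (translate x T) - C) *v v)) (at x within UNIV)"
      by (simp add: matrix_vector_mult_diff_rdistrib)
    show "onorm (\<lambda>v. (W (translate x T) - C) *v v) \<le> B"
      by (rule onorm_le) (use B T in auto)
  qed auto
  then show ?thesis by (simp add: f_def matrix_vector_mult_diff_distrib algebra_simps)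
qed

end

section \<open>The Ruelle-Sullivan matrix of a class\<close>

context flc_space
begin

lemma integrable_continuous_map:
  fixes F :: "('d, 'l) pattern \<Rightarrow> real^'d"
  assumes \<mu>: "invariant_probability L \<Omega> \<mu>" and F: "continuous_map X euclidean F"
  shows "integrable \<mu> F"
proof -
  interpret prob_space \<mu> using \<mu> unfolding invariant_probability_def by blast
  have "compactin euclidean (F ` \<Omega>)" using image_compactin[OF _ F] compact by (simp add: compact_space_def)
  then have "bounded (F ` \<Omega>)" by (simp add: compact_imp_bounded)
  then obtain b where b: "\<And>T. T \<in> \<Omega> \<Longrightarrow> norm (F T) \<le> b" unfolding bounded_iff by auto
  have sp: "space \<mu> = \<Omega>" "sets \<mu> = sigma_sets \<Omega> {U. openin X U}" using \<mu> unfolding invariant_probability_def by blast+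
  show ?thesis
    by (rule integrable_const_bound[where B = b]) (use b sp measurable_continuous[OF F sp] in auto)
qed

lemma integral_translate:
  fixes F :: "('d, 'l) pattern \<Rightarrow> real^'d"
  assumes \<mu>: "invariant_probability L \<Omega> \<mu>" and F: "continuous_map X euclidean F"
  shows "(LINT T|\<mu>. F (translate v T)) = (LINT T|\<mu>. F T)"
proof -
  have sp: "space \<mu> = \<Omega>" "sets \<mu> = sigma_sets \<Omega> {U. openin X U}"
    and inv: "\<And>x B. B \<in> sets \<mu> \<Longrightarrow> emeasure \<mu> (translate x ` B) = emeasure \<mu> B"
    using \<mu> unfolding invariant_probability_def by blast+
  have m: "translate v \<in> measurable \<mu> \<mu>" by (rule measurable_translate[OF sp])
  have "distr \<mu> \<mu> (translate v) = \<mu>"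
  proof (rule measure_eqI)
    fix B assume "B \<in> sets (distr \<mu> \<mu> (translate v))"
    then have B: "B \<in> sets \<mu>" by simp
    have sub: "B \<subseteq> \<Omega>" using sets.sets_into_space[OF B] sp by simp
    have "translate v -` B \<inter> space \<mu> = translate (- v) ` B"
      using sub by (auto simp: sp translate_image_iff)
    then show "emeasure (distr \<mu> \<mu> (translate v)) B = emeasure \<mu> B"
      using B by (simp add: emeasure_distr[OF m] inv)
  qed simp
  then show ?thesis
    using integral_distr[OF m measurable_continuous[OF F sp]] by metis
qed

lemma flow_box_function_continuous:
  assumes fb: "flow_box L \<Omega> \<Xi> \<epsilon> U"
    and \<alpha>: "continuous_map (prod_topology X euclidean) euclidean (\<lambda>(T, x). \<alpha> T x)"
    and c: "\<And>S x. S \<in> \<Xi> \<Longrightarrow> norm x < \<epsilon> \<Longrightarrow> c (translate x S) = \<alpha> S x"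
  shows "continuous_map (subtopology X U) euclidean c"
proof -
  let ?P = "prod_topology (subtopology X \<Xi>) (top_of_set (ball (0::real^'d) \<epsilon>))"
  let ?f = "\<lambda>(S, x). translate x S"
  have h: "homeomorphic_map ?P (subtopology X U) ?f" using fb unfolding flow_box_def by blast
  then obtain g where g: "homeomorphic_maps ?P (subtopology X U) ?f g" using homeomorphic_map_maps by blast
  have gc: "continuous_map (subtopology X U) ?P g" and fg': "\<forall>T\<in>topspace (subtopology X U). ?f (g T) = T"
    using g unfolding homeomorphic_maps_def by simp_all
  note fg = fg'[rule_format]
  have "continuous_map ?P euclidean (\<lambda>(T, x). \<alpha> T x)"
    unfolding subtopology_Times[symmetric] by (rule continuous_map_from_subtopology[OF \<alpha>])
  from continuous_map_compose[OF gc this]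
  have "continuous_map (subtopology X U) euclidean ((\<lambda>(T, x). \<alpha> T x) \<circ> g)" .
  moreover have "((\<lambda>(T, x). \<alpha> T x) \<circ> g) T = c T" if T: "T \<in> topspace (subtopology X U)" for T
  proof -
    have "g T \<in> topspace ?P" using continuous_map_image_subset_topspace[OF gc] T by blast
    then obtain S x where S: "g T = (S, x)" "S \<in> \<Xi>" "norm x < \<epsilon>" by auto
    then have "T = translate x S" using fg[OF T] by simp
    then show ?thesis using c[OF S(2,3)] S(1) by simp
  qed
  ultimately show ?thesis by (rule continuous_map_eq)
qed

text \<open>Cohomologous cocycles differ by \<open>s (T - v) - s T\<close>: on a common refinement the differences of
  the box functions, corrected by the cochain \<open>b\<close>, glue to a global continuous function \<open>s\<close>. The
  relation holds for small \<open>v\<close> and so, both sides being cocycles, along whole leaves.\<close>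

lemma strong_class_eq_imp_coboundary:
  assumes \<alpha>: "strong_cocycle L \<Omega> \<alpha>" and \<beta>: "PE_cocycle \<beta>" and pc: "primitive_cocycle \<beta> \<U> g"
    and eq: "strong_class L \<Omega> \<alpha> = strong_class L \<Omega> \<beta>"
  shows "\<exists>s. continuous_map X euclidean s \<and> (\<forall>T\<in>\<Omega>. \<forall>v. \<alpha> T v - \<beta> T v = s (translate v T) - s T)"
proof -
  have ac: "continuous_map (prod_topology X euclidean) euclidean (\<lambda>(T, x). \<alpha> T x)"
    and aadd: "\<And>T x y. T \<in> \<Omega> \<Longrightarrow> \<alpha> T x + \<alpha> (translate x T) y = \<alpha> T (x + y)"
    using \<alpha> unfolding strong_cocycle_def by blast+
  note badd = PE_cocycle_add[OF \<beta>]
  have gc: "cech_cocycle X (\<U>, g)" by (rule primitive_cocycle_cech_cocycle[OF pc])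
  then have "(\<U>, g) \<in> strong_class L \<Omega> \<alpha>"
    unfolding eq strong_class_primitive[OF \<beta> pc] using primitive_cocycles_cohomologous[OF pc pc] by simp
  then obtain \<V> k where fbc: "flow_box_cocycle L \<Omega> \<alpha> (\<V>, k)" and coh: "cech_cohomologous X (\<V>, k) (\<U>, g)"
    unfolding strong_class_def by auto
  obtain \<Xi> \<epsilon> a where fb: "\<And>U. U \<in> \<V> \<Longrightarrow> flow_box L \<Omega> (\<Xi> U) (\<epsilon> U) U"
    and a: "\<And>U S x. U \<in> \<V> \<Longrightarrow> S \<in> \<Xi> U \<Longrightarrow> norm x < \<epsilon> U \<Longrightarrow> a U (translate x S) = \<alpha> S x"
    and k: "\<And>U V T. U \<in> \<V> \<Longrightarrow> V \<in> \<V> \<Longrightarrow> T \<in> U \<inter> V \<Longrightarrow> k U V T = a U T - a V T"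
    using fbc unfolding flow_box_cocycle_def prod.case by blast
  obtain c where cov: "open_cover X \<U>" and c: "\<And>U. U \<in> \<U> \<Longrightarrow> primitive \<beta> U (c U)"
    and g: "\<And>U V T. U \<in> \<U> \<Longrightarrow> V \<in> \<U> \<Longrightarrow> T \<in> U \<inter> V \<Longrightarrow> g U V T = c U T - c V T"
    using pc unfolding primitive_cocycle_def by blast
  obtain \<W> \<rho> \<sigma> b where W: "open_cover X \<W>"
    "\<forall>W\<in>\<W>. \<rho> W \<in> \<V> \<and> W \<subseteq> \<rho> W \<and> \<sigma> W \<in> \<U> \<and> W \<subseteq> \<sigma> W \<and> locally_constant_on X W (b W)"
    "\<forall>W\<in>\<W>. \<forall>W'\<in>\<W>. \<forall>x\<in>W \<inter> W'. k (\<rho> W) (\<rho> W') x - g (\<sigma> W) (\<sigma> W') x = b W x - b W' x"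
    using coh unfolding cech_cohomologous_def prod.case by (elim exE conjE) (rule that)
  have Wop: "openin X W" if "W \<in> \<W>" for W using W(1) that unfolding open_cover_def by blast
  have "\<forall>T\<in>\<Omega>. \<exists>W\<in>\<W>. T \<in> W" using W(1) unfolding open_cover_def by auto
  then obtain w where w: "\<And>T. T \<in> \<Omega> \<Longrightarrow> w T \<in> \<W> \<and> T \<in> w T" by metis
  define h where "h W T = a (\<rho> W) T - c (\<sigma> W) T - b W T" for W T
  define s where "s T = h (w T) T" for T
  have s: "s T = h W T" if WT: "W \<in> \<W>" "T \<in> W" for W T
  proof -
    have T: "T \<in> \<Omega>" using openin_subset[OF Wop[OF WT(1)]] WT(2) by auto
    note w = w[OF T]
    have "k (\<rho> (w T)) (\<rho> W) T - g (\<sigma> (w T)) (\<sigma> W) T = b (w T) T - b W T"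
      using W(3) w WT by blast
    moreover have "k (\<rho> (w T)) (\<rho> W) T = a (\<rho> (w T)) T - a (\<rho> W) T"
      by (rule k) (use W(2) w WT in blast)+
    moreover have "g (\<sigma> (w T)) (\<sigma> W) T = c (\<sigma> (w T)) T - c (\<sigma> W) T"
      by (rule g) (use W(2) w WT in blast)+
    ultimately show ?thesis unfolding s_def h_def by (simp add: algebra_simps)
  qed
  have local: "\<exists>d>0. \<forall>v. norm v < d \<longrightarrow> \<alpha> T v - \<beta> T v = s (translate v T) - s T" if T: "T \<in> \<Omega>" for T
  proof -
    obtain W where WT: "W \<in> \<W>" "T \<in> W" using w[OF T] by blast
    have W': "\<rho> W \<in> \<V>" "W \<subseteq> \<rho> W" "\<sigma> W \<in> \<U>" "W \<subseteq> \<sigma> W" "locally_constant_on X W (b W)" using W(2) WT(1) by blast+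
    obtain r1 d1 where 1: "r1 > 0" "d1 > 0"
      "\<forall>T'\<in>\<Omega>. \<forall>z. norm z < d1 \<longrightarrow> agree r1 z T T' \<longrightarrow> T' \<in> W \<and> b W T' = b W T"
      using locally_constant_onD[OF W'(5) WT(2) Wop[OF WT(1)]] by (elim exE conjE)
    have "\<exists>r>0. \<exists>\<delta>>0. \<forall>T'\<in>\<Omega>. \<forall>z. norm z < \<delta> \<longrightarrow> agree r z T T' \<longrightarrow> T' \<in> \<sigma> W \<and> c (\<sigma> W) T' = c (\<sigma> W) T + \<beta> T z"
      using c[OF W'(3)] W'(4) WT(2) unfolding primitive_def by blast
    then obtain r2 d2 where 2: "r2 > 0" "d2 > 0"
      "\<forall>T'\<in>\<Omega>. \<forall>z. norm z < d2 \<longrightarrow> agree r2 z T T' \<longrightarrow> T' \<in> \<sigma> W \<and> c (\<sigma> W) T' = c (\<sigma> W) T + \<beta> T z"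
      by (elim exE conjE)
    have TU: "T \<in> \<rho> W" using W'(2) WT(2) by blast
    have sub: "\<rho> W \<subseteq> \<Omega>" "\<Xi> (\<rho> W) \<subseteq> \<Omega>"
      using fb[OF W'(1)] openin_subset[of X "\<rho> W"] flc_transversal_subset unfolding flow_box_def by auto
    have "(\<lambda>(S, x). translate x S) ` topspace (prod_topology (subtopology X (\<Xi> (\<rho> W))) (top_of_set (ball (0::real^'d) (\<epsilon> (\<rho> W)))))
        = topspace (subtopology X (\<rho> W))"
      using fb[OF W'(1)] homeomorphic_imp_surjective_map unfolding flow_box_def by blast
    then have "(\<lambda>(S, x). translate x S) ` (\<Xi> (\<rho> W) \<times> ball (0::real^'d) (\<epsilon> (\<rho> W))) = \<rho> W"
      using sub by (simp add: Int_absorb1 Int_absorb2)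
    then have "T \<in> (\<lambda>(S, x). translate x S) ` (\<Xi> (\<rho> W) \<times> ball (0::real^'d) (\<epsilon> (\<rho> W)))" using TU by simp
    then obtain S x where S: "S \<in> \<Xi> (\<rho> W)" "norm x < \<epsilon> (\<rho> W)" "T = translate x S" by auto
    have S\<Omega>: "S \<in> \<Omega>" using S(1) sub by blast
    define d where "d = min (min d1 d2) (\<epsilon> (\<rho> W) - norm x)"
    have d: "d > 0" using 1 2 S(2) by (simp add: d_def)
    have "\<alpha> T v - \<beta> T v = s (translate v T) - s T" if v: "norm v < d" for v
    proof -
      have v': "norm v < d1" "norm v < d2" "norm v < \<epsilon> (\<rho> W) - norm x" using v by (simp_all add: d_def)
      have tv: "translate v T \<in> \<Omega>" using T by simp
      have b: "translate v T \<in> W" "b W (translate v T) = b W T"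
        using 1(3)[rule_format, OF tv v'(1) agree_translate] by blast+
      have c': "c (\<sigma> W) (translate v T) = c (\<sigma> W) T + \<beta> T v"
        using 2(3)[rule_format, OF tv v'(2) agree_translate] by blast
      have "a (\<rho> W) (translate v T) = a (\<rho> W) (translate (x + v) S)" by (simp add: S(3) translate_translate add.commute)
      also have "\<dots> = \<alpha> S (x + v)"
        by (rule a[OF W'(1) S(1)]) (use norm_triangle_ineq[of x v] v'(3) in linarith)
      also have "\<dots> = a (\<rho> W) T + \<alpha> T v"
        using aadd[OF S\<Omega>, of x v] a[OF W'(1) S(1,2)] S(3) by simp
      finally have a': "a (\<rho> W) (translate v T) = a (\<rho> W) T + \<alpha> T v" .
      show ?thesis
        unfolding s[OF WT] s[OF WT(1) b(1)] h_def a' c' b(2) by (simp add: algebra_simps)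
    qed
    then show ?thesis using d by blast
  qed
  have global: "\<alpha> T v - \<beta> T v = s (translate v T) - s T" if T: "T \<in> \<Omega>" for T v
  proof -
    define \<phi> where "\<phi> v = s (translate v T) - s T - (\<alpha> T v - \<beta> T v)" for v
    have "(\<phi> has_derivative (\<lambda>_. 0)) (at v within UNIV)" for v
    proof -
      obtain d where d: "d > 0" "\<And>u. norm u < d \<Longrightarrow>
          \<alpha> (translate v T) u - \<beta> (translate v T) u = s (translate u (translate v T)) - s (translate v T)"
        using local[of "translate v T"] T by auto
      have const: "\<phi> v = \<phi> y" if "y \<in> ball v d" for y
      proof -
        define u where "u = y - v"
        have u: "norm u < d" "y = v + u" using that by (auto simp: u_def dist_norm norm_minus_commute)
        have "\<phi> y - \<phi> v = (s (translate u (translate v T)) - s (translate v T)) - (\<alpha> T y - \<alpha> T v - (\<beta> T y - \<beta> T v))"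
          by (simp add: \<phi>_def u(2) translate_translate add.commute algebra_simps)
        also have "\<alpha> T y - \<alpha> T v = \<alpha> (translate v T) u" using aadd[OF T, of v u] u(2) by (simp add: algebra_simps)
        also have "\<beta> T y - \<beta> T v = \<beta> (translate v T) u" using badd[OF T, of v u] u(2) by (simp add: algebra_simps)
        finally show ?thesis using d(2)[OF u(1)] by simp
      qed
      have "((\<lambda>_. \<phi> v) has_derivative (\<lambda>_. 0)) (at v within UNIV)" by (rule has_derivative_const)
      from has_derivative_transform_within_open[OF this open_ball[of v d]] show ?thesis using const d(1) by simp
    qed
    then obtain k where k: "\<And>v. \<phi> v = k" using has_derivative_zero_constant[OF convex_UNIV, of \<phi>] by blast
    have "\<phi> 0 = 0" using aadd[OF T, of 0 0] PE_cocycle_0[OF \<beta> T] by (simp add: \<phi>_def)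
    then show ?thesis using k[of 0] k[of v] by (simp add: \<phi>_def)
  qed
  have "continuous_map X euclidean s"
  proof (rule continuous_euclideanI)
    fix T e assume T: "T \<in> \<Omega>" and e: "(e::real) > 0"
    obtain W where WT: "W \<in> \<W>" "T \<in> W" using w[OF T] by blast
    have W': "\<rho> W \<in> \<V>" "W \<subseteq> \<rho> W" "\<sigma> W \<in> \<U>" "W \<subseteq> \<sigma> W" "locally_constant_on X W (b W)" using W(2) WT(1) by blast+
    obtain r1 d1 where 1: "r1 > 0" "d1 > 0"
      "\<forall>T'\<in>\<Omega>. \<forall>z. norm z < d1 \<longrightarrow> agree r1 z T T' \<longrightarrow> T' \<in> W \<and> b W T' = b W T"
      using locally_constant_onD[OF W'(5) WT(2) Wop[OF WT(1)]] by (elim exE conjE)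
    have "\<exists>r>0. \<exists>\<delta>>0. \<forall>T'\<in>\<Omega>. \<forall>z. norm z < \<delta> \<longrightarrow> agree r z T T' \<longrightarrow> T' \<in> \<sigma> W \<and> c (\<sigma> W) T' = c (\<sigma> W) T + \<beta> T z"
      using c[OF W'(3)] W'(4) WT(2) unfolding primitive_def by blast
    then obtain r2 d2 where 2: "r2 > 0" "d2 > 0"
      "\<forall>T'\<in>\<Omega>. \<forall>z. norm z < d2 \<longrightarrow> agree r2 z T T' \<longrightarrow> T' \<in> \<sigma> W \<and> c (\<sigma> W) T' = c (\<sigma> W) T + \<beta> T z"
      by (elim exE conjE)
    have U: "openin X (\<rho> W)" using fb[OF W'(1)] unfolding flow_box_def by blast
    have "continuous_map (subtopology X (\<rho> W)) euclidean (a (\<rho> W))"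
      by (rule flow_box_function_continuous[OF fb[OF W'(1)] ac a[OF W'(1)]])
    from openin_continuous_map_preimage[OF this, of "ball (a (\<rho> W) T) (e / 2)"]
    have "openin (subtopology X (\<rho> W)) {T' \<in> topspace (subtopology X (\<rho> W)). a (\<rho> W) T' \<in> ball (a (\<rho> W) T) (e / 2)}" by simp
    then have "openin X {T' \<in> topspace (subtopology X (\<rho> W)). a (\<rho> W) T' \<in> ball (a (\<rho> W) T) (e / 2)}"
      using openin_open_subtopology[OF U] by blast
    moreover have "T \<in> {T' \<in> topspace (subtopology X (\<rho> W)). a (\<rho> W) T' \<in> ball (a (\<rho> W) T) (e / 2)}"
      using T WT(2) W'(2) e by auto
    ultimately have "\<exists>r>0. \<exists>\<delta>>0. \<forall>T'\<in>\<Omega>. \<forall>z. norm z < \<delta> \<longrightarrow> agree r z T T' \<longrightarrow>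
        T' \<in> {T' \<in> topspace (subtopology X (\<rho> W)). a (\<rho> W) T' \<in> ball (a (\<rho> W) T) (e / 2)}"
      unfolding openin_iff_agree by (elim conjE) (erule bspec)
    then obtain r3 d3 where 3: "r3 > 0" "d3 > 0"
      "\<forall>T'\<in>\<Omega>. \<forall>z. norm z < d3 \<longrightarrow> agree r3 z T T' \<longrightarrow>
        T' \<in> {T' \<in> topspace (subtopology X (\<rho> W)). a (\<rho> W) T' \<in> ball (a (\<rho> W) T) (e / 2)}"
      by (elim exE conjE)
    obtain d4 where 4: "d4 > 0" "\<And>z. dist z 0 < d4 \<Longrightarrow> dist (\<beta> T z) (\<beta> T 0) < e / 2"
      using PE_cocycle_continuous[OF \<beta> T] e unfolding continuous_on_iff by (metis UNIV_I half_gt_zero)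
    define d r where "d = min (min d1 d2) (min d3 d4)" and "r = max r1 (max r2 r3)"
    have "dist (s T') (s T) < e" if T': "T' \<in> \<Omega>" "norm z < d" "agree r z T T'" for T' z
    proof -
      have ag: "agree r1 z T T'" "agree r2 z T T'" "agree r3 z T T'" using agree_mono[OF T'(3)] by (simp_all add: r_def)
      have z: "norm z < d1" "norm z < d2" "norm z < d3" "norm z < d4" using T'(2) by (simp_all add: d_def)
      have b: "T' \<in> W" "b W T' = b W T" using 1(3)[rule_format, OF T'(1) z(1) ag(1)] by blast+
      have c': "c (\<sigma> W) T' = c (\<sigma> W) T + \<beta> T z" using 2(3)[rule_format, OF T'(1) z(2) ag(2)] by blast
      have a': "dist (a (\<rho> W) T) (a (\<rho> W) T') < e / 2" using 3(3)[rule_format, OF T'(1) z(3) ag(3)] by simp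
      have "norm (\<beta> T z) < e / 2" using 4(2)[of z] z(4) PE_cocycle_0[OF \<beta> T] by simp
      moreover have "s T' - s T = (a (\<rho> W) T' - a (\<rho> W) T) - \<beta> T z"
        unfolding s[OF WT] s[OF WT(1) b(1)] h_def c' b(2) by (simp add: algebra_simps)
      ultimately show ?thesis
        using norm_triangle_ineq4[of "a (\<rho> W) T' - a (\<rho> W) T" "\<beta> T z"] a' by (simp add: dist_norm norm_minus_commute)
    qed
    then show "\<exists>r>0. \<exists>\<delta>>0. \<forall>T'\<in>\<Omega>. \<forall>z. norm z < \<delta> \<longrightarrow> agree r z T T' \<longrightarrow> dist (s T') (s T) < e"
      using 1(1,2) 2(1,2) 3(1,2) 4(1) by (intro exI[of _ r] conjI exI[of _ d]) (auto simp: d_def r_def)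
  qed
  then show ?thesis using global by blast
qed

lemma strong_cocycle_continuous:
  assumes "strong_cocycle L \<Omega> \<alpha>"
  shows "continuous_map X euclidean (\<lambda>T. \<alpha> T v)"
proof -
  have "continuous_map X (prod_topology X euclidean) (\<lambda>T. (T, v))"
    by (intro continuous_map_pairedI) (simp_all add: continuous_map_id[unfolded id_def])
  from continuous_map_compose[OF this, of euclidean "\<lambda>(T, x). \<alpha> T x"] assms show ?thesis
    unfolding strong_cocycle_def by (simp add: o_def)
qed

lemma strong_class_eq_imp_integral_eq:
  assumes \<mu>: "invariant_probability L \<Omega> \<mu>"
    and \<alpha>: "strong_cocycle L \<Omega> \<alpha>" and \<beta>: "PE_cocycle \<beta>" and pc: "primitive_cocycle \<beta> \<U> g"
    and eq: "strong_class L \<Omega> \<alpha> = strong_class L \<Omega> \<beta>"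
  shows "(LINT T|\<mu>. \<alpha> T v) = (LINT T|\<mu>. \<beta> T v)"
proof -
  obtain s where s: "continuous_map X euclidean s" "\<And>T. T \<in> \<Omega> \<Longrightarrow> \<alpha> T v - \<beta> T v = s (translate v T) - s T"
    using strong_class_eq_imp_coboundary[OF \<alpha> \<beta> pc eq] by blast
  have sp: "space \<mu> = \<Omega>" using \<mu> unfolding invariant_probability_def by blast
  have sv: "continuous_map X euclidean (\<lambda>T. s (translate v T))"
    using continuous_map_compose[OF continuous_translate s(1)] by (simp add: o_def)
  have "(LINT T|\<mu>. \<alpha> T v) - (LINT T|\<mu>. \<beta> T v) = (LINT T|\<mu>. \<alpha> T v - \<beta> T v)"
    by (intro Bochner_Integration.integral_diff[symmetric] integrable_continuous_map[OF \<mu>]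
        strong_cocycle_continuous \<alpha> PE_cocycle_strong_cocycle \<beta>)
  also have "\<dots> = (LINT T|\<mu>. s (translate v T) - s T)"
    by (intro Bochner_Integration.integral_cong) (simp_all add: s(2) sp)
  also have "\<dots> = (LINT T|\<mu>. s (translate v T)) - (LINT T|\<mu>. s T)"
    by (intro Bochner_Integration.integral_diff integrable_continuous_map[OF \<mu>] s(1) sv)
  also have "\<dots> = 0" by (simp add: integral_translate[OF \<mu> s(1)])
  finally show ?thesis by simp
qed

text \<open>All cocycles of the class have the same integral. For a nearly constant form the integral differs
  from \<open>C *v v\<close> by an arbitrarily small multiple of \<open>norm v\<close>.\<close>

theorem ruelle_sullivan_PE_form:
  assumes ue: "uniquely_ergodic L \<Omega>" and \<mu>: "invariant_probability L \<Omega> \<mu>"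
    and W: "PE_form W" and pc: "primitive_cocycle (leaf_integral W) \<U> g"
  shows "ruelle_sullivan L \<Omega> \<mu> (strong_class L \<Omega> (leaf_integral W)) = (\<chi> i j. LINT T|\<mu>. W T $ i $ j)"
proof -
  let ?\<beta> = "leaf_integral W"
  note \<beta> = PE_form_cocycle[OF W]
  define \<alpha> where "\<alpha> = (SOME \<alpha>. strong_cocycle L \<Omega> \<alpha> \<and> strong_class L \<Omega> \<alpha> = strong_class L \<Omega> ?\<beta>)"
  have \<alpha>c: "strong_cocycle L \<Omega> \<alpha> \<and> strong_class L \<Omega> \<alpha> = strong_class L \<Omega> ?\<beta>"
    unfolding \<alpha>_def by (rule someI[of _ ?\<beta>]) (use PE_cocycle_strong_cocycle[OF \<beta>] in blast)
  have \<alpha>: "(LINT T|\<mu>. \<alpha> T v) = (LINT T|\<mu>. ?\<beta> T v)" for v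
    by (rule strong_class_eq_imp_integral_eq[OF \<mu> conjunct1[OF \<alpha>c] \<beta> pc conjunct2[OF \<alpha>c]])
  define C :: "real^'d^'d" where "C = (\<chi> i j. LINT T|\<mu>. W T $ i $ j)"
  interpret prob_space \<mu> using \<mu> unfolding invariant_probability_def by blast
  have sp: "space \<mu> = \<Omega>" using \<mu> unfolding invariant_probability_def by blast
  have "(LINT T|\<mu>. ?\<beta> T v) = C *v v" for v
  proof -
    have "norm ((LINT T|\<mu>. ?\<beta> T v) - C *v v) \<le> B * norm v" if Bp: "B > 0" for B
    proof -
      obtain W' where W': "PE_form W'" "primitive_cocycle (leaf_integral W') \<U> g"
        "\<And>T v. T \<in> \<Omega> \<Longrightarrow> norm ((W' T - C) *v v) \<le> B * norm v"
        using PE_form_nearly_constant[OF ue \<mu> W pc Bp] unfolding C_def by blast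
      note \<beta>' = PE_form_cocycle[OF W'(1)]
      have eq: "(LINT T|\<mu>. leaf_integral W' T v) = (LINT T|\<mu>. ?\<beta> T v)"
        by (rule strong_class_eq_imp_integral_eq[OF \<mu> PE_cocycle_strong_cocycle[OF \<beta>'] \<beta> pc])
          (simp add: strong_class_primitive[OF \<beta>' W'(2)] strong_class_primitive[OF \<beta> pc])
      have near: "norm (leaf_integral W' T v - C *v v) \<le> B * norm v" if "T \<in> \<Omega>" for T
        using leaf_integral_nearly_linear[OF W'(1) that W'(3), of v 0] PE_cocycle_0[OF \<beta>' that] by simp
      have int: "integrable \<mu> (\<lambda>T. leaf_integral W' T v)"
        by (intro integrable_continuous_map[OF \<mu>] strong_cocycle_continuous PE_cocycle_strong_cocycle \<beta>')
      have "(LINT T|\<mu>. ?\<beta> T v) - C *v v = (LINT T|\<mu>. leaf_integral W' T v - C *v v)"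
        using int by (simp add: eq prob_space)
      also have "norm \<dots> \<le> (LINT T|\<mu>. norm (leaf_integral W' T v - C *v v))" by (rule integral_norm_bound)
      also have "\<dots> \<le> (LINT T|\<mu>. B * norm v)"
        using int near by (intro integral_mono) (auto simp: sp)
      finally show ?thesis by (simp add: prob_space)
    qed
    then have "norm ((LINT T|\<mu>. ?\<beta> T v) - C *v v) \<le> e" if "e > 0" for e
    proof -
      have "e / (norm v + 1) > 0" using that by (simp add: add_nonneg_pos)
      from \<open>\<And>B. B > 0 \<Longrightarrow> norm ((LINT T|\<mu>. ?\<beta> T v) - C *v v) \<le> B * norm v\<close>[OF this]
      have "norm ((LINT T|\<mu>. ?\<beta> T v) - C *v v) \<le> e / (norm v + 1) * norm v" .
      also have "\<dots> \<le> e" using that by (simp add: divide_le_eq add_nonneg_pos)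
      finally show ?thesis .
    qed
    then have "norm ((LINT T|\<mu>. ?\<beta> T v) - C *v v) \<le> 0" by (rule field_le_epsilon[of _ 0, simplified])
    then show ?thesis by simp
  qed
  then have "ruelle_sullivan L \<Omega> \<mu> (strong_class L \<Omega> ?\<beta>) = matrix (\<lambda>v. C *v v)"
    unfolding ruelle_sullivan_def Let_def \<alpha>_def[symmetric] \<alpha> by simp
  then show ?thesis by (simp add: C_def)
qed

end

section \<open>Deforming a tiling along a cocycle\<close>

text \<open>A cocycle that maps each leaf onto \<open>\<real>\<^sup>d\<close> in a bilipschitz way. A patch of radius \<open>R\<^sub>0\<close>, the radius
  of the labels, determines the displacement to all vertices at distance up to \<open>4 * radius\<close>.\<close>

locale leaf_deformation = flc_space L \<Omega>
  for L :: "'l metric" and \<Omega> :: "('d::finite, 'l) pattern set" +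
  fixes \<beta> :: "('d, 'l) pattern \<Rightarrow> real^'d \<Rightarrow> real^'d" and m M R R\<^sub>0 :: real
  assumes cocycle: "T \<in> \<Omega> \<Longrightarrow> \<beta> T x + \<beta> (translate x T) y = \<beta> T (x + y)"
    and local: "T \<in> \<Omega> \<Longrightarrow> T' \<in> \<Omega> \<Longrightarrow> agree s z T T' \<Longrightarrow> R + norm x \<le> s \<Longrightarrow> \<beta> T' x = \<beta> T (z + x) - \<beta> T z"
    and m: "0 < m" "T \<in> \<Omega> \<Longrightarrow> m * norm (x - y) \<le> norm (\<beta> T x - \<beta> T y)"
    and M: "0 < M" "T \<in> \<Omega> \<Longrightarrow> norm (\<beta> T x - \<beta> T y) \<le> M * norm (x - y)"
    and surj: "T \<in> \<Omega> \<Longrightarrow> \<exists>x. \<beta> T x = y"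
    and R: "0 < R" "R + 4 * radius < R\<^sub>0"
begin

definition deform :: "('d, 'l) pattern \<Rightarrow> ('d, ('d, 'l) pattern) pattern" where
  "deform T = deformed T R\<^sub>0 (\<beta> T)"

lemma R0: "0 < R\<^sub>0" "radius < R\<^sub>0" using R radius(1) by linarith+

lemma \<beta>_0: "T \<in> \<Omega> \<Longrightarrow> \<beta> T 0 = 0" using cocycle[of T 0 0] by simp

lemma \<beta>_inj: "T \<in> \<Omega> \<Longrightarrow> \<beta> T x = \<beta> T y \<Longrightarrow> x = y"
proof -
  assume "T \<in> \<Omega>" "\<beta> T x = \<beta> T y"
  then have "m * norm (x - y) \<le> 0" using m(2)[of T x y] by simp
  then show "x = y" using m(1) by (simp add: mult_le_0_iff)
qed

lemma mem_deform: "(t, l) \<in> deform T \<longleftrightarrow> (\<exists>p\<in>vertices T. t = {\<beta> T p} \<and> l = patch (translate p T) 0 R\<^sub>0)"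
  unfolding deform_def deformed_def by blast

text \<open>By the cocycle property, moving the origin by \<open>x\<close> and deforming moves it by \<open>\<beta> T x\<close> in the
  deformed pattern.\<close>

lemma deform_translate:
  assumes T: "T \<in> \<Omega>"
  shows "deform (translate x T) = translate (\<beta> T x) (deform T)"
proof -
  have "(t, l) \<in> deform (translate x T) \<longleftrightarrow> (t, l) \<in> translate (\<beta> T x) (deform T)" for t l
  proof
    assume "(t, l) \<in> deform (translate x T)"
    then obtain p where p: "p + x \<in> vertices T" "t = {\<beta> (translate x T) p}" "l = patch (translate (p + x) T) 0 R\<^sub>0"
      unfolding mem_deform translate_translate by (auto simp: vertices_translate)
    have "({\<beta> T (p + x)}, l) \<in> deform T" using p by (auto simp: mem_deform)
    then have "((\<lambda>q. q - \<beta> T x) ` {\<beta> T (p + x)}, l) \<in> translate (\<beta> T x) (deform T)" by (rule translateI)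
    moreover have "\<beta> T (p + x) - \<beta> T x = \<beta> (translate x T) p"
      using cocycle[OF T, of x p] by (simp add: algebra_simps)
    ultimately show "(t, l) \<in> translate (\<beta> T x) (deform T)" by (simp add: p(2))
  next
    assume "(t, l) \<in> translate (\<beta> T x) (deform T)"
    then obtain t' where t': "(t', l) \<in> deform T" "t = (\<lambda>q. q - \<beta> T x) ` t'" by (rule translateE)
    then obtain p where p: "p \<in> vertices T" "t' = {\<beta> T p}" "l = patch (translate p T) 0 R\<^sub>0"
      unfolding mem_deform by blast
    have "\<beta> T p - \<beta> T x = \<beta> (translate x T) (p - x)" using cocycle[OF T, of x "p - x"] by (simp add: algebra_simps)
    then show "(t, l) \<in> deform (translate x T)"
      unfolding mem_deform vertices_translate translate_translate
      by (intro bexI[of _ "p - x"]) (simp_all add: p t'(2) vertices_translate)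
  qed
  then show ?thesis by (simp add: set_eq_iff split_paired_all)
qed

text \<open>A patch of the deformed pattern only involves vertices near the origin, because \<open>\<beta>\<close> moves
  distant points far away; and positions and labels of these are read off from a large patch.\<close>

lemma deform_patch:
  assumes T: "T \<in> \<Omega>" "T' \<in> \<Omega>" and eq: "patch T 0 r = patch T' 0 r" and r: "s / m + R + R\<^sub>0 \<le> r"
  shows "patch (deform T) 0 s = patch (deform T') 0 s"
proof -
  have *: "(t, l) \<in> patch (deform T') 0 s"
    if T: "T \<in> \<Omega>" "T' \<in> \<Omega>" and eq: "patch T 0 r = patch T' 0 r" and tl: "(t, l) \<in> patch (deform T) 0 s" for T T' t l
  proof -
    have tl': "(t, l) \<in> deform T" "t \<inter> ball 0 s \<noteq> {}" using tl by (simp_all add: patch_def)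
    obtain p where p: "p \<in> vertices T" "t = {\<beta> T p}" "l = patch (translate p T) 0 R\<^sub>0"
      using tl'(1) unfolding mem_deform by blast
    have b: "norm (\<beta> T p) < s" using tl'(2) p(2) by simp
    have "m * norm p < s" using m(2)[OF T(1), of p 0] \<beta>_0[OF T(1)] b by simp
    then have np: "norm p < s / m" using m(1) by (simp add: pos_less_divide_eq mult.commute)
    have ag: "agree r 0 T T'" using eq by (simp add: agree_def)
    have "p \<in> vertices T'" using agree_vertices[OF ag, of p] np r R R0 p(1) by simp
    moreover have "\<beta> T' p = \<beta> T p" using local[OF T ag, of p] np r R0 \<beta>_0[OF T(1)] by simp
    moreover have "patch (translate p T') 0 R\<^sub>0 = l"
      using agree_patch_translate[OF ag, of p R\<^sub>0] np r R p(3) by simp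
    ultimately have "(t, l) \<in> deform T'" unfolding mem_deform p(2) by (intro bexI[of _ p]) simp_all
    then show ?thesis using p(2) b by (simp add: patch_def)
  qed
  show ?thesis using *[OF T eq] *[OF T(2,1) eq[symmetric]] by (auto simp: set_eq_iff)
qed

lemma deform_agree:
  assumes T: "T \<in> \<Omega>" "T' \<in> \<Omega>" and ag: "agree r z T T'" and r: "s / m + R + R\<^sub>0 \<le> r"
  shows "agree s (\<beta> T z) (deform T) (deform T')"
  using deform_patch[OF _ T(2) ag[unfolded agree_def] r] T
  unfolding agree_def deform_translate[OF T(1), symmetric] by simp

lemma deform_dense: "T \<in> \<Omega> \<Longrightarrow> \<exists>p\<in>vertices T. dist x (\<beta> T p) \<le> M * radius"
proof -
  assume T: "T \<in> \<Omega>"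
  obtain y where y: "\<beta> T y = x" using surj[OF T] by blast
  obtain p where p: "p \<in> vertices T" "dist y p \<le> radius" using radius(2)[OF T] by blast
  have "dist x (\<beta> T p) \<le> M * dist y p" using M(2)[OF T, of y p] by (simp add: y dist_norm)
  also have "\<dots> \<le> M * radius" using p(2) M(1) by simp
  finally show ?thesis using p(1) by blast
qed

lemma labelled_delone_deform:
  assumes T: "T \<in> \<Omega>"
  shows "labelled_delone discrete_labels (deform T)"
  unfolding labelled_delone_def
proof (intro conjI)
  show "\<forall>(t, l)\<in>deform T. (\<exists>p. t = {p}) \<and> l \<in> mspace discrete_labels" by (auto simp: mem_deform)
  have "m * gap \<le> dist p q" if pq: "({p}, l) \<in> deform T" "({q}, l') \<in> deform T" "(p, l) \<noteq> (q, l')" for p l q l'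
  proof -
    obtain p0 where p0: "p0 \<in> vertices T" "p = \<beta> T p0" "l = patch (translate p0 T) 0 R\<^sub>0" using pq(1) by (auto simp: mem_deform)
    obtain q0 where q0: "q0 \<in> vertices T" "q = \<beta> T q0" "l' = patch (translate q0 T) 0 R\<^sub>0" using pq(2) by (auto simp: mem_deform)
    have "p0 \<noteq> q0" using pq(3) p0 q0 by auto
    then have "gap \<le> dist p0 q0" using gap(2)[OF T p0(1) q0(1)] by linarith
    then have "m * gap \<le> m * dist p0 q0" using m(1) by simp
    also have "\<dots> \<le> dist p q" using m(2)[OF T, of p0 q0] by (simp add: p0 q0 dist_norm)
    finally show ?thesis .
  qed
  moreover have "m * gap > 0" using m(1) gap(1) by simp
  ultimately show "\<exists>r>0. \<forall>p l q l'. ({p}, l) \<in> deform T \<longrightarrow> ({q}, l') \<in> deform T \<longrightarrow> (p, l) \<noteq> (q, l') \<longrightarrow> r \<le> dist p q"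
    by (intro exI[of _ "m * gap"]) simp
  have "\<exists>p l. ({p}, l) \<in> deform T \<and> dist x p \<le> M * radius" for x
    using deform_dense[OF T, of x] by (auto simp: mem_deform)
  moreover have "M * radius > 0" using M(1) radius(1) by simp
  ultimately show "\<exists>R>0. \<forall>x. \<exists>p l. ({p}, l) \<in> deform T \<and> dist x p \<le> R"
    by (intro exI[of _ "M * radius"]) simp
qed

lemma deform_continuous:
  assumes \<Omega>': "\<And>T. T \<in> \<Omega> \<Longrightarrow> deform T \<in> \<Omega>'" "\<And>S. S \<in> \<Omega>' \<Longrightarrow> labelled_delone discrete_labels S"
  shows "continuous_map X (pattern_topology discrete_labels \<Omega>') deform"
proof (rule continuous_patternI)
  show "compact t \<and> t \<noteq> {} \<and> l \<in> mspace discrete_labels" if "S \<in> \<Omega>'" "(t, l) \<in> S" for S t l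
    using \<Omega>'(2)[OF that(1)] that(2) unfolding labelled_delone_def by force
  fix T and s e :: real assume T: "T \<in> \<Omega>" and s: "s > 0" and e: "e > 0"
  have "norm (\<beta> T z) < e" if "norm z < e / M" for z
    using M(2)[OF T, of z 0] \<beta>_0[OF T] that M(1) by (simp add: pos_less_divide_eq mult.commute)
  then have "\<forall>T'\<in>\<Omega>. \<forall>z. norm z < e / M \<longrightarrow> agree (s / m + R + R\<^sub>0) z T T' \<longrightarrow>
      (\<exists>w. norm w < e \<and> agree s w (deform T) (deform T'))"
    using deform_agree[OF T] by blast
  moreover have "0 < s / m + R + R\<^sub>0" "0 < e / M" using R R0 s e m(1) M(1) by (auto intro!: add_pos_pos)
  ultimately show "\<exists>r>0. \<exists>\<delta>>0. \<forall>T'\<in>\<Omega>. \<forall>z. norm z < \<delta> \<longrightarrow> agree r z T T' \<longrightarrow>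
      (\<exists>w. norm w < e \<and> agree s w (deform T) (deform T'))" by blast
qed (rule \<Omega>'(1))

text \<open>The labels record the patches around the vertices. From a vertex that two patterns with the
  same deformation share, with the same patch around it, the next vertices and their displacement
  can be read off from that patch; since the displacement determines the vertex, those have the
  same label, hence the same patch. Walking outwards, all patches coincide.\<close>

lemma deform_eq_at_vertex:
  assumes S: "S \<in> \<Omega>" "S' \<in> \<Omega>" and eq: "deform S = deform S'"
    and 0: "0 \<in> vertices S" "patch S 0 R\<^sub>0 = patch S' 0 R\<^sub>0"
  shows "S = S'"
proof -
  have step: "q \<in> vertices S' \<and> \<beta> S' q = \<beta> S q \<and> patch (translate q S) 0 R\<^sub>0 = patch (translate q S') 0 R\<^sub>0"
    if q: "q \<in> vertices S" and d: "norm (q - p) \<le> 4 * radius" and \<beta>p: "\<beta> S' p = \<beta> S p"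
      and p: "patch (translate p S) 0 R\<^sub>0 = patch (translate p S') 0 R\<^sub>0" for p q
  proof -
    have ag: "agree R\<^sub>0 0 (translate p S) (translate p S')" using p by (simp add: agree_def)
    have q': "q \<in> vertices S'"
      using agree_vertices[OF ag, of "q - p"] q d R by (simp add: vertices_translate)
    have "\<beta> (translate p S') (q - p) = \<beta> (translate p S) (q - p)"
      using local[OF _ _ ag, of "q - p"] S d R \<beta>_0[of "translate p S"] by simp
    then have \<beta>q: "\<beta> S' q = \<beta> S q"
      using cocycle[OF S(1), of p "q - p"] cocycle[OF S(2), of p "q - p"] \<beta>p by simp
    have "({\<beta> S q}, patch (translate q S) 0 R\<^sub>0) \<in> deform S'" using q by (auto simp: eq[symmetric] mem_deform)
    then obtain q2 where q2: "q2 \<in> vertices S'" "\<beta> S' q2 = \<beta> S q" "patch (translate q S) 0 R\<^sub>0 = patch (translate q2 S') 0 R\<^sub>0"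
      unfolding mem_deform by auto
    then have "q2 = q" using \<beta>_inj[OF S(2), of q2 q] \<beta>q by simp
    then show ?thesis using q' \<beta>q q2(3) by simp
  qed
  have all: "q \<in> vertices S \<Longrightarrow> norm q \<le> real n * radius \<Longrightarrow>
      q \<in> vertices S' \<and> \<beta> S' q = \<beta> S q \<and> patch (translate q S) 0 R\<^sub>0 = patch (translate q S') 0 R\<^sub>0" for q n
  proof (induction n arbitrary: q)
    case 0
    show ?case by (rule step[of q 0]) (use 0 radius(1) S \<beta>_0 assms(5) in simp_all)
  next
    case (Suc n)
    show ?case
    proof (cases "norm q \<le> 4 * radius")
      case True
      show ?thesis by (rule step[of q 0]) (use Suc True S \<beta>_0 assms(5) in simp_all)
    next
      case False
      \<comment> \<open>a vertex near this point is closer to the origin than \<open>q\<close>, yet not far from \<open>q\<close>\<close>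
      define x where "x = ((norm q - 3 * radius) / norm q) *\<^sub>R q"
      have nq: "norm q > 4 * radius" using False by simp
      then have q0: "norm q > 0" using radius(1) by linarith
      have nx: "norm x = norm q - 3 * radius" using nq q0 radius(1) by (simp add: x_def)
      have "q - x = (3 * radius / norm q) *\<^sub>R q"
        using q0 by (simp add: x_def diff_divide_distrib algebra_simps)
      then have qx: "norm (q - x) = 3 * radius" using q0 radius(1) by simp
      obtain p where p: "p \<in> vertices S" "dist x p \<le> radius" using radius(2)[OF S(1)] by blast
      have "norm p \<le> norm x + dist x p" using norm_triangle_ineq4[of x "x - p"] by (simp add: dist_norm)
      then have "norm p \<le> real n * radius" using nx p(2) Suc.prems(2) radius(1) by (simp add: algebra_simps)
      note p' = Suc.IH[OF p(1) this]
      have "norm (q - p) \<le> 4 * radius"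
        using norm_triangle_ineq[of "q - x" "x - p"] qx p(2) by (simp add: dist_norm)
      then show ?thesis using step[OF Suc.prems(1), of p] p' by blast
    qed
  qed
  have patch_eq: "patch S q R\<^sub>0 = patch S' q R\<^sub>0" if q: "q \<in> vertices S" for q
  proof -
    obtain n :: nat where "norm q / radius \<le> real n" using real_arch_simple by blast
    then have "norm q \<le> real n * radius" using radius(1) by (simp add: pos_divide_le_eq)
    from all[OF q this] have "patch (translate q S) 0 R\<^sub>0 = patch (translate q S') 0 R\<^sub>0" by blast
    then have "translate (- q) (translate q (patch S q R\<^sub>0)) = translate (- q) (translate q (patch S' q R\<^sub>0))"
      by (simp add: patch_translate)
    then show ?thesis by simp
  qed
  have "\<exists>q\<in>vertices S. \<tau> \<in> S \<longrightarrow> \<tau> \<in> patch S q R\<^sub>0" "\<exists>q\<in>vertices S. \<tau> \<in> S' \<longrightarrow> \<tau> \<in> patch S' q R\<^sub>0" for \<tau>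
  proof -
    obtain t l where \<tau>: "\<tau> = (t, l)" by fastforce
    have "\<exists>q\<in>vertices S. (t, l) \<in> S2 \<longrightarrow> (t, l) \<in> patch S2 q R\<^sub>0" if S2: "S2 \<in> \<Omega>" for S2
    proof (cases "(t, l) \<in> S2")
      case True
      then obtain x where x: "x \<in> t" using tiles[OF S2] by blast
      obtain q where q: "q \<in> vertices S" "dist x q \<le> radius" using radius(2)[OF S(1)] by blast
      then have "x \<in> ball q R\<^sub>0" using R0 by (simp add: dist_commute)
      then show ?thesis using x q(1) True unfolding patch_def by blast
    next
      case False
      then show ?thesis using 0(1) by blast
    qed
    then show "\<exists>q\<in>vertices S. \<tau> \<in> S \<longrightarrow> \<tau> \<in> patch S q R\<^sub>0" "\<exists>q\<in>vertices S. \<tau> \<in> S' \<longrightarrow> \<tau> \<in> patch S' q R\<^sub>0"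
      using S unfolding \<tau> by blast+
  qed
  then show ?thesis using patch_eq patch_subset by blast
qed

text \<open>A common point of the deformations is a common vertex up to translation. The vector from it back
  to the origin has the same displacement, and so is the same, in both patterns.\<close>

lemma deform_inj: "inj_on deform \<Omega>"
proof (rule inj_onI)
  fix S S' assume S: "S \<in> \<Omega>" "S' \<in> \<Omega>" and eq: "deform S = deform S'"
  obtain p where p: "p \<in> vertices S" using radius(2)[OF S(1), of 0] by blast
  then have "({\<beta> S p}, patch (translate p S) 0 R\<^sub>0) \<in> deform S'" by (auto simp: eq[symmetric] mem_deform)
  then obtain p' where p': "p' \<in> vertices S'" "\<beta> S' p' = \<beta> S p" "patch (translate p S) 0 R\<^sub>0 = patch (translate p' S') 0 R\<^sub>0"
    unfolding mem_deform by auto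
  have pp: "translate p S = translate p' S'"
  proof (rule deform_eq_at_vertex)
    show "deform (translate p S) = deform (translate p' S')"
      by (simp add: deform_translate S eq p'(2))
  qed (use S p p' in \<open>simp_all add: vertices_translate\<close>)
  have "\<beta> S' (p' - p) = \<beta> S' p' + \<beta> (translate p' S') (- p)" using cocycle[OF S(2), of p' "- p"] by simp
  also have "\<dots> = \<beta> S p + \<beta> (translate p S) (- p)" by (simp only: pp p'(2))
  also have "\<dots> = \<beta> S' 0" using cocycle[OF S(1), of p "- p"] \<beta>_0 S by simp
  finally have "p' = p" using \<beta>_inj[OF S(2)] by fastforce
  then have "translate (- p) (translate p S) = translate (- p) (translate p S')" using pp by simp
  then show "S = S'" by simp
qed

subsection \<open>The space of deformed patterns\<close>

lemma polytope_deform: "(t, l) \<in> deform T \<Longrightarrow> polytope t \<and> t \<noteq> {} \<and> l \<in> mspace discrete_labels"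
  by (auto simp: mem_deform polytope_sing)

lemma vertices_deform: "vertices (deform T) = \<beta> T ` vertices T"
proof -
  have "p \<in> vertices (deform T) \<longleftrightarrow> (\<exists>t l. (t, l) \<in> deform T \<and> p extreme_point_of t)" for p
    by (auto simp: vertices_def)
  then show ?thesis by (auto simp: mem_deform)
qed

text \<open>Every patch of a deformed pattern lies, after a translation, in a patch of fixed radius of
  the deformation of a pattern with a vertex at the origin. There are finitely many of the latter.\<close>

lemma FLC_deform: "FLC (deform ` \<Omega>)"
  unfolding FLC_def
proof (intro allI impI)
  fix r :: real assume r: "r > 0"
  define s where "s = r + M * radius"
  define r' where "r' = s / m + R + R\<^sub>0"
  have s: "s > 0" using r M(1) radius(1) by (simp add: s_def add_pos_pos)
  then have r': "r' > 0" using m(1) R R0 by (simp add: r'_def add_pos_pos)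
  define Q where "Q = {patch (deform T) 0 s |T. T \<in> \<Omega> \<and> 0 \<in> vertices T}"
  have "\<exists>f. \<forall>T\<in>\<Omega>. patch (deform T) 0 s = f (patch T 0 r')"
  proof (intro exI[of _ "\<lambda>P. patch (deform (SOME T. T \<in> \<Omega> \<and> patch T 0 r' = P)) 0 s"] ballI)
    fix T assume T: "T \<in> \<Omega>"
    have *: "(SOME S. S \<in> \<Omega> \<and> patch S 0 r' = patch T 0 r') \<in> \<Omega> \<and>
        patch (SOME S. S \<in> \<Omega> \<and> patch S 0 r' = patch T 0 r') 0 r' = patch T 0 r'"
      by (rule someI[of _ T]) (simp add: T)
    show "patch (deform T) 0 s = patch (deform (SOME S. S \<in> \<Omega> \<and> patch S 0 r' = patch T 0 r')) 0 s"
      by (rule deform_patch[OF T conjunct1[OF *] conjunct2[OF *, symmetric]]) (simp add: r'_def)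
  qed
  then obtain f where f: "\<And>T. T \<in> \<Omega> \<Longrightarrow> patch (deform T) 0 s = f (patch T 0 r')" by blast
  have "Q \<subseteq> f ` {patch T 0 r' |T. T \<in> \<Omega> \<and> 0 \<in> vertices T}" unfolding Q_def using f by blast
  then have "finite Q" using finite_vertex_patches[OF r'] finite_subset by blast
  moreover have "finite P" if "P \<in> Q" for P
    using that labelled_delone_finite_patch[OF labelled_delone_deform] unfolding Q_def by blast
  ultimately have fin: "finite (\<Union>P\<in>Q. Pow P)" by simp
  have "\<exists>P\<in>(\<Union>P\<in>Q. Pow P). \<exists>y. patch (deform T) x r = translate y P" if T: "T \<in> \<Omega>" for T x
  proof -
    obtain p where p: "p \<in> vertices T" "dist x (\<beta> T p) \<le> M * radius" using deform_dense[OF T] by blast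
    define P where "P = patch (deform (translate p T)) (x - \<beta> T p) r"
    have "ball (x - \<beta> T p) r \<subseteq> ball 0 s" using p(2) by (simp add: s_def ball_subset_ball_iff dist_norm)
    then have "P \<subseteq> patch (deform (translate p T)) 0 s" unfolding P_def patch_def by blast
    moreover have "patch (deform (translate p T)) 0 s \<in> Q"
      unfolding Q_def using T p(1) by (intro CollectI exI[of _ "translate p T"]) (simp add: vertices_translate)
    ultimately have "P \<in> (\<Union>P\<in>Q. Pow P)" by blast
    moreover have "P = translate (\<beta> T p) (patch (deform T) x r)"
      by (simp add: P_def deform_translate[OF T] patch_translate)
    then have "patch (deform T) x r = translate (- \<beta> T p) P" by simp
    ultimately show ?thesis by blast
  qed
  then show "\<exists>F. finite F \<and> (\<forall>T\<in>deform ` \<Omega>. \<forall>x. \<exists>P\<in>F. \<exists>y. patch T x r = translate y P)"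
    using fin by blast
qed

lemma deform_flc_space: "flc_space discrete_labels (deform ` \<Omega>)"
proof
  show "polytope t \<and> t \<noteq> {} \<and> l \<in> mspace discrete_labels" if "T \<in> deform ` \<Omega>" "(t, l) \<in> T" for T t l
    using that polytope_deform by blast
  show "translate x T \<in> deform ` \<Omega>" if "T \<in> deform ` \<Omega>" for T x
  proof -
    obtain S where S: "S \<in> \<Omega>" "T = deform S" using \<open>T \<in> deform ` \<Omega>\<close> by blast
    obtain y where "\<beta> S y = x" using surj[OF S(1)] by blast
    then have "translate x T = deform (translate y S)" by (simp add: S deform_translate)
    then show ?thesis using S by simp
  qed
  show "finite (patch T x R)" if "T \<in> deform ` \<Omega>" for T x R
    using that labelled_delone_finite_patch[OF labelled_delone_deform] by blast
  show "FLC (deform ` \<Omega>)" by (rule FLC_deform)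
  have "continuous_map X (pattern_topology discrete_labels (deform ` \<Omega>)) deform"
    by (rule deform_continuous) (use labelled_delone_deform in blast)+
  then have "compactin (pattern_topology discrete_labels (deform ` \<Omega>)) (deform ` \<Omega>)"
    using image_compactin[of X \<Omega>] compact by (simp add: compact_space_def)
  then show "compact_space (pattern_topology discrete_labels (deform ` \<Omega>))" by (simp add: compact_space_def)
  have "M * radius > 0" using M(1) radius(1) by simp
  moreover have "\<exists>p\<in>vertices T. dist x p \<le> M * radius" if "T \<in> deform ` \<Omega>" for T x
    using that deform_dense[of _ x] by (auto simp: vertices_deform)
  ultimately show "\<exists>\<rho>>0. \<forall>T\<in>deform ` \<Omega>. \<forall>x. \<exists>p\<in>vertices T. dist x p \<le> \<rho>" by blast
qed

lemma deform_homeomorphic: "homeomorphic_map X (pattern_topology discrete_labels (deform ` \<Omega>)) deform"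
proof (rule continuous_imp_homeomorphic_map)
  show "continuous_map X (pattern_topology discrete_labels (deform ` \<Omega>)) deform"
    by (rule deform_continuous) (use labelled_delone_deform in blast)+
  show "Hausdorff_space (pattern_topology discrete_labels (deform ` \<Omega>))"
    by (rule flc_space.Hausdorff[OF deform_flc_space])
qed (use compact deform_inj in simp_all)

text \<open>Discrete labels at distance less than 1 are equal.\<close>

lemma eps_close_delone_image:
  assumes "eps_close discrete_labels e S S'" "labelled_delone discrete_labels S'" "({p}, l) \<in> S" "norm p < 1 / e" "e \<le> 1"
  shows "\<exists>q. ({q}, l) \<in> S' \<and> dist p q < e"
proof -
  obtain A A' f where A: "patch S 0 (1 / e) \<subseteq> A" "A' \<subseteq> S'" "bij_betw f A A'"
    "\<forall>s\<in>A. hausdorff_dist (fst s) (fst (f s)) < e \<and> mdist discrete_labels (snd s) (snd (f s)) < e"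
    using assms(1) unfolding eps_close_def by (elim exE conjE)
  have "({p}, l) \<in> A" using A(1) assms(3,4) by (auto simp: patch_def)
  then have fp: "f ({p}, l) \<in> S'" "hausdorff_dist {p} (fst (f ({p}, l))) < e" "mdist discrete_labels l (snd (f ({p}, l))) < e"
    using A(2-4) bij_betwE by fastforce+
  obtain t l' where f: "f ({p}, l) = (t, l')" by fastforce
  obtain q where q: "t = {q}" using assms(2) fp(1) unfolding f labelled_delone_def by blast
  have "l' = l" using fp(3) assms(5) by (simp add: f mdist_discrete_labels split: if_splits)
  moreover have "dist p q < e"
    using fp(2) hausdorff_dist_le_iff[of "{p}" "{q}" "hausdorff_dist {p} {q}"] by (simp add: f q)
  ultimately show ?thesis using fp(1) f q by auto
qed

lemma eps_close_delone_preimage: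
  assumes "eps_close discrete_labels e S S'" "labelled_delone discrete_labels S" "({q}, l) \<in> S'" "norm q < 1 / e" "e \<le> 1"
  shows "\<exists>p. ({p}, l) \<in> S \<and> dist p q < e"
proof -
  obtain A A' f where A: "A \<subseteq> S" "patch S' 0 (1 / e) \<subseteq> A'" "bij_betw f A A'"
    "\<forall>s\<in>A. hausdorff_dist (fst s) (fst (f s)) < e \<and> mdist discrete_labels (snd s) (snd (f s)) < e"
    using assms(1) unfolding eps_close_def by (elim exE conjE)
  have "({q}, l) \<in> A'" using A(2) assms(3,4) by (auto simp: patch_def)
  then obtain s where s: "s \<in> A" "f s = ({q}, l)" using bij_betw_imp_surj_on[OF A(3)] by (metis imageE)
  obtain t l' where tl: "s = (t, l')" by fastforce
  have fp: "hausdorff_dist t {q} < e" "mdist discrete_labels l' l < e"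
    using bspec[OF A(4) s(1)] s(2) by (simp_all add: tl)
  have "(t, l') \<in> S" using A(1) s(1) tl by blast
  then obtain p where p: "t = {p}" using assms(2) unfolding labelled_delone_def by blast
  have "l' = l" using fp(2) assms(5) by (simp add: mdist_discrete_labels split: if_splits)
  moreover have "dist p q < e"
    using fp(1) hausdorff_dist_le_iff[of "{p}" "{q}" "hausdorff_dist {p} {q}"] by (simp add: p)
  ultimately show ?thesis using \<open>(t, l') \<in> S\<close> p by blast
qed

lemma labelled_delone_limit:
  assumes S: "labelled_delone K S" and near: "\<And>e. e > 0 \<Longrightarrow> \<exists>q. ({q}, l) \<in> S \<and> dist p q < e"
  shows "({p}, l) \<in> S"
proof -
  obtain r where r: "r > 0" "\<And>p l q m. ({p}, l) \<in> S \<Longrightarrow> ({q}, m) \<in> S \<Longrightarrow> (p, l) \<noteq> (q, m) \<Longrightarrow> r \<le> dist p q"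
    using S unfolding labelled_delone_def by blast
  obtain q where q: "({q}, l) \<in> S" "dist p q < r / 2" using near[of "r / 2"] r(1) by auto
  have "p = q"
  proof (rule ccontr)
    assume "p \<noteq> q"
    then obtain q' where q': "({q'}, l) \<in> S" "dist p q' < min (r / 2) (dist p q)" using near[of "min (r / 2) (dist p q)"] r(1) by auto
    then have "q' \<noteq> q" by auto
    then have "r \<le> dist q' q" using r(2)[OF q'(1) q(1)] by simp
    moreover have "dist q' q \<le> dist p q' + dist p q" by (metis dist_commute dist_triangle)
    ultimately show False using q(2) q'(2) by simp
  qed
  then show ?thesis using q(1) by simp
qed

text \<open>A Delone set that is approximated by deformations of patterns near \<open>T\<close> is the deformation
  of \<open>T\<close>: both are discrete, and any point of one is approximated by points of the other with the
  same label.\<close>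

lemma deform_limit:
  assumes T: "T \<in> \<Omega>" and S: "labelled_delone discrete_labels S"
    and near: "\<And>r \<delta> e. r > 0 \<Longrightarrow> \<delta> > 0 \<Longrightarrow> e > 0 \<Longrightarrow> \<exists>T'\<in>cylinder T r \<delta>. eps_close discrete_labels e S (deform T')"
  shows "deform T = S"
proof -
  note DT = labelled_delone_deform[OF T]
  have near': "\<exists>T' w. labelled_delone discrete_labels (deform T') \<and> norm w < e \<and> agree s w (deform T) (deform T') \<and> eps_close discrete_labels e S (deform T')"
    if s: "s > 0" and e: "e > 0" for s e
  proof -
    have "0 < s / m + R + R\<^sub>0" "0 < e / M" using R R0 s e m(1) M(1) by (auto intro!: add_pos_pos)
    from near[OF this e] obtain T' where T': "T' \<in> cylinder T (s / m + R + R\<^sub>0) (e / M)" "eps_close discrete_labels e S (deform T')" by blast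
    obtain z where z: "T' \<in> \<Omega>" "norm z < e / M" "agree (s / m + R + R\<^sub>0) z T T'" by (rule cylinderE[OF T'(1)])
    have "norm (\<beta> T z) < e"
      using M(2)[OF T, of z 0] \<beta>_0[OF T] z(2) M(1) by (simp add: pos_less_divide_eq mult.commute)
    then show ?thesis
      using deform_agree[OF T z(1,3), of s] labelled_delone_deform[OF z(1)] T'(2) by blast
  qed
  have le: "({p}, l) \<in> deform T" if pl: "({p}, l) \<in> S" for p l
  proof (rule labelled_delone_limit[OF DT])
    fix e :: real assume e: "e > 0"
    define d where "d = min (min 1 (e / 2)) (1 / (norm p + 1))"
    have d: "0 < d" "d \<le> 1" "d \<le> e / 2" "d \<le> 1 / (norm p + 1)" using e by (simp_all add: d_def add_nonneg_pos)
    have "d * (norm p + 1) \<le> 1" using d(4) by (simp add: pos_le_divide_eq add_nonneg_pos)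
    then have "d * norm p < 1" using d(1) by (simp add: algebra_simps)
    then have np: "norm p < 1 / d" using d(1) by (simp add: pos_less_divide_eq mult.commute)
    obtain T' w where T': "labelled_delone discrete_labels (deform T')" "norm w < d" "agree (norm p + 2) w (deform T) (deform T')"
      "eps_close discrete_labels d S (deform T')" using near'[of "norm p + 2" d] d(1) by (auto simp: add_nonneg_pos)
    obtain q where q: "({q}, l) \<in> deform T'" "dist p q < d" using eps_close_delone_image[OF T'(4,1) pl np d(2)] by blast
    have "norm q < norm p + 2" using norm_triangle_ineq4[of p "p - q"] q(2) d(2) by (simp add: dist_norm)
    then have "({q}, l) \<in> patch (deform T') 0 (norm p + 2)" using q(1) by (simp add: patch_def)
    then have "({q}, l) \<in> translate w (deform T)" using T'(3) patch_subset unfolding agree_def by blast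
    then have "({q + w}, l) \<in> deform T" by (simp add: mem_translate)
    moreover have "dist p (q + w) < e"
      using norm_triangle_ineq4[of "p - q" w] q(2) T'(2) d(3) by (simp add: dist_norm diff_diff_eq)
    ultimately show "\<exists>q. ({q}, l) \<in> deform T \<and> dist p q < e" by blast
  qed
  have ge: "({p}, l) \<in> S" if pl: "({p}, l) \<in> deform T" for p l
  proof (rule labelled_delone_limit[OF S])
    fix e :: real assume e: "e > 0"
    define d where "d = min (min 1 (e / 2)) (1 / (norm p + 2))"
    have d: "0 < d" "d \<le> 1" "d \<le> e / 2" "d \<le> 1 / (norm p + 2)" using e by (simp_all add: d_def add_nonneg_pos)
    have "d * (norm p + 2) \<le> 1" using d(4) by (simp add: pos_le_divide_eq add_nonneg_pos)
    then have np: "norm p + 2 \<le> 1 / d" using d(1) by (simp add: pos_le_divide_eq mult.commute)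
    obtain T' w where T': "labelled_delone discrete_labels (deform T')" "norm w < d" "agree (norm p + 2) w (deform T) (deform T')"
      "eps_close discrete_labels d S (deform T')" using near'[of "norm p + 2" d] d(1) by (auto simp: add_nonneg_pos)
    have nq: "norm (p - w) < norm p + 2" using norm_triangle_ineq4[of p w] T'(2) d(2) by simp
    have "({p - w}, l) \<in> translate w (deform T)" using translateI[OF pl, of w] by simp
    then have "({p - w}, l) \<in> patch (translate w (deform T)) 0 (norm p + 2)" using nq by (simp add: patch_def)
    then have "({p - w}, l) \<in> deform T'" using T'(3) patch_subset unfolding agree_def by blast
    then obtain q where q: "({q}, l) \<in> S" "dist q (p - w) < d"
      using eps_close_delone_preimage[OF T'(4) S _ _ d(2), of "p - w" l] nq np by auto
    have "dist p q < e"
      using norm_triangle_ineq4[of w "q - (p - w)"] q(2) T'(2) d(3) by (simp add: dist_norm norm_minus_commute)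
    then show "\<exists>q. ({q}, l) \<in> S \<and> dist p q < e" using q(1) by blast
  qed
  have "t = {the_elem t}" if "(t, l) \<in> deform T \<union> S" for t l
    using that DT S unfolding labelled_delone_def by fastforce
  then show ?thesis using le ge by (metis (no_types, lifting) UnI1 UnI2 subrelI subset_antisym)
qed

text \<open>Minimality gives one inclusion. For the other, a Delone set outside \<open>deform ` \<Omega>\<close> is kept away from
  the deformations of a neighbourhood of each pattern, and finitely many of these cover \<open>\<Omega>\<close>.\<close>

lemma delone_hull_deform:
  assumes min: "minimal L \<Omega>" and T: "T \<in> \<Omega>"
  shows "delone_hull discrete_labels (deform T) = deform ` \<Omega>"
proof
  let ?Y = "pattern_topology discrete_labels {S :: ('d, ('d, 'l) pattern) pattern. labelled_delone discrete_labels S}"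
  have orb: "orbit (deform T) = deform ` orbit T"
  proof -
    have "translate x (deform T) \<in> deform ` orbit T" for x
    proof -
      obtain y where "\<beta> T y = x" using surj[OF T] by blast
      then have "translate x (deform T) = deform (translate y T)" by (simp add: deform_translate[OF T])
      then show ?thesis unfolding orbit_def by blast
    qed
    moreover have "deform (translate y T) \<in> orbit (deform T)" for y
      unfolding orbit_def by (simp add: deform_translate[OF T])
    ultimately show ?thesis unfolding orbit_def by blast
  qed
  have c: "continuous_map X ?Y deform"
    by (rule deform_continuous) (use labelled_delone_deform in blast)+
  have "deform ` (X closure_of orbit T) \<subseteq> ?Y closure_of (deform ` orbit T)"
    by (rule continuous_map_image_closure_subset[OF c])
  then show "deform ` \<Omega> \<subseteq> delone_hull discrete_labels (deform T)"
    using min T unfolding minimal_def delone_hull_def orb by simp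
  have "closedin ?Y (deform ` \<Omega>)"
    unfolding closedin_def openin_pattern_topology topspace_pattern_topology
  proof (intro conjI ballI)
    show "deform ` \<Omega> \<subseteq> {S. labelled_delone discrete_labels S}" using labelled_delone_deform by blast
    fix S assume "S \<in> {S. labelled_delone discrete_labels S} - deform ` \<Omega>"
    then have S: "labelled_delone discrete_labels S" "\<And>T. T \<in> \<Omega> \<Longrightarrow> deform T \<noteq> S" by blast+
    have "\<exists>r \<delta> e. r > 0 \<and> \<delta> > 0 \<and> e > 0 \<and> (\<forall>T'\<in>cylinder T r \<delta>. \<not> eps_close discrete_labels e S (deform T'))" if T: "T \<in> \<Omega>" for T
      using deform_limit[OF T S(1)] S(2)[OF T] by blast
    then obtain r \<delta> e where rde: "\<And>T. T \<in> \<Omega> \<Longrightarrow> r T > 0 \<and> \<delta> T > 0 \<and> (e T :: real) > 0 \<and>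
        (\<forall>T'\<in>cylinder T (r T) (\<delta> T). \<not> eps_close discrete_labels (e T) S (deform T'))" by metis
    obtain F where F: "finite F" "F \<subseteq> \<Omega>" "\<Omega> \<subseteq> (\<Union>T\<in>F. cylinder T (r T) (\<delta> T))"
      using finite_cylinder_cover[of r \<delta>] rde by blast
    define \<epsilon> where "\<epsilon> = Min (insert 1 (e ` F))"
    have \<epsilon>: "\<epsilon> > 0" "\<And>T. T \<in> F \<Longrightarrow> \<epsilon> \<le> e T" using F rde by (auto simp: \<epsilon>_def)
    have "S' \<notin> deform ` \<Omega>" if "eps_close discrete_labels \<epsilon> S S'" for S'
    proof
      assume "S' \<in> deform ` \<Omega>"
      then obtain T' where T': "T' \<in> \<Omega>" "S' = deform T'" by blast
      obtain T0 where T0: "T0 \<in> F" "T' \<in> cylinder T0 (r T0) (\<delta> T0)" using F(3) T'(1) by blast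
      have "eps_close discrete_labels (e T0) S (deform T')"
        using eps_close_mono[OF that \<epsilon>(1) \<epsilon>(2)[OF T0(1)]] T'(2) by simp
      then show False using rde[of T0] F(2) T0 by blast
    qed
    then show "\<exists>\<epsilon>>0. \<forall>S'\<in>{S. labelled_delone discrete_labels S}. eps_close discrete_labels \<epsilon> S S' \<longrightarrow>
        S' \<in> {S. labelled_delone discrete_labels S} - deform ` \<Omega>" using \<epsilon>(1) by blast
  qed blast
  moreover have "orbit T \<subseteq> \<Omega>" using T by (auto simp: orbit_def)
  then have "orbit (deform T) \<subseteq> deform ` \<Omega>" unfolding orb by (rule image_mono)
  ultimately show "delone_hull discrete_labels (deform T) \<subseteq> deform ` \<Omega>"
    unfolding delone_hull_def by (rule closure_of_minimal[rotated])
qed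

end

section \<open>Pullback of Cech cocycles\<close>

lemma image_preimage_homeomorphic_map:
  assumes "homeomorphic_map X Y h" "V \<subseteq> topspace Y"
  shows "h ` {x \<in> topspace X. h x \<in> V} = V"
proof
  show "V \<subseteq> h ` {x \<in> topspace X. h x \<in> V}"
  proof
    fix y assume y: "y \<in> V"
    then have "y \<in> h ` topspace X" using homeomorphic_imp_surjective_map[OF assms(1)] assms(2) by blast
    then show "y \<in> h ` {x \<in> topspace X. h x \<in> V}" using y by blast
  qed
qed blast

lemma locally_constant_on_pullback:
  assumes h: "continuous_map X Y h" and f: "locally_constant_on Y A f"
  shows "locally_constant_on X {x \<in> topspace X. h x \<in> A} (\<lambda>x. f (h x))"
  unfolding locally_constant_on_def
proof
  let ?A = "{x \<in> topspace X. h x \<in> A}"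
  fix x assume "x \<in> ?A"
  then have x: "x \<in> topspace X" "h x \<in> A" by simp_all
  obtain U where U: "openin (subtopology Y A) U" "h x \<in> U" "\<forall>y\<in>U. f y = f (h x)"
    using bspec[OF f[unfolded locally_constant_on_def] x(2)] by (elim exE conjE)
  obtain V where V: "openin Y V" "U = V \<inter> A" using U(1) unfolding openin_subtopology by (elim exE conjE)
  let ?V = "{x \<in> topspace X. h x \<in> V}"
  have "openin (subtopology X ?A) (?V \<inter> ?A)"
    unfolding openin_subtopology by (rule exI[of _ ?V], rule conjI[OF openin_continuous_map_preimage[OF h V(1)] refl])
  moreover have "x \<in> ?V \<inter> ?A" using x U(2) V(2) by simp
  moreover have "\<forall>y\<in>?V \<inter> ?A. f (h y) = f (h x)" using U(3) V(2) by simp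
  ultimately show "\<exists>U. openin (subtopology X ?A) U \<and> x \<in> U \<and> (\<forall>y\<in>U. f (h y) = f (h x))"
    by (intro exI conjI)
qed

lemma open_cover_pullback:
  assumes h: "continuous_map X Y h" and \<V>: "open_cover Y \<V>"
  shows "open_cover X ((\<lambda>V. {x \<in> topspace X. h x \<in> V}) ` \<V>)"
  unfolding open_cover_def
proof (intro conjI)
  show "\<forall>U\<in>(\<lambda>V. {x \<in> topspace X. h x \<in> V}) ` \<V>. openin X U"
    using openin_continuous_map_preimage[OF h] \<V> unfolding open_cover_def by blast
  show "\<Union>((\<lambda>V. {x \<in> topspace X. h x \<in> V}) ` \<V>) = topspace X"
    using continuous_map_image_subset_topspace[OF h] \<V> unfolding open_cover_def by blast
qed

lemma cech_cocycle_pullback: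
  assumes h: "homeomorphic_map X Y h" and e: "cech_cocycle Y e"
  shows "cech_cocycle X (cocycle_pullback X h e)"
proof -
  obtain \<V> k where ek: "e = (\<V>, k)" by fastforce
  have \<V>: "open_cover Y \<V>"
    and lc: "\<And>U V. U \<in> \<V> \<Longrightarrow> V \<in> \<V> \<Longrightarrow> locally_constant_on Y (U \<inter> V) (k U V)"
    and coc: "\<And>U V W x. U \<in> \<V> \<Longrightarrow> V \<in> \<V> \<Longrightarrow> W \<in> \<V> \<Longrightarrow> x \<in> U \<inter> V \<inter> W \<Longrightarrow> k U V x + k V W x = k U W x"
    using e unfolding ek cech_cocycle_def by blast+
  note c = homeomorphic_imp_continuous_map[OF h]
  have im: "h ` {x \<in> topspace X. h x \<in> V} = V" if "V \<in> \<V>" for V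
    using \<V> that openin_subset[of Y V] unfolding open_cover_def by (intro image_preimage_homeomorphic_map[OF h]) blast
  have "locally_constant_on X ({x \<in> topspace X. h x \<in> U} \<inter> {x \<in> topspace X. h x \<in> V}) (\<lambda>x. k U V (h x))"
    if "U \<in> \<V>" "V \<in> \<V>" for U V
  proof -
    have "{x \<in> topspace X. h x \<in> U} \<inter> {x \<in> topspace X. h x \<in> V} = {x \<in> topspace X. h x \<in> U \<inter> V}" by blast
    then show ?thesis using locally_constant_on_pullback[OF c lc[OF that]] by simp
  qed
  then show ?thesis
    unfolding ek cocycle_pullback_def cech_cocycle_def prod.case
    by (simp add: open_cover_pullback[OF c \<V>] im coc)
qed

lemma cech_cohomologous_pullback:
  assumes h: "homeomorphic_map X Y h" and e: "cech_cocycle Y e" "cech_cocycle Y e'" "cech_cohomologous Y e e'"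
  shows "cech_cohomologous X (cocycle_pullback X h e) (cocycle_pullback X h e')"
proof -
  obtain \<U> c where ec: "e = (\<U>, c)" by fastforce
  obtain \<V> k where ek: "e' = (\<V>, k)" by fastforce
  obtain \<W> \<rho> \<sigma> b where W: "open_cover Y \<W>"
    "\<forall>W\<in>\<W>. \<rho> W \<in> \<U> \<and> W \<subseteq> \<rho> W \<and> \<sigma> W \<in> \<V> \<and> W \<subseteq> \<sigma> W \<and> locally_constant_on Y W (b W)"
    "\<forall>W\<in>\<W>. \<forall>W'\<in>\<W>. \<forall>x\<in>W \<inter> W'. c (\<rho> W) (\<rho> W') x - k (\<sigma> W) (\<sigma> W') x = b W x - b W' x"
    using e(3) unfolding ec ek cech_cohomologous_def prod.case by (elim exE conjE) (rule that)
  note hc = homeomorphic_imp_continuous_map[OF h]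
  let ?pre = "\<lambda>V. {x \<in> topspace X. h x \<in> V}"
  have oc: "open_cover Y \<U>" "open_cover Y \<V>" using e(1,2) by (simp_all add: ec ek cech_cocycle_def)
  have "\<forall>V\<in>\<U> \<union> \<V> \<union> \<W>. openin Y V" using oc W(1) by (simp add: open_cover_def ball_Un)
  then have im: "h ` ?pre V = V" if "V \<in> \<U> \<union> \<V> \<union> \<W>" for V
    using that openin_subset[of Y V] by (intro image_preimage_homeomorphic_map[OF h]) simp
  note imU = im[OF UnI1[OF UnI1]] and imV = im[OF UnI1[OF UnI2]] and imW = im[OF UnI2]
  show ?thesis
    unfolding ec ek cocycle_pullback_def cech_cohomologous_def prod.case
  proof (rule exI[of _ "?pre ` \<W>"], rule exI[of _ "\<lambda>W. ?pre (\<rho> (h ` W))"],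
      rule exI[of _ "\<lambda>W. ?pre (\<sigma> (h ` W))"], rule exI[of _ "\<lambda>W x. b (h ` W) (h x)"], intro conjI)
    show "open_cover X (?pre ` \<W>)" by (rule open_cover_pullback[OF hc W(1)])
    show "\<forall>W\<in>?pre ` \<W>. ?pre (\<rho> (h ` W)) \<in> ?pre ` \<U> \<and> W \<subseteq> ?pre (\<rho> (h ` W)) \<and>
        ?pre (\<sigma> (h ` W)) \<in> ?pre ` \<V> \<and> W \<subseteq> ?pre (\<sigma> (h ` W)) \<and> locally_constant_on X W (\<lambda>x. b (h ` W) (h x))"
    proof
      fix W' assume "W' \<in> ?pre ` \<W>"
      then obtain W0 where W0: "W0 \<in> \<W>" "W' = ?pre W0" by blast
      have i: "h ` W' = W0" unfolding W0(2) by (rule imW[OF W0(1)])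
      have w: "\<rho> W0 \<in> \<U>" "W0 \<subseteq> \<rho> W0" "\<sigma> W0 \<in> \<V>" "W0 \<subseteq> \<sigma> W0" "locally_constant_on Y W0 (b W0)"
        using bspec[OF W(2) W0(1)] by simp_all
      have "?pre W0 \<subseteq> ?pre (\<rho> W0)" "?pre W0 \<subseteq> ?pre (\<sigma> W0)" using w(2,4) by blast+
      then show "?pre (\<rho> (h ` W')) \<in> ?pre ` \<U> \<and> W' \<subseteq> ?pre (\<rho> (h ` W')) \<and>
        ?pre (\<sigma> (h ` W')) \<in> ?pre ` \<V> \<and> W' \<subseteq> ?pre (\<sigma> (h ` W')) \<and> locally_constant_on X W' (\<lambda>x. b (h ` W') (h x))"
        using locally_constant_on_pullback[OF hc w(5)] w(1,3) unfolding i unfolding W0(2) by (intro conjI imageI)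
    qed
    show "\<forall>W\<in>?pre ` \<W>. \<forall>W'\<in>?pre ` \<W>. \<forall>x\<in>W \<inter> W'.
        c (h ` ?pre (\<rho> (h ` W))) (h ` ?pre (\<rho> (h ` W'))) (h x) - k (h ` ?pre (\<sigma> (h ` W))) (h ` ?pre (\<sigma> (h ` W'))) (h x) =
        b (h ` W) (h x) - b (h ` W') (h x)"
    proof (intro ballI)
      fix V V' x assume V: "V \<in> ?pre ` \<W>" "V' \<in> ?pre ` \<W>" "x \<in> V \<inter> V'"
      obtain W0 where W0: "W0 \<in> \<W>" "V = ?pre W0" using V(1) by blast
      obtain W1 where W1: "W1 \<in> \<W>" "V' = ?pre W1" using V(2) by blast
      have i: "h ` V = W0" "h ` V' = W1" unfolding W0(2) W1(2) by (rule imW[OF W0(1)], rule imW[OF W1(1)])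
      have j: "h ` ?pre (\<rho> W0) = \<rho> W0" "h ` ?pre (\<rho> W1) = \<rho> W1" "h ` ?pre (\<sigma> W0) = \<sigma> W0" "h ` ?pre (\<sigma> W1) = \<sigma> W1"
        using bspec[OF W(2) W0(1)] bspec[OF W(2) W1(1)] by (simp_all only: imU imV)
      have "h x \<in> W0 \<inter> W1" using V(3) W0(2) W1(2) by blast
      then show "c (h ` ?pre (\<rho> (h ` V))) (h ` ?pre (\<rho> (h ` V'))) (h x) -
          k (h ` ?pre (\<sigma> (h ` V))) (h ` ?pre (\<sigma> (h ` V'))) (h x) = b (h ` V) (h x) - b (h ` V') (h x)"
        unfolding i j by (rule W(3)[rule_format, OF W0(1) W1(1)])
    qed
  qed
qed

context leaf_deformation
begin

text \<open>A function that changes by \<open>v\<close> under translation by \<open>v\<close> on the deformed patterns changes by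
  \<open>\<beta> T x\<close> under translation by \<open>x\<close> on the original ones.\<close>

lemma primitive_pullback:
  assumes c: "flc_space.primitive (deform ` \<Omega>) (\<lambda>T v. v) V c"
  shows "primitive \<beta> {T \<in> topspace X. deform T \<in> V} (\<lambda>T. c (deform T))"
  unfolding primitive_def
proof
  interpret D: flc_space discrete_labels "deform ` \<Omega>" by (rule deform_flc_space)
  fix T assume "T \<in> {T \<in> topspace X. deform T \<in> V}"
  then have T: "T \<in> \<Omega>" "deform T \<in> V" by simp_all
  have "\<exists>r>0. \<exists>\<delta>>0. \<forall>S\<in>deform ` \<Omega>. \<forall>z. norm z < \<delta> \<longrightarrow> agree r z (deform T) S \<longrightarrow> S \<in> V \<and> c S = c (deform T) + z"
    using c T(2) unfolding D.primitive_def by (rule bspec)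
  then obtain r \<delta> where r: "r > 0" "\<delta> > 0"
    "\<forall>S\<in>deform ` \<Omega>. \<forall>z. norm z < \<delta> \<longrightarrow> agree r z (deform T) S \<longrightarrow> S \<in> V \<and> c S = c (deform T) + z"
    by (elim exE conjE)
  have "T' \<in> {T \<in> topspace X. deform T \<in> V} \<and> c (deform T') = c (deform T) + \<beta> T z"
    if T': "T' \<in> \<Omega>" "norm z < \<delta> / M" "agree (r / m + R + R\<^sub>0) z T T'" for T' z
  proof -
    have "norm (\<beta> T z) < \<delta>"
      using M(2)[OF T(1), of z 0] \<beta>_0[OF T(1)] T'(2) M(1) by (simp add: pos_less_divide_eq mult.commute)
    from r(3)[rule_format, OF imageI[OF T'(1)] this deform_agree[OF T(1) T'(1,3)]] show ?thesis
      using T'(1) by simp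
  qed
  moreover have "0 < r / m + R + R\<^sub>0" "0 < \<delta> / M" using R R0 r(1,2) m(1) M(1) by (auto intro!: add_pos_pos)
  ultimately show "\<exists>r>0. \<exists>\<delta>>0. \<forall>T'\<in>\<Omega>. \<forall>z. norm z < \<delta> \<longrightarrow> agree r z T T' \<longrightarrow>
      T' \<in> {T \<in> topspace X. deform T \<in> V} \<and> c (deform T') = c (deform T) + \<beta> T z" by blast
qed

text \<open>Both classes can be computed from primitives: those of the shape cocycle on the deformed space pull
  back to primitives of \<open>\<beta>\<close>.\<close>

lemma homeo_class_deform:
  assumes \<beta>: "PE_cocycle \<beta>"
  shows "homeo_class L \<Omega> discrete_labels (deform ` \<Omega>) deform = strong_class L \<Omega> \<beta>"
proof -
  let ?Y = "pattern_topology discrete_labels (deform ` \<Omega>)"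
  interpret D: flc_space discrete_labels "deform ` \<Omega>" by (rule deform_flc_space)
  note h = deform_homeomorphic
  have shape: "D.PE_cocycle (\<lambda>T v. v)" by (simp add: D.PE_cocycle_def)
  obtain \<V> k where "flow_box_cocycle discrete_labels (deform ` \<Omega>) (\<lambda>T v. v) (\<V>, k)"
    using D.flow_box_cocycle_exists[of "\<lambda>T v. v"] by auto
  then have pk: "D.primitive_cocycle (\<lambda>T v. v) \<V> k" by (rule D.flow_box_cocycle_primitive[OF shape])
  note kc = D.primitive_cocycle_cech_cocycle[OF pk]
  obtain c where \<V>: "open_cover ?Y \<V>" and c: "\<forall>V\<in>\<V>. D.primitive (\<lambda>T v. v) V (c V)"
    and k: "\<forall>U\<in>\<V>. \<forall>V\<in>\<V>. \<forall>T\<in>U \<inter> V. k U V T = c U T - c V T"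
    using pk unfolding D.primitive_cocycle_def by (elim exE conjE)
  let ?pre = "\<lambda>V. {T \<in> topspace X. deform T \<in> V}"
  let ?k = "\<lambda>U U' T. k (deform ` U) (deform ` U') (deform T)"
  have pull: "cocycle_pullback X deform (\<V>, k) = (?pre ` \<V>, ?k)" by (simp add: cocycle_pullback_def)
  have im: "deform ` ?pre V = V" if "V \<in> \<V>" for V
    using \<V> that openin_subset[of ?Y V] unfolding open_cover_def by (intro image_preimage_homeomorphic_map[OF h]) blast
  have pk': "primitive_cocycle \<beta> (?pre ` \<V>) ?k"
    unfolding primitive_cocycle_def
  proof (intro conjI exI[of _ "\<lambda>U T. c (deform ` U) (deform T)"] ballI)
    show "open_cover X (?pre ` \<V>)" by (rule open_cover_pullback[OF homeomorphic_imp_continuous_map[OF h] \<V>])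
    show "primitive \<beta> U (\<lambda>T. c (deform ` U) (deform T))" if U: "U \<in> ?pre ` \<V>" for U
    proof -
      obtain V where V: "V \<in> \<V>" "U = ?pre V" using U by blast
      show ?thesis unfolding V(2) im[OF V(1)] by (rule primitive_pullback) (use c V(1) in blast)
    qed
    fix U U' T assume U: "U \<in> ?pre ` \<V>" "U' \<in> ?pre ` \<V>" "T \<in> U \<inter> U'"
    obtain V V' where V: "V \<in> \<V>" "U = ?pre V" "V' \<in> \<V>" "U' = ?pre V'" using U by blast
    have "deform T \<in> V \<inter> V'" using U(3) V by blast
    then have "k V V' (deform T) = c V (deform T) - c V' (deform T)" using k V(1,3) by blast
    then show "?k U U' T = c (deform ` U) (deform T) - c (deform ` U') (deform T)"
      unfolding V(2,4) im[OF V(1)] im[OF V(3)] .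
  qed
  have "fundamental_shape_class discrete_labels (deform ` \<Omega>) = {e. cech_cocycle ?Y e \<and> cech_cohomologous ?Y (\<V>, k) e}"
    unfolding fundamental_shape_class_def by (rule D.strong_class_primitive[OF shape pk])
  moreover have "strong_class L \<Omega> \<beta> = {a. cech_cocycle X a \<and> cech_cohomologous X (cocycle_pullback X deform (\<V>, k)) a}"
    unfolding pull by (rule strong_class_primitive[OF \<beta> pk'])
  moreover have "cech_cohomologous X (cocycle_pullback X deform (\<V>, k)) a"
    if a: "cech_cocycle X a" and e: "cech_cocycle ?Y e" "cech_cohomologous ?Y (\<V>, k) e" "cech_cohomologous X (cocycle_pullback X deform e) a"
    for a e
  proof -
    have "trans {(a, a' :: (('d, 'l) pattern, real^'d) cech_cochain).
        cech_cocycle X a \<and> cech_cocycle X a' \<and> cech_cohomologous X a a'}"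
      using equiv_cech_cohomologous[of X] by (rule equivE)
    from transD[OF this, of "cocycle_pullback X deform (\<V>, k)" "cocycle_pullback X deform e" a]
    show ?thesis
      using cech_cocycle_pullback[OF h kc] cech_cocycle_pullback[OF h e(1)] cech_cohomologous_pullback[OF h kc e(1,2)] a e(3)
      by simp
  qed
  moreover have "cech_cohomologous ?Y (\<V>, k) (\<V>, k)"
    by (rule D.primitive_cocycles_cohomologous[OF pk pk])
  ultimately show ?thesis
    unfolding homeo_class_def cech_pullback_def using kc by blast
qed

end

section \<open>Forms close to an invertible matrix\<close>

lemma invertible_matrix_lower_bound:
  fixes C :: "real^'n::finite^'n"
  assumes "invertible C"
  shows "\<exists>m>0. \<forall>v. m * norm v \<le> norm (C *v v)"
proof -
  obtain C' where C': "C' ** C = mat 1" using assms unfolding invertible_def by blast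
  have "norm v \<le> (onorm ((*v) C') + 1) * norm (C *v v)" for v
  proof -
    have "norm v = norm (C' *v (C *v v))" by (simp add: matrix_vector_mul_assoc C')
    also have "\<dots> \<le> onorm ((*v) C') * norm (C *v v)" by (rule onorm) simp
    also have "\<dots> \<le> (onorm ((*v) C') + 1) * norm (C *v v)" by (intro mult_right_mono) simp_all
    finally show ?thesis .
  qed
  moreover have "onorm ((*v) C') + 1 > 0" using onorm_pos_le[of "(*v) C'"] by simp
  ultimately show ?thesis
    by (intro exI[of _ "inverse (onorm ((*v) C') + 1)"]) (simp add: field_simps)
qed

text \<open>Solving \<open>f x = y\<close> amounts to finding a fixed point of \<open>x - C\<^sup>-\<^sup>1 (f x - y)\<close>, a contraction.\<close>

lemma nearly_linear_surj:
  fixes f :: "real^'n::finite \<Rightarrow> real^'n" and C :: "real^'n^'n"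
  assumes C: "invertible C" and m: "0 < m" "\<And>v. m * norm v \<le> norm (C *v v)"
    and f: "\<And>x y. norm (f x - f y - C *v (x - y)) \<le> m / 2 * norm (x - y)"
  shows "\<exists>x. f x = y"
proof -
  obtain C' where C': "C ** C' = mat 1" using C unfolding invertible_def by blast
  define F where "F x = x - C' *v (f x - y)" for x
  have CF: "C *v F x = C *v x - (f x - y)" for x
    by (simp add: F_def matrix_vector_mult_diff_distrib matrix_vector_mul_assoc C')
  have "dist (F x) (F z) \<le> 1 / 2 * dist x z" for x z
  proof -
    have "m * norm (F x - F z) \<le> norm (C *v (F x - F z))" by (rule m(2))
    also have "C *v (F x - F z) = - (f x - f z - C *v (x - z))"
      by (simp add: matrix_vector_mult_diff_distrib CF)
    also have "norm \<dots> \<le> m * (1 / 2 * norm (x - z))" using f[of x z] by (simp only: norm_minus_cancel)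
    finally show ?thesis using m(1) by (simp add: dist_norm)
  qed
  then have "\<exists>!x. F x = x" by (intro banach_fix_type[of "1 / 2"]) auto
  then obtain x where "F x = x" by blast
  then have "f x = y" using CF[of x] by simp
  then show ?thesis by blast
qed

context flc_space
begin

lemma leaf_deformationI:
  assumes W: "PE_form W" and C: "invertible C" and m: "0 < m" "\<And>v. m * norm v \<le> norm (C *v v)"
    and near: "\<And>T v. T \<in> \<Omega> \<Longrightarrow> norm ((W T - C) *v v) \<le> m / 2 * norm v"
    and loc: "\<And>T T' s z x. T \<in> \<Omega> \<Longrightarrow> T' \<in> \<Omega> \<Longrightarrow> agree s z T T' \<Longrightarrow> R + norm x \<le> s \<Longrightarrow>
      leaf_integral W T' x = leaf_integral W T (z + x) - leaf_integral W T z"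
    and R: "0 < R" "R + 4 * radius < R\<^sub>0"
  shows "leaf_deformation L \<Omega> (leaf_integral W) (m / 2) (onorm ((*v) C) + m / 2) R R\<^sub>0"
proof
  note near' = leaf_integral_nearly_linear[OF W _ near]
  show "leaf_integral W T x + leaf_integral W (translate x T) y = leaf_integral W T (x + y)" if "T \<in> \<Omega>" for T x y
    by (rule PE_cocycle_add[OF PE_form_cocycle[OF W] that])
  show "leaf_integral W T' x = leaf_integral W T (z + x) - leaf_integral W T z"
    if "T \<in> \<Omega>" "T' \<in> \<Omega>" "agree s z T T'" "R + norm x \<le> s" for T T' s z x by (rule loc[OF that])
  show "m / 2 * norm (x - y) \<le> norm (leaf_integral W T x - leaf_integral W T y)" if "T \<in> \<Omega>" for T x y
    using norm_triangle_ineq4[of "leaf_integral W T x - leaf_integral W T y" "leaf_integral W T x - leaf_integral W T y - C *v (x - y)"]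
      near'[OF that, of x y] m(2)[of "x - y"] by simp
  show "norm (leaf_integral W T x - leaf_integral W T y) \<le> (onorm ((*v) C) + m / 2) * norm (x - y)" if "T \<in> \<Omega>" for T x y
  proof -
    have "norm (C *v (x - y)) \<le> onorm ((*v) C) * norm (x - y)" by (rule onorm) simp
    then show ?thesis
      using norm_triangle_ineq[of "leaf_integral W T x - leaf_integral W T y - C *v (x - y)" "C *v (x - y)"] near'[OF that, of x y]
      by (simp add: distrib_right)
  qed
  show "\<exists>x. leaf_integral W T x = y" if "T \<in> \<Omega>" for T y
    by (rule nearly_linear_surj[OF C m near'[OF that]])
  show "0 < onorm ((*v) C) + m / 2" using onorm_pos_le[of "(*v) C"] m(1) by (simp add: add_nonneg_pos)
  show "0 < m / 2" using m(1) by simp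
  show "0 < R" "R + 4 * radius < R\<^sub>0" by (rule R)+
qed

text \<open>Up to translation there are finitely many tiles, as each meets a ball of radius 1 around one of
  its points.\<close>

lemma tiles_bounded: "\<exists>D. \<forall>T\<in>\<Omega>. \<forall>t l. (t, l) \<in> T \<longrightarrow> (\<forall>x\<in>t. \<forall>y\<in>t. dist x y \<le> D)"
proof -
  obtain F where F: "finite F" "\<And>P. P \<in> F \<Longrightarrow> \<exists>T\<in>\<Omega>. \<exists>x. P = patch T x 1"
    "\<And>T x. T \<in> \<Omega> \<Longrightarrow> \<exists>P\<in>F. \<exists>y. patch T x 1 = translate y P"
    using finite_patch_types[of 1] by auto
  define A where "A = (\<Union>P\<in>F. fst ` P)"
  have "finite A" unfolding A_def using F(1,2) finite_patch by fastforce
  moreover have "bounded t" if t: "t \<in> A" for t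
  proof -
    obtain P l where "P \<in> F" "(t, l) \<in> P" using t unfolding A_def by auto
    then obtain T x where "T \<in> \<Omega>" "(t, l) \<in> patch T x 1" using F(2) by blast
    then show ?thesis using tiles_compact patch_subset compact_imp_bounded by blast
  qed
  ultimately have "bounded (\<Union>A)" by (simp add: bounded_Union)
  then obtain D where D: "\<And>x y. x \<in> \<Union>A \<Longrightarrow> y \<in> \<Union>A \<Longrightarrow> dist x y \<le> D" unfolding bounded_two_points by blast
  have "dist x y \<le> D" if T: "T \<in> \<Omega>" "(t, l) \<in> T" "x \<in> t" "y \<in> t" for T t l x y
  proof -
    obtain P v where P: "P \<in> F" "patch T x 1 = translate v P" using F(3)[OF T(1)] by blast
    have "x \<in> t \<inter> ball x 1" using T(3) by simp
    then have "(t, l) \<in> translate v P" unfolding P(2)[symmetric] patch_def using T(2) by blast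
    then have "((\<lambda>p. p + v) ` t, l) \<in> P" by (simp only: mem_translate)
    then have "(\<lambda>p. p + v) ` t \<in> fst ` P" by (rule image_eqI[rotated]) simp
    then have "(\<lambda>p. p + v) ` t \<in> A" unfolding A_def using P(1) by blast
    then have "dist (x + v) (y + v) \<le> D" using T(3,4) by (intro D) blast+
    then show ?thesis by simp
  qed
  then show ?thesis by blast
qed

text \<open>A point in two Voronoi cells is within \<open>radius\<close> of both centres.\<close>

lemma neighbours_bounded: "\<exists>D. \<forall>T\<in>\<Omega>. \<forall>p q. neighbours T p q \<longrightarrow> dist p q \<le> D"
proof -
  obtain D where D: "\<forall>T\<in>\<Omega>. \<forall>t l. (t, l) \<in> T \<longrightarrow> (\<forall>x\<in>t. \<forall>y\<in>t. dist x y \<le> D)" using tiles_bounded by blast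
  have "dist p q \<le> max D (2 * radius)" if T: "T \<in> \<Omega>" and pq: "neighbours T p q" for T p q
    using pq unfolding neighbours_def
  proof (elim disjE conjE exE)
    assume "\<exists>(t, l)\<in>T. p extreme_point_of t \<and> q extreme_point_of t"
    then obtain t l where "(t, l) \<in> T" "p \<in> t" "q \<in> t" unfolding extreme_point_of_def by blast
    then have "dist p q \<le> D" using D T by blast
    then show ?thesis by simp
  next
    fix z assume z: "\<forall>v\<in>vertices T. dist z p \<le> dist z v \<and> dist z q \<le> dist z v"
    obtain v where "v \<in> vertices T" "dist z v \<le> radius" using radius(2)[OF T] by blast
    then have "dist z p \<le> radius" "dist z q \<le> radius" using z by force+
    then show ?thesis using dist_triangle[of p q z] by (simp add: dist_commute)
  qed
  then show ?thesis by blast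
qed

subsection \<open>The shape change of a form\<close>

text \<open>Any pattern with a vertex at the origin can serve as the base point \<open>T\<close>; the shape change is
  \<open>deform\<close>, and the form of \<open>T\<close> is the restriction of \<open>W\<close> to its leaf.\<close>

lemma leaf_integral_shape_change:
  assumes W: "PE_form W" and C: "invertible C" and m: "0 < m" "\<And>v. m * norm v \<le> norm (C *v v)"
    and near: "\<And>T v. T \<in> \<Omega> \<Longrightarrow> norm ((W T - C) *v v) \<le> m / 2 * norm v"
    and min: "minimal L \<Omega>" and ne: "\<Omega> \<noteq> {}"
  shows "\<exists>\<Omega>' h. shape_change L \<Omega> \<Omega>' h \<and> homeo_class L \<Omega> discrete_labels \<Omega>' h = strong_class L \<Omega> (leaf_integral W)"
proof -
  let ?\<beta> = "leaf_integral W"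
  note \<beta> = PE_form_cocycle[OF W]
  obtain R1 where R1: "\<forall>T\<in>\<Omega>. \<forall>T'\<in>\<Omega>. patch T 0 R1 = patch T' 0 R1 \<longrightarrow> W T = W T'"
    using W unfolding PE_form_def by blast
  obtain R2 where R2: "R2 > 0"
    "\<And>T T' s z x. T \<in> \<Omega> \<Longrightarrow> T' \<in> \<Omega> \<Longrightarrow> agree s z T T' \<Longrightarrow> R2 + norm x \<le> s \<Longrightarrow> ?\<beta> T' x = ?\<beta> T (z + x) - ?\<beta> T z"
    using PE_cocycle_agree[OF \<beta>] by metis
  obtain D where D: "\<forall>T\<in>\<Omega>. \<forall>p q. neighbours T p q \<longrightarrow> dist p q \<le> D" using neighbours_bounded by blast
  define R where "R = max R1 R2"
  have R: "0 < R" "R1 \<le> R" "R2 \<le> R" using R2(1) by (simp_all add: R_def)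
  \<comment> \<open>large enough for the deformed pattern to determine \<open>T\<close> and for neighbours to lie within the labels\<close>
  define R0 where "R0 = R + max D (4 * radius) + 1"
  have "R + 4 * radius < R0" by (simp add: R0_def)
  then interpret leaf_deformation L \<Omega> ?\<beta> "m / 2" "onorm ((*v) C) + m / 2" R R0
    using R2(2) R by (intro leaf_deformationI[OF W C m near]) auto
  obtain T0 where T0: "T0 \<in> \<Omega>" using ne by blast
  obtain p where p: "p \<in> vertices T0" using radius(2)[OF T0, of 0] by blast
  define T where "T = translate p T0"
  have T: "T \<in> \<Omega>" "0 \<in> vertices T" using T0 p by (simp_all add: T_def vertices_translate)
  define \<omega> where "\<omega> x = W (translate x T)" for x
  have \<omega>: "smooth \<omega>" "closed_form \<omega>" using W T(1) unfolding PE_form_def \<omega>_def[abs_def] by blast+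
  have PE: "strongly_PE T R \<omega>"
    unfolding strongly_PE_def
  proof (intro allI impI)
    fix x y assume eq: "patch (translate x T) 0 R = patch (translate y T) 0 R"
    have "patch (translate x T) 0 R1 = patch (translate y T) 0 R1"
      by (rule patch_eq_subball[OF eq]) (use \<open>R1 \<le> R\<close> in auto)
    then show "\<omega> x = \<omega> y" using R1 T(1) unfolding \<omega>_def by simp
  qed
  have A: "form_integral \<omega> = ?\<beta> T" unfolding leaf_integral_def \<omega>_def[abs_def] ..
  have "homeomorphism UNIV UNIV (?\<beta> T) (inv (?\<beta> T))"
  proof (rule homeomorphismI)
    have inj: "inj (?\<beta> T)" using \<beta>_inj[OF T(1)] by (simp add: inj_def)
    have sur: "surj (?\<beta> T)" unfolding surj_def using surj[OF T(1)] by metis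
    show "continuous_on UNIV (?\<beta> T)" by (rule PE_cocycle_continuous[OF \<beta> T(1)])
    have "dist (inv (?\<beta> T) x) (inv (?\<beta> T) y) \<le> 2 / m * dist x y" for x y
    proof -
      have "m / 2 * norm (inv (?\<beta> T) x - inv (?\<beta> T) y) \<le> norm (x - y)"
        using leaf_deformation.m(2)[OF leaf_deformation_axioms T(1), of "inv (?\<beta> T) x" "inv (?\<beta> T) y"] surj_f_inv_f[OF sur] by simp
      then show ?thesis using m(1) by (simp add: dist_norm field_simps)
    qed
    then have "(2 / m)-lipschitz_on UNIV (inv (?\<beta> T))" using m(1) by (intro lipschitz_onI) simp_all
    then show "continuous_on UNIV (inv (?\<beta> T))" by (rule lipschitz_on_continuous_on)
    show "inv (?\<beta> T) (?\<beta> T x) = x" for x using inj by simp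
    show "?\<beta> T (inv (?\<beta> T) y) = y" for y by (rule surj_f_inv_f[OF sur])
  qed simp_all
  then have hom: "\<exists>B. homeomorphism UNIV UNIV (?\<beta> T) B" by blast
  have nb: "R + dist p q < R0" if "neighbours T p q" for p q
  proof -
    have "dist p q \<le> D" using D T(1) that by blast
    then show ?thesis by (simp add: R0_def)
  qed
  have "shape_change L \<Omega> (deform ` \<Omega>) deform"
    unfolding shape_change_def
  proof (rule exI[of _ T], rule exI[of _ \<omega>], rule exI[of _ R], rule exI[of _ R0], rule exI[of _ "?\<beta> T"],
      rule exI[of _ "deform T"], intro conjI allI impI)
    show "deform T = deformed T R0 (?\<beta> T)" by (rule deform_def)
    show "deform ` \<Omega> = delone_hull discrete_labels (deform T)" by (rule delone_hull_deform[OF min T(1), symmetric])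
  qed (use T \<omega> R(1) PE A hom nb labelled_delone_deform deform_homeomorphic deform_translate in simp_all)
  then show ?thesis using homeo_class_deform[OF \<beta>] by blast
qed

end

theorem theorem1p5:
  fixes L :: "'l metric"
    and \<Omega> :: "('d::finite, 'l) pattern set"
    and \<mu> :: "('d, 'l) pattern measure"
    and a :: "(('d, 'l) pattern, real ^ 'd) cech_cochain set"
  assumes "tiling_space L \<Omega>"
    and "FLC \<Omega>"
    and "aperiodic \<Omega>"
    and "minimal L \<Omega>"
    and "uniquely_ergodic L \<Omega>"
    and "invariant_probability L \<Omega> \<mu>"
    and "a \<in> cech_H1 (pattern_topology L \<Omega>)"
    and "invertible (ruelle_sullivan L \<Omega> \<mu> a)"
  shows "\<exists>\<Omega>' h. shape_change L \<Omega> \<Omega>' h \<and> homeo_class L \<Omega> discrete_labels \<Omega>' h = a"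
proof -
  interpret flc_space L \<Omega> by (rule tiling_space_flc_space[OF assms(1,2)])
  let ?R = "{(a, a' :: (('d, 'l) pattern, real^'d) cech_cochain). cech_cocycle X a \<and> cech_cocycle X a' \<and> cech_cohomologous X a a'}"
  obtain e where e: "cech_cocycle X e" "a = ?R `` {e}"
    using assms(7) unfolding cech_H1_def by (auto elim!: quotientE)
  obtain \<U> g where eg: "e = (\<U>, g)" by fastforce
  have coc: "cech_cocycle X (\<U>, g)" and a: "a = {b. cech_cocycle X b \<and> cech_cohomologous X (\<U>, g) b}"
    using e by (auto simp: eg)
  obtain W where W: "PE_form W" "primitive_cocycle (leaf_integral W) \<U> g"
    using cech_cocycle_PE_form[OF coc] by blast
  define C where "C = (\<chi> i j. LINT T|\<mu>. W T $ i $ j)"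
  have "ruelle_sullivan L \<Omega> \<mu> a = C"
    unfolding a strong_class_primitive[OF PE_form_cocycle[OF W(1)] W(2), symmetric] C_def
    by (rule ruelle_sullivan_PE_form[OF assms(5,6) W])
  then have C: "invertible C" using assms(8) by simp
  obtain m where m: "m > 0" "\<forall>v. m * norm v \<le> norm (C *v v)" using invertible_matrix_lower_bound[OF C] by blast
  have "m / 2 > 0" using m(1) by simp
  then obtain W' where W': "PE_form W'" "primitive_cocycle (leaf_integral W') \<U> g"
    "\<forall>T\<in>\<Omega>. \<forall>v. norm ((W' T - C) *v v) \<le> m / 2 * norm v"
    using PE_form_nearly_constant[OF assms(5,6) W, of "m / 2"] unfolding C_def by blast
  have "space \<mu> \<noteq> {}" "space \<mu> = \<Omega>"
    using assms(6) prob_space.not_empty unfolding invariant_probability_def by blast+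
  then have "\<Omega> \<noteq> {}" by simp
  from leaf_integral_shape_change[OF W'(1) C m(1) m(2)[rule_format] W'(3)[rule_format] assms(4) this]
  show ?thesis
    unfolding strong_class_primitive[OF PE_form_cocycle[OF W'(1)] W'(2)] a .
qed

end
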